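(* For $d\in\mathbb N$ let $\mathcal L_F:M(d,d)\to\mathbb R$ be $\mathcal L_F(W)=\big\|\sum_{i=1}^d w_i^{\otimes 3}-\sum_{i=1}^d e_i^{\otimes 3}\big\|_F^2$, where $w_1,\dots,w_d$ are the rows of $W$. The following sequences of weight matrices define families of critical points of $\mathcal L_F$ (families 4 and 5 for all sufficiently large $d$), with the stated isotropy group, loss (value of $\mathcal L_F$), orbit length $|(S_d\times S_d)W|$, and spectrum of the Hessian $\nabla^2\mathcal L_F$ (eigenvalues listed with multiplicities). Asymptotic notation refers to $d\to\infty$. 1. $\mathfrak C_I(d)=I_d$. Isotropy $\Delta S_d$; loss $0$; orbit length $d!$. Hessian (exact): type $\mathfrak t$: $18,\,6$, each of multiplicity $1$; type $\mathfrak s_d$: $18,\,6,\,6$, each of multiplicity $d-1$; type $\mathfrak x_d$: $6$ of multiplicity $(d-1)(d-2)/2$; type $\mathfrak y_d$: $6$ of multiplicity $d(d-3)/2$. 2. $\mathfrak C_0(d)=0_{d,d}$, the zero matrix. Isotropy $S_d\times S_d$; loss $d$; orbit length $1$; all Hessian eigenvalues are $0$. 3. $\mathfrak C_1(d)=d^{-1}\mathcal I_{d,d}$. Isotropy $S_d\times S_d$; loss $d-\frac1d$; orbit length $1$. Hessian modulo $o(d^{-1})$: $18/d$ of multiplicity $1$ (trivial component); $0$ and $-6/d$, each of multiplicity $d-1$ (the two components that are the standard representation of one factor of $S_d\times S_d$ tensored with the trivial representation of the other); $-12/d$ of multiplicity $(d-1)^2$ (component $\mathfrak s_d\otimes\mathfrak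 s_d$). 4. A family $\mathfrak C_2(d)=\frac1d(\mathcal I_{d,d}-2I_d)+o(d^{-1})$ in the fixed point space $\{\xi_1I_d+\xi_2(\mathcal I_{d,d}-I_d):\xi_1,\xi_2\in\mathbb R\}$ of $\Delta S_d$, where the error term is entrywise. Isotropy $\Delta S_d$; loss $d-\frac1d$ modulo $o(d^{-1})$; orbit length $d!$. Hessian modulo $o(d^{-1})$: type $\mathfrak t$: $18/d,\,12/d$, each of multiplicity $1$; type $\mathfrak s_d$: $12/d,\,0,\,-6/d$, each of multiplicity $d-1$; type $\mathfrak x_d$: $-12/d$ of multiplicity $(d-1)(d-2)/2$; type $\mathfrak y_d$: $-12/d$ of multiplicity $d(d-3)/2$. 5. A family $\mathfrak C_3(d)=\Xi_d(\xi_1(d),\dots,\xi_5(d))$, where $$\xi_1(d)=-\tfrac1d-\tfrac{13}{3d^2}-\tfrac{77}{9d^3}+\tfrac{6421}{81d^4}+o(d^{-4}),\qquad \xi_2(d)=\tfrac1d+\tfrac{13}{3d^2}+\tfrac{149}{9d^3}+\tfrac{2867}{81d^4}+o(d^{-4}),$$ $$\xi_3(d)=o(d^{-4}),\qquad \xi_4(d)=o(d^{-4}),\qquad \xi_5(d)=1+o(d^{-4}).$$ Isotropy $\Delta(S_{d-1}\times S_1)$; loss $d-1$ modulo $o(d^{-1})$; orbit length $d\cdot d!$. Hessian eigenvalues modulo $o(d^{-1})$: $18$ (multiplicity $1$), $6$ ($d-1$), $18/d$ ($1$), $12/d$ ($d-1$), $6/d$ ($1$), $0$ ($2d-4$), $-6/d$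 ($d-2$), $-12/d$ ($d^2-5d+5$). 6. $\mathfrak C_4(d)=I_{d-2}\oplus\begin{bmatrix}1/2&1/2\\1/2&1/2\end{bmatrix}$. Isotropy $\Delta(S_{d-2}\times S_2)$; loss $3/2$; orbit length $d(d-1)\,d!/2$. Hessian eigenvalues (exact): $18$ (multiplicity $d-2$), $9$ ($1$), $6$ ($d^2-3d+2$), $3$ ($d-2$), $0$ ($d-1$), $-3$ ($1$), $-6$ ($1$). 7. $\mathfrak C_5(d)=I_{d-2}\oplus\begin{bmatrix}1&0\\0&0\end{bmatrix}$. Isotropy $\Delta(S_{d-2}\times S_1^2)$; loss $1$; orbit length $d(d-1)\,d!$. Hessian eigenvalues (exact): $18$ (multiplicity $d-1$), $6$ ($(d-1)^2$), $0$ ($d$).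
   Context: $M(k,d)$ is the space of real $k\times d$ matrices with the Euclidean inner product, $e_i$ is the $i$-th unit vector of $\mathbb R^d$, and $\mathcal I_{d,d}$ is the $d\times d$ matrix with all entries $1$. The Frobenius norm on order-$3$ tensors is $\|T\|_F^2=\sum_{i,j,k}T_{ijk}^2$; thus $\langle v^{\otimes 3},w^{\otimes 3}\rangle_F=\langle v,w\rangle^3$. $S_d\times S_d$ acts on $M(d,d)$ by $((\sigma_1,\sigma_2)A)_{ij}=A_{\sigma_1^{-1}(i),\sigma_2^{-1}(j)}$, and $\mathcal L_F$ is invariant under this action. The isotropy group of $A$ is the largest subgroup of $S_d\times S_d$ fixing $A$. For a subgroup $G\subseteq S_d$, $\Delta G=\{(g,g):g\in G\}$. The subgroups $S_{d-1}\times S_1$, $S_{d-2}\times S_2$ and $S_{d-2}\times S_1^2$ of $S_d$ are, respectively, the permutations fixing the index $d$, those preserving the set $\{d-1,d\}$, and those fixing both $d-1$ and $d$. Parametrization of the fixed point space $M(d,d)^{\Delta(S_{d-1}\times S_1)}$: $\Xi_d(\xi_1,\dots,\xi_5)$ is the matrix whose upper-left $(d-1)\times(d-1)$ block has diagonal entries $\xi_1$ and off-diagonal entries $\xi_2$, whose entries $(i,d)$, $i<d$, equal $\xi_3$, whose entries $(d,j)$, $j<d$, equal $\xi_4$, and whose $(d,d)$ entry equals $\xi_5$. Irreducible $S_d$-representations: $\mathfrak t$ trivial (degree $1$); $\mathfrak s_d$ standard (degree $d-1$); $\mathfrak x_d=\wedge^2\mathfrak s_d$ (degree $(d-1)(d-2)/2$);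 $\mathfrak y_d$ associated with the partition $(d-2,2)$ (degree $d(d-3)/2$). Under $\Delta S_d\cong S_d$, $M(d,d)\cong 2\mathfrak t\oplus 3\mathfrak s_d\oplus\mathfrak x_d\oplus\mathfrak y_d$. Under $S_d\times S_d$, $M(d,d)$ is the sum of the trivial representation, the two representations given by the standard representation of one factor and the trivial representation of the other, and the external tensor product $\mathfrak s_d\otimes\mathfrak s_d$. The Hessian at a point commutes with the isotropy group of that point; "type" refers to the corresponding isotypic component. "Modulo $o(d^{-1})$" means that the quantity equals the listed value plus an $o(d^{-1})$ term.
   Formalization: Corrected: family 5 loss is d-1-1/d mod o(1/d); family 6 isotropy is all (g,h) preserving {d-1,d} with g=h on 1..d-2, orbit length d(d-1)d!/4; family 7 isotropy is Delta(S_{d-1}xS_1), orbit length d*d!. Family 1 spectrum by type is for d>=3; families 6, 7 for d>=2. *)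

theory Defs
  imports
    "HOL-Analysis.Analysis"
    "HOL-Algebra.Group_Action"
    "HOL-Algebra.Sym_Groups"
    "HOL-Library.Function_Algebras"
    "HOL-Library.Landau_Symbols"
    "HOL-Library.Multiset"
begin

instantiation "fun" :: (type, real_vector) real_vector
begin

definition scaleR_fun_def: "c *\<^sub>R f = (\<lambda>x. c *\<^sub>R f x)"

instance
  by standard (auto simp: scaleR_fun_def plus_fun_def scaleR_add_right scaleR_add_left)

end

text \<open>
  The size \<open>d\<close> varies within a single proposition, so a vector or matrix is a real function on
  (pairs of) natural numbers that vanishes outside the index range. Indices start at \<open>1\<close>.
\<close>

type_synonym vect = "nat \<Rightarrow> real"
type_synonym matr = "nat \<Rightarrow> nat \<Rightarrow> real"
type_synonym tens3 = "nat \<Rightarrow> nat \<Rightarrow> nat \<Rightarrow> real"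

definition Mat :: "nat \<Rightarrow> nat \<Rightarrow> matr set" where
  "Mat k d = {A. \<forall>i j. i \<notin> {1..k} \<or> j \<notin> {1..d} \<longrightarrow> A i j = 0}"

definition unit_vec :: "nat \<Rightarrow> vect" where
  "unit_vec i = (\<lambda>j. of_bool (j = i))"

definition unit_mat :: "nat \<Rightarrow> nat \<Rightarrow> matr" where
  "unit_mat i j = (\<lambda>k l. of_bool (k = i \<and> l = j))"

definition tensor_cube :: "vect \<Rightarrow> tens3" where
  "tensor_cube v = (\<lambda>j k l. v j * v k * v l)"

definition frobenius_norm :: "nat \<Rightarrow> tens3 \<Rightarrow> real" where
  "frobenius_norm d T = sqrt (\<Sum>i = 1..d. \<Sum>j = 1..d. \<Sum>k = 1..d. (T i j k)\<^sup>2)"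

definition loss :: "nat \<Rightarrow> matr \<Rightarrow> real" where
  "loss d W = (frobenius_norm d
     ((\<Sum>i = 1..d. tensor_cube (W i)) - (\<Sum>i = 1..d. tensor_cube (unit_vec i))))\<^sup>2"

text \<open>
  The loss is a polynomial in the entries, so gradient and Hessian are given by the (iterated)
  partial derivatives with respect to the entries.
\<close>

definition partial_deriv :: "nat \<Rightarrow> nat \<Rightarrow> (matr \<Rightarrow> real) \<Rightarrow> matr \<Rightarrow> real" where
  "partial_deriv i j f W = deriv (\<lambda>t. f (W + t *\<^sub>R unit_mat i j)) 0"

definition critical :: "nat \<Rightarrow> matr \<Rightarrow> bool" where
  "critical d W \<longleftrightarrow> W \<in> Mat d d \<and>
     (\<forall>i \<in> {1..d}. \<forall>j \<in> {1..d}. partial_deriv i j (loss d) W = 0)"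

definition hessian :: "nat \<Rightarrow> matr \<Rightarrow> matr \<Rightarrow> matr" where
  "hessian d W X = (\<lambda>k l. if k \<in> {1..d} \<and> l \<in> {1..d}
     then \<Sum>i = 1..d. \<Sum>j = 1..d. partial_deriv k l (partial_deriv i j (loss d)) W * X i j
     else 0)"

text \<open>
  \<open>S\<close> lists the eigenvalues of \<open>H\<close> on the subspace \<open>V\<close>, each repeated according to the dimension of
  its eigenspace in \<open>V\<close>. The condition on \<open>size S\<close> says that these eigenspaces fill \<open>V\<close>; in
  particular \<open>V\<close> is then \<open>H\<close>-invariant.
\<close>

definition has_spectrum :: "('v::real_vector \<Rightarrow> 'v) \<Rightarrow> 'v set \<Rightarrow> real multiset \<Rightarrow> bool" where
  "has_spectrum H V S \<longleftrightarrow>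
     (\<forall>\<mu>. dim {X \<in> V. H X = \<mu> *\<^sub>R X} = count S \<mu>) \<and> size S = dim V"

text \<open>
  In addition to the spectra on the individual isotypic components, their union is required to be
  the spectrum on all of \<open>V\<close>.
\<close>

definition has_spectrum_by_type ::
  "('v::real_vector \<Rightarrow> 'v) \<Rightarrow> 'v set \<Rightarrow> ('v set \<times> real multiset) list \<Rightarrow> bool" where
  "has_spectrum_by_type H V T \<longleftrightarrow>
     (\<forall>(U, S) \<in> set T. has_spectrum H U S) \<and> has_spectrum H V (sum_list (map snd T))"

definition eq_mod_inverse :: "(nat \<Rightarrow> real) \<Rightarrow> (nat \<Rightarrow> real) \<Rightarrow> bool" where
  "eq_mod_inverse f g \<longleftrightarrow> (\<lambda>d. f d - g d) \<in> o(\<lambda>d. 1 / real d)"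

abbreviation S2 :: "nat \<Rightarrow> ((nat \<Rightarrow> nat) \<times> (nat \<Rightarrow> nat)) monoid" where
  "S2 d \<equiv> sym_group d \<times>\<times> sym_group d"

definition vec_act :: "(nat \<Rightarrow> nat) \<Rightarrow> vect \<Rightarrow> vect" where
  "vec_act g x = (\<lambda>i. x (inv_into UNIV g i))"

definition mat_act :: "(nat \<Rightarrow> nat) \<times> (nat \<Rightarrow> nat) \<Rightarrow> matr \<Rightarrow> matr" where
  "mat_act g A = (\<lambda>i j. A (inv_into UNIV (fst g) i) (inv_into UNIV (snd g) j))"

definition isotropy :: "nat \<Rightarrow> matr \<Rightarrow> ((nat \<Rightarrow> nat) \<times> (nat \<Rightarrow> nat)) set" where
  "isotropy d W = stabilizer (S2 d) mat_act W"

definition orbit_length :: "nat \<Rightarrow> matr \<Rightarrow> nat" where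
  "orbit_length d W = card (Group_Action.orbit (S2 d) mat_act W)"

definition Delta :: "'g set \<Rightarrow> ('g \<times> 'g) set" where
  "Delta G = (\<lambda>g. (g, g)) ` G"

definition fix_last :: "nat \<Rightarrow> (nat \<Rightarrow> nat) set" where
  "fix_last d = {g \<in> carrier (sym_group d). g d = d}"

definition preserve_last_two :: "nat \<Rightarrow> (nat \<Rightarrow> nat) set" where
  "preserve_last_two d = {g \<in> carrier (sym_group d). g ` {d - 1, d} = {d - 1, d}}"

text \<open>
  \<open>G\<close> acts on \<open>V\<close> by \<open>\<rho>\<close> and on the irreducible model \<open>U\<close> by \<open>\<tau>\<close>. The isotypic component is the sum
  of all subrepresentations of \<open>V\<close> isomorphic to \<open>U\<close>, that is, of all images of injective
  equivariant linear maps.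
\<close>

definition isotypic ::
  "'g set \<Rightarrow> ('g \<Rightarrow> 'v::real_vector \<Rightarrow> 'v) \<Rightarrow> 'v set \<Rightarrow>
   ('g \<Rightarrow> 'u::real_vector \<Rightarrow> 'u) \<Rightarrow> 'u set \<Rightarrow> 'v set" where
  "isotypic G \<rho> V \<tau> U = span (\<Union> {f ` U | f. linear f \<and> inj_on f U \<and> f ` U \<subseteq> V \<and>
     (\<forall>g \<in> G. \<forall>u \<in> U. f (\<tau> g u) = \<rho> g (f u))})"

definition std_rep :: "nat \<Rightarrow> vect set" where
  "std_rep d = {x. (\<forall>i. i \<notin> {1..d} \<longrightarrow> x i = 0) \<and> (\<Sum>i = 1..d. x i) = 0}"

definition outer :: "vect \<Rightarrow> vect \<Rightarrow> matr" where
  "outer x y = (\<lambda>i j. x i * y j)"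

definition ext_square_rep :: "nat \<Rightarrow> matr set" where
  "ext_square_rep d = span {outer x y - outer y x | x y. x \<in> std_rep d \<and> y \<in> std_rep d}"

definition tensor_rep :: "nat \<Rightarrow> matr set" where
  "tensor_rep d = span {outer x y | x y. x \<in> std_rep d \<and> y \<in> std_rep d}"

text \<open>
  The Specht module of the partition \<open>(d - 2, 2)\<close>. A tabloid of this shape is determined by its
  second row, a two-element subset of \<open>{1..d}\<close>. The generator below is the polytabloid of a tableau
  whose first two columns are \<open>a\<close> above \<open>b\<close> and \<open>c\<close> above \<open>e\<close>. For \<open>d < 4\<close> there is no such
  tableau and the module is \<open>{0}\<close>.
\<close>

definition polytabloid :: "nat \<Rightarrow> nat \<Rightarrow> nat \<Rightarrow> nat \<Rightarrow> nat set \<Rightarrow> real" where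
  "polytabloid a b c e = (\<lambda>A. of_bool (A = {b, e}) - of_bool (A = {a, e})
     - of_bool (A = {b, c}) + of_bool (A = {a, c}))"

definition specht_rep :: "nat \<Rightarrow> (nat set \<Rightarrow> real) set" where
  "specht_rep d = span {polytabloid a b c e | a b c e.
     {a, b, c, e} \<subseteq> {1..d} \<and> distinct [a, b, c, e]}"

definition tabloid_act :: "(nat \<Rightarrow> nat) \<Rightarrow> (nat set \<Rightarrow> real) \<Rightarrow> (nat set \<Rightarrow> real)" where
  "tabloid_act g f = (\<lambda>A. f (inv_into UNIV g ` A))"

definition diag_isotypic ::
  "nat \<Rightarrow> ((nat \<Rightarrow> nat) \<Rightarrow> 'u::real_vector \<Rightarrow> 'u) \<Rightarrow> 'u set \<Rightarrow> matr set" where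
  "diag_isotypic d = isotypic (carrier (sym_group d)) (\<lambda>g. mat_act (g, g)) (Mat d d)"

definition type_t :: "nat \<Rightarrow> matr set" where
  "type_t d = diag_isotypic d (\<lambda>_ x. x) (UNIV :: real set)"

definition type_s :: "nat \<Rightarrow> matr set" where
  "type_s d = diag_isotypic d vec_act (std_rep d)"

definition type_x :: "nat \<Rightarrow> matr set" where
  "type_x d = diag_isotypic d (\<lambda>g. mat_act (g, g)) (ext_square_rep d)"

definition type_y :: "nat \<Rightarrow> matr set" where
  "type_y d = diag_isotypic d tabloid_act (specht_rep d)"

definition prod_isotypic ::
  "nat \<Rightarrow> ((nat \<Rightarrow> nat) \<times> (nat \<Rightarrow> nat) \<Rightarrow> 'u::real_vector \<Rightarrow> 'u) \<Rightarrow> 'u set \<Rightarrow> matr set" where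
  "prod_isotypic d = isotypic (carrier (S2 d)) mat_act (Mat d d)"

definition type_tt :: "nat \<Rightarrow> matr set" where
  "type_tt d = prod_isotypic d (\<lambda>_ x. x) (UNIV :: real set)"

definition type_st :: "nat \<Rightarrow> matr set" where
  "type_st d = prod_isotypic d (\<lambda>g. vec_act (fst g)) (std_rep d)"

definition type_ts :: "nat \<Rightarrow> matr set" where
  "type_ts d = prod_isotypic d (\<lambda>g. vec_act (snd g)) (std_rep d)"

definition type_ss :: "nat \<Rightarrow> matr set" where
  "type_ss d = prod_isotypic d mat_act (tensor_rep d)"

definition id_mat :: "nat \<Rightarrow> matr" where
  "id_mat d = (\<lambda>i j. of_bool (i \<in> {1..d} \<and> j = i))"

definition ones_mat :: "nat \<Rightarrow> matr" where
  "ones_mat d = (\<lambda>i j. of_bool (i \<in> {1..d} \<and> j \<in> {1..d}))"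

definition direct_sum :: "nat \<Rightarrow> matr \<Rightarrow> matr \<Rightarrow> matr" where
  "direct_sum n A B = (\<lambda>i j. if i \<le> n \<and> j \<le> n then A i j
     else if n < i \<and> n < j then B (i - n) (j - n) else 0)"

definition Xi :: "nat \<Rightarrow> real \<Rightarrow> real \<Rightarrow> real \<Rightarrow> real \<Rightarrow> real \<Rightarrow> matr" where
  "Xi d \<xi>1 \<xi>2 \<xi>3 \<xi>4 \<xi>5 = (\<lambda>i j.
     if i \<notin> {1..d} \<or> j \<notin> {1..d} then 0
     else if i < d \<and> j < d then (if i = j then \<xi>1 else \<xi>2)
     else if i < d then \<xi>3
     else if j < d then \<xi>4
     else \<xi>5)"

definition C_I :: "nat \<Rightarrow> matr" where
  "C_I d = id_mat d"

definition C_0 :: "nat \<Rightarrow> matr" where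
  "C_0 d = 0"

definition C_1 :: "nat \<Rightarrow> matr" where
  "C_1 d = (1 / real d) *\<^sub>R ones_mat d"

definition C_4 :: "nat \<Rightarrow> matr" where
  "C_4 d = direct_sum (d - 2) (id_mat (d - 2)) ((1 / 2) *\<^sub>R ones_mat 2)"

definition C_5 :: "nat \<Rightarrow> matr" where
  "C_5 d = direct_sum (d - 2) (id_mat (d - 2)) (unit_mat 1 1)"

end

theory Submission
  imports Defs "HOL-Real_Asymp.Real_Asymp"
begin

text \<open>
  The seven families are block sums of matrices \<open>a I + b J\<close>. On such a matrix the Hessian acts on the
  isotypic components through explicit matrices of size at most three, and for a block sum the
  off-diagonal blocks decouple, so every spectrum reduces to eigenvalue problems of bounded size.

  For the asymptotic families the critical equations are solved with the ratio \<open>t = a / b\<close>, which is a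
  root near \<open>-2\<close> of a single polynomial. A sign change traps this root up to \<open>O(d\<^sup>-\<^sup>4)\<close>, and the
  rescaled Hessian matrices converge to upper triangular ones with distinct diagonal entries, so
  that the eigenvalues exist and converge by the intermediate value theorem.
\<close>

text \<open>The loss depends on \<open>W\<close> only through its entries and its Gram matrix, and
  at \<open>a I + b J\<close> the Gram matrix and its entrywise square have the same shape again.
  This is what makes gradient and Hessian explicit.

  Isotypic components are defined by all equivariant maps, so they must be computed. A generator of
  the irreducible module is negated by suitable transpositions, which confines its image to very few
  parameters.

  The ratio -2 comes from the critical equation \<open>b^3 t^2 (t^2 + 4 t + 2 n) = t + 2\<close>:
  for \<open>b\<close> of order \<open>1 / n\<close> its left side is of order \<open>n^-2\<close>,
  so \<open>t + 2\<close> tends to 0.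

  In the fifth family \<xi>3 and \<xi>4 are exactly 0 and \<xi>5 is exactly 1. Its upper left block
  is then the fourth family in dimension \<open>d - 1\<close>, so one ratio sequence serves both
  families, and the expansion in \<open>d\<close> is an expansion in \<open>n = d - 1\<close>
  re-expressed.\<close>

lemma sum_of_bool_eq:
  fixes f :: "nat \<Rightarrow> real"
  assumes "k \<in> A" "finite A"
  shows "(\<Sum>i\<in>A. of_bool (i = k) * f i) = f k" "(\<Sum>i\<in>A. of_bool (k = i) * f i) = f k"
    "(\<Sum>i\<in>A. f i * of_bool (i = k)) = f k" "(\<Sum>i\<in>A. f i * of_bool (k = i)) = f k"
  using assms by (simp_all add: of_bool_def if_distrib if_distribR cong: if_cong)

lemma sum_tensor_apply: "(\<Sum>i\<in>A. f i) a b c = (\<Sum>i\<in>A. f i a b c)"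
  for f :: "'a \<Rightarrow> tens3"
  by (induction A rule: infinite_finite_induct) auto

section \<open>Loss, gradient and Hessian in terms of the Gram matrix\<close>

definition gram :: "nat \<Rightarrow> matr \<Rightarrow> matr" where
  "gram d W i j = (\<Sum>l = 1..d. W i l * W j l)"

lemma gram_commute: "gram d W i j = gram d W j i"
  by (simp add: gram_def mult.commute)

text \<open>For fixed \<open>i\<close> and \<open>j\<close> the summand is one function evaluated at
  \<open>a\<close>, at \<open>b\<close> and at \<open>c\<close>, so the triple sum is a cube: the
  Frobenius pairing of two tensor cubes is the cube of the inner product.\<close>

lemma sum_tensor_product:
  fixes u v :: matr
  shows "(\<Sum>a\<in>A. \<Sum>b\<in>A. \<Sum>c\<in>A. (\<Sum>i\<in>I. u i a * u i b * u i c) * (\<Sum>j\<in>J. v j a * v j b * v j c))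
    = (\<Sum>i\<in>I. \<Sum>j\<in>J. (\<Sum>a\<in>A. u i a * v j a) ^ 3)"
proof -
  have swap: "(\<Sum>a\<in>A. \<Sum>i\<in>I. \<Sum>j\<in>J. f a i j) = (\<Sum>i\<in>I. \<Sum>j\<in>J. \<Sum>a\<in>A. f a i j)"
    for f :: "nat \<Rightarrow> nat \<Rightarrow> nat \<Rightarrow> real"
    by (subst sum.swap) (rule sum.cong[OF refl], rule sum.swap)
  have "(\<Sum>a\<in>A. \<Sum>b\<in>A. \<Sum>c\<in>A. (\<Sum>i\<in>I. u i a * u i b * u i c) * (\<Sum>j\<in>J. v j a * v j b * v j c))
    = (\<Sum>a\<in>A. \<Sum>b\<in>A. \<Sum>c\<in>A. \<Sum>i\<in>I. \<Sum>j\<in>J. (u i a * v j a) * (u i b * v j b) * (u i c * v j c))"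
    by (simp add: sum_product mult_ac)
  also have "\<dots> = (\<Sum>i\<in>I. \<Sum>j\<in>J. \<Sum>a\<in>A. \<Sum>b\<in>A. \<Sum>c\<in>A. (u i a * v j a) * (u i b * v j b) * (u i c * v j c))"
    by (simp only: swap)
  also have "\<dots> = (\<Sum>i\<in>I. \<Sum>j\<in>J. (\<Sum>a\<in>A. u i a * v j a) ^ 3)"
    by (simp only: sum_distrib_left[symmetric] sum_distrib_right[symmetric] power3_eq_cube)
  finally show ?thesis .
qed

text \<open>Expanding the square leaves three pairings of sums of tensor cubes. Rows pair with rows
  through the Gram matrix, rows with unit vectors through single entries, and the unit vectors among
  themselves contribute \<open>d\<close>.\<close>

lemma loss_gram:
  "loss d W = (\<Sum>i=1..d. \<Sum>j=1..d. (gram d W i j) ^ 3) - 2 * (\<Sum>i=1..d. \<Sum>j=1..d. (W i j) ^ 3) + real d"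
proof -
  let ?A = "{1..d}"
  define P where "P a b c = (\<Sum>i\<in>?A. W i a * W i b * W i c)" for a b c
  define D where "D a b c = (\<Sum>i\<in>?A. unit_vec i a * unit_vec i b * unit_vec i c)" for a b c
  have "loss d W = (\<Sum>a\<in>?A. \<Sum>b\<in>?A. \<Sum>c\<in>?A. (P a b c - D a b c)\<^sup>2)"
    unfolding loss_def frobenius_norm_def
    by (subst real_sqrt_pow2) (auto intro!: sum_nonneg simp: sum_tensor_apply P_def D_def tensor_cube_def)
  also have "\<dots> = (\<Sum>a\<in>?A. \<Sum>b\<in>?A. \<Sum>c\<in>?A. P a b c * P a b c)
     - 2 * (\<Sum>a\<in>?A. \<Sum>b\<in>?A. \<Sum>c\<in>?A. P a b c * D a b c) + (\<Sum>a\<in>?A. \<Sum>b\<in>?A. \<Sum>c\<in>?A. D a b c * D a b c)"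
  proof -
    have "(P a b c - D a b c)\<^sup>2 = P a b c * P a b c - 2 * (P a b c * D a b c) + D a b c * D a b c" for a b c
      by (simp add: power2_eq_square algebra_simps)
    then show ?thesis
      by (simp only: sum.distrib sum_subtractf sum_distrib_left[symmetric])
  qed
  also have "(\<Sum>a\<in>?A. \<Sum>b\<in>?A. \<Sum>c\<in>?A. P a b c * P a b c) = (\<Sum>i\<in>?A. \<Sum>j\<in>?A. (gram d W i j) ^ 3)"
    unfolding P_def gram_def by (rule sum_tensor_product)
  also have "(\<Sum>a\<in>?A. \<Sum>b\<in>?A. \<Sum>c\<in>?A. P a b c * D a b c)
      = (\<Sum>i\<in>?A. \<Sum>j\<in>?A. (\<Sum>a\<in>?A. W i a * unit_vec j a) ^ 3)"
    unfolding P_def D_def by (rule sum_tensor_product)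
  also have "\<dots> = (\<Sum>i\<in>?A. \<Sum>j\<in>?A. (W i j) ^ 3)"
    by (intro sum.cong refl) (simp only: unit_vec_def sum_of_bool_eq finite_atLeastAtMost)
  also have "(\<Sum>a\<in>?A. \<Sum>b\<in>?A. \<Sum>c\<in>?A. D a b c * D a b c)
      = (\<Sum>i\<in>?A. \<Sum>j\<in>?A. (\<Sum>a\<in>?A. unit_vec i a * unit_vec j a) ^ 3)"
    unfolding D_def by (rule sum_tensor_product)
  also have "\<dots> = (\<Sum>i\<in>?A. \<Sum>j\<in>?A. if i = j then 1 else 0)"
    by (intro sum.cong refl) (simp add: unit_vec_def sum_of_bool_eq del: sum_of_bool_mult_eq sum_mult_of_bool_eq)
  also have "\<dots> = real d"
    by simp
  finally show ?thesis .
qed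

text \<open>The closed form that \<open>partial_loss\<close> identifies with the partial
  derivatives. In the first term 6 is the exponent 3 times the two places at which row
  \<open>k\<close> enters the Gram matrix; in the second it is the exponent times the factor 2 of
  the cross term.\<close>

definition grad :: "nat \<Rightarrow> matr \<Rightarrow> matr" where
  "grad d W k l = 6 * (\<Sum>j=1..d. (gram d W k j)\<^sup>2 * W j l) - 6 * (W k l)\<^sup>2"

lemma unit_mat_add_apply: "(W + t *\<^sub>R unit_mat k l) i j = W i j + t * of_bool (i = k \<and> j = l)"
  by (simp add: unit_mat_def scaleR_fun_def)

text \<open>Only the entry in row \<open>k\<close> and column \<open>l\<close> moves, so only the
  summand \<open>m = l\<close> varies. For \<open>i = j = k\<close> both terms of the product rule
  survive.\<close>

lemma gram_has_derivative:
  assumes "l \<in> {1..d}"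
  shows "((\<lambda>t. gram d (W + t *\<^sub>R unit_mat k l) i j) has_real_derivative
     of_bool (i = k) * W j l + of_bool (j = k) * W i l) (at 0)"
proof -
  have "((\<lambda>t. gram d (W + t *\<^sub>R unit_mat k l) i j) has_real_derivative
     (\<Sum>m=1..d. of_bool (i = k \<and> m = l) * W j m + W i m * of_bool (j = k \<and> m = l))) (at 0)"
    unfolding gram_def unit_mat_add_apply
    by (rule DERIV_sum) (auto intro!: derivative_eq_intros)
  also have "(\<Sum>m=1..d. of_bool (i = k \<and> m = l) * W j m + W i m * of_bool (j = k \<and> m = l))
     = of_bool (i = k) * W j l + of_bool (j = k) * W i l"
  proof -
    have "(\<Sum>m=1..d. of_bool (i = k \<and> m = l) * W j m + W i m * of_bool (j = k \<and> m = l))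
      = (\<Sum>m=1..d. of_bool (m = l) * (of_bool (i = k) * W j m + of_bool (j = k) * W i m))"
      by (intro sum.cong refl) (auto simp: of_bool_def)
    then show ?thesis using assms by (simp only: sum_of_bool_eq finite_atLeastAtMost)
  qed
  finally show ?thesis .
qed

lemma entry_has_derivative:
  "((\<lambda>t. (W + t *\<^sub>R unit_mat k l) i j) has_real_derivative of_bool (i = k \<and> j = l)) (at 0)"
  unfolding unit_mat_add_apply by (auto intro!: derivative_eq_intros)

lemma zero_direction: "W + 0 *\<^sub>R X = (W :: matr)"
  by simp

lemma partial_loss:
  assumes "k \<in> {1..d}" "l \<in> {1..d}"
  shows "partial_deriv k l (loss d) W = grad d W k l"
proof -
  let ?A = "{1..d}"
  let ?g = "gram d W"
  have "((\<lambda>t. loss d (W + t *\<^sub>R unit_mat k l)) has_real_derivative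
    (\<Sum>i\<in>?A. \<Sum>j\<in>?A. 3 * (?g i j)\<^sup>2 * (of_bool (i = k) * W j l + of_bool (j = k) * W i l))
     - 2 * (\<Sum>i\<in>?A. \<Sum>j\<in>?A. 3 * (W i j)\<^sup>2 * of_bool (i = k \<and> j = l))) (at 0)"
    unfolding loss_gram
  proof (rule DERIV_cong[OF DERIV_add[OF DERIV_diff[OF _ DERIV_cmult] DERIV_const]])
    show "((\<lambda>t. \<Sum>i\<in>?A. \<Sum>j\<in>?A. gram d (W + t *\<^sub>R unit_mat k l) i j ^ 3) has_real_derivative
      (\<Sum>i\<in>?A. \<Sum>j\<in>?A. 3 * (?g i j)\<^sup>2 * (of_bool (i = k) * W j l + of_bool (j = k) * W i l))) (at 0)"
      by (intro DERIV_sum, rule DERIV_cong[OF DERIV_power[OF gram_has_derivative[OF assms(2)]]])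
        (simp add: zero_direction)
    show "((\<lambda>t. \<Sum>i\<in>?A. \<Sum>j\<in>?A. (W + t *\<^sub>R unit_mat k l) i j ^ 3) has_real_derivative
      (\<Sum>i\<in>?A. \<Sum>j\<in>?A. 3 * (W i j)\<^sup>2 * of_bool (i = k \<and> j = l))) (at 0)"
      by (intro DERIV_sum, rule DERIV_cong[OF DERIV_power[OF entry_has_derivative]])
        (simp add: zero_direction)
  qed simp
  also have "(\<Sum>i\<in>?A. \<Sum>j\<in>?A. 3 * (?g i j)\<^sup>2 * (of_bool (i = k) * W j l + of_bool (j = k) * W i l))
    = (\<Sum>j\<in>?A. 3 * (?g k j)\<^sup>2 * W j l) + (\<Sum>i\<in>?A. 3 * (?g i k)\<^sup>2 * W i l)"
  proof -
    have "(\<Sum>i\<in>?A. \<Sum>j\<in>?A. 3 * (?g i j)\<^sup>2 * (of_bool (i = k) * W j l + of_bool (j = k) * W i l))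
      = (\<Sum>i\<in>?A. of_bool (i = k) * (\<Sum>j\<in>?A. 3 * (?g i j)\<^sup>2 * W j l)) +
        (\<Sum>i\<in>?A. \<Sum>j\<in>?A. of_bool (j = k) * (3 * (?g i j)\<^sup>2 * W i l))"
      by (simp add: distrib_left sum.distrib sum_distrib_left mult_ac)
    then show ?thesis using assms by (simp add: sum_of_bool_eq del: sum_mult_of_bool_eq)
  qed
  \<comment> \<open>The two halves of the product rule agree because the Gram matrix is
    symmetric.\<close>
  also have "(\<Sum>i\<in>?A. 3 * (?g i k)\<^sup>2 * W i l) = (\<Sum>j\<in>?A. 3 * (?g k j)\<^sup>2 * W j l)"
    by (simp add: gram_commute)
  also have "(\<Sum>i\<in>?A. \<Sum>j\<in>?A. 3 * (W i j)\<^sup>2 * of_bool (i = k \<and> j = l)) = 3 * (W k l)\<^sup>2"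
  proof -
    have "(\<Sum>i\<in>?A. \<Sum>j\<in>?A. 3 * (W i j)\<^sup>2 * of_bool (i = k \<and> j = l))
      = (\<Sum>i\<in>?A. of_bool (i = k) * (\<Sum>j\<in>?A. of_bool (j = l) * (3 * (W i j)\<^sup>2)))"
      by (simp add: of_bool_conj sum_distrib_left mult_ac)
    then show ?thesis using assms by (simp add: sum_of_bool_eq del: sum_mult_of_bool_eq)
  qed
  also have "(\<Sum>j\<in>?A. 3 * (?g k j)\<^sup>2 * W j l) + (\<Sum>j\<in>?A. 3 * (?g k j)\<^sup>2 * W j l)
      - 2 * (3 * (W k l)\<^sup>2) = grad d W k l"
    by (simp add: grad_def sum_distrib_left mult_ac)
  finally have "((\<lambda>t. loss d (W + t *\<^sub>R unit_mat k l)) has_real_derivative grad d W k l) (at 0)" .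
  then show ?thesis unfolding partial_deriv_def by (rule DERIV_imp_deriv)
qed

lemma critical_iff:
  "critical d W \<longleftrightarrow> W \<in> Mat d d \<and> (\<forall>k\<in>{1..d}. \<forall>l\<in>{1..d}. grad d W k l = 0)"
  by (simp add: critical_def partial_loss)

text \<open>The Gram factor of a summand varies if row \<open>k\<close> is row \<open>i\<close> or
  the summation row \<open>m\<close>; the factor \<open>W m j\<close> varies only for
  \<open>m = k\<close> and \<open>j = l\<close>. These are the first three terms, and the last one
  is the derivative of the square.\<close>

lemma partial_grad:
  assumes "k \<in> {1..d}" "l \<in> {1..d}"
  shows "partial_deriv k l (\<lambda>V. grad d V i j) W =
    12 * (of_bool (i = k) * (\<Sum>m=1..d. gram d W i m * W m l * W m j) + gram d W i k * W i l * W k j)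
    + 6 * (of_bool (j = l) * (gram d W i k)\<^sup>2) - 12 * of_bool (i = k \<and> j = l) * W i j"
proof -
  let ?A = "{1..d}"
  let ?g = "gram d W"
  have "((\<lambda>t. grad d (W + t *\<^sub>R unit_mat k l) i j) has_real_derivative
    6 * (\<Sum>m\<in>?A. 2 * ?g i m * (of_bool (i = k) * W m l + of_bool (m = k) * W i l) * W m j
       + of_bool (m = k \<and> j = l) * (?g i m)\<^sup>2)
     - 12 * W i j * of_bool (i = k \<and> j = l)) (at 0)"
    unfolding grad_def
  proof (rule DERIV_cong[OF DERIV_diff[OF DERIV_cmult DERIV_cmult]])
    show "((\<lambda>t. \<Sum>m\<in>?A. (gram d (W + t *\<^sub>R unit_mat k l) i m)\<^sup>2 * (W + t *\<^sub>R unit_mat k l) m j)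
      has_real_derivative (\<Sum>m\<in>?A. 2 * ?g i m * (of_bool (i = k) * W m l + of_bool (m = k) * W i l) * W m j
       + of_bool (m = k \<and> j = l) * (?g i m)\<^sup>2)) (at 0)"
      by (intro DERIV_sum, rule DERIV_cong[OF DERIV_mult[OF
          DERIV_power[OF gram_has_derivative[OF assms(2)]] entry_has_derivative]])
        (simp add: zero_direction algebra_simps del: of_bool_eq_1_iff)
    show "((\<lambda>t. ((W + t *\<^sub>R unit_mat k l) i j)\<^sup>2) has_real_derivative
      2 * W i j * of_bool (i = k \<and> j = l)) (at 0)"
      by (rule DERIV_cong[OF DERIV_power[OF entry_has_derivative]]) (simp add: zero_direction)
  qed simp
  also have "(\<Sum>m\<in>?A. 2 * ?g i m * (of_bool (i = k) * W m l + of_bool (m = k) * W i l) * W m j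
       + of_bool (m = k \<and> j = l) * (?g i m)\<^sup>2)
     = of_bool (i = k) * (\<Sum>m\<in>?A. 2 * ?g i m * W m l * W m j)
       + (\<Sum>m\<in>?A. of_bool (m = k) * (2 * ?g i m * W i l * W m j))
       + (\<Sum>m\<in>?A. of_bool (m = k) * (of_bool (j = l) * (?g i m)\<^sup>2))"
    by (simp add: sum.distrib[symmetric] sum_distrib_left of_bool_conj algebra_simps
      del: sum_mult_of_bool_eq sum_of_bool_mult_eq)
  also have "\<dots> = of_bool (i = k) * (\<Sum>m\<in>?A. 2 * ?g i m * W m l * W m j)
       + 2 * ?g i k * W i l * W k j + of_bool (j = l) * (?g i k)\<^sup>2"
    using assms by (simp add: sum_of_bool_eq del: sum_mult_of_bool_eq)
  also have "6 * (of_bool (i = k) * (\<Sum>m\<in>?A. 2 * ?g i m * W m l * W m j)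
       + 2 * ?g i k * W i l * W k j + of_bool (j = l) * (?g i k)\<^sup>2) - 12 * W i j * of_bool (i = k \<and> j = l)
     = 12 * (of_bool (i = k) * (\<Sum>m=1..d. gram d W i m * W m l * W m j) + gram d W i k * W i l * W k j)
    + 6 * (of_bool (j = l) * (gram d W i k)\<^sup>2) - 12 * of_bool (i = k \<and> j = l) * W i j"
    by (simp add: sum_distrib_left mult_ac distrib_left)
  finally have "((\<lambda>t. grad d (W + t *\<^sub>R unit_mat k l) i j) has_real_derivative
      12 * (of_bool (i = k) * (\<Sum>m=1..d. gram d W i m * W m l * W m j) + gram d W i k * W i l * W k j)
    + 6 * (of_bool (j = l) * (gram d W i k)\<^sup>2) - 12 * of_bool (i = k \<and> j = l) * W i j) (at 0)" .
  then show ?thesis unfolding partial_deriv_def by (rule DERIV_imp_deriv)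
qed

text \<open>This is the derivative of \<open>grad\<close> in the direction \<open>X\<close>: the
  bracket is the derivative of the Gram entry at \<open>k\<close> and \<open>m\<close>, namely the
  inner product of row \<open>m\<close> of \<open>W\<close> with row \<open>k\<close> of
  \<open>X\<close> plus the same with \<open>k\<close> and \<open>m\<close> exchanged.\<close>

lemma hessian_formula:
  assumes "k \<in> {1..d}" "l \<in> {1..d}"
  shows "hessian d W X k l =
    12 * (\<Sum>m=1..d. gram d W k m * ((\<Sum>j=1..d. W m j * X k j) + (\<Sum>j=1..d. W k j * X m j)) * W m l)
    + 6 * (\<Sum>m=1..d. (gram d W k m)\<^sup>2 * X m l) - 12 * W k l * X k l"
proof -
  let ?A = "{1..d}"
  let ?g = "gram d W"
  have "hessian d W X k l = (\<Sum>i\<in>?A. \<Sum>j\<in>?A. partial_deriv k l (\<lambda>V. grad d V i j) W * X i j)"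
  proof -
    \<comment> \<open>The inner derivative is replaced as a function of the matrix and not only at
      \<open>W\<close>, as the outer derivative requires.\<close>
    have "partial_deriv k l (partial_deriv i j (loss d)) W = partial_deriv k l (\<lambda>V. grad d V i j) W"
      if "i \<in> ?A" "j \<in> ?A" for i j
      unfolding partial_deriv_def[of k l] by (simp add: partial_loss[OF that])
    then show ?thesis using assms by (simp add: hessian_def)
  qed
  also have "\<dots> = 12 * (\<Sum>i\<in>?A. of_bool (i = k) * (\<Sum>j\<in>?A. (\<Sum>m\<in>?A. ?g i m * W m l * W m j) * X i j))
     + 12 * (\<Sum>i\<in>?A. \<Sum>j\<in>?A. ?g i k * W i l * W k j * X i j)
     + 6 * (\<Sum>i\<in>?A. \<Sum>j\<in>?A. of_bool (j = l) * ((?g i k)\<^sup>2 * X i j))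
     - 12 * (\<Sum>i\<in>?A. of_bool (i = k) * (\<Sum>j\<in>?A. of_bool (j = l) * (W i j * X i j)))"
    by (simp add: partial_grad[OF assms] sum.distrib sum_subtractf sum_distrib_left of_bool_conj algebra_simps
      del: sum_mult_of_bool_eq sum_of_bool_mult_eq)
  also have "\<dots> = 12 * (\<Sum>j\<in>?A. (\<Sum>m\<in>?A. ?g k m * W m l * W m j) * X k j)
     + 12 * (\<Sum>i\<in>?A. \<Sum>j\<in>?A. ?g i k * W i l * W k j * X i j)
     + 6 * (\<Sum>i\<in>?A. (?g i k)\<^sup>2 * X i l) - 12 * (W k l * X k l)"
    using assms by (simp only: sum_of_bool_eq finite_atLeastAtMost)
  also have "(\<Sum>j\<in>?A. (\<Sum>m\<in>?A. ?g k m * W m l * W m j) * X k j)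
     = (\<Sum>m\<in>?A. ?g k m * (\<Sum>j\<in>?A. W m j * X k j) * W m l)"
    by (simp add: sum_distrib_left sum_distrib_right mult_ac) (rule sum.swap)
  also have "(\<Sum>i\<in>?A. \<Sum>j\<in>?A. ?g i k * W i l * W k j * X i j)
     = (\<Sum>m\<in>?A. ?g k m * (\<Sum>j\<in>?A. W k j * X m j) * W m l)"
    by (simp add: sum_distrib_left sum_distrib_right mult_ac gram_commute)
  finally show ?thesis
    by (simp add: gram_commute[of d W _ k] algebra_simps sum.distrib)
qed

lemma hessian_outside: "\<not> (k \<in> {1..d} \<and> l \<in> {1..d}) \<Longrightarrow> hessian d W X k l = 0"
  unfolding hessian_def by (rule if_not_P)

lemma linear_hessian: "linear (hessian d W)"
  by (rule linearI)
    (auto simp: hessian_def fun_eq_iff scaleR_fun_def sum.distrib sum_distrib_left algebra_simps)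

section \<open>Eigenbases and spectra\<close>

definition diagonal_on :: "('v::real_vector \<Rightarrow> 'v) \<Rightarrow> 'v set \<Rightarrow> real multiset \<Rightarrow> bool" where
  "diagonal_on H V S \<longleftrightarrow> (\<exists>B \<mu>. finite B \<and> independent B \<and> span B = V \<and>
     (\<forall>v\<in>B. H v = \<mu> v *\<^sub>R v) \<and> S = image_mset \<mu> (mset_set B))"

lemma diagonal_on_subspace: "diagonal_on H V S \<Longrightarrow> subspace V"
  unfolding diagonal_on_def by (auto intro: subspace_span)

lemma count_image_mset_set:
  assumes "finite B"
  shows "count (image_mset f (mset_set B)) x = card {v \<in> B. f v = x}"
proof -
  have "f -` {x} \<inter> B = {v \<in> B. f v = x}" by auto
  then show ?thesis using assms by (simp add: count_image_mset count_mset_set')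
qed

text \<open>Eigenbases can be joined along direct sums, which dimensions of eigenspaces do not allow
  directly; so spectra are derived as \<open>diagonal_on\<close> and translated here. Comparing
  coefficients in the eigenbasis shows that the eigenspace of \<mu> in \<open>V\<close> is spanned
  by the basis vectors with eigenvalue \<mu>.\<close>

lemma diagonal_on_has_spectrum:
  assumes H: "linear H" and diag: "diagonal_on H V S"
  shows "has_spectrum H V S"
proof -
  from diag obtain B m where B: "finite B" "independent B" "span B = V"
    and m: "\<And>v. v \<in> B \<Longrightarrow> H v = m v *\<^sub>R v" and S: "S = image_mset m (mset_set B)"
    unfolding diagonal_on_def by blast
  have eig: "{X \<in> V. H X = \<mu> *\<^sub>R X} = span {v \<in> B. m v = \<mu>}" for \<mu>
  proof (intro equalityI subsetI)
    fix X assume X: "X \<in> {X \<in> V. H X = \<mu> *\<^sub>R X}"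
    then obtain c where c: "X = (\<Sum>v\<in>B. c v *\<^sub>R v)"
      using B by (auto simp: span_finite)
    have "(\<Sum>v\<in>B. (c v * (m v - \<mu>)) *\<^sub>R v) = H X - \<mu> *\<^sub>R X"
      unfolding c by (simp add: linear_sum[OF H] linear_scale[OF H] m scaleR_sum_right
          sum_subtractf[symmetric] algebra_simps)
    also have "\<dots> = 0" using X by simp
    finally have "c v * (m v - \<mu>) = 0" if "v \<in> B" for v
      using independentD[OF B(2,1) order_refl, of "\<lambda>v. c v * (m v - \<mu>)"] that by blast
    then have "X = (\<Sum>v\<in>{v \<in> B. m v = \<mu>}. c v *\<^sub>R v)"
      unfolding c using B(1) by (intro sum.mono_neutral_right) auto
    then show "X \<in> span {v \<in> B. m v = \<mu>}"
      by (auto intro!: span_sum span_scale intro: span_base)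
  next
    fix X assume X: "X \<in> span {v \<in> B. m v = \<mu>}"
    then have "X \<in> V" using B(3) span_mono[of "{v \<in> B. m v = \<mu>}" B] by auto
    moreover from X have "H X = \<mu> *\<^sub>R X"
      by (induction rule: span_induct_alt)
        (auto simp: linear_0[OF H] linear_add[OF H] linear_scale[OF H] m algebra_simps)
    ultimately show "X \<in> {X \<in> V. H X = \<mu> *\<^sub>R X}" by simp
  qed
  have "dim {X \<in> V. H X = \<mu> *\<^sub>R X} = count S \<mu>" for \<mu>
    unfolding eig S count_image_mset_set[OF B(1)]
    by (rule dim_span_eq_card_independent) (rule independent_mono[OF B(2)], auto)
  moreover have "size S = dim V"
    using B by (auto simp: S dim_eq_card_independent)
  ultimately show ?thesis by (simp add: has_spectrum_def)
qed

text \<open>A vanishing combination splits into a part in \<open>span B\<close> and its negative in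
  \<open>span C\<close>. Both lie in the intersection, hence vanish, and the independence of
  \<open>B\<close> and of \<open>C\<close> applies.\<close>

lemma independent_Un:
  fixes B C :: "'v::real_vector set"
  assumes "finite B" "independent B" "finite C" "independent C" "span B \<inter> span C \<subseteq> {0}"
  shows "independent (B \<union> C)" "B \<inter> C = {}"
proof -
  show disj: "B \<inter> C = {}"
    using assms dependent_zero[of B] by (auto dest: span_base)
  show "independent (B \<union> C)"
  proof (rule independent_if_scalars_zero)
    fix f x assume sum0: "(\<Sum>v\<in>B \<union> C. f v *\<^sub>R v) = 0" and x: "x \<in> B \<union> C"
    let ?b = "\<Sum>v\<in>B. f v *\<^sub>R v" and ?c = "\<Sum>v\<in>C. f v *\<^sub>R v"
    have bc: "?b + ?c = 0"
      using sum0 disj assms by (simp add: sum.union_disjoint)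
    have "?b \<in> span B" "?c \<in> span C"
      by (auto intro!: span_sum span_scale intro: span_base)
    moreover from bc have "?c = - ?b" by (simp add: eq_neg_iff_add_eq_0 add.commute)
    ultimately have "?b \<in> span B \<inter> span C"
      using span_neg[of ?c C] by simp
    then have "?b = 0" "?c = 0" using assms(5) bc by auto
    then show "f x = 0"
      using x independentD[OF assms(2,1) order_refl, of f] independentD[OF assms(4,3) order_refl, of f] by blast
  qed (use assms in auto)
qed

lemma diagonal_on_sum:
  assumes "diagonal_on H U S" "diagonal_on H V T" "U \<inter> V \<subseteq> {0}"
    and W: "W = {u + v | u v. u \<in> U \<and> v \<in> V}"
  shows "diagonal_on H W (S + T)"
proof -
  from assms(1) obtain B m where B: "finite B" "independent B" "span B = U"
    and m: "\<And>v. v \<in> B \<Longrightarrow> H v = m v *\<^sub>R v" and S: "S = image_mset m (mset_set B)"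
    unfolding diagonal_on_def by blast
  from assms(2) obtain C n where C: "finite C" "independent C" "span C = V"
    and n: "\<And>v. v \<in> C \<Longrightarrow> H v = n v *\<^sub>R v" and T: "T = image_mset n (mset_set C)"
    unfolding diagonal_on_def by blast
  note BC = independent_Un[OF B(1,2) C(1,2)]
  have disj: "B \<inter> C = {}" using BC(2) assms(3) B C by auto
  have ind: "independent (B \<union> C)" using BC(1) assms(3) B C by auto
  have "image_mset (\<lambda>v. if v \<in> B then m v else n v) (mset_set (B \<union> C)) = S + T"
    unfolding S T mset_set_Union[OF B(1) C(1) disj] image_mset_union
    using disj B(1) C(1) by (auto intro!: arg_cong2[where f = "(+)"] image_mset_cong)
  moreover have "span (B \<union> C) = W" unfolding W span_Un B C by auto
  moreover have "\<forall>v\<in>B \<union> C. H v = (if v \<in> B then m v else n v) *\<^sub>R v" using m n by auto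
  ultimately show ?thesis
    unfolding diagonal_on_def using B(1) C(1) ind
    by (intro exI[of _ "B \<union> C"] exI[of _ "\<lambda>v. if v \<in> B then m v else n v"]) simp
qed

text \<open>The type of matrices is infinite-dimensional, so the finiteness of a basis of
  \<open>V\<close> has to come from the finite set \<open>F\<close>.\<close>

lemma diagonal_on_const:
  assumes "subspace V" "V \<subseteq> span F" "finite F" "\<And>v. v \<in> V \<Longrightarrow> H v = \<mu> *\<^sub>R v"
  shows "diagonal_on H V (replicate_mset (dim V) \<mu>)"
proof -
  obtain B where B: "B \<subseteq> V" "independent B" "V \<subseteq> span B" "card B = dim V"
    using basis_exists[of V] by blast
  have "finite B"
    using independent_span_bound[OF assms(3) B(2)] B(1) assms(2) by auto
  moreover have "span B = V"
    using B assms(1) by (simp add: span_subspace)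
  moreover have "image_mset (\<lambda>_. \<mu>) (mset_set B) = replicate_mset (dim V) \<mu>"
    using B(4) by (simp add: image_mset_const_eq)
  ultimately show ?thesis
    unfolding diagonal_on_def using B assms(4) by (intro exI[of _ B] exI[of _ "\<lambda>_. \<mu>"]) auto
qed

text \<open>Transports an eigenbasis along a map that intertwines up to the factor \<open>c\<close>.
  With \<open>H\<close> the identity, \<open>c\<close> becomes the eigenvalue on an embedded copy of
  an irreducible representation.\<close>

lemma diagonal_on_image:
  assumes f: "linear f" "inj_on f V" and diag: "diagonal_on H V S"
    and H': "\<And>v. v \<in> V \<Longrightarrow> H' (f v) = c *\<^sub>R f (H v)"
  shows "diagonal_on H' (f ` V) (image_mset ((*) c) S)"
proof -
  from diag obtain B m where B: "finite B" "independent B" "span B = V"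
    and m: "\<And>v. v \<in> B \<Longrightarrow> H v = m v *\<^sub>R v" and S: "S = image_mset m (mset_set B)"
    unfolding diagonal_on_def by blast
  have BV: "B \<subseteq> V" using B(3) span_superset by blast
  then have inj: "inj_on f B" using f(2) inj_on_subset by blast
  have "independent (f ` B)"
    using linear_independent_injective_image[OF f(1)] B f(2)
    by (metis linear_dependent_inj_imageD[OF f(1)])
  moreover have "span (f ` B) = f ` V"
    using linear_span_image[OF f(1)] B(3) by simp
  moreover have "\<forall>v\<in>f ` B. H' v = (c * m (inv_into B f v)) *\<^sub>R v"
    using inj BV H' m by (auto simp: linear_scale[OF f(1)] subset_iff)
  moreover have "image_mset ((*) c) S = image_mset (\<lambda>v. c * m (inv_into B f v)) (mset_set (f ` B))"
    unfolding S image_mset_mset_set[OF inj, symmetric] multiset.map_comp o_def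
    using inj B(1) by (intro image_mset_cong) simp
  ultimately show ?thesis unfolding diagonal_on_def using B(1)
    by (intro exI[of _ "f ` B"] exI[of _ "\<lambda>v. c * m (inv_into B f v)"]) simp
qed

text \<open>The functionals \<open>c\<close> form a dual system to the vectors \<open>e\<close>,
  which gives independence, and the expansion of each vector of \<open>V\<close> gives spanning.
  With \<open>H\<close> the identity this computes dimensions.\<close>

lemma diagonal_on_coords:
  assumes I: "finite I" and c: "\<And>i. i \<in> I \<Longrightarrow> linear (c i :: 'v::real_vector \<Rightarrow> real)"
    and ce: "\<And>i j. i \<in> I \<Longrightarrow> j \<in> I \<Longrightarrow> c i (e j) = of_bool (i = j)"
    and H: "\<And>i. i \<in> I \<Longrightarrow> H (e i) = \<mu> i *\<^sub>R e i"
    and V: "subspace V" "\<And>i. i \<in> I \<Longrightarrow> e i \<in> V" "\<And>x. x \<in> V \<Longrightarrow> x = (\<Sum>i\<in>I. c i x *\<^sub>R e i)"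
  shows "diagonal_on H V (image_mset \<mu> (mset_set I))"
proof -
  have inj: "inj_on e I"
    by (rule inj_onI) (metis ce of_bool_eq_iff)
  have "independent (e ` I)"
  proof (rule independent_if_scalars_zero)
    fix f x assume sum0: "(\<Sum>v\<in>e ` I. f v *\<^sub>R v) = 0" and x: "x \<in> e ` I"
    then obtain i where i: "i \<in> I" "x = e i" by auto
    have "0 = c i (\<Sum>j\<in>I. f (e j) *\<^sub>R e j)"
      using sum0 inj c[OF i(1)] by (simp add: sum.reindex linear_0)
    also have "\<dots> = (\<Sum>j\<in>I. f (e j) * c i (e j))"
      using c[OF i(1)] by (simp add: linear_sum linear_scale)
    also have "\<dots> = (\<Sum>j\<in>I. if j = i then f (e j) else 0)"
      using i by (intro sum.cong) (auto simp: ce)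
    also have "\<dots> = f x" using i I by simp
    finally show "f x = 0" by simp
  qed (use I in simp)
  moreover have "span (e ` I) = V"
  proof (rule span_subspace)
    show "V \<subseteq> span (e ` I)"
    proof
      fix x assume "x \<in> V"
      then show "x \<in> span (e ` I)"
        by (subst V(3)) (auto intro!: span_sum span_scale intro: span_base)
    qed
  qed (use V in auto)
  moreover have "\<forall>v\<in>e ` I. H v = \<mu> (inv_into I e v) *\<^sub>R v"
    using inj H by auto
  moreover have "image_mset \<mu> (mset_set I) = image_mset (\<lambda>v. \<mu> (inv_into I e v)) (mset_set (e ` I))"
    unfolding image_mset_mset_set[OF inj, symmetric] multiset.map_comp o_def
    using inj I by (intro image_mset_cong) simp
  ultimately show ?thesis unfolding diagonal_on_def using I
    by (intro exI[of _ "e ` I"] exI[of _ "\<lambda>v. \<mu> (inv_into I e v)"]) simp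
qed

lemma diagonal_on_dim: "diagonal_on H V S \<Longrightarrow> dim V = size S"
  unfolding diagonal_on_def by (auto simp: dim_eq_card_independent)

text \<open>Dimensions are sizes of eigenbases of the identity, so additivity is an instance of
  \<open>diagonal_on_sum\<close>.\<close>

lemma dim_direct_sum:
  fixes U V :: "'v::real_vector set"
  assumes "subspace U" "subspace V" "U \<subseteq> span F" "V \<subseteq> span F" "finite F" "U \<inter> V \<subseteq> {0}"
  shows "dim {u + v | u v. u \<in> U \<and> v \<in> V} = dim U + dim V"
proof -
  have "diagonal_on (\<lambda>v. v) U (replicate_mset (dim U) 1)" "diagonal_on (\<lambda>v. v) V (replicate_mset (dim V) 1)"
    using assms by (auto intro!: diagonal_on_const)
  from diagonal_on_dim[OF diagonal_on_sum[OF this assms(6) refl]] show ?thesis by simp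
qed

section \<open>Isotypic components, the group action and orbit lengths\<close>

lemma isotypic_superset:
  assumes "linear f" "inj_on f U" "f ` U \<subseteq> V" "\<And>g u. g \<in> G \<Longrightarrow> u \<in> U \<Longrightarrow> f (\<tau> g u) = \<rho> g (f u)"
  shows "f ` U \<subseteq> isotypic G \<rho> V \<tau> U"
proof -
  let ?F = "{f ` U | f. linear f \<and> inj_on f U \<and> f ` U \<subseteq> V \<and> (\<forall>g\<in>G. \<forall>u\<in>U. f (\<tau> g u) = \<rho> g (f u))}"
  have "f ` U = f ` U \<and> linear f \<and> inj_on f U \<and> f ` U \<subseteq> V \<and> (\<forall>g\<in>G. \<forall>u\<in>U. f (\<tau> g u) = \<rho> g (f u))"
    using assms(1-3) by (intro conjI refl ballI assms(4))
  then have "f ` U \<in> ?F"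
    by (intro CollectI) (rule exI)
  then show ?thesis
    unfolding isotypic_def by (rule order_trans[OF Union_upper span_superset])
qed

text \<open>The counterpart of \<open>isotypic_superset\<close>: an isotypic component is bounded
  from above by bounding the image of \<open>U\<close> under every equivariant linear map into
  \<open>V\<close>.\<close>

lemma isotypic_subset:
  assumes "subspace W" "\<And>f. linear f \<Longrightarrow> f ` U \<subseteq> V \<Longrightarrow>
    (\<And>g u. g \<in> G \<Longrightarrow> u \<in> U \<Longrightarrow> f (\<tau> g u) = \<rho> g (f u)) \<Longrightarrow> f ` U \<subseteq> W"
  shows "isotypic G \<rho> V \<tau> U \<subseteq> W"
  unfolding isotypic_def
proof (intro span_minimal Union_least assms(1))
  fix Y assume "Y \<in> {f ` U | f. linear f \<and> inj_on f U \<and> f ` U \<subseteq> V \<and> (\<forall>g\<in>G. \<forall>u\<in>U. f (\<tau> g u) = \<rho> g (f u))}"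
  then obtain f where "Y = f ` U" "linear f" "f ` U \<subseteq> V" "\<forall>g\<in>G. \<forall>u\<in>U. f (\<tau> g u) = \<rho> g (f u)"
    by blast
  then show "Y \<subseteq> W" using assms(2)[of f] by simp
qed

lemma subspace_isotypic: "subspace (isotypic G \<rho> V \<tau> U)"
  unfolding isotypic_def by (rule subspace_span)

lemma mat_act_apply: "mat_act (g, h) A i j = A (inv_into UNIV g i) (inv_into UNIV h j)"
  by (simp add: mat_act_def)

lemma group_S2: "group (S2 d)"
  by (intro DirProd_group sym_group_is_group)

lemma carrier_S2: "(g, h) \<in> carrier (S2 d) \<longleftrightarrow> g permutes {1..d} \<and> h permutes {1..d}"
  by (simp add: DirProd_def sym_group_carrier)

lemma bij_mat_act:
  assumes "g permutes A" "h permutes B"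
  shows "bij (mat_act (g, h))"
proof (rule o_bij)
  show "mat_act (inv_into UNIV g, inv_into UNIV h) \<circ> mat_act (g, h) = id"
    by (intro ext) (simp add: mat_act_def permutes_inv_inv[OF assms(1)] permutes_inv_inv[OF assms(2)]
      permutes_inverses[OF assms(1)] permutes_inverses[OF assms(2)])
  show "mat_act (g, h) \<circ> mat_act (inv_into UNIV g, inv_into UNIV h) = id"
    by (intro ext) (simp add: mat_act_def permutes_inv_inv[OF assms(1)] permutes_inv_inv[OF assms(2)]
      permutes_inverses[OF assms(1)] permutes_inverses[OF assms(2)])
qed

lemma carrier_BijGroup_UNIV: "f \<in> carrier (BijGroup UNIV) \<longleftrightarrow> bij f"
  by (simp add: BijGroup_def Bij_def extensional_def)

lemma mult_BijGroup_UNIV: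
  assumes "bij f" "bij g"
  shows "f \<otimes>\<^bsub>BijGroup UNIV\<^esub> g = f \<circ> g"
  unfolding BijGroup_def using assms
  by (simp add: Bij_def extensional_def compose_def comp_def restrict_UNIV)

lemma mult_S2: "(g, h) \<otimes>\<^bsub>S2 d\<^esub> (g', h') = (g \<circ> g', h \<circ> h')"
  by (simp add: DirProd_def sym_group_mult)

text \<open>Inverting a composition reverses its factors, so the inverses in \<open>mat_act\<close>
  make it a left action. Acting on the whole type makes every \<open>mat_act\<close> a bijection
  without restriction.\<close>

lemma group_action_mat_act: "group_action (S2 d) UNIV mat_act"
  unfolding group_action_def group_hom_def group_hom_axioms_def
proof (intro conjI group_S2 group_BijGroup homI)
  fix x assume x: "x \<in> carrier (S2 d)"
  obtain g h where gh: "x = (g, h)" by (cases x)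
  from x have "g permutes {1..d} \<and> h permutes {1..d}"
    unfolding gh carrier_S2 .
  then show "mat_act x \<in> carrier (BijGroup UNIV)"
    unfolding gh carrier_BijGroup_UNIV by (blast intro: bij_mat_act)
next
  fix x y assume xy: "x \<in> carrier (S2 d)" "y \<in> carrier (S2 d)"
  obtain g h g' h' where gh: "x = (g, h)" "y = (g', h')" by (cases x, cases y)
  from xy(1) have x: "g permutes {1..d}" "h permutes {1..d}"
    unfolding gh carrier_S2 by (rule conjunct1, rule conjunct2)
  from xy(2) have y: "g' permutes {1..d}" "h' permutes {1..d}"
    unfolding gh carrier_S2 by (rule conjunct1, rule conjunct2)
  have inv: "inv_into UNIV (g \<circ> g') i = inv_into UNIV g' (inv_into UNIV g i)"
    "inv_into UNIV (h \<circ> h') i = inv_into UNIV h' (inv_into UNIV h i)" for i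
    using x y by (simp_all add: o_inv_distrib permutes_bij)
  show "mat_act (x \<otimes>\<^bsub>S2 d\<^esub> y) = mat_act x \<otimes>\<^bsub>BijGroup UNIV\<^esub> mat_act y"
    unfolding gh mult_S2 mult_BijGroup_UNIV[OF bij_mat_act[OF x] bij_mat_act[OF y]]
    by (intro ext) (simp only: mat_act_apply o_apply inv)
qed

text \<open>The orbit-stabilizer theorem; all orbit lengths below are obtained by counting isotropy
  groups.\<close>

lemma orbit_length_isotropy: "orbit_length d W * card (isotropy d W) = fact d * fact d"
proof -
  have "order (S2 d) = fact d * fact d"
    using card_permutations[of "{1..d}" d]
    by (simp add: order_def DirProd_def sym_group_def card_cartesian_product)
  then show ?thesis
    using group_action.orbit_stabilizer_theorem[OF group_action_mat_act, of W d]
    by (simp add: orbit_length_def isotropy_def)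
qed

text \<open>Substituting \<open>g i\<close> and \<open>h j\<close> for the indices removes the
  inverses.\<close>

lemma isotropy_iff:
  "(g, h) \<in> isotropy d W \<longleftrightarrow> g permutes {1..d} \<and> h permutes {1..d} \<and> (\<forall>i j. W (g i) (h j) = W i j)"
proof -
  have "mat_act (g, h) W = W \<longleftrightarrow> (\<forall>i j. W (g i) (h j) = W i j)"
    if "g permutes {1..d}" "h permutes {1..d}"
    unfolding fun_eq_iff mat_act_apply
    using permutes_inverses[OF that(1)] permutes_inverses[OF that(2)] by metis
  then show ?thesis
    unfolding isotropy_def stabilizer_def mem_Collect_eq carrier_S2 by blast
qed

lemma Delta_iff: "(g, h) \<in> Delta G \<longleftrightarrow> g = h \<and> g \<in> G"
  by (auto simp: Delta_def)

lemma card_Delta: "card (Delta G) = card G"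
  unfolding Delta_def by (rule card_image) (auto simp: inj_on_def)

lemma card_sym_group: "card (carrier (sym_group d)) = fact d"
  using card_permutations[of "{1..d}" d] by (simp add: sym_group_def)

lemma fix_last_eq:
  assumes "d \<ge> 1"
  shows "fix_last d = {g. g permutes {1..d - 1}}"
proof -
  have "x \<notin> {1..d - 1} \<longleftrightarrow> x \<notin> {1..d} \<or> x = d" for x
    using assms by auto
  then have "g permutes {1..d - 1} \<longleftrightarrow> g permutes {1..d} \<and> g d = d" for g
    unfolding permutes_def by blast
  then show ?thesis by (simp add: fix_last_def sym_group_def)
qed

lemma card_fix_last: "d \<ge> 1 \<Longrightarrow> card (fix_last d) = fact (d - 1)"
  using card_permutations[of "{1..d - 1}" "d - 1"] by (simp add: fix_last_eq)

section \<open>Matrices supported on a block\<close>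

definition Supp :: "nat set \<Rightarrow> nat set \<Rightarrow> matr set" where
  "Supp R C = {A. \<forall>i j. i \<notin> R \<or> j \<notin> C \<longrightarrow> A i j = 0}"

lemma Mat_eq_Supp: "Mat k d = Supp {1..k} {1..d}"
  by (simp add: Mat_def Supp_def)

lemma subspace_Supp: "subspace (Supp R C)"
  by (auto simp: subspace_def Supp_def scaleR_fun_def)

lemma linear_entry: "linear (\<lambda>A. A i j :: real)"
  by (rule linearI) (auto simp: scaleR_fun_def)

lemma unit_mat_in_Supp: "i \<in> R \<Longrightarrow> j \<in> C \<Longrightarrow> unit_mat i j \<in> Supp R C"
  by (auto simp: Supp_def unit_mat_def)

lemma sum_fun_apply2: "(\<Sum>x\<in>A. f x) i j = (\<Sum>x\<in>A. f x i j)"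
  for f :: "'a \<Rightarrow> matr"
  by (induction A rule: infinite_finite_induct) auto

lemma sum_fun_apply1: "(\<Sum>x\<in>A. f x) i = (\<Sum>x\<in>A. f x i)"
  for f :: "'a \<Rightarrow> vect"
  by (induction A rule: infinite_finite_induct) auto

lemma Supp_expand:
  assumes "finite R" "finite C" "A \<in> Supp R C"
  shows "A = (\<Sum>p\<in>R \<times> C. A (fst p) (snd p) *\<^sub>R unit_mat (fst p) (snd p))"
proof (intro ext)
  fix i j
  have "(\<Sum>p\<in>R \<times> C. A (fst p) (snd p) *\<^sub>R unit_mat (fst p) (snd p)) i j
    = (\<Sum>p\<in>R \<times> C. if p = (i, j) then A i j else 0)"
    unfolding sum_fun_apply2 by (intro sum.cong) (auto simp: unit_mat_def scaleR_fun_def)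
  also have "\<dots> = A i j"
    using assms by (auto simp: Supp_def)
  finally show "A i j = (\<Sum>p\<in>R \<times> C. A (fst p) (snd p) *\<^sub>R unit_mat (fst p) (snd p)) i j" ..
qed

text \<open>The unit matrices are the eigenbasis. Applied to the identity map it gives the dimension
  of a block.\<close>

lemma diagonal_on_Supp:
  assumes "finite R" "finite C" "\<And>i j. i \<in> R \<Longrightarrow> j \<in> C \<Longrightarrow> H (unit_mat i j) = \<mu> i j *\<^sub>R unit_mat i j"
  shows "diagonal_on H (Supp R C) (image_mset (\<lambda>p. \<mu> (fst p) (snd p)) (mset_set (R \<times> C)))"
proof (rule diagonal_on_coords[where c = "\<lambda>p A. A (fst p) (snd p)" and e = "\<lambda>p. unit_mat (fst p) (snd p)"])
  show "unit_mat (fst i') (snd i') (fst i) (snd i) = of_bool (i = i')"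
    if "i \<in> R \<times> C" "i' \<in> R \<times> C" for i i' by (auto simp: unit_mat_def prod_eq_iff)
next
  show "A = (\<Sum>p\<in>R \<times> C. A (fst p) (snd p) *\<^sub>R unit_mat (fst p) (snd p))" if "A \<in> Supp R C" for A
    by (rule Supp_expand[OF assms(1,2) that])
next
  show "H (unit_mat (fst p) (snd p)) = \<mu> (fst p) (snd p) *\<^sub>R unit_mat (fst p) (snd p)" if "p \<in> R \<times> C" for p
    using that by (intro assms(3)) auto
next
  show "unit_mat (fst p) (snd p) \<in> Supp R C" if "p \<in> R \<times> C" for p
    using that by (intro unit_mat_in_Supp) auto
next
  show "linear (\<lambda>A. A (fst p) (snd p) :: real)" for p :: "nat \<times> nat"
    by (rule linear_entry)
qed (rule finite_cartesian_product[OF assms(1,2)] subspace_Supp)+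

lemma dim_Supp: "finite R \<Longrightarrow> finite C \<Longrightarrow> dim (Supp R C) = card R * card C"
  using diagonal_on_dim[OF diagonal_on_Supp[of R C "\<lambda>v. v" "\<lambda>_ _. 1"]]
  by (simp add: card_cartesian_product)

lemma Supp_subset_span:
  "finite R \<Longrightarrow> finite C \<Longrightarrow> Supp R C \<subseteq> span ((\<lambda>p. unit_mat (fst p) (snd p)) ` (R \<times> C))"
proof
  fix A assume "finite R" "finite C" "A \<in> Supp R C"
  then show "A \<in> span ((\<lambda>p. unit_mat (fst p) (snd p)) ` (R \<times> C))"
    by (subst Supp_expand[of R C A]) (auto intro!: span_sum span_scale intro: span_base)
qed

lemma diagonal_on_const_Supp:
  assumes "finite R" "finite C" "subspace V" "V \<subseteq> Supp R C" "\<And>v. v \<in> V \<Longrightarrow> H v = \<mu> *\<^sub>R v"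
  shows "diagonal_on H V (replicate_mset (dim V) \<mu>)"
  by (rule diagonal_on_const[OF assms(3) order_trans[OF assms(4) Supp_subset_span]])
    (use assms in auto)

lemma dim_direct_sum_Supp:
  assumes "finite R" "finite C" "subspace U" "subspace V" "U \<subseteq> Supp R C" "V \<subseteq> Supp R C" "U \<inter> V \<subseteq> {0}"
  shows "dim {u + v | u v. u \<in> U \<and> v \<in> V} = dim U + dim V"
  using assms
  by (intro dim_direct_sum[where F = "(\<lambda>p. unit_mat (fst p) (snd p)) ` (R \<times> C)"]
      order_trans[OF _ Supp_subset_span]) auto

section \<open>The isotypic components under the diagonal action\<close>

lemma subspace_std_rep: "subspace (std_rep d)"
  by (auto simp: subspace_def std_rep_def scaleR_fun_def sum.distrib sum_distrib_left[symmetric])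

lemma unit_vec_diff_std: "a \<in> {1..d} \<Longrightarrow> b \<in> {1..d} \<Longrightarrow> unit_vec a - unit_vec b \<in> std_rep d"
  by (auto simp: std_rep_def unit_vec_def sum_subtractf)

text \<open>The multiples of \<open>unit_vec d\<close> add up to the coordinate sum, which is 0. The
  summand \<open>i = d\<close> vanishes and is kept for uniformity.\<close>

lemma std_expand:
  assumes "u \<in> std_rep d"
  shows "u = (\<Sum>i=1..d. u i *\<^sub>R (unit_vec i - unit_vec d))"
proof
  fix k
  have "(\<Sum>i=1..d. u i *\<^sub>R (unit_vec i - unit_vec d)) k
     = (\<Sum>i=1..d. u i * of_bool (k = i)) - (\<Sum>i=1..d. u i) * of_bool (k = d)"
    unfolding sum_fun_apply1
    by (simp add: scaleR_fun_def unit_vec_def algebra_simps sum_subtractf sum_distrib_left del: sum_mult_of_bool_eq)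
  also have "\<dots> = u k"
    using assms by (cases "k \<in> {1..d}") (auto simp: std_rep_def sum_of_bool_eq intro!: sum.neutral simp del: sum_mult_of_bool_eq)
  finally show "u k = (\<Sum>i=1..d. u i *\<^sub>R (unit_vec i - unit_vec d)) k" ..
qed

text \<open>The dimension of the standard representation, phrased as an eigenbasis of the identity
  so that \<open>diagonal_on_image\<close> can carry it to every copy inside the matrices.\<close>

lemma std_rep_diagonal: "diagonal_on (\<lambda>u. u) (std_rep d) (replicate_mset (d - 1) 1)"
proof -
  have "diagonal_on (\<lambda>u. u) (std_rep d) (image_mset (\<lambda>_. 1) (mset_set {1..d - 1}))"
  proof (rule diagonal_on_coords[where c = "\<lambda>i u. u i" and e = "\<lambda>i. unit_vec i - unit_vec d"])
    fix u assume u: "u \<in> std_rep d"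
    have last: "i = d" if "i \<in> {1..d} - {1..d - 1}" for i
      using that by auto
    have "(\<Sum>i=1..d. u i *\<^sub>R (unit_vec i - unit_vec d)) = (\<Sum>i=1..d - 1. u i *\<^sub>R (unit_vec i - unit_vec d))"
    proof (rule sum.mono_neutral_right)
      show "\<forall>i\<in>{1..d} - {1..d - 1}. u i *\<^sub>R (unit_vec i - unit_vec d) = 0"
        using last by (metis diff_self scaleR_zero_right)
      show "{1..d - 1} \<subseteq> {1..d}" by (rule atLeastatMost_subset_iff[THEN iffD2]) simp
    qed (rule finite_atLeastAtMost)
    with std_expand[OF u] show "u = (\<Sum>i=1..d - 1. u i *\<^sub>R (unit_vec i - unit_vec d))"
      by (rule trans)
  next
    fix i j assume "i \<in> {1..d - 1}" "j \<in> {1..d - 1}"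
    then show "(unit_vec j - unit_vec d) i = of_bool (i = j)" by (auto simp: unit_vec_def)
  next
    fix i assume "i \<in> {1..d - 1}"
    then show "unit_vec i - unit_vec d \<in> std_rep d" by (intro unit_vec_diff_std) auto
  next
    show "linear (\<lambda>u :: vect. u i)" for i by (rule linearI) (simp_all add: scaleR_fun_def)
  next
    show "unit_vec i - unit_vec d = 1 *\<^sub>R (unit_vec i - unit_vec d)" for i by simp
  qed (rule finite_atLeastAtMost subspace_std_rep)+
  then show ?thesis by (simp add: image_mset_const_eq)
qed

text \<open>\<open>mix d a b\<close> is \<open>a I + b J\<close> with \<open>J\<close> the all-ones matrix.\<close>

definition mix :: "nat \<Rightarrow> real \<Rightarrow> real \<Rightarrow> matr" where
  "mix d a b = (\<lambda>i j. of_bool (i \<in> {1..d} \<and> j \<in> {1..d}) * (a * of_bool (i = j) + b))"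

text \<open>Three copies of the standard representation at once: \<open>u\<close> sits on the
  diagonal, \<open>v\<close> is constant along rows and \<open>w\<close> is constant along
  columns.\<close>

definition std_mat :: "nat \<Rightarrow> vect \<Rightarrow> vect \<Rightarrow> vect \<Rightarrow> matr" where
  "std_mat d u v w = (\<lambda>i j. of_bool (i \<in> {1..d} \<and> j \<in> {1..d}) * (of_bool (i = j) * u i + v i + w j))"

definition triv_space :: "nat \<Rightarrow> matr set" where
  "triv_space d = {mix d a b | a b. True}"

definition std_space :: "nat \<Rightarrow> matr set" where
  "std_space d = {std_mat d u v w | u v w. u \<in> std_rep d \<and> v \<in> std_rep d \<and> w \<in> std_rep d}"

text \<open>The model of the tensor square of the standard representation. Its antisymmetric part is
  the type x, its symmetric part with zero diagonal the type y.\<close>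

definition zero_sums :: "nat \<Rightarrow> matr set" where
  "zero_sums d = {A \<in> Mat d d. \<forall>k. (\<Sum>l=1..d. A k l) = 0 \<and> (\<Sum>l=1..d. A l k) = 0}"

definition alt_space :: "nat \<Rightarrow> matr set" where
  "alt_space d = {A \<in> zero_sums d. \<forall>i j. A j i = - A i j}"

definition sym_space :: "nat \<Rightarrow> matr set" where
  "sym_space d = {A \<in> zero_sums d. (\<forall>i j. A j i = A i j) \<and> (\<forall>i. A i i = 0)}"

lemma subspace_zero_sums: "subspace (zero_sums d)"
  by (auto simp: subspace_def zero_sums_def Mat_def scaleR_fun_def sum.distrib sum_distrib_left[symmetric])

lemma subspace_alt_space: "subspace (alt_space d)"
proof -
  have "alt_space d = zero_sums d \<inter> {A. \<forall>i j. A i j + A j i = 0}"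
    unfolding alt_space_def by (auto simp: eq_neg_iff_add_eq_0)
  moreover have "subspace {A :: matr. \<forall>i j. A i j + A j i = 0}"
    by (rule subspaceI) (auto simp: scaleR_fun_def add.assoc add.left_commute simp flip: distrib_left)
  ultimately show ?thesis using subspace_zero_sums by (simp only: subspace_inter)
qed

lemma subspace_sym_space: "subspace (sym_space d)"
proof -
  have "sym_space d = zero_sums d \<inter> {A. \<forall>i j. A i j - A j i = 0} \<inter> {A. \<forall>i. A i i = 0}"
    unfolding sym_space_def by auto
  moreover have "subspace {A :: matr. \<forall>i j. A i j - A j i = 0}" "subspace {A :: matr. \<forall>i. A i i = 0}"
    by (auto intro!: subspaceI simp: scaleR_fun_def)
  ultimately show ?thesis using subspace_zero_sums by (simp only: subspace_inter)
qed

lemma mix_add: "mix d a b + mix d a' b' = mix d (a + a') (b + b')"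
  by (auto simp: mix_def fun_eq_iff algebra_simps)

lemma mix_scale: "c *\<^sub>R mix d a b = mix d (c * a) (c * b)"
  by (auto simp: mix_def fun_eq_iff algebra_simps scaleR_fun_def)

lemma mix_zero: "mix d 0 0 = 0"
  by (auto simp: mix_def fun_eq_iff)

lemma subspace_triv_space: "subspace (triv_space d)"
proof (rule subspaceI)
  show "0 \<in> triv_space d" unfolding triv_space_def using mix_zero[of d] by force
next
  fix A B assume "A \<in> triv_space d" "B \<in> triv_space d"
  then obtain a b a' b' where "A = mix d a b" "B = mix d a' b'" unfolding triv_space_def by blast
  then have "A + B = mix d (a + a') (b + b')" by (simp only: mix_add)
  then show "A + B \<in> triv_space d" unfolding triv_space_def by blast
next
  fix c A assume "A \<in> triv_space d"
  then obtain a b where "A = mix d a b" unfolding triv_space_def by blast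
  then have "c *\<^sub>R A = mix d (c * a) (c * b)" by (simp only: mix_scale)
  then show "c *\<^sub>R A \<in> triv_space d" unfolding triv_space_def by blast
qed

lemma std_mat_add: "std_mat d u v w + std_mat d u' v' w' = std_mat d (u + u') (v + v') (w + w')"
  by (auto simp: std_mat_def fun_eq_iff algebra_simps)

lemma std_mat_scale: "c *\<^sub>R std_mat d u v w = std_mat d (c *\<^sub>R u) (c *\<^sub>R v) (c *\<^sub>R w)"
  by (auto simp: std_mat_def fun_eq_iff algebra_simps scaleR_fun_def)

lemma std_mat_zero: "std_mat d 0 0 0 = 0"
  by (auto simp: std_mat_def fun_eq_iff)

lemma subspace_std_space: "subspace (std_space d)"
proof (rule subspaceI)
  show "0 \<in> std_space d"
    using std_mat_zero[of d] subspace_0[OF subspace_std_rep, of d] unfolding std_space_def by force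
next
  fix A B assume "A \<in> std_space d" "B \<in> std_space d"
  then obtain u v w u' v' w' where "A = std_mat d u v w" "B = std_mat d u' v' w'"
    and uvw: "u \<in> std_rep d" "v \<in> std_rep d" "w \<in> std_rep d" "u' \<in> std_rep d" "v' \<in> std_rep d" "w' \<in> std_rep d"
    unfolding std_space_def by blast
  then have "A + B = std_mat d (u + u') (v + v') (w + w')" by (simp only: std_mat_add)
  then show "A + B \<in> std_space d"
    unfolding std_space_def using uvw subspace_add[OF subspace_std_rep, of _ d] by blast
next
  fix c A assume "A \<in> std_space d"
  then obtain u v w where "A = std_mat d u v w"
    and uvw: "u \<in> std_rep d" "v \<in> std_rep d" "w \<in> std_rep d"
    unfolding std_space_def by blast
  then have "c *\<^sub>R A = std_mat d (c *\<^sub>R u) (c *\<^sub>R v) (c *\<^sub>R w)" by (simp only: std_mat_scale)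
  then show "c *\<^sub>R A \<in> std_space d"
    unfolding std_space_def using uvw subspace_scale[OF subspace_std_rep, of _ d] by blast
qed

lemma mat_act_eq_iff:
  assumes "g permutes A" "h permutes B"
  shows "mat_act (g, h) X = Y \<longleftrightarrow> (\<forall>i j. Y (g i) (h j) = X i j)"
  unfolding fun_eq_iff mat_act_apply
  using permutes_inverses[OF assms(1)] permutes_inverses[OF assms(2)] by metis

lemma vec_act_apply: "g permutes A \<Longrightarrow> vec_act g u (g i) = u i"
  by (simp add: vec_act_def permutes_inverses)

lemma mat_act_apply': "g permutes A \<Longrightarrow> h permutes B \<Longrightarrow> mat_act (g, h) X (g i) (h j) = X i j"
  by (simp add: mat_act_def permutes_inverses)

lemma permutes_range: "g permutes {1..d} \<Longrightarrow> g i \<in> {1..d} \<longleftrightarrow> i \<in> {1..d}"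
  by (rule permutes_in_image)

lemma permutes_eq: "g permutes A \<Longrightarrow> g i = g j \<longleftrightarrow> i = j"
  by (metis permutes_inverses(2))

lemma vec_act_unit_vec: "g permutes A \<Longrightarrow> vec_act g (unit_vec a) = unit_vec (g a)"
  by (auto simp: vec_act_def unit_vec_def fun_eq_iff permutes_inverses permutes_inv_eq)

lemma vec_act_diff: "vec_act g (u - v) = vec_act g u - vec_act g v"
  by (auto simp: vec_act_def fun_eq_iff)

lemma exists_permutes2:
  assumes "a \<in> A" "b \<in> A" "c \<in> A" "e \<in> A" "a \<noteq> b" "c \<noteq> e"
  shows "\<exists>g. g permutes A \<and> g a = c \<and> g b = e"
proof -
  let ?t = "Transposition.transpose a c"
  let ?g = "Transposition.transpose (?t b) e \<circ> ?t"
  have "?t b \<in> A" using assms by (auto simp: Transposition.transpose_def)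
  then have "?g permutes A" using assms by (intro permutes_compose permutes_swap_id) auto
  moreover have "?g a = c" "?g b = e" using assms by (auto simp: Transposition.transpose_def)
  ultimately show ?thesis by blast
qed

lemma exists_permutes3:
  assumes "a \<in> A" "b \<in> A" "c \<in> A" "distinct [a, b, c]"
  shows "\<exists>g. g permutes A \<and> g a = b \<and> g b = c \<and> g c = a"
proof -
  let ?g = "Transposition.transpose a b \<circ> Transposition.transpose b c"
  have "?g permutes A" using assms by (intro permutes_compose permutes_swap_id) auto
  moreover have "?g a = b" "?g b = c" "?g c = a" using assms by (auto simp: Transposition.transpose_def)
  ultimately show ?thesis by blast
qed

lemma carrier_sym_group: "g \<in> carrier (sym_group d) \<longleftrightarrow> g permutes {1..d}"
  by (rule sym_group_carrier)

text \<open>The image of 1 is an invariant matrix. Permutations act transitively on diagonal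
  positions and on off-diagonal positions, so it is determined by one value of each kind.\<close>

lemma type_t_eq:
  assumes "d \<ge> 1"
  shows "type_t d = triv_space d"
proof (rule antisym)
  show "type_t d \<subseteq> triv_space d"
    unfolding type_t_def diag_isotypic_def
  proof (rule isotypic_subset[OF subspace_triv_space])
    fix f :: "real \<Rightarrow> matr"
    assume f: "linear f" "range f \<subseteq> Mat d d"
      and eq: "\<And>g u. g \<in> carrier (sym_group d) \<Longrightarrow> u \<in> UNIV \<Longrightarrow> f u = mat_act (g, g) (f u)"
    have inv: "f 1 (g i) (g j) = f 1 i j" if "g permutes {1..d}" for g i j
      using eq[of g 1] that mat_act_eq_iff[OF that that, of "f 1" "f 1"]
      by (simp add: carrier_sym_group)
    have Mat: "f 1 \<in> Mat d d" using f by auto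
    have diag: "f 1 i i = f 1 1 1" if "i \<in> {1..d}" for i
    proof -
      have "Transposition.transpose 1 i permutes {1..d}"
        using that assms by (intro permutes_swap_id) auto
      from inv[OF this, of 1 1] show ?thesis by simp
    qed
    have off: "f 1 i j = f 1 1 2" if ij: "i \<in> {1..d}" "j \<in> {1..d}" "i \<noteq> j" for i j
    proof -
      have "2 \<in> {1..d}" using ij by auto
      then obtain g where g: "g permutes {1..d}" "g 1 = i" "g 2 = j"
        using exists_permutes2[of 1 "{1..d}" 2 i j] ij assms by auto
      from inv[OF g(1), of 1 2] show ?thesis by (simp only: g)
    qed
    have "f 1 = mix d (f 1 1 1 - f 1 1 2) (f 1 1 2)"
    proof (intro ext)
      fix i j show "f 1 i j = mix d (f 1 1 1 - f 1 1 2) (f 1 1 2) i j"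
        using Mat diag[of i] off[of i j] by (cases "i \<in> {1..d} \<and> j \<in> {1..d}") (auto simp: mix_def Mat_def)
    qed
    then have "f 1 \<in> triv_space d" unfolding triv_space_def by blast
    then have "c *\<^sub>R f 1 \<in> triv_space d" for c by (rule subspace_scale[OF subspace_triv_space])
    moreover have "f c = c *\<^sub>R f 1" for c
      using linear_scale[OF f(1), of c 1] by simp
    ultimately show "range f \<subseteq> triv_space d"
      by (metis image_subsetI)
  qed
next
  \<comment> \<open>\<open>a + b\<close> is the entry at \<open>1 1\<close>, so the hypothesis makes
    the embedding injective. It is used for the identity matrix and for the all-ones matrix, which
    span the space.\<close>
  have sup: "range (\<lambda>c. c *\<^sub>R mix d a b) \<subseteq> type_t d" if ab: "a + b \<noteq> 0" for a b
    unfolding type_t_def diag_isotypic_def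
  proof (rule isotypic_superset)
    show "linear (\<lambda>c. c *\<^sub>R mix d a b)" by (rule linearI) (auto simp: algebra_simps)
    have "mix d a b 1 1 \<noteq> 0" using assms ab by (simp add: mix_def)
    then show "inj (\<lambda>c. c *\<^sub>R mix d a b)" by (auto intro!: injI)
    show "range (\<lambda>c. c *\<^sub>R mix d a b) \<subseteq> Mat d d" by (auto simp: Mat_def mix_def scaleR_fun_def)
    fix g c assume "g \<in> carrier (sym_group d)" "c \<in> (UNIV :: real set)"
    then have g: "g permutes {1..d}" by (simp only: carrier_sym_group)
    show "c *\<^sub>R mix d a b = mat_act (g, g) (c *\<^sub>R mix d a b)"
      by (rule sym) (simp only: mat_act_eq_iff[OF g g] mix_scale, simp only: mix_def permutes_range[OF g] permutes_eq[OF g], simp)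
  qed
  show "triv_space d \<subseteq> type_t d"
  proof
    fix A assume "A \<in> triv_space d"
    then obtain a b where A: "A = mix d a b" by (auto simp: triv_space_def)
    have "A = a *\<^sub>R mix d 1 0 + b *\<^sub>R mix d 0 1" by (simp add: A mix_scale mix_add)
    moreover have "a *\<^sub>R mix d 1 0 \<in> type_t d" "b *\<^sub>R mix d 0 1 \<in> type_t d"
      using sup[of 1 0] sup[of 0 1] by auto
    ultimately show "A \<in> type_t d"
      by (simp only:) (auto simp: type_t_def diag_isotypic_def intro: subspace_add[OF subspace_isotypic])
  qed
qed

lemma linear_std_mat:
  "linear (\<lambda>u. std_mat d u 0 0)" "linear (\<lambda>u. std_mat d 0 u 0)" "linear (\<lambda>u. std_mat d 0 0 u)"
  by (auto intro!: linearI simp: std_mat_def fun_eq_iff scaleR_fun_def algebra_simps)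

lemma inj_std_mat:
  "inj_on (\<lambda>u. std_mat d u 0 0) (std_rep d)" "inj_on (\<lambda>u. std_mat d 0 u 0) (std_rep d)"
  "inj_on (\<lambda>u. std_mat d 0 0 u) (std_rep d)"
proof -
  have *: "u = v" if "u \<in> std_rep d" "v \<in> std_rep d" "\<And>k. k \<in> {1..d} \<Longrightarrow> u k = v k" for u v
    using that unfolding std_rep_def by (auto intro!: ext) (metis atLeastAtMost_iff)
  show "inj_on (\<lambda>u. std_mat d u 0 0) (std_rep d)"
  proof (intro inj_onI *, assumption, assumption)
    fix u v k assume "std_mat d u 0 0 = std_mat d v 0 0" "k \<in> {1..d}"
    then show "u k = v k" by (auto simp: std_mat_def dest!: fun_cong[where x = k])
  qed
  show "inj_on (\<lambda>u. std_mat d 0 u 0) (std_rep d)"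
  proof (intro inj_onI *, assumption, assumption)
    fix u v k assume "std_mat d 0 u 0 = std_mat d 0 v 0" "k \<in> {1..d}"
    then show "u k = v k" by (auto simp: std_mat_def dest!: fun_cong[where x = k])
  qed
  show "inj_on (\<lambda>u. std_mat d 0 0 u) (std_rep d)"
  proof (intro inj_onI *, assumption, assumption)
    fix u v k assume "std_mat d 0 0 u = std_mat d 0 0 v" "k \<in> {1..d}"
    then show "u k = v k" by (auto simp: std_mat_def dest!: fun_cong[where x = k])
  qed
qed

lemma std_mat_in_Mat: "std_mat d u v w \<in> Mat d d"
  by (auto simp: Mat_def std_mat_def)

lemma std_mat_act:
  assumes g: "g permutes {1..d}"
  shows "mat_act (g, g) (std_mat d u v w) = std_mat d (vec_act g u) (vec_act g v) (vec_act g w)"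
  by (simp only: mat_act_eq_iff[OF g g] std_mat_def permutes_range[OF g] permutes_eq[OF g] vec_act_apply[OF g], simp)

lemma vec_act_0: "vec_act g 0 = 0"
  by (simp add: vec_act_def fun_eq_iff)

text \<open>An equivariant map is determined by its value \<open>B\<close> on a difference of two
  unit vectors. The swap of \<open>a\<close> and \<open>b\<close> negates \<open>B\<close> and the
  permutations of the other indices fix it, which leaves few free entries; these match
  \<open>std_mat\<close> with all three vectors proportional to that difference.\<close>

lemma type_s_eq:
  assumes d: "d \<ge> 3"
  shows "type_s d = std_space d"
proof (rule antisym)
  show "type_s d \<subseteq> std_space d"
    unfolding type_s_def diag_isotypic_def
  proof (rule isotypic_subset[OF subspace_std_space])
    fix f :: "vect \<Rightarrow> matr"
    assume f: "linear f" "f ` std_rep d \<subseteq> Mat d d"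
      and eq: "\<And>g u. g \<in> carrier (sym_group d) \<Longrightarrow> u \<in> std_rep d \<Longrightarrow> f (vec_act g u) = mat_act (g, g) (f u)"
    define v where "v a b = unit_vec a - unit_vec b" for a b
    have v: "v a b \<in> std_rep d" if "a \<in> {1..d}" "b \<in> {1..d}" for a b
      unfolding v_def using that by (rule unit_vec_diff_std)
    have act: "f (v (g a) (g b)) (g i) (g j) = f (v a b) i j"
      if "g permutes {1..d}" "a \<in> {1..d}" "b \<in> {1..d}" for g a b i j
      using eq[of g "v a b"] v[of a b] that mat_act_apply'[OF that(1) that(1), of "f (v a b)" i j]
      by (simp add: carrier_sym_group v_def vec_act_diff vec_act_unit_vec)
    have gen: "f (v a b) \<in> std_space d" if ab: "a \<in> {1..d}" "b \<in> {1..d}" "a \<noteq> b" for a b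
    proof -
      define B where "B = f (v a b)"
      have BM: "B i j = 0" if "i \<notin> {1..d} \<or> j \<notin> {1..d}" for i j
      proof -
        have "B \<in> Mat d d" unfolding B_def using f(2) v[OF ab(1,2)] by blast
        then show ?thesis using that unfolding Mat_def by blast
      qed
      have neg: "f (v b a) i j = - B i j" for i j
        using linear_neg[OF f(1), of "v a b"] by (simp add: B_def v_def)
      have sw: "B (Transposition.transpose a b i) (Transposition.transpose a b j) = - B i j" for i j
        using act[of "Transposition.transpose a b" a b i j] ab neg[of "Transposition.transpose a b i" "Transposition.transpose a b j"]
        by (simp add: permutes_swap_id B_def)
      have fix1: "B i j = 0" if "i \<notin> {a, b}" "j \<notin> {a, b}" for i j
        using sw[of i j] that by (simp add: Transposition.transpose_def)
      \<comment> \<open>A third index; this is where \<open>d\<close> must be at least 3.\<close>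
      obtain m where m: "m \<in> {1..d}" "m \<noteq> a" "m \<noteq> b"
      proof -
        have "card ({1..d} - {a, b}) \<ge> 1"
          using d ab by (simp add: card_Diff_subset)
        then have "{1..d} - {a, b} \<noteq> {}" by (metis card.empty not_one_le_zero)
        then show ?thesis using that by blast
      qed
      have inv: "B (Transposition.transpose m j i) (Transposition.transpose m j k) = B i k" if "j \<in> {1..d}" "j \<noteq> a" "j \<noteq> b" for i j k
        using act[of "Transposition.transpose m j" a b i k] ab that m by (simp add: permutes_swap_id B_def Transposition.transpose_def)
      define c c' where "c = B a m" and "c' = B m a"
      have row: "B a j = c" "B j a = c'" if "j \<in> {1..d}" "j \<noteq> a" "j \<noteq> b" for j
        using inv[OF that, of a m] inv[OF that, of m a] that m by (auto simp: c_def c'_def Transposition.transpose_def)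
      have row': "B b j = - c" "B j b = - c'" if "j \<in> {1..d}" "j \<noteq> a" "j \<noteq> b" for j
        using sw[of a j] sw[of j a] row[OF that] that ab by (auto simp: Transposition.transpose_def)
      have bb: "B b b = - B a a" "B b a = - B a b"
        using sw[of a a] sw[of a b] ab by (auto simp: Transposition.transpose_def)
      \<comment> \<open>The symmetries of the pair alone do not determine this entry. It follows
        from the relation that the differences along a cycle of three indices add up to 0.\<close>
      have abc: "B a b = c - c'"
      proof -
        obtain g where g: "g permutes {1..d}" "g a = b" "g b = m" "g m = a"
          using exists_permutes3[of a "{1..d}" b m] ab m by auto
        obtain h where h: "h permutes {1..d}" "h a = m" "h m = b" "h b = a"
          using exists_permutes3[of a "{1..d}" m b] ab m by auto
        have "v a b + v b m + v m a = 0" by (simp add: v_def)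
        then have "f (v a b) + f (v b m) + f (v m a) = 0"
          by (simp add: linear_0[OF f(1)] flip: linear_add[OF f(1)])
        from fun_cong[OF fun_cong[OF this], of a b]
        have "f (v a b) a b + f (v b m) a b + f (v m a) a b = 0" by simp
        moreover have "f (v b m) a b = B m a"
          using act[OF g(1) ab(1,2), of m a] by (simp add: g B_def)
        moreover have "f (v m a) a b = B b m"
          using act[OF h(1) ab(1,2), of b m] by (simp add: h B_def)
        ultimately show ?thesis using row' m by (simp add: B_def[symmetric] c'_def)
      qed
      \<comment> \<open>\<open>c\<close> and \<open>c'\<close> are the constant values in row
        \<open>a\<close> and column \<open>a\<close>; the diagonal coefficient is chosen so that the
        entry at \<open>a a\<close> comes out right.\<close>
      have "B = std_mat d ((B a a - c - c') *\<^sub>R v a b) (c *\<^sub>R v a b) (c' *\<^sub>R v a b)" (is "_ = ?R")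
      proof (intro ext)
        fix i j
        show "B i j = ?R i j"
        proof (cases "i \<in> {1..d} \<and> j \<in> {1..d}")
          case False
          then show ?thesis using BM[of i j] by (auto simp: std_mat_def)
        next
          case True
          then have R: "?R i j = of_bool (i = j) * (B a a - c - c') * v a b i + c * v a b i + c' * v a b j"
            by (simp add: std_mat_def scaleR_fun_def)
          have vab: "v a b a = 1" "v a b b = - 1" "\<And>k. k \<noteq> a \<Longrightarrow> k \<noteq> b \<Longrightarrow> v a b k = 0"
            using ab by (simp_all add: v_def unit_vec_def)
          consider "i = a" "j = a" | "i = a" "j = b" | "i = b" "j = a" | "i = b" "j = b"
            | "i = a" "j \<noteq> a" "j \<noteq> b" | "i = b" "j \<noteq> a" "j \<noteq> b" | "j = a" "i \<noteq> a" "i \<noteq> b"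
            | "j = b" "i \<noteq> a" "i \<noteq> b" | "i \<notin> {a, b}" "j \<notin> {a, b}" by blast
          then have "B i j = of_bool (i = j) * (B a a - c - c') * v a b i + c * v a b i + c' * v a b j"
          proof cases
            case 1 then show ?thesis by (simp add: vab)
          next
            case 2 then show ?thesis using ab by (simp add: vab abc)
          next
            case 3 then show ?thesis using ab by (simp add: vab bb(2) abc)
          next
            case 4 then show ?thesis by (simp add: vab bb(1))
          next
            case 5 then show ?thesis using row[of j] True by (simp add: vab)
          next
            case 6 then show ?thesis using row'[of j] True by (simp add: vab)
          next
            case 7 then show ?thesis using row[of i] True by (simp add: vab)
          next
            case 8 then show ?thesis using row'[of i] True by (simp add: vab)
          next
            case 9 then show ?thesis using fix1[of i j] by (simp add: vab)
          qed
          then show ?thesis using R by simp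
        qed
      qed
      then show ?thesis
        unfolding B_def[symmetric] std_space_def using v[OF ab(1,2)] subspace_scale[OF subspace_std_rep, of _ d]
        by blast
    qed
    have gen': "f (v a b) \<in> std_space d" if "a \<in> {1..d}" "b \<in> {1..d}" for a b
      using gen[OF that] subspace_0[OF subspace_std_space, of d]
      by (cases "a = b") (auto simp: v_def linear_0[OF f(1)])
    show "f ` std_rep d \<subseteq> std_space d"
    proof
      fix X assume "X \<in> f ` std_rep d"
      then obtain u where u: "u \<in> std_rep d" "X = f u" by blast
      have "X = (\<Sum>i=1..d. u i *\<^sub>R f (v i d))"
        unfolding u(2) by (subst std_expand[OF u(1)]) (simp add: linear_sum[OF f(1)] linear_scale[OF f(1)] v_def)
      then show "X \<in> std_space d"
        using gen' d by (auto intro!: subspace_sum[OF subspace_std_space] subspace_scale[OF subspace_std_space])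
    qed
  qed
next
  have eqv: "std_mat d (vec_act g u) 0 0 = mat_act (g, g) (std_mat d u 0 0)"
    "std_mat d 0 (vec_act g u) 0 = mat_act (g, g) (std_mat d 0 u 0)"
    "std_mat d 0 0 (vec_act g u) = mat_act (g, g) (std_mat d 0 0 u)"
    if "g \<in> carrier (sym_group d)" for g u
    using that unfolding carrier_sym_group by (simp_all only: std_mat_act vec_act_0)
  have sup: "(\<lambda>u. std_mat d u 0 0) ` std_rep d \<subseteq> type_s d" "(\<lambda>u. std_mat d 0 u 0) ` std_rep d \<subseteq> type_s d"
    "(\<lambda>u. std_mat d 0 0 u) ` std_rep d \<subseteq> type_s d"
    unfolding type_s_def diag_isotypic_def
    using std_mat_in_Mat by (intro isotypic_superset linear_std_mat inj_std_mat eqv; blast)+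
  show "std_space d \<subseteq> type_s d"
  proof
    fix A assume "A \<in> std_space d"
    then obtain u v w where A: "A = std_mat d u v w" and uvw: "u \<in> std_rep d" "v \<in> std_rep d" "w \<in> std_rep d"
      by (auto simp: std_space_def)
    have "A = std_mat d u 0 0 + std_mat d 0 v 0 + std_mat d 0 0 w" by (simp add: A std_mat_add)
    moreover have "subspace (type_s d)" unfolding type_s_def diag_isotypic_def by (rule subspace_isotypic)
    ultimately show "A \<in> type_s d"
      using sup uvw by (simp only:) (intro subspace_add; blast)
  qed
qed

abbreviation evec_diff :: "nat \<Rightarrow> nat \<Rightarrow> vect" where
  "evec_diff a b \<equiv> unit_vec a - unit_vec b"

lemma sum_of_bool_Mat:
  assumes "A \<in> Mat d d"
  shows "(\<Sum>j=1..d. A i j * of_bool (l = j)) = A i l" "(\<Sum>j=1..d. A j i * of_bool (l = j)) = A l i"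
proof -
  have "A i l = 0 \<and> A l i = 0" if "l \<notin> {1..d}"
    using assms that unfolding Mat_def by blast
  then show "(\<Sum>j=1..d. A i j * of_bool (l = j)) = A i l" "(\<Sum>j=1..d. A j i * of_bool (l = j)) = A l i"
    by (cases "l \<in> {1..d}"; simp add: sum_of_bool_eq del: sum_mult_of_bool_eq; force intro!: sum.neutral)+
qed

text \<open>All terms that involve \<open>unit_vec d\<close> carry a row sum or a column sum of
  \<open>A\<close> as coefficient and vanish.\<close>

lemma zero_sums_expand:
  assumes A: "A \<in> zero_sums d"
  shows "A = (\<Sum>i=1..d. \<Sum>j=1..d. A i j *\<^sub>R outer (evec_diff i d) (evec_diff j d))"
proof (intro ext)
  fix k l
  from A have M: "A \<in> Mat d d" and z: "(\<Sum>l=1..d. A k l) = 0" "(\<Sum>l=1..d. A l k) = 0" for k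
    by (auto simp: zero_sums_def)
  have "(\<Sum>i=1..d. \<Sum>j=1..d. A i j *\<^sub>R outer (evec_diff i d) (evec_diff j d)) k l
     = (\<Sum>i=1..d. (of_bool (k = i) - of_bool (k = d)) *
         ((\<Sum>j=1..d. A i j * of_bool (l = j)) - of_bool (l = d) * (\<Sum>j=1..d. A i j)))"
    unfolding sum_fun_apply2 scaleR_fun_def outer_def unit_vec_def fun_diff_def sum_distrib_left
      sum_subtractf[symmetric] real_scaleR_def
    by (intro sum.cong refl) (simp add: algebra_simps)
  also have "\<dots> = (\<Sum>i=1..d. A i l * of_bool (k = i)) - (\<Sum>i=1..d. A i l * of_bool (k = d))"
    unfolding sum_of_bool_Mat(1)[OF M] z(1) sum_subtractf[symmetric]
    by (intro sum.cong refl) (simp add: algebra_simps)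
  also have "\<dots> = A k l"
    unfolding sum_of_bool_Mat(2)[OF M] sum_distrib_right[symmetric] z by simp
  finally show "A k l = (\<Sum>i=1..d. \<Sum>j=1..d. A i j *\<^sub>R outer (evec_diff i d) (evec_diff j d)) k l" ..
qed

text \<open>The wedge of two differences of unit vectors. It is the signed adjacency matrix of the
  oriented cycle \<open>a\<close>, \<open>b\<close>, \<open>c\<close>, which is why every
  transposition of the three indices negates it.\<close>

definition cyc :: "nat \<Rightarrow> nat \<Rightarrow> nat \<Rightarrow> matr" where
  "cyc a b c = outer (evec_diff a c) (evec_diff b c) - outer (evec_diff b c) (evec_diff a c)"

lemma cyc_apply: "cyc a b c i j = of_bool (i = a \<and> j = b) - of_bool (i = b \<and> j = a)
  + of_bool (i = b \<and> j = c) - of_bool (i = c \<and> j = b) + of_bool (i = c \<and> j = a) - of_bool (i = a \<and> j = c)"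
  by (simp add: cyc_def outer_def unit_vec_def of_bool_conj algebra_simps)

lemma cyc_swap:
  fixes a b c :: nat
  shows "cyc b a c = - cyc a b c" "cyc c b a = - cyc a b c" "cyc a c b = - cyc a b c"
  by (intro ext; simp add: cyc_apply)+

lemma cyc_degenerate: "cyc a a c = 0" "cyc a c c = 0" "cyc c a c = 0"
  by (intro ext; simp add: cyc_def outer_def)+

lemma cyc_act:
  assumes "g permutes A"
  shows "mat_act (g, g) (cyc a b c) = cyc (g a) (g b) (g c)"
  unfolding mat_act_eq_iff[OF assms assms] cyc_apply permutes_eq[OF assms] by blast

text \<open>\<open>zero_sums_expand\<close> is applied to \<open>A\<close> and to its transpose,
  which is \<open>- A\<close>; this doubles \<open>A\<close> and explains the factor
  \<open>1 / 2\<close>.\<close>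

lemma alt_expand:
  assumes A: "A \<in> alt_space d"
  shows "A = (1 / 2) *\<^sub>R (\<Sum>i=1..d. \<Sum>j=1..d. A i j *\<^sub>R cyc i j d)"
proof (intro ext)
  fix k l
  have Z: "A \<in> zero_sums d" and alt: "A l k = - A k l" using A unfolding alt_space_def by blast+
  have "(\<Sum>i=1..d. \<Sum>j=1..d. A i j *\<^sub>R cyc i j d) k l =
     (\<Sum>i=1..d. \<Sum>j=1..d. A i j *\<^sub>R outer (evec_diff i d) (evec_diff j d)) k l
     - (\<Sum>i=1..d. \<Sum>j=1..d. A i j *\<^sub>R outer (evec_diff i d) (evec_diff j d)) l k"
    unfolding sum_fun_apply2 scaleR_fun_def cyc_def outer_def fun_diff_def sum_subtractf[symmetric]
    by (intro sum.cong refl) (simp add: algebra_simps)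
  also have "\<dots> = 2 * A k l"
    unfolding zero_sums_expand[OF Z, symmetric] alt by simp
  finally show "A k l = ((1 / 2) *\<^sub>R (\<Sum>i=1..d. \<Sum>j=1..d. A i j *\<^sub>R cyc i j d)) k l"
    by (simp add: scaleR_fun_def)
qed

lemma outer_in_zero_sums:
  assumes "x \<in> std_rep d" "y \<in> std_rep d"
  shows "outer x y \<in> zero_sums d"
  using assms
  by (auto simp: zero_sums_def Mat_def std_rep_def outer_def sum_distrib_left[symmetric] sum_distrib_right[symmetric])

lemma cyc_in_ext: "a \<in> {1..d} \<Longrightarrow> b \<in> {1..d} \<Longrightarrow> c \<in> {1..d} \<Longrightarrow> cyc a b c \<in> ext_square_rep d"
  unfolding ext_square_rep_def cyc_def
  by (intro span_base CollectI exI[of _ "evec_diff a c"] exI[of _ "evec_diff b c"] conjI refl unit_vec_diff_std)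

lemma ext_square_rep_eq: "ext_square_rep d = alt_space d"
proof (rule antisym)
  show "ext_square_rep d \<subseteq> alt_space d"
    unfolding ext_square_rep_def
  proof (rule span_minimal[OF _ subspace_alt_space], clarify)
    fix x y assume "x \<in> std_rep d" "y \<in> std_rep d"
    then have "outer x y - outer y x \<in> zero_sums d"
      by (intro subspace_diff[OF subspace_zero_sums] outer_in_zero_sums)
    then show "outer x y - outer y x \<in> alt_space d"
      unfolding alt_space_def by (auto simp: outer_def)
  qed
  show "alt_space d \<subseteq> ext_square_rep d"
  proof
    fix A assume A: "A \<in> alt_space d"
    have "cyc i j d \<in> ext_square_rep d" if "i \<in> {1..d}" "j \<in> {1..d}" for i j
      using that by (intro cyc_in_ext) auto
    then have "(1 / 2) *\<^sub>R (\<Sum>i=1..d. \<Sum>j=1..d. A i j *\<^sub>R cyc i j d) \<in> ext_square_rep d"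
      unfolding ext_square_rep_def by (intro span_scale span_sum)
    then show "A \<in> ext_square_rep d"
      by (simp only: alt_expand[OF A, symmetric])
  qed
qed

lemma swap_permutes: "a \<in> A \<Longrightarrow> b \<in> A \<Longrightarrow> Transposition.transpose a b permutes A"
  by (rule permutes_swap_id)

text \<open>Schur's lemma made explicit: the image is negated by the three transpositions of
  \<open>a\<close>, \<open>b\<close>, \<open>c\<close>, and up to a factor only
  \<open>cyc a b c\<close> has this property.\<close>

lemma equivariant_cyc:
  fixes f :: "matr \<Rightarrow> matr"
  assumes f: "linear f"
    and eq: "\<And>g u. g \<in> carrier (sym_group d) \<Longrightarrow> u \<in> ext_square_rep d \<Longrightarrow> f (mat_act (g, g) u) = mat_act (g, g) (f u)"
    and abc: "a \<in> {1..d}" "b \<in> {1..d}" "c \<in> {1..d}" "a \<noteq> b" "b \<noteq> c" "a \<noteq> c"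
  shows "f (cyc a b c) = f (cyc a b c) a b *\<^sub>R cyc a b c"
proof (intro ext)
  define B where "B = f (cyc a b c)"
  have act: "f (cyc (g a) (g b) (g c)) (g i) (g j) = B i j" if g: "g permutes {1..d}" for g i j
    using eq[of g "cyc a b c"] cyc_in_ext[OF abc(1-3)] mat_act_apply'[OF g g, of B i j] g
    by (simp add: carrier_sym_group cyc_act[OF g] B_def)
  have neg: "f (- cyc a b c) i j = - B i j" for i j
    using linear_neg[OF f, of "cyc a b c"] by (simp add: B_def)
  have sw: "B (Transposition.transpose a b i) (Transposition.transpose a b j) = - B i j"
    "B (Transposition.transpose b c i) (Transposition.transpose b c j) = - B i j"
    "B (Transposition.transpose a c i) (Transposition.transpose a c j) = - B i j" for i j
    using act[OF swap_permutes[OF abc(1,2)], of i j] act[OF swap_permutes[OF abc(2,3)], of i j]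
      act[OF swap_permutes[OF abc(1,3)], of i j] abc(4-6)
    by (simp_all add: cyc_swap[where a = a and b = b and c = c] neg)
  \<comment> \<open>If one of the transpositions fixes both indices, the entry equals its own
    negative. This covers the diagonal and every position with an index outside \<open>a\<close>,
    \<open>b\<close>, \<open>c\<close>.\<close>
  have zero: "B i j = 0"
    if "i \<notin> {a, b} \<and> j \<notin> {a, b} \<or> i \<notin> {b, c} \<and> j \<notin> {b, c} \<or> i \<notin> {a, c} \<and> j \<notin> {a, c}" for i j
    using that sw[of i j] by (auto simp: Transposition.transpose_def)
  have "B b a = - B a b" "B a c = - B a b" "B b c = - B a c" "B c a = - B b a" "B c b = - B c a"
    using sw(1)[of a b] sw(2)[of a b] sw(1)[of a c] sw(2)[of b a] sw(1)[of c a] abc(4-6)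
    by (simp_all add: Transposition.transpose_def)
  then have val: "B b a = - B a b" "B a c = - B a b" "B b c = B a b" "B c a = B a b" "B c b = - B a b"
    by simp_all
  fix i j
  consider "i = a" "j = b" | "i = b" "j = a" | "i = b" "j = c" | "i = c" "j = b" | "i = c" "j = a" | "i = a" "j = c"
    | "(i, j) \<notin> {(a, b), (b, a), (b, c), (c, b), (c, a), (a, c)}" by auto
  then have "B i j = B a b * cyc a b c i j"
  proof cases
    case 7
    have "i \<notin> {a, b} \<and> j \<notin> {a, b} \<or> i \<notin> {b, c} \<and> j \<notin> {b, c} \<or> i \<notin> {a, c} \<and> j \<notin> {a, c}"
      using 7 abc(4-6) by blast
    then have "B i j = 0" by (rule zero)
    moreover have "\<not> (i = a \<and> j = b)" "\<not> (i = b \<and> j = a)" "\<not> (i = b \<and> j = c)"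
      "\<not> (i = c \<and> j = b)" "\<not> (i = c \<and> j = a)" "\<not> (i = a \<and> j = c)"
      using 7 by blast+
    then have "cyc a b c i j = 0" unfolding cyc_apply by (simp only: of_bool_eq)
    ultimately show ?thesis by simp
  qed (use abc(4-6) val in \<open>simp_all add: cyc_apply\<close>)
  then show "f (cyc a b c) i j = (f (cyc a b c) a b *\<^sub>R cyc a b c) i j"
    by (simp add: B_def scaleR_fun_def)
qed

lemma zero_sums_subset_Mat: "zero_sums d \<subseteq> Mat d d" "alt_space d \<subseteq> Mat d d" "sym_space d \<subseteq> Mat d d"
  by (auto simp: zero_sums_def alt_space_def sym_space_def)

text \<open>The matrices \<open>cyc i j d\<close> span the exterior square and an equivariant map
  multiplies each of them by a scalar, so it cannot leave \<open>alt_space\<close>. The inclusion is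
  itself an embedding, which gives the other direction.\<close>

lemma type_x_eq:
  assumes d: "d \<ge> 1"
  shows "type_x d = alt_space d"
proof (rule antisym)
  show "type_x d \<subseteq> alt_space d"
    unfolding type_x_def diag_isotypic_def
  proof (rule isotypic_subset[OF subspace_alt_space])
    fix f :: "matr \<Rightarrow> matr"
    assume f: "linear f"
      and eq: "\<And>g u. g \<in> carrier (sym_group d) \<Longrightarrow> u \<in> ext_square_rep d \<Longrightarrow> f (mat_act (g, g) u) = mat_act (g, g) (f u)"
    have gen: "f (cyc i j d) \<in> alt_space d" if "i \<in> {1..d}" "j \<in> {1..d}" for i j
    proof (cases "i \<noteq> j \<and> j \<noteq> d \<and> i \<noteq> d")
      case True
      then have "f (cyc i j d) = f (cyc i j d) i j *\<^sub>R cyc i j d"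
        using that d by (intro equivariant_cyc[OF f eq]) auto
      moreover have "cyc i j d \<in> alt_space d"
        using cyc_in_ext[of i d j d] that d by (simp add: ext_square_rep_eq)
      ultimately show ?thesis
        by (metis subspace_scale[OF subspace_alt_space])
    next
      case False
      then have "cyc i j d = 0" by (metis cyc_degenerate)
      then show ?thesis by (simp add: linear_0[OF f] subspace_0[OF subspace_alt_space])
    qed
    show "f ` ext_square_rep d \<subseteq> alt_space d"
    proof
      fix X assume "X \<in> f ` ext_square_rep d"
      then obtain A where A: "A \<in> alt_space d" "X = f A" by (auto simp: ext_square_rep_eq)
      have "f A = (1 / 2) *\<^sub>R (\<Sum>i=1..d. \<Sum>j=1..d. A i j *\<^sub>R f (cyc i j d))"
        using arg_cong[OF alt_expand[OF A(1)], of f]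
        by (simp only: linear_scale[OF f] linear_sum[OF f])
      then show "X \<in> alt_space d"
        unfolding A(2) using gen
        by (simp only:) (intro subspace_scale[OF subspace_alt_space] subspace_sum[OF subspace_alt_space])
    qed
  qed
  have "(\<lambda>x. x) ` ext_square_rep d \<subseteq> type_x d"
    unfolding type_x_def diag_isotypic_def
  proof (rule isotypic_superset)
    show "linear (\<lambda>x :: matr. x)" by (rule linearI) simp_all
    show "(\<lambda>x. x) ` ext_square_rep d \<subseteq> Mat d d"
      using zero_sums_subset_Mat(2) by (simp add: ext_square_rep_eq)
  qed simp_all
  then show "alt_space d \<subseteq> type_x d" by (simp add: ext_square_rep_eq)
qed

text \<open>The symmetric matrix whose off-diagonal entry at \<open>i j\<close> is the coefficient
  of the tabloid with second row \<open>{i, j}\<close> in the polytabloid.\<close>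

definition polymat :: "nat \<Rightarrow> nat \<Rightarrow> nat \<Rightarrow> nat \<Rightarrow> matr" where
  "polymat a b c e = outer (evec_diff a b) (evec_diff c e) + outer (evec_diff c e) (evec_diff a b)"

lemma polymat_apply: "polymat a b c e i j =
    (of_bool (i = a) - of_bool (i = b)) * (of_bool (j = c) - of_bool (j = e))
  + (of_bool (i = c) - of_bool (i = e)) * (of_bool (j = a) - of_bool (j = b))"
  by (simp add: polymat_def outer_def unit_vec_def)

lemma polymat_in_sym_space:
  assumes "{a, b, c, e} \<subseteq> {1..d}" "distinct [a, b, c, e]"
  shows "polymat a b c e \<in> sym_space d"
proof -
  have "polymat a b c e \<in> zero_sums d"
    unfolding polymat_def using assms
    by (intro subspace_add[OF subspace_zero_sums] outer_in_zero_sums unit_vec_diff_std) auto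
  moreover have "polymat a b c e j i = polymat a b c e i j" for i j
    by (simp add: polymat_apply mult.commute)
  moreover have "polymat a b c e i i = 0" for i
    using assms by (auto simp: polymat_apply)
  ultimately show ?thesis unfolding sym_space_def by blast
qed

text \<open>The equivariant map that embeds the Specht module into the matrices: a function on
  two-element sets becomes a symmetric matrix with zero diagonal.\<close>

definition tabloid_mat :: "nat \<Rightarrow> (nat set \<Rightarrow> real) \<Rightarrow> matr" where
  "tabloid_mat d h = (\<lambda>i j. of_bool (i \<in> {1..d} \<and> j \<in> {1..d} \<and> i \<noteq> j) * h {i, j})"

lemma tabloid_mat_polytabloid:
  assumes "{a, b, c, e} \<subseteq> {1..d}" "distinct [a, b, c, e]"
  shows "tabloid_mat d (polytabloid a b c e) = polymat a b c e"
proof (intro ext)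
  fix i j :: nat
  have pair: "(of_bool ({i, j} = {x, y}) :: real) = of_bool (i = x) * of_bool (j = y) + of_bool (i = y) * of_bool (j = x)"
    if "x \<noteq> y" for x y :: nat
    unfolding doubleton_eq_iff using that by (cases "i = x"; cases "j = y") simp_all
  have "polytabloid a b c e {i, j} = of_bool ({i, j} = {b, e}) - of_bool ({i, j} = {a, e})
      - of_bool ({i, j} = {b, c}) + of_bool ({i, j} = {a, c})"
    unfolding polytabloid_def ..
  also have "\<dots> = polymat a b c e i j"
    using pair[of b e] pair[of a e] pair[of b c] pair[of a c] assms(2)
    by (simp only: polymat_apply distinct.simps list.set insert_iff empty_iff de_Morgan_disj simp_thms)
      (simp only: algebra_simps)
  finally have P: "polytabloid a b c e {i, j} = polymat a b c e i j" .
  have "polymat a b c e i j = 0" if "\<not> (i \<in> {1..d} \<and> j \<in> {1..d} \<and> i \<noteq> j)"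
    using polymat_in_sym_space[OF assms] that unfolding sym_space_def zero_sums_def Mat_def by blast
  then show "tabloid_mat d (polytabloid a b c e) i j = polymat a b c e i j"
    unfolding tabloid_mat_def P by (cases "i \<in> {1..d} \<and> j \<in> {1..d} \<and> i \<noteq> j") auto
qed

lemma linear_tabloid_mat: "linear (tabloid_mat d)"
  by (rule linearI; intro ext; simp add: tabloid_mat_def scaleR_fun_def algebra_simps)

text \<open>
  Subtracting the polytabloids with two fixed indices \<open>d\<close> and \<open>d - 1\<close> clears all other rows and
  columns, and what remains is a combination of polytabloids with last column \<open>d - 1, d\<close>.
\<close>

lemma sym_space_subset_span:
  assumes d: "d \<ge> 3"
  shows "sym_space d \<subseteq> span {polymat a b c e | a b c e. {a, b, c, e} \<subseteq> {1..d} \<and> distinct [a, b, c, e]}"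
    (is "_ \<subseteq> span ?P")
proof
  fix A assume A: "A \<in> sym_space d"
  define m where "m = d - 1"
  have m: "m \<in> {1..d}" "d \<in> {1..d}" "m \<noteq> d" "1 \<in> {1..d}" "1 \<noteq> m" "1 \<noteq> d" using d by (auto simp: m_def)
  let ?I = "{1..d - 2}"
  have I: "i \<in> {1..d}" "i \<noteq> m" "i \<noteq> d" if "i \<in> ?I" for i using that d by (auto simp: m_def)
  have I': "i \<in> ?I" if "i \<in> {1..d}" "i \<noteq> m" "i \<noteq> d" for i using that d by (auto simp: m_def)
  \<comment> \<open>The last two indices are subtracted, so within \<open>?I\<close> the summand
    only touches the positions \<open>i j\<close> and \<open>j i\<close>. Each unordered pair is met
    twice, hence the factor \<open>1 / 2\<close>.\<close>
  define G where "G = (1 / 2) *\<^sub>R (\<Sum>i\<in>?I. \<Sum>j\<in>?I. A i j *\<^sub>R polymat i d j m)"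
  have Aii: "A i i = 0" for i using A unfolding sym_space_def by blast
  have Asym: "A j i = A i j" for i j using A unfolding sym_space_def by blast
  have mem: "polymat a b c e \<in> span ?P" if "{a, b, c, e} \<subseteq> {1..d}" "distinct [a, b, c, e]" for a b c e
    by (rule span_base) (use that in blast)
  have Apm: "A i j *\<^sub>R polymat i d j m \<in> span ?P" if "i \<in> ?I" "j \<in> ?I" for i j
  proof (cases "i = j")
    case False
    have "{i, d, j, m} \<subseteq> {1..d}" using I[OF that(1)] I[OF that(2)] m by blast
    moreover have "distinct [i, d, j, m]" using False I(2,3)[OF that(1)] I(2,3)[OF that(2)] m(3) by auto
    ultimately show ?thesis by (intro span_scale mem)
  next
    case True
    then show ?thesis by (simp only: Aii scaleR_zero_left span_zero)
  qed
  have G: "G \<in> span ?P"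
    unfolding G_def by (rule span_scale, rule span_sum, rule span_sum, rule Apm)
  have span_sub: "span ?P \<subseteq> sym_space d"
    using polymat_in_sym_space by (intro span_minimal subspace_sym_space) auto
  define L where "L = A - G"
  have L: "L \<in> sym_space d"
    unfolding L_def using A G span_sub by (intro subspace_diff[OF subspace_sym_space]) auto
  have LM: "L \<in> Mat d d" and rows: "(\<Sum>l=1..d. L k l) = 0" and Lsym: "L j i = L i j" and Lii: "L i i = 0" for i j k
    using L unfolding sym_space_def zero_sums_def by blast+
  have L0: "L i j = 0" if "i \<in> ?I" "j \<in> ?I" for i j
  proof -
    have ne: "i \<noteq> d" "i \<noteq> m" "j \<noteq> d" "j \<noteq> m" using I that by auto
    have "(\<Sum>i'\<in>?I. \<Sum>j'\<in>?I. A i' j' *\<^sub>R polymat i' d j' m) i j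
      = (\<Sum>i'\<in>?I. of_bool (i = i') * (\<Sum>j'\<in>?I. of_bool (j = j') * A i' j'))
        + (\<Sum>i'\<in>?I. of_bool (j = i') * (\<Sum>j'\<in>?I. of_bool (i = j') * A i' j'))"
      unfolding sum_fun_apply2 scaleR_fun_def polymat_apply sum_distrib_left sum.distrib[symmetric]
      using ne by (intro sum.cong refl) (simp add: algebra_simps)
    also have "\<dots> = A i j + A j i"
      by (simp only: sum_of_bool_eq[OF that(1)] sum_of_bool_eq[OF that(2)] finite_atLeastAtMost)
    finally show ?thesis by (simp add: L_def G_def scaleR_fun_def Asym[of i j])
  qed
  define v where "v i = L i m" for i
  have split: "(\<Sum>l=1..d. h l) = (\<Sum>l\<in>?I. h l) + h m + h d" for h :: "nat \<Rightarrow> real"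
  proof -
    have "{1..d} = insert d (insert m ?I)" using d by (auto simp: m_def)
    moreover have "m \<notin> ?I" "d \<notin> insert m ?I" using d by (auto simp: m_def)
    ultimately show ?thesis by simp
  qed
  have vd: "L i d = - v i" if "i \<in> ?I" for i
  proof -
    have "(\<Sum>l\<in>?I. L i l) = 0" by (rule sum.neutral) (use L0 that in blast)
    then show ?thesis using rows[of i] unfolding split v_def by linarith
  qed
  have rm: "(\<Sum>i\<in>?I. v i) + L m d = 0"
    using rows[of m] unfolding split v_def Lii Lsym[of m] by linarith
  \<comment> \<open>The last two rows give the same two quantities with opposite signs, so both the
    corner entry and the sum of the \<open>v i\<close> vanish.\<close>
  have rd: "- (\<Sum>i\<in>?I. v i) + L m d = 0"
  proof -
    have "(\<Sum>l\<in>?I. L d l) = (\<Sum>i\<in>?I. - v i)"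
      by (intro sum.cong refl) (simp only: Lsym[of d] vd)
    then show ?thesis using rows[of d] unfolding split Lii Lsym[of d m] sum_negf by linarith
  qed
  have md: "L m d = 0" and v0: "(\<Sum>i\<in>?I. v i) = 0" using rm rd by simp_all
  \<comment> \<open>Index 1 serves as base point. Its total coefficient is the sum of the
    \<open>v i\<close>, that is 0, and the summand \<open>i = 1\<close> is the zero matrix.\<close>
  have Lsum: "L = (\<Sum>i\<in>?I. v i *\<^sub>R polymat i 1 m d)"
  proof (intro ext)
    fix i j
    have vsum: "(\<Sum>i'\<in>?I. of_bool (k = i') * v i') = of_bool (k \<in> ?I) * v k" for k
      by (cases "k \<in> ?I") (auto simp: sum_of_bool_eq intro!: sum.neutral simp del: sum_of_bool_mult_eq)
    have "(\<Sum>i'\<in>?I. v i' *\<^sub>R polymat i' 1 m d) i j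
      = (of_bool (j = m) - of_bool (j = d)) * ((\<Sum>i'\<in>?I. of_bool (i = i') * v i') - of_bool (i = 1) * (\<Sum>i'\<in>?I. v i'))
      + (of_bool (i = m) - of_bool (i = d)) * ((\<Sum>i'\<in>?I. of_bool (j = i') * v i') - of_bool (j = 1) * (\<Sum>i'\<in>?I. v i'))"
      unfolding sum_fun_apply2 scaleR_fun_def polymat_apply sum_distrib_left sum.distrib[symmetric] sum_subtractf[symmetric]
      by (intro sum.cong refl) (simp add: algebra_simps)
    also have "\<dots> = (of_bool (j = m) - of_bool (j = d)) * (of_bool (i \<in> ?I) * v i)
      + (of_bool (i = m) - of_bool (i = d)) * (of_bool (j \<in> ?I) * v j)"
      by (simp only: vsum v0 mult_zero_right diff_zero)
    also have "\<dots> = L i j"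
    proof (cases "i \<in> {1..d} \<and> j \<in> {1..d}")
      case False
      then have "L i j = 0" using LM unfolding Mat_def by blast
      moreover have "i \<notin> {1..d} \<Longrightarrow> i \<notin> ?I \<and> i \<noteq> m \<and> i \<noteq> d" "j \<notin> {1..d} \<Longrightarrow> j \<notin> ?I \<and> j \<noteq> m \<and> j \<noteq> d"
        using I m by blast+
      then have "i \<notin> ?I \<and> i \<noteq> m \<and> i \<noteq> d \<or> j \<notin> ?I \<and> j \<noteq> m \<and> j \<noteq> d"
        using False by blast
      ultimately show ?thesis by (elim disjE conjE) (simp_all del: atLeastAtMost_iff)
    next
      case True
      have mI: "m \<notin> ?I" "d \<notin> ?I" using I by blast+
      consider "i \<in> ?I" "j \<in> ?I" | "i \<in> ?I" "j = m" | "i \<in> ?I" "j = d" | "i = m" "j \<in> ?I" | "i = d" "j \<in> ?I"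
        | "i \<in> {m, d}" "j \<in> {m, d}" using I' True by blast
      then show ?thesis
      proof cases
        case 1 then show ?thesis using L0[OF 1] I[OF 1(1)] I[OF 1(2)] by simp
      next
        case 2 then show ?thesis using I[OF 2(1)] m by (simp add: v_def)
      next
        case 3 then show ?thesis using I[OF 3(1)] m vd[OF 3(1)] by simp
      next
        case 4
        have "L m j = L j m" by (rule Lsym)
        then show ?thesis using I(2,3)[OF 4(2)] m(3) 4 by (simp add: v_def del: atLeastAtMost_iff)
      next
        case 5
        have "L d j = L j d" by (rule Lsym)
        then show ?thesis using I(2,3)[OF 5(2)] m(3) 5 vd[OF 5(2)] by (simp del: atLeastAtMost_iff)
      next
        case 6
        have "L d m = L m d" by (rule Lsym)
        then show ?thesis using 6 mI md Lii[of m] Lii[of d] by (auto simp del: atLeastAtMost_iff)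
      qed
    qed
    finally show "L i j = (\<Sum>i\<in>?I. v i *\<^sub>R polymat i 1 m d) i j" ..
  qed
  have vpm: "v i *\<^sub>R polymat i 1 m d \<in> span ?P" if "i \<in> ?I" for i
  proof (cases "i = 1")
    case True
    then have "polymat i 1 m d = 0" by (intro ext) (simp add: polymat_apply)
    then show ?thesis by (simp only: scaleR_zero_right span_zero)
  next
    case False
    have "{i, 1, m, d} \<subseteq> {1..d}" using I[OF that] m by blast
    moreover have "distinct [i, 1, m, d]" using False I(2,3)[OF that] m(3,5,6) by auto
    ultimately show ?thesis by (intro span_scale mem)
  qed
  have "L \<in> span ?P" unfolding Lsum by (rule span_sum, rule vpm)
  moreover have "A = L + G" by (simp add: L_def)
  ultimately show "A \<in> span ?P" using G by (simp only: span_add)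
qed

lemma polytabloid_in_specht:
  "{a, b, c, e} \<subseteq> {1..d} \<Longrightarrow> distinct [a, b, c, e] \<Longrightarrow> polytabloid a b c e \<in> specht_rep d"
  unfolding specht_rep_def by (rule span_base) blast

lemma polytabloid_swap:
  "polytabloid b a c e = - polytabloid a b c e" "polytabloid a b e c = - polytabloid a b c e"
  "polytabloid c e a b = polytabloid a b c e"
  by (intro ext; simp add: polytabloid_def insert_commute)+

lemma permutes_inv_image_eq:
  assumes "g permutes S"
  shows "inv_into UNIV g ` A = B \<longleftrightarrow> A = g ` B"
  using permutes_inverses[OF assms] by (metis (no_types, lifting) image_image image_ident image_cong)

lemma tabloid_act_polytabloid:
  assumes "g permutes S"
  shows "tabloid_act g (polytabloid a b c e) = polytabloid (g a) (g b) (g c) (g e)"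
  by (intro ext) (simp add: tabloid_act_def polytabloid_def permutes_inv_image_eq[OF assms])

text \<open>The transpositions of \<open>a b\<close> and of \<open>c e\<close> negate the
  polytabloid, and exchanging the two columns of the tableau fixes it. Only eight entries of the
  image can be nonzero, and these symmetries tie them to the entry at \<open>a c\<close>.\<close>

lemma equivariant_polytabloid:
  fixes f :: "(nat set \<Rightarrow> real) \<Rightarrow> matr"
  assumes f: "linear f"
    and eq: "\<And>g u. g \<in> carrier (sym_group d) \<Longrightarrow> u \<in> specht_rep d \<Longrightarrow> f (tabloid_act g u) = mat_act (g, g) (f u)"
    and abce: "{a, b, c, e} \<subseteq> {1..d}" "distinct [a, b, c, e]"
  shows "f (polytabloid a b c e) = f (polytabloid a b c e) a c *\<^sub>R polymat a b c e"
proof (intro ext)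
  define B where "B = f (polytabloid a b c e)"
  have R: "a \<in> {1..d}" "b \<in> {1..d}" "c \<in> {1..d}" "e \<in> {1..d}" using abce(1) by blast+
  have ne: "a \<noteq> b" "a \<noteq> c" "a \<noteq> e" "b \<noteq> c" "b \<noteq> e" "c \<noteq> e" using abce(2) by simp_all
  have act: "f (polytabloid (g a) (g b) (g c) (g e)) (g i) (g j) = B i j" if g: "g permutes {1..d}" for g i j
    using eq[of g "polytabloid a b c e"] polytabloid_in_specht[OF abce] mat_act_apply'[OF g g, of B i j] g
    by (simp add: carrier_sym_group tabloid_act_polytabloid[OF g] B_def)
  have neg: "f (- polytabloid a b c e) i j = - B i j" for i j
    using linear_neg[OF f, of "polytabloid a b c e"] by (simp add: B_def)
  have swp: "polytabloid b a c e = - polytabloid a b c e" "polytabloid a b e c = - polytabloid a b c e"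
    "polytabloid c e a b = polytabloid a b c e"
    by (rule polytabloid_swap)+
  have sw1: "B (Transposition.transpose a b i) (Transposition.transpose a b j) = - B i j" for i j
    using act[OF swap_permutes[OF R(1,2)], of i j] ne neg by (simp add: swp)
  have sw2: "B (Transposition.transpose c e i) (Transposition.transpose c e j) = - B i j" for i j
    using act[OF swap_permutes[OF R(3,4)], of i j] ne neg by (simp add: swp)
  have sw3: "B c a = B a c"
  proof -
    let ?g = "Transposition.transpose a c \<circ> Transposition.transpose b e"
    have g: "?g permutes {1..d}" using R by (intro permutes_compose swap_permutes)
    have "?g a = c" "?g b = e" "?g c = a" "?g e = b"
      using ne by (auto simp: Transposition.transpose_def)
    with act[OF g, of a c] show ?thesis by (simp only: swp(3) B_def[symmetric])
  qed
  have zero: "B i j = 0" if "i \<notin> {a, b} \<and> j \<notin> {a, b} \<or> i \<notin> {c, e} \<and> j \<notin> {c, e}" for i j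
    using that sw1[of i j] sw2[of i j] by (auto simp: Transposition.transpose_def)
  have "B b c = - B a c" "B a e = - B a c" "B b e = - B b c" "B c b = - B c a" "B e a = - B c a" "B e b = - B e a"
    using sw1[of a c] sw2[of a c] sw2[of b c] sw1[of c a] sw2[of c a] sw1[of e a] ne
    by (simp_all add: Transposition.transpose_def)
  then have val: "B b c = - B a c" "B a e = - B a c" "B b e = B a c" "B c a = B a c" "B c b = - B a c"
    "B e a = - B a c" "B e b = B a c"
    using sw3 by simp_all
  fix i j
  have "B i j = B a c * polymat a b c e i j"
  proof (cases "i \<in> {a, b} \<and> j \<in> {c, e} \<or> i \<in> {c, e} \<and> j \<in> {a, b}")
    case True
    then consider "i = a" "j = c" | "i = a" "j = e" | "i = b" "j = c" | "i = b" "j = e"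
      | "i = c" "j = a" | "i = c" "j = b" | "i = e" "j = a" | "i = e" "j = b" by blast
    then show ?thesis
      by cases (use ne val in \<open>simp_all add: polymat_apply\<close>)
  next
    case False
    then have "i \<notin> {a, b} \<and> j \<notin> {a, b} \<or> i \<notin> {c, e} \<and> j \<notin> {c, e}"
      using ne by blast
    then have "B i j = 0" by (rule zero)
    moreover have "(i \<noteq> a \<and> i \<noteq> b) \<or> (j \<noteq> c \<and> j \<noteq> e)" "(i \<noteq> c \<and> i \<noteq> e) \<or> (j \<noteq> a \<and> j \<noteq> b)"
      using False by blast+
    then have "polymat a b c e i j = 0" by (elim disjE) (simp_all add: polymat_apply)
    ultimately show ?thesis by simp
  qed
  then show "f (polytabloid a b c e) i j = (f (polytabloid a b c e) a c *\<^sub>R polymat a b c e) i j"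
    by (simp add: B_def scaleR_fun_def)
qed

text \<open>Elements of the Specht module vanish off the two-element subsets of the index range.
  This makes \<open>tabloid_mat\<close> injective on it.\<close>

lemma specht_vanish:
  assumes "h \<in> specht_rep d" "\<And>i j. i \<in> {1..d} \<Longrightarrow> j \<in> {1..d} \<Longrightarrow> i \<noteq> j \<Longrightarrow> h {i, j} = 0"
  shows "h = 0"
proof
  fix A
  show "h A = 0 A"
  proof (cases "\<exists>i j. i \<in> {1..d} \<and> j \<in> {1..d} \<and> i \<noteq> j \<and> A = {i, j}")
    case True
    then show ?thesis using assms(2) by auto
  next
    case False
    have "specht_rep d \<subseteq> {h. h A = 0}"
      unfolding specht_rep_def
    proof (rule span_minimal)
      show "subspace {h :: nat set \<Rightarrow> real. h A = 0}"
        by (rule subspaceI) (auto simp: scaleR_fun_def)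
      show "{polytabloid a b c e | a b c e. {a, b, c, e} \<subseteq> {1..d} \<and> distinct [a, b, c, e]} \<subseteq> {h. h A = 0}"
      proof clarify
        fix a b c e assume R: "{a, b, c, e} \<subseteq> {1..d}" and D: "distinct [a, b, c, e]"
        have R: "a \<in> {1..d}" "b \<in> {1..d}" "c \<in> {1..d}" "e \<in> {1..d}" using R by blast+
        have ne: "a \<noteq> c" "a \<noteq> e" "b \<noteq> c" "b \<noteq> e" using D by simp_all
        have "A \<noteq> {b, e}" "A \<noteq> {a, e}" "A \<noteq> {b, c}" "A \<noteq> {a, c}" using False R ne by blast+
        then show "polytabloid a b c e A = 0" by (simp add: polytabloid_def)
      qed
    qed
    then show ?thesis using assms(1) by auto
  qed
qed

text \<open>The image of each polytabloid is a multiple of a \<open>polymat\<close>, which gives the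
  upper bound. For the lower bound \<open>sym_space\<close> is spanned by these matrices, so it is
  the image of the Specht module under one embedding.\<close>

lemma type_y_eq:
  assumes d: "d \<ge> 3"
  shows "type_y d = sym_space d"
proof (rule antisym)
  show "type_y d \<subseteq> sym_space d"
    unfolding type_y_def diag_isotypic_def
  proof (rule isotypic_subset[OF subspace_sym_space])
    fix f :: "(nat set \<Rightarrow> real) \<Rightarrow> matr"
    assume f: "linear f"
      and eq: "\<And>g u. g \<in> carrier (sym_group d) \<Longrightarrow> u \<in> specht_rep d \<Longrightarrow> f (tabloid_act g u) = mat_act (g, g) (f u)"
    have "f ` specht_rep d = span (f ` {polytabloid a b c e | a b c e. {a, b, c, e} \<subseteq> {1..d} \<and> distinct [a, b, c, e]})"
      unfolding specht_rep_def by (rule linear_span_image[OF f, symmetric])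
    also have "\<dots> \<subseteq> sym_space d"
    proof (rule span_minimal[OF _ subspace_sym_space], clarify)
      fix a b c e assume *: "{a, b, c, e} \<subseteq> {1..d}" "distinct [a, b, c, e]"
      show "f (polytabloid a b c e) \<in> sym_space d"
        by (subst equivariant_polytabloid[OF f eq *])
          (simp_all only: subspace_scale[OF subspace_sym_space polymat_in_sym_space[OF *]])
    qed
    finally show "f ` specht_rep d \<subseteq> sym_space d" .
  qed
next
  let ?P = "{polytabloid a b c e | a b c e. {a, b, c, e} \<subseteq> {1..d} \<and> distinct [a, b, c, e]}"
  have "sym_space d \<subseteq> span (tabloid_mat d ` ?P)"
  proof (rule order_trans[OF sym_space_subset_span[OF d]], rule span_mono, clarify)
    fix a b c e assume *: "{a, b, c, e} \<subseteq> {1..d}" "distinct [a, b, c, e]"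
    then show "polymat a b c e \<in> tabloid_mat d ` ?P"
      unfolding tabloid_mat_polytabloid[OF *, symmetric] by blast
  qed
  also have "\<dots> = tabloid_mat d ` specht_rep d"
    unfolding specht_rep_def by (rule linear_span_image[OF linear_tabloid_mat])
  also have "\<dots> \<subseteq> type_y d"
    unfolding type_y_def diag_isotypic_def
  proof (rule isotypic_superset[OF linear_tabloid_mat])
    show "inj_on (tabloid_mat d) (specht_rep d)"
    proof (rule inj_onI)
      fix h h' assume hh: "h \<in> specht_rep d" "h' \<in> specht_rep d" "tabloid_mat d h = tabloid_mat d h'"
      have "h - h' \<in> specht_rep d"
        using hh unfolding specht_rep_def by (intro span_diff)
      moreover have "(h - h') {i, j} = 0" if "i \<in> {1..d}" "j \<in> {1..d}" "i \<noteq> j" for i j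
        using fun_cong[OF fun_cong[OF hh(3)], of i j] that by (simp add: tabloid_mat_def)
      ultimately have "h - h' = 0" by (rule specht_vanish)
      then show "h = h'" by simp
    qed
    show "tabloid_mat d ` specht_rep d \<subseteq> Mat d d"
      by (auto simp: Mat_def tabloid_mat_def)
    fix g u assume "g \<in> carrier (sym_group d)"
    then have g: "g permutes {1..d}" by (simp only: carrier_sym_group)
    have "tabloid_act g u {g i, g j} = u {i, j}" for i j
      using permutes_inverses(2)[OF g] by (simp add: tabloid_act_def)
    then show "tabloid_mat d (tabloid_act g u) = mat_act (g, g) (tabloid_mat d u)"
      by (intro sym[of "mat_act (g, g) (tabloid_mat d u)"])
        (simp only: mat_act_eq_iff[OF g g] tabloid_mat_def permutes_range[OF g] permutes_eq[OF g], simp)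
  qed
  finally show "sym_space d \<subseteq> type_y d" .
qed

section \<open>The isotypic components under the product action\<close>

definition const_space :: "nat \<Rightarrow> matr set" where
  "const_space d = {mix d 0 b | b. True}"

definition row_space :: "nat \<Rightarrow> matr set" where
  "row_space d = (\<lambda>u. std_mat d 0 u 0) ` std_rep d"

definition col_space :: "nat \<Rightarrow> matr set" where
  "col_space d = (\<lambda>u. std_mat d 0 0 u) ` std_rep d"

lemma subspace_const_space: "subspace (const_space d)"
proof -
  have "const_space d = range (\<lambda>c. c *\<^sub>R mix d 0 1)"
    unfolding const_space_def by (auto simp: mix_scale)
  moreover have "linear (\<lambda>c. c *\<^sub>R mix d 0 1)" by (rule linearI) (simp_all add: algebra_simps)
  ultimately show ?thesis using linear_subspace_image[OF _ subspace_UNIV] by metis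
qed

lemma subspace_row_space: "subspace (row_space d)"
  unfolding row_space_def by (rule linear_subspace_image[OF linear_std_mat(2) subspace_std_rep])

lemma subspace_col_space: "subspace (col_space d)"
  unfolding col_space_def by (rule linear_subspace_image[OF linear_std_mat(3) subspace_std_rep])

lemma std_mat_act2:
  assumes g: "g permutes {1..d}" and h: "h permutes {1..d}"
  shows "mat_act (g, h) (std_mat d 0 v w) = std_mat d 0 (vec_act g v) (vec_act h w)"
  by (simp only: mat_act_eq_iff[OF g h] std_mat_def permutes_range[OF g] permutes_range[OF h]
      vec_act_apply[OF g] vec_act_apply[OF h], simp)

lemma mix_act2:
  assumes g: "g permutes {1..d}" and h: "h permutes {1..d}"
  shows "mat_act (g, h) (mix d 0 b) = mix d 0 b"
  by (simp only: mat_act_eq_iff[OF g h] mix_def permutes_range[OF g] permutes_range[OF h], simp)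

lemma carrier_S2E:
  assumes "g \<in> carrier (S2 d)"
  obtains g1 g2 where "g = (g1, g2)" "g1 permutes {1..d}" "g2 permutes {1..d}"
proof -
  obtain g1 g2 where g: "g = (g1, g2)" by (cases g)
  show thesis using that[OF g] assms unfolding g carrier_S2 by blast
qed

lemma type_tt_eq:
  assumes "d \<ge> 1"
  shows "type_tt d = const_space d"
proof (rule antisym)
  show "type_tt d \<subseteq> const_space d"
    unfolding type_tt_def prod_isotypic_def
  proof (rule isotypic_subset[OF subspace_const_space])
    fix f :: "real \<Rightarrow> matr"
    assume f: "linear f" "range f \<subseteq> Mat d d"
      and eq: "\<And>g u. g \<in> carrier (S2 d) \<Longrightarrow> u \<in> UNIV \<Longrightarrow> f u = mat_act g (f u)"
    have inv: "f 1 (g i) (h j) = f 1 i j" if "g permutes {1..d}" "h permutes {1..d}" for g h i j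
    proof -
      have "mat_act (g, h) (f 1) = f 1"
        by (rule eq[symmetric]) (use that in \<open>simp_all only: carrier_S2 UNIV_I\<close>)
      then show ?thesis unfolding mat_act_eq_iff[OF that] by blast
    qed
    have Mat: "f 1 \<in> Mat d d" using f by auto
    have all: "f 1 i j = f 1 1 1" if "i \<in> {1..d}" "j \<in> {1..d}" for i j
    proof -
      have "1 \<in> {1..d}" using assms by simp
      from inv[OF swap_permutes[OF this that(1)] swap_permutes[OF this that(2)], of 1 1]
      show ?thesis by simp
    qed
    have "f 1 = mix d 0 (f 1 1 1)"
    proof (intro ext)
      fix i j show "f 1 i j = mix d 0 (f 1 1 1) i j"
        using Mat all[of i j] by (cases "i \<in> {1..d} \<and> j \<in> {1..d}") (auto simp: mix_def Mat_def)
    qed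
    then have "f 1 \<in> const_space d" unfolding const_space_def by blast
    then have "c *\<^sub>R f 1 \<in> const_space d" for c by (rule subspace_scale[OF subspace_const_space])
    moreover have "f c = c *\<^sub>R f 1" for c
      using linear_scale[OF f(1), of c 1] by simp
    ultimately show "range f \<subseteq> const_space d"
      by (metis image_subsetI)
  qed
next
  have "range (\<lambda>c. c *\<^sub>R mix d 0 1) \<subseteq> type_tt d"
    unfolding type_tt_def prod_isotypic_def
  proof (rule isotypic_superset)
    show "linear (\<lambda>c. c *\<^sub>R mix d 0 1)" by (rule linearI) (auto simp: algebra_simps)
    have "mix d 0 1 1 1 \<noteq> 0" using assms by (simp add: mix_def)
    then show "inj (\<lambda>c. c *\<^sub>R mix d 0 1)" by (auto intro!: injI)
    show "range (\<lambda>c. c *\<^sub>R mix d 0 1) \<subseteq> Mat d d" by (auto simp: Mat_def mix_def scaleR_fun_def)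
    fix g and c :: real assume "g \<in> carrier (S2 d)"
    then show "c *\<^sub>R mix d 0 1 = mat_act g (c *\<^sub>R mix d 0 1)"
      by (elim carrier_S2E) (simp only: mix_scale mult_zero_right mix_act2)
  qed
  moreover have "const_space d = range (\<lambda>c. c *\<^sub>R mix d 0 1)"
    unfolding const_space_def by (auto simp: mix_scale)
  ultimately show "const_space d \<subseteq> type_tt d" by simp
qed

text \<open>The swap of \<open>a\<close> and \<open>d\<close> negates the generator, so an invariant
  functional takes a value equal to its own negative on it.\<close>

lemma invariant_functional_std:
  fixes \<phi> :: "vect \<Rightarrow> real"
  assumes \<phi>: "linear \<phi>" and inv: "\<And>g u. g permutes {1..d} \<Longrightarrow> u \<in> std_rep d \<Longrightarrow> \<phi> (vec_act g u) = \<phi> u"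
    and u: "u \<in> std_rep d" and d: "d \<ge> 1"
  shows "\<phi> u = 0"
proof -
  have "\<phi> (evec_diff a d) = 0" if a: "a \<in> {1..d}" for a
  proof -
    have d': "d \<in> {1..d}" using d by simp
    note g = swap_permutes[OF a d']
    have "vec_act (Transposition.transpose a d) (evec_diff a d) = - evec_diff a d"
      by (simp add: vec_act_diff vec_act_unit_vec[OF g])
    then have "- \<phi> (evec_diff a d) = \<phi> (evec_diff a d)"
      using inv[OF g unit_vec_diff_std[OF a d']] linear_neg[OF \<phi>, of "evec_diff a d"] by simp
    then show ?thesis by simp
  qed
  then have "(\<Sum>i=1..d. u i *\<^sub>R \<phi> (evec_diff i d)) = 0"
    by (intro sum.neutral ballI) simp
  then show ?thesis
    using arg_cong[OF std_expand[OF u], of \<phi>] by (simp only: linear_sum[OF \<phi>] linear_scale[OF \<phi>])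
qed

lemma vec_act_id: "vec_act id u = u"
  by (simp add: vec_act_def)

lemma std_repI: "(\<And>i. i \<notin> {1..d} \<Longrightarrow> x i = 0) \<Longrightarrow> (\<Sum>i=1..d. x i) = 0 \<Longrightarrow> x \<in> std_rep d"
  unfolding std_rep_def by blast

text \<open>The second factor acts trivially on the module, so every image is constant along rows.
  The sum of its first column is an invariant functional of \<open>u\<close> and therefore 0, which
  puts that column into the standard representation.\<close>

lemma type_st_eq:
  assumes d: "d \<ge> 1"
  shows "type_st d = row_space d"
proof (rule antisym)
  show "type_st d \<subseteq> row_space d"
    unfolding type_st_def prod_isotypic_def
  proof (rule isotypic_subset[OF subspace_row_space])
    fix f :: "vect \<Rightarrow> matr"
    assume f: "linear f" "f ` std_rep d \<subseteq> Mat d d"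
      and eq: "\<And>g u. g \<in> carrier (S2 d) \<Longrightarrow> u \<in> std_rep d \<Longrightarrow> f (vec_act (fst g) u) = mat_act g (f u)"
    have act: "f (vec_act g u) = mat_act (g, h) (f u)"
      if "g permutes {1..d}" "h permutes {1..d}" "u \<in> std_rep d" for g h u
      using eq[of "(g, h)" u] that unfolding carrier_S2 fst_conv by blast
    show "f ` std_rep d \<subseteq> row_space d"
    proof
      fix X assume "X \<in> f ` std_rep d"
      then obtain u where u: "u \<in> std_rep d" "X = f u" by blast
      have M: "f u i j = 0" if "i \<notin> {1..d} \<or> j \<notin> {1..d}" for i j
        using f(2) u(1) that unfolding Mat_def by blast
      have const: "f u i j = f u i 1" if "j \<in> {1..d}" for i j
      proof -
        have "1 \<in> {1..d}" using d by simp
        note h = swap_permutes[OF this that]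
        from act[OF permutes_id h u(1)] have "mat_act (id, Transposition.transpose 1 j) (f u) = f u"
          by (simp only: vec_act_id)
        then have "f u (id i) (Transposition.transpose 1 j 1) = f u i 1"
          unfolding mat_act_eq_iff[OF permutes_id h] by blast
        then show ?thesis by simp
      qed
      have "(\<Sum>i=1..d. f u i 1) = 0"
      proof (rule invariant_functional_std[OF _ _ u(1) d, of "\<lambda>u. \<Sum>i=1..d. f u i 1"])
        show "linear (\<lambda>u. \<Sum>i=1..d. f u i 1)"
        proof (rule linearI)
          show "(\<Sum>i=1..d. f (c *\<^sub>R u) i 1) = c *\<^sub>R (\<Sum>i=1..d. f u i 1)" for c u
            unfolding linear_scale[OF f(1)] by (simp add: scaleR_fun_def sum_distrib_left)
        qed (simp add: linear_add[OF f(1)] sum.distrib)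
        fix g u assume g: "g permutes {1..d}" and u: "u \<in> std_rep d"
        have "(\<Sum>i=1..d. f (vec_act g u) i 1) = (\<Sum>i=1..d. (\<lambda>i. f u i 1) (inv_into UNIV g i))"
          by (simp add: act[OF g permutes_id u] mat_act_apply)
        also have "\<dots> = (\<Sum>i=1..d. f u i 1)"
          using sum.permute[OF permutes_inv[OF g], of "\<lambda>i. f u i 1"] by (simp only: o_def)
        finally show "(\<Sum>i=1..d. f (vec_act g u) i 1) = (\<Sum>i=1..d. f u i 1)" .
      qed
      then have "(\<lambda>i. f u i 1) \<in> std_rep d"
        by (intro std_repI M) auto
      moreover have "f u = std_mat d 0 (\<lambda>i. f u i 1) 0"
      proof (intro ext)
        fix i j show "f u i j = std_mat d 0 (\<lambda>i. f u i 1) 0 i j"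
          using M[of i j] const[of j i] by (cases "i \<in> {1..d} \<and> j \<in> {1..d}") (auto simp: std_mat_def)
      qed
      ultimately show "X \<in> row_space d" unfolding row_space_def u(2) by (metis image_eqI)
    qed
  qed
  show "row_space d \<subseteq> type_st d"
    unfolding type_st_def prod_isotypic_def row_space_def
  proof (rule isotypic_superset[OF linear_std_mat(2) inj_std_mat(2)])
    show "(\<lambda>u. std_mat d 0 u 0) ` std_rep d \<subseteq> Mat d d" using std_mat_in_Mat by blast
    fix g u assume "g \<in> carrier (S2 d)"
    then show "std_mat d 0 (vec_act (fst g) u) 0 = mat_act g (std_mat d 0 u 0)"
      by (elim carrier_S2E) (simp only: std_mat_act2 fst_conv vec_act_0)
  qed
qed

lemma type_ts_eq:
  assumes d: "d \<ge> 1"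
  shows "type_ts d = col_space d"
proof (rule antisym)
  show "type_ts d \<subseteq> col_space d"
    unfolding type_ts_def prod_isotypic_def
  proof (rule isotypic_subset[OF subspace_col_space])
    fix f :: "vect \<Rightarrow> matr"
    assume f: "linear f" "f ` std_rep d \<subseteq> Mat d d"
      and eq: "\<And>g u. g \<in> carrier (S2 d) \<Longrightarrow> u \<in> std_rep d \<Longrightarrow> f (vec_act (snd g) u) = mat_act g (f u)"
    have act: "f (vec_act h u) = mat_act (g, h) (f u)"
      if "g permutes {1..d}" "h permutes {1..d}" "u \<in> std_rep d" for g h u
      using eq[of "(g, h)" u] that unfolding carrier_S2 snd_conv by blast
    show "f ` std_rep d \<subseteq> col_space d"
    proof
      fix X assume "X \<in> f ` std_rep d"
      then obtain u where u: "u \<in> std_rep d" "X = f u" by blast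
      have M: "f u i j = 0" if "i \<notin> {1..d} \<or> j \<notin> {1..d}" for i j
        using f(2) u(1) that unfolding Mat_def by blast
      have const: "f u i j = f u 1 j" if "i \<in> {1..d}" for i j
      proof -
        have "1 \<in> {1..d}" using d by simp
        note h = swap_permutes[OF this that]
        from act[OF h permutes_id u(1)] have "mat_act (Transposition.transpose 1 i, id) (f u) = f u"
          by (simp only: vec_act_id)
        then have "f u (Transposition.transpose 1 i 1) (id j) = f u 1 j"
          unfolding mat_act_eq_iff[OF h permutes_id] by blast
        then show ?thesis by simp
      qed
      have "(\<Sum>i=1..d. f u 1 i) = 0"
      proof (rule invariant_functional_std[OF _ _ u(1) d, of "\<lambda>u. \<Sum>i=1..d. f u 1 i"])
        show "linear (\<lambda>u. \<Sum>i=1..d. f u 1 i)"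
        proof (rule linearI)
          show "(\<Sum>i=1..d. f (c *\<^sub>R u) 1 i) = c *\<^sub>R (\<Sum>i=1..d. f u 1 i)" for c u
            unfolding linear_scale[OF f(1)] by (simp add: scaleR_fun_def sum_distrib_left)
        qed (simp add: linear_add[OF f(1)] sum.distrib)
        fix g u assume g: "g permutes {1..d}" and u: "u \<in> std_rep d"
        have "(\<Sum>i=1..d. f (vec_act g u) 1 i) = (\<Sum>i=1..d. (\<lambda>i. f u 1 i) (inv_into UNIV g i))"
          by (simp add: act[OF permutes_id g u] mat_act_apply)
        also have "\<dots> = (\<Sum>i=1..d. f u 1 i)"
          using sum.permute[OF permutes_inv[OF g], of "\<lambda>i. f u 1 i"] by (simp only: o_def)
        finally show "(\<Sum>i=1..d. f (vec_act g u) 1 i) = (\<Sum>i=1..d. f u 1 i)" .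
      qed
      then have "(\<lambda>i. f u 1 i) \<in> std_rep d"
        by (intro std_repI M) auto
      moreover have "f u = std_mat d 0 0 (\<lambda>i. f u 1 i)"
      proof (intro ext)
        fix i j show "f u i j = std_mat d 0 0 (\<lambda>i. f u 1 i) i j"
          using M[of i j] const[of i j] by (cases "i \<in> {1..d} \<and> j \<in> {1..d}") (auto simp: std_mat_def)
      qed
      ultimately show "X \<in> col_space d" unfolding col_space_def u(2) by (metis image_eqI)
    qed
  qed
  show "col_space d \<subseteq> type_ts d"
    unfolding type_ts_def prod_isotypic_def col_space_def
  proof (rule isotypic_superset[OF linear_std_mat(3) inj_std_mat(3)])
    show "(\<lambda>u. std_mat d 0 0 u) ` std_rep d \<subseteq> Mat d d" using std_mat_in_Mat by blast
    fix g u assume "g \<in> carrier (S2 d)"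
    then show "std_mat d 0 0 (vec_act (snd g) u) = mat_act g (std_mat d 0 0 u)"
      by (elim carrier_S2E) (simp only: std_mat_act2 snd_conv vec_act_0)
  qed
qed

lemma tensor_rep_eq:
  assumes d: "d \<ge> 1"
  shows "tensor_rep d = zero_sums d"
proof (rule antisym)
  show "tensor_rep d \<subseteq> zero_sums d"
    unfolding tensor_rep_def
    by (rule span_minimal[OF _ subspace_zero_sums]) (auto intro: outer_in_zero_sums)
  show "zero_sums d \<subseteq> tensor_rep d"
  proof
    fix A assume A: "A \<in> zero_sums d"
    have "outer (evec_diff i d) (evec_diff j d) \<in> tensor_rep d" if "i \<in> {1..d}" "j \<in> {1..d}" for i j
      unfolding tensor_rep_def using that d unit_vec_diff_std[of i d d] unit_vec_diff_std[of j d d]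
      by (intro span_base) auto
    then have "(\<Sum>i=1..d. \<Sum>j=1..d. A i j *\<^sub>R outer (evec_diff i d) (evec_diff j d)) \<in> tensor_rep d"
      unfolding tensor_rep_def by (intro span_scale span_sum)
    then show "A \<in> tensor_rep d" by (simp only: zero_sums_expand[OF A, symmetric])
  qed
qed

lemma mat_act_outer: "mat_act (g, h) (outer x y) = outer (vec_act g x) (vec_act h y)"
  by (simp add: mat_act_def outer_def vec_act_def)

text \<open>Swapping \<open>j\<close> and \<open>d\<close> in the second factor alone negates the
  image \<open>B\<close> of a generator while only permuting each row, so every row sum equals its
  own negative. The first factor treats the column sums in the same way.\<close>

lemma type_ss_eq:
  assumes d: "d \<ge> 1"
  shows "type_ss d = zero_sums d"
proof (rule antisym)
  show "type_ss d \<subseteq> zero_sums d"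
    unfolding type_ss_def prod_isotypic_def
  proof (rule isotypic_subset[OF subspace_zero_sums])
    fix f :: "matr \<Rightarrow> matr"
    assume f: "linear f" "f ` tensor_rep d \<subseteq> Mat d d"
      and eq: "\<And>g u. g \<in> carrier (S2 d) \<Longrightarrow> u \<in> tensor_rep d \<Longrightarrow> f (mat_act g u) = mat_act g (f u)"
    have d': "d \<in> {1..d}" using d by simp
    have gen: "f (outer (evec_diff i d) (evec_diff j d)) \<in> zero_sums d" if ij: "i \<in> {1..d}" "j \<in> {1..d}" for i j
    proof -
      define B where "B = f (outer (evec_diff i d) (evec_diff j d))"
      have T: "outer (evec_diff i d) (evec_diff j d) \<in> tensor_rep d"
        unfolding tensor_rep_eq[OF d] using ij d' by (intro outer_in_zero_sums unit_vec_diff_std)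
      have act: "f (outer (vec_act g (evec_diff i d)) (vec_act h (evec_diff j d))) k l
        = B (inv_into UNIV g k) (inv_into UNIV h l)" if "g permutes {1..d}" "h permutes {1..d}" for g h k l
        using eq[of "(g, h)", OF _ T] that unfolding carrier_S2 mat_act_outer B_def
        by (simp add: mat_act_apply)
      have neg: "f (outer (- evec_diff i d) (evec_diff j d)) = - B" "f (outer (evec_diff i d) (- evec_diff j d)) = - B"
      proof -
        have "outer (- evec_diff i d) (evec_diff j d) = - outer (evec_diff i d) (evec_diff j d)"
          "outer (evec_diff i d) (- evec_diff j d) = - outer (evec_diff i d) (evec_diff j d)"
          by (intro ext; simp add: outer_def algebra_simps)+
        then show "f (outer (- evec_diff i d) (evec_diff j d)) = - B" "f (outer (evec_diff i d) (- evec_diff j d)) = - B"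
          unfolding B_def using linear_neg[OF f(1)] by metis+
      qed
      have va: "vec_act (Transposition.transpose a d) (evec_diff a d) = - evec_diff a d" if "a \<in> {1..d}" for a
        by (simp add: vec_act_diff vec_act_unit_vec[OF swap_permutes[OF that d']])
      have "(\<Sum>l=1..d. B k l) = 0" for k
      proof -
        note h = swap_permutes[OF ij(2) d']
        have "- B k l = B k (inv_into UNIV (Transposition.transpose j d) l)" for l
          using act[OF permutes_id h, of k l] unfolding vec_act_id va[OF ij(2)] neg by simp
        then have "(\<Sum>l=1..d. - B k l) = (\<Sum>l=1..d. B k (inv_into UNIV (Transposition.transpose j d) l))"
          by (simp only:)
        also have "\<dots> = (\<Sum>l=1..d. B k l)"
          using sum.permute[OF permutes_inv[OF h], of "B k"] by (simp only: o_def)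
        finally show ?thesis by (simp add: sum_negf)
      qed
      moreover have "(\<Sum>l=1..d. B l k) = 0" for k
      proof -
        note h = swap_permutes[OF ij(1) d']
        have "- B l k = B (inv_into UNIV (Transposition.transpose i d) l) k" for l
          using act[OF h permutes_id, of l k] unfolding vec_act_id va[OF ij(1)] neg by simp
        then have "(\<Sum>l=1..d. - B l k) = (\<Sum>l=1..d. B (inv_into UNIV (Transposition.transpose i d) l) k)"
          by (simp only:)
        also have "\<dots> = (\<Sum>l=1..d. B l k)"
          using sum.permute[OF permutes_inv[OF h], of "\<lambda>l. B l k"] by (simp only: o_def)
        finally show ?thesis by (simp add: sum_negf)
      qed
      moreover have "B \<in> Mat d d" using f(2) T unfolding B_def by blast
      ultimately show ?thesis unfolding zero_sums_def B_def[symmetric] by blast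
    qed
    show "f ` tensor_rep d \<subseteq> zero_sums d"
    proof
      fix X assume "X \<in> f ` tensor_rep d"
      then obtain A where A: "A \<in> zero_sums d" "X = f A" unfolding tensor_rep_eq[OF d] by blast
      have X: "X = (\<Sum>i=1..d. \<Sum>j=1..d. A i j *\<^sub>R f (outer (evec_diff i d) (evec_diff j d)))"
        unfolding A(2) using arg_cong[OF zero_sums_expand[OF A(1)], of f]
        by (simp only: linear_scale[OF f(1)] linear_sum[OF f(1)])
      show "X \<in> zero_sums d"
        unfolding X by (rule subspace_sum[OF subspace_zero_sums], rule subspace_sum[OF subspace_zero_sums],
          rule subspace_scale[OF subspace_zero_sums], rule gen)
    qed
  qed
  have "(\<lambda>x. x) ` tensor_rep d \<subseteq> type_ss d"
    unfolding type_ss_def prod_isotypic_def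
  proof (rule isotypic_superset)
    show "linear (\<lambda>x :: matr. x)" by (rule linearI) simp_all
    show "(\<lambda>x. x) ` tensor_rep d \<subseteq> Mat d d"
      using zero_sums_subset_Mat(1) by (simp add: tensor_rep_eq[OF d])
  qed simp_all
  then show "zero_sums d \<subseteq> type_ss d" by (simp add: tensor_rep_eq[OF d])
qed

section \<open>Decomposition of the matrix space into types\<close>

lemma diagonal_on_zero: "diagonal_on H {0} {#}"
  unfolding diagonal_on_def by (intro exI[of _ "{}"]) (simp add: independent_empty)

text \<open>Every decomposition below has four summands: four types, four blocks, or three copies of
  the standard representation together with the zero space.\<close>

lemma diagonal_on_sum4:
  fixes H :: "'a::real_vector \<Rightarrow> 'a"
  assumes "diagonal_on H U1 M1" "diagonal_on H U2 M2" "diagonal_on H U3 M3" "diagonal_on H U4 M4"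
    and ind: "\<And>u1 u2 u3 u4. u1 \<in> U1 \<Longrightarrow> u2 \<in> U2 \<Longrightarrow> u3 \<in> U3 \<Longrightarrow> u4 \<in> U4 \<Longrightarrow>
      u1 + u2 + u3 + u4 = 0 \<Longrightarrow> u1 = 0 \<and> u2 = 0 \<and> u3 = 0 \<and> u4 = 0"
    and W: "W = {u1 + u2 + u3 + u4 | u1 u2 u3 u4. u1 \<in> U1 \<and> u2 \<in> U2 \<and> u3 \<in> U3 \<and> u4 \<in> U4}"
  shows "diagonal_on H W (M1 + M2 + M3 + M4)"
proof -
  note sub = assms(1-4)[THEN diagonal_on_subspace]
  note zero = sub[THEN subspace_0]
  have "U1 \<inter> U2 \<subseteq> {0}"
  proof
    fix x assume "x \<in> U1 \<inter> U2"
    then have "x = 0 \<and> - x = 0 \<and> (0 :: 'a) = 0 \<and> (0 :: 'a) = 0"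
      using zero subspace_neg[OF sub(2)] by (intro ind) auto
    then show "x \<in> {0}" by simp
  qed
  note d2 = diagonal_on_sum[OF assms(1,2) this refl]
  have "{u + v | u v. u \<in> U1 \<and> v \<in> U2} \<inter> U3 \<subseteq> {0}"
  proof
    fix x assume "x \<in> {u + v | u v. u \<in> U1 \<and> v \<in> U2} \<inter> U3"
    then obtain u v where uv: "x = u + v" "u \<in> U1" "v \<in> U2" "x \<in> U3" by blast
    then have "u = 0 \<and> v = 0 \<and> - x = 0 \<and> (0 :: 'a) = 0"
      using zero subspace_neg[OF sub(3), of x] by (intro ind) simp_all
    then show "x \<in> {0}" by simp
  qed
  note d3 = diagonal_on_sum[OF d2 assms(3) this refl]
  have "{w + x | w x. w \<in> {u + v | u v. u \<in> U1 \<and> v \<in> U2} \<and> x \<in> U3} \<inter> U4 \<subseteq> {0}"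
  proof
    fix x assume "x \<in> {w + x | w x. w \<in> {u + v | u v. u \<in> U1 \<and> v \<in> U2} \<and> x \<in> U3} \<inter> U4"
    then obtain u v w where uv: "x = u + v + w" "u \<in> U1" "v \<in> U2" "w \<in> U3" "x \<in> U4" by blast
    then have "u = 0 \<and> v = 0 \<and> w = 0 \<and> - x = 0"
      using subspace_neg[OF sub(4), of x] by (intro ind) simp_all
    then show "x \<in> {0}" by simp
  qed
  note d4 = diagonal_on_sum[OF d3 assms(4) this refl]
  have "W = {w + x | w x. w \<in> {w + x | w x. w \<in> {u + v | u v. u \<in> U1 \<and> v \<in> U2} \<and> x \<in> U3} \<and> x \<in> U4}"
    unfolding W by blast
  then show ?thesis using d4 by simp
qed

lemma mix_entry: "i \<in> {1..d} \<Longrightarrow> j \<in> {1..d} \<Longrightarrow> mix d a b i j = a * of_bool (i = j) + b"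
  by (simp add: mix_def)

lemma std_mat_entry: "i \<in> {1..d} \<Longrightarrow> j \<in> {1..d} \<Longrightarrow> std_mat d u v w i j = of_bool (i = j) * u i + v i + w j"
  by (simp add: std_mat_def)

lemma mix_in_Mat: "mix d a b \<in> Mat d d"
  by (auto simp: Mat_def mix_def)

lemma sum_mix:
  assumes "k \<in> {1..d}"
  shows "(\<Sum>l=1..d. mix d a b k l) = a + real d * b" "(\<Sum>l=1..d. mix d a b l k) = a + real d * b"
proof -
  have "(\<Sum>l=1..d. mix d a b k l) = (\<Sum>l=1..d. a * of_bool (k = l) + b)"
    by (intro sum.cong refl) (simp only: mix_entry assms)
  also have "\<dots> = a + real d * b"
    using sum_of_bool_eq(4)[OF assms, of "\<lambda>_. a"] by (simp only: sum.distrib) simp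
  finally show "(\<Sum>l=1..d. mix d a b k l) = a + real d * b" .
  have "(\<Sum>l=1..d. mix d a b l k) = (\<Sum>l=1..d. a * of_bool (l = k) + b)"
    by (intro sum.cong refl) (simp only: mix_entry assms)
  also have "\<dots> = a + real d * b"
    using sum_of_bool_eq(3)[OF assms, of "\<lambda>_. a"] by (simp only: sum.distrib) simp
  finally show "(\<Sum>l=1..d. mix d a b l k) = a + real d * b" .
qed

lemma sum_std_mat:
  assumes "k \<in> {1..d}" "v \<in> std_rep d" "w \<in> std_rep d"
  shows "(\<Sum>l=1..d. std_mat d u v w k l) = u k + real d * v k"
    "(\<Sum>l=1..d. std_mat d u v w l k) = u k + real d * w k"
proof -
  have vw: "(\<Sum>l=1..d. v l) = 0" "(\<Sum>l=1..d. w l) = 0" using assms unfolding std_rep_def by blast+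
  have "(\<Sum>l=1..d. std_mat d u v w k l) = (\<Sum>l=1..d. of_bool (k = l) * u k + v k + w l)"
    by (intro sum.cong refl) (simp only: std_mat_entry assms(1))
  also have "\<dots> = u k + real d * v k"
    using sum_of_bool_eq(2)[OF assms(1), of "\<lambda>_. u k"] vw by (simp only: sum.distrib) simp
  finally show "(\<Sum>l=1..d. std_mat d u v w k l) = u k + real d * v k" .
  have "(\<Sum>l=1..d. std_mat d u v w l k) = (\<Sum>l=1..d. of_bool (l = k) * u l + v l + w k)"
    by (intro sum.cong refl) (simp only: std_mat_entry assms(1))
  also have "\<dots> = u k + real d * w k"
    using sum_of_bool_eq(1)[OF assms(1), of u] vw by (simp only: sum.distrib) simp
  finally show "(\<Sum>l=1..d. std_mat d u v w l k) = u k + real d * w k" .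
qed

lemma std_rep_sum: "u \<in> std_rep d \<Longrightarrow> (\<Sum>i=1..d. u i) = 0"
  unfolding std_rep_def by blast

lemma std_rep_outside: "u \<in> std_rep d \<Longrightarrow> i \<notin> {1..d} \<Longrightarrow> u i = 0"
  unfolding std_rep_def by blast

text \<open>Types x and y have zero row sums, column sums and diagonal, so these three data separate
  the other two types from them. Summation over the index isolates \<open>a\<close> and
  \<open>b\<close>; the system left for \<open>u\<close>, \<open>v\<close>, \<open>w\<close> is
  singular exactly for \<open>d = 2\<close>.\<close>

lemma diag_types_independent:
  assumes d: "d \<ge> 3" and mem: "T \<in> triv_space d" "S \<in> std_space d" "X \<in> alt_space d" "Y \<in> sym_space d"
    and sum0: "T + S + X + Y = 0"
  shows "T = 0 \<and> S = 0 \<and> X = 0 \<and> Y = 0"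
proof -
  obtain a b where T: "T = mix d a b" using mem(1) unfolding triv_space_def by blast
  obtain u v w where S: "S = std_mat d u v w" and uvw: "u \<in> std_rep d" "v \<in> std_rep d" "w \<in> std_rep d"
    using mem(2) unfolding std_space_def by blast
  have X: "(\<Sum>l=1..d. X k l) = 0" "(\<Sum>l=1..d. X l k) = 0" "X i j = - X j i" for k i j
    using mem(3) unfolding alt_space_def zero_sums_def by blast+
  have Y: "(\<Sum>l=1..d. Y k l) = 0" "(\<Sum>l=1..d. Y l k) = 0" "Y i j = Y j i" "Y i i = 0" for k i j
    using mem(4) unfolding sym_space_def zero_sums_def by blast+
  have Xii: "X i i = 0" for i using X(3)[of i i] by simp
  have ent: "T i j + S i j + X i j + Y i j = 0" for i j
    using fun_cong[OF fun_cong[OF sum0], of i j] by simp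
  have row: "a + real d * b + (u k + real d * v k) = 0" if "k \<in> {1..d}" for k
  proof -
    have "(\<Sum>l=1..d. T k l + S k l + X k l + Y k l) = 0" by (simp only: ent sum.neutral_const)
    then show ?thesis unfolding sum.distrib X(1,2) Y(1,2) T S sum_mix[OF that] sum_std_mat[OF that uvw(2,3)] by simp
  qed
  have col: "a + real d * b + (u k + real d * w k) = 0" if "k \<in> {1..d}" for k
  proof -
    have "(\<Sum>l=1..d. T l k + S l k + X l k + Y l k) = 0" by (simp only: ent sum.neutral_const)
    then show ?thesis unfolding sum.distrib X(1,2) Y(1,2) T S sum_mix[OF that] sum_std_mat[OF that uvw(2,3)] by simp
  qed
  have dia: "a + b + (u k + v k + w k) = 0" if "k \<in> {1..d}" for k
    using ent[of k k] unfolding T S mix_entry[OF that that] std_mat_entry[OF that that] Xii Y(4) by simp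
  have "(\<Sum>k=1..d. a + real d * b + (u k + real d * v k)) = 0"
    by (rule sum.neutral) (use row in blast)
  then have ab1: "a + real d * b = 0"
    using d by (simp add: sum.distrib sum_distrib_left[symmetric] std_rep_sum[OF uvw(1)] std_rep_sum[OF uvw(2)] del: One_nat_def)
  have "(\<Sum>k=1..d. a + b + (u k + v k + w k)) = 0"
    by (rule sum.neutral) (use dia in blast)
  then have ab2: "a + b = 0"
    using d by (simp add: sum.distrib std_rep_sum[OF uvw(1)] std_rep_sum[OF uvw(2)] std_rep_sum[OF uvw(3)] del: One_nat_def)
  have "(real d - 1) * b = (a + real d * b) - (a + b)" by (simp add: algebra_simps)
  then have "(real d - 1) * b = 0" by (simp only: ab1 ab2 diff_self)
  then have ab: "a = 0" "b = 0" using ab2 d by auto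
  have zero: "u k = 0 \<and> v k = 0 \<and> w k = 0" if "k \<in> {1..d}" for k
  proof -
    have e: "u k + real d * v k = 0" "u k + real d * w k = 0" "u k + v k + w k = 0"
      using row[OF that] col[OF that] dia[OF that] ab by simp_all
    have "real d * (v k - w k) = (u k + real d * v k) - (u k + real d * w k)" by (simp add: algebra_simps)
    then have "real d * (v k - w k) = 0" by (simp only: e diff_self)
    then have vw: "v k = w k" using d by simp
    have "(real d - 2) * v k = (u k + real d * v k) - (u k + v k + v k)" by (simp add: algebra_simps)
    then have "(real d - 2) * v k = 0" using e vw by simp
    then have "v k = 0" using d by simp
    then show ?thesis using e vw by simp
  qed
  have uvw0: "u = 0" "v = 0" "w = 0"
    using zero std_rep_outside[OF uvw(1)] std_rep_outside[OF uvw(2)] std_rep_outside[OF uvw(3)]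
    by (auto simp: fun_eq_iff simp del: atLeastAtMost_iff)
  have TS: "T = 0" "S = 0" by (simp_all only: T S ab uvw0 mix_zero std_mat_zero)
  \<comment> \<open>What remains is a matrix that is both symmetric and antisymmetric.\<close>
  have XY: "X i j = - Y i j" for i j using ent[of i j] unfolding TS by simp
  have "X i j = 0" for i j using XY[of i j] XY[of j i] X(3)[of i j] Y(3)[of i j] by linarith
  moreover from this have "Y i j = 0" for i j using XY[of i j] by simp
  ultimately show ?thesis using TS by (auto intro!: ext)
qed

text \<open>The parameters of types t and s are solved from the row sums, column sums and diagonal
  of \<open>A\<close>. The remainder has all of these equal to 0 and splits into its antisymmetric
  and symmetric parts.\<close>

lemma diag_types_cover:
  assumes d: "d \<ge> 3"
  shows "Mat d d = {T + S + X + Y | T S X Y. T \<in> triv_space d \<and> S \<in> std_space d \<and> X \<in> alt_space d \<and> Y \<in> sym_space d}"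
proof (intro equalityI subsetI)
  fix A assume "A \<in> {T + S + X + Y | T S X Y. T \<in> triv_space d \<and> S \<in> std_space d \<and> X \<in> alt_space d \<and> Y \<in> sym_space d}"
  then obtain T S X Y where A: "A = T + S + X + Y" "T \<in> triv_space d" "S \<in> std_space d" "X \<in> alt_space d" "Y \<in> sym_space d"
    by blast
  have "T \<in> Mat d d" "S \<in> Mat d d" "X \<in> Mat d d" "Y \<in> Mat d d"
    using A(2-5) mix_in_Mat std_mat_in_Mat zero_sums_subset_Mat unfolding triv_space_def std_space_def by blast+
  then show "A \<in> Mat d d"
    unfolding A(1) Mat_eq_Supp by (intro subspace_add[OF subspace_Supp])
next
  fix A assume A: "A \<in> Mat d d"
  define n where "n = real d"
  have n: "n \<noteq> 0" "n - 1 \<noteq> 0" "n - 2 \<noteq> 0" using d by (auto simp: n_def)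
  define r c D where "r k = (\<Sum>l=1..d. A k l)" and "c k = (\<Sum>l=1..d. A l k)" and "D k = A k k" for k
  define s t where "s = (\<Sum>k=1..d. r k)" and "t = (\<Sum>k=1..d. D k)"
  have sc: "(\<Sum>k=1..d. c k) = s" unfolding s_def c_def r_def by (rule sum.swap)
  \<comment> \<open>\<open>a\<close> and \<open>b\<close> are chosen so that a row sum of
    \<open>mix\<close> is the mean row sum of \<open>A\<close> and its diagonal entry is the mean
    diagonal entry.\<close>
  define b where "b = (s - t) / (n * (n - 1))"
  define a where "a = t / n - b"
  have ab: "a + b = t / n" "a + n * b = s / n"
    using n by (simp_all add: a_def b_def divide_simps) (simp_all add: algebra_simps)
  define r' c' D' where "r' k = r k - s / n" and "c' k = c k - s / n" and "D' k = D k - t / n" for k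
  have sums: "(\<Sum>k=1..d. r' k) = 0" "(\<Sum>k=1..d. c' k) = 0" "(\<Sum>k=1..d. D' k) = 0"
    using n sc by (simp_all add: r'_def c'_def D'_def sum_subtractf s_def[symmetric] t_def[symmetric] n_def[symmetric] del: One_nat_def)
  \<comment> \<open>The solution of \<open>u + n v = r'\<close>, \<open>u + n w = c'\<close>,
    \<open>u + v + w = D'\<close>. Adding the first two equations and using the third leaves
    \<open>(n - 2) u = n D' - r' - c'\<close>.\<close>
  define u v w where "u k = of_bool (k \<in> {1..d}) * ((n * D' k - r' k - c' k) / (n - 2))"
    and "v k = of_bool (k \<in> {1..d}) * ((r' k - u k) / n)"
    and "w k = of_bool (k \<in> {1..d}) * ((c' k - u k) / n)" for k
  have usum: "(\<Sum>k=1..d. u k) = 0"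
  proof -
    have "(\<Sum>k=1..d. u k) = (\<Sum>k=1..d. (n * D' k - r' k - c' k) / (n - 2))"
      by (intro sum.cong refl) (simp add: u_def)
    also have "\<dots> = 0" using sums by (simp add: sum_divide_distrib[symmetric] sum_subtractf sum_distrib_left[symmetric])
    finally show ?thesis .
  qed
  have "(\<Sum>k=1..d. v k) = (\<Sum>k=1..d. (r' k - u k) / n)" "(\<Sum>k=1..d. w k) = (\<Sum>k=1..d. (c' k - u k) / n)"
    by (intro sum.cong refl; simp add: v_def w_def)+
  then have vwsum: "(\<Sum>k=1..d. v k) = 0" "(\<Sum>k=1..d. w k) = 0"
    using sums usum by (simp_all add: sum_divide_distrib[symmetric] sum_subtractf)
  have std: "u \<in> std_rep d" "v \<in> std_rep d" "w \<in> std_rep d"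
    using usum vwsum by (auto intro!: std_repI simp: u_def v_def w_def)
  define B where "B = A - mix d a b - std_mat d u v w"
  have BM: "B \<in> Mat d d"
    unfolding B_def Mat_eq_Supp using A mix_in_Mat std_mat_in_Mat
    by (intro subspace_diff[OF subspace_Supp]) (simp_all add: Mat_eq_Supp)
  have row: "(\<Sum>l=1..d. B k l) = 0" and col: "(\<Sum>l=1..d. B l k) = 0" and dia: "B k k = 0" for k
  proof -
    have "(\<Sum>l=1..d. B k l) = 0 \<and> (\<Sum>l=1..d. B l k) = 0 \<and> B k k = 0"
    proof (cases "k \<in> {1..d}")
      case False
      then have "B k l = 0" "B l k = 0" for l using BM unfolding Mat_def by blast+
      then show ?thesis by simp
    next
      case True
      have uk: "v k = (r' k - u k) / n" "w k = (c' k - u k) / n" "u k = (n * D' k - r' k - c' k) / (n - 2)"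
        using True by (simp_all add: u_def v_def w_def)
      have "(\<Sum>l=1..d. B k l) = r k - (a + n * b) - (u k + n * v k)"
        unfolding B_def fun_diff_def sum_subtractf sum_mix[OF True] sum_std_mat[OF True std(2,3)] r_def n_def ..
      also have "\<dots> = 0" unfolding ab(2) uk(1) using n by (simp add: r'_def)
      finally have 1: "(\<Sum>l=1..d. B k l) = 0" .
      have "(\<Sum>l=1..d. B l k) = c k - (a + n * b) - (u k + n * w k)"
        unfolding B_def fun_diff_def sum_subtractf sum_mix[OF True] sum_std_mat[OF True std(2,3)] c_def n_def ..
      also have "\<dots> = 0" unfolding ab(2) uk(2) using n by (simp add: c'_def)
      finally have 2: "(\<Sum>l=1..d. B l k) = 0" .
      have "B k k = D k - (a + b) - (u k + v k + w k)"
        unfolding B_def fun_diff_def mix_entry[OF True True] std_mat_entry[OF True True] D_def by simp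
      also have "\<dots> = D' k - (r' k + c' k) / n - (n - 2) * u k / n"
        unfolding ab(1) uk(1,2) using n by (simp add: D'_def field_simps)
      also have "\<dots> = 0" unfolding uk(3) using n by (simp add: field_simps)
      finally show ?thesis using 1 2 by blast
    qed
    then show "(\<Sum>l=1..d. B k l) = 0" "(\<Sum>l=1..d. B l k) = 0" "B k k = 0" by blast+
  qed
  define X Y where "X = (\<lambda>i j. (B i j - B j i) / 2)" and "Y = (\<lambda>i j. (B i j + B j i) / 2)"
  have Bout: "B i j = 0" if "i \<notin> {1..d} \<or> j \<notin> {1..d}" for i j using BM that unfolding Mat_def by blast
  have "X \<in> zero_sums d" "Y \<in> zero_sums d"
    unfolding zero_sums_def Mat_def X_def Y_def
    using Bout row col
    by (auto simp: sum_divide_distrib[symmetric] sum_subtractf sum.distrib simp del: atLeastAtMost_iff)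
  moreover have "X j i = - X i j" "Y j i = Y i j" "Y i i = 0" for i j
    using dia by (simp_all add: X_def Y_def field_simps)
  ultimately have "X \<in> alt_space d" "Y \<in> sym_space d"
    unfolding alt_space_def sym_space_def by blast+
  moreover have "mix d a b \<in> triv_space d" "std_mat d u v w \<in> std_space d"
    unfolding triv_space_def std_space_def using std by blast+
  moreover have "A = mix d a b + std_mat d u v w + X + Y"
    by (intro ext) (simp add: X_def Y_def B_def field_simps)
  ultimately show "A \<in> {T + S + X + Y | T S X Y. T \<in> triv_space d \<and> S \<in> std_space d \<and> X \<in> alt_space d \<and> Y \<in> sym_space d}"
    by blast
qed

text \<open>Row sums and column sums give \<open>b + v k = 0\<close> and \<open>b + w k = 0\<close>;
  summing over \<open>k\<close> gives \<open>b = 0\<close>.\<close>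

lemma prod_types_independent:
  assumes d: "d \<ge> 1" and mem: "T \<in> const_space d" "S \<in> row_space d" "X \<in> col_space d" "Y \<in> zero_sums d"
    and sum0: "T + S + X + Y = 0"
  shows "T = 0 \<and> S = 0 \<and> X = 0 \<and> Y = 0"
proof -
  obtain b where T: "T = mix d 0 b" using mem(1) unfolding const_space_def by blast
  obtain v where S: "S = std_mat d 0 v 0" and v: "v \<in> std_rep d" using mem(2) unfolding row_space_def by blast
  obtain w where X: "X = std_mat d 0 0 w" and w: "w \<in> std_rep d" using mem(3) unfolding col_space_def by blast
  have z: "0 \<in> std_rep d" by (rule subspace_0[OF subspace_std_rep])
  have Y: "(\<Sum>l=1..d. Y k l) = 0" "(\<Sum>l=1..d. Y l k) = 0" for k
    using mem(4) unfolding zero_sums_def by blast+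
  have ent: "T i j + S i j + X i j + Y i j = 0" for i j
    using fun_cong[OF fun_cong[OF sum0], of i j] by simp
  have row: "b + v k = 0" and col: "b + w k = 0" if "k \<in> {1..d}" for k
  proof -
    have "(\<Sum>l=1..d. T k l + S k l + X k l + Y k l) = 0" by (simp only: ent sum.neutral_const)
    then have "real d * (b + v k) = 0"
      unfolding sum.distrib Y T S X sum_mix[OF that] sum_std_mat[OF that v z] sum_std_mat[OF that z w]
      by (simp add: algebra_simps)
    then show "b + v k = 0" using d by simp
    have "(\<Sum>l=1..d. T l k + S l k + X l k + Y l k) = 0" by (simp only: ent sum.neutral_const)
    then have "real d * (b + w k) = 0"
      unfolding sum.distrib Y T S X sum_mix[OF that] sum_std_mat[OF that v z] sum_std_mat[OF that z w]
      by (simp add: algebra_simps)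
    then show "b + w k = 0" using d by simp
  qed
  have "(\<Sum>k=1..d. b + v k) = 0" by (rule sum.neutral) (use row in blast)
  then have b: "b = 0" using d by (simp add: sum.distrib std_rep_sum[OF v] del: One_nat_def)
  have "v k = 0" "w k = 0" for k
    using row[of k] col[of k] b std_rep_outside[OF v, of k] std_rep_outside[OF w, of k] by auto
  then have vw: "v = 0" "w = 0" by (auto intro!: ext)
  have TSX: "T = 0" "S = 0" "X = 0" by (simp_all only: T S X b vw mix_zero std_mat_zero)
  then show ?thesis using sum0 by simp
qed

text \<open>The analysis of variance: the grand mean, the deviations of the row and column means
  from it, and a remainder with zero sums.\<close>

lemma prod_types_cover:
  assumes d: "d \<ge> 1"
  shows "Mat d d = {T + S + X + Y | T S X Y. T \<in> const_space d \<and> S \<in> row_space d \<and> X \<in> col_space d \<and> Y \<in> zero_sums d}"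
proof (intro equalityI subsetI)
  fix A assume "A \<in> {T + S + X + Y | T S X Y. T \<in> const_space d \<and> S \<in> row_space d \<and> X \<in> col_space d \<and> Y \<in> zero_sums d}"
  then obtain T S X Y where A: "A = T + S + X + Y" "T \<in> const_space d" "S \<in> row_space d" "X \<in> col_space d" "Y \<in> zero_sums d"
    by blast
  have "T \<in> Mat d d" "S \<in> Mat d d" "X \<in> Mat d d" "Y \<in> Mat d d"
    using A(2-5) mix_in_Mat std_mat_in_Mat zero_sums_subset_Mat unfolding const_space_def row_space_def col_space_def by blast+
  then show "A \<in> Mat d d"
    unfolding A(1) Mat_eq_Supp by (intro subspace_add[OF subspace_Supp])
next
  fix A assume A: "A \<in> Mat d d"
  define n where "n = real d"
  have n: "n \<noteq> 0" using d by (auto simp: n_def)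
  define r c where "r k = (\<Sum>l=1..d. A k l)" and "c k = (\<Sum>l=1..d. A l k)" for k
  define s where "s = (\<Sum>k=1..d. r k)"
  have sc: "(\<Sum>k=1..d. c k) = s" unfolding s_def c_def r_def by (rule sum.swap)
  define v w where "v k = of_bool (k \<in> {1..d}) * (r k / n - s / n\<^sup>2)"
    and "w k = of_bool (k \<in> {1..d}) * (c k / n - s / n\<^sup>2)" for k
  have "(\<Sum>k=1..d. v k) = (\<Sum>k=1..d. r k / n - s / n\<^sup>2)" "(\<Sum>k=1..d. w k) = (\<Sum>k=1..d. c k / n - s / n\<^sup>2)"
    by (intro sum.cong refl; simp add: v_def w_def)+
  then have "(\<Sum>k=1..d. v k) = 0" "(\<Sum>k=1..d. w k) = 0"
    using n sc by (simp_all add: sum_subtractf sum_divide_distrib[symmetric] s_def[symmetric] n_def[symmetric] power2_eq_square del: One_nat_def)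
  then have std: "v \<in> std_rep d" "w \<in> std_rep d"
    by (auto intro!: std_repI simp: v_def w_def)
  have z: "0 \<in> std_rep d" by (rule subspace_0[OF subspace_std_rep])
  define Y where "Y = A - mix d 0 (s / n\<^sup>2) - std_mat d 0 v w"
  have YM: "Y \<in> Mat d d"
    unfolding Y_def Mat_eq_Supp using A mix_in_Mat std_mat_in_Mat
    by (intro subspace_diff[OF subspace_Supp]) (simp_all add: Mat_eq_Supp)
  have "(\<Sum>l=1..d. Y k l) = 0 \<and> (\<Sum>l=1..d. Y l k) = 0" for k
  proof (cases "k \<in> {1..d}")
    case False
    then have "Y k l = 0" "Y l k = 0" for l using YM unfolding Mat_def by blast+
    then show ?thesis by simp
  next
    case True
    have "(\<Sum>l=1..d. Y k l) = r k - n * (s / n\<^sup>2) - n * v k"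
      unfolding Y_def fun_diff_def sum_subtractf sum_mix[OF True] sum_std_mat[OF True std] r_def n_def by simp
    also have "\<dots> = 0" using True n by (simp add: v_def field_simps power2_eq_square)
    finally have 1: "(\<Sum>l=1..d. Y k l) = 0" .
    have "(\<Sum>l=1..d. Y l k) = c k - n * (s / n\<^sup>2) - n * w k"
      unfolding Y_def fun_diff_def sum_subtractf sum_mix[OF True] sum_std_mat[OF True std] c_def n_def by simp
    also have "\<dots> = 0" using True n by (simp add: w_def field_simps power2_eq_square)
    finally show ?thesis using 1 by blast
  qed
  then have "Y \<in> zero_sums d" unfolding zero_sums_def using YM by blast
  moreover have "A = mix d 0 (s / n\<^sup>2) + std_mat d 0 v 0 + std_mat d 0 0 w + Y"
    unfolding Y_def add.assoc[of "mix d 0 (s / n\<^sup>2)" "std_mat d 0 v 0"] std_mat_add by simp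
  moreover have "mix d 0 (s / n\<^sup>2) \<in> const_space d" "std_mat d 0 v 0 \<in> row_space d" "std_mat d 0 0 w \<in> col_space d"
    unfolding const_space_def row_space_def col_space_def using std by blast+
  ultimately show "A \<in> {T + S + X + Y | T S X Y. T \<in> const_space d \<and> S \<in> row_space d \<and> X \<in> col_space d \<and> Y \<in> zero_sums d}"
    by blast
qed

section \<open>Critical equations, loss and Hessian at \<open>a I + b J\<close>\<close>

definition gram_off :: "nat \<Rightarrow> real \<Rightarrow> real \<Rightarrow> real" where
  "gram_off d a b = 2 * a * b + real d * b\<^sup>2"

text \<open>The Gram matrix of \<open>a I + b J\<close> is \<open>a^2 I + q J\<close> with
  \<open>q = gram_off d a b\<close>. Its entrywise square is again of this shape, with
  \<open>gram_gap\<close> as the coefficient of \<open>I\<close> and \<open>q^2\<close> as that of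
  \<open>J\<close>.\<close>

definition gram_gap :: "nat \<Rightarrow> real \<Rightarrow> real \<Rightarrow> real" where
  "gram_gap d a b = (gram_off d a b + a\<^sup>2)\<^sup>2 - (gram_off d a b)\<^sup>2"

lemma gram_mix:
  assumes "k \<in> {1..d}" "m \<in> {1..d}"
  shows "gram d (mix d a b) k m = gram_off d a b + a\<^sup>2 * of_bool (m = k)"
proof -
  have "gram d (mix d a b) k m = (\<Sum>l=1..d. of_bool (k = l) * (a * (a * of_bool (m = l) + b))
     + of_bool (m = l) * (a * b) + b\<^sup>2)"
    unfolding gram_def using assms
    by (intro sum.cong refl) (simp only: mix_entry, simp add: algebra_simps power2_eq_square)
  also have "\<dots> = a * (a * of_bool (m = k) + b) + a * b + real d * b\<^sup>2"
    using sum_of_bool_eq(2)[OF assms(1), of "\<lambda>l. a * (a * of_bool (m = l) + b)"]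
      sum_of_bool_eq(2)[OF assms(2), of "\<lambda>_. a * b"]
    by (simp only: sum.distrib finite_atLeastAtMost) simp
  finally show ?thesis by (simp add: gram_off_def algebra_simps power2_eq_square)
qed

lemma gram_mix_power2:
  assumes "k \<in> {1..d}" "m \<in> {1..d}"
  shows "(gram d (mix d a b) k m)\<^sup>2 = (gram_off d a b)\<^sup>2 + gram_gap d a b * of_bool (m = k)"
  unfolding gram_mix[OF assms] gram_gap_def by (cases "m = k") simp_all

lemma sum_gram_power2:
  assumes "k \<in> {1..d}"
  shows "(\<Sum>m=1..d. (gram d (mix d a b) k m)\<^sup>2 * f m) = (gram_off d a b)\<^sup>2 * (\<Sum>m=1..d. f m) + gram_gap d a b * f k"
proof -
  have "(\<Sum>m=1..d. (gram d (mix d a b) k m)\<^sup>2 * f m)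
    = (\<Sum>m=1..d. (gram_off d a b)\<^sup>2 * f m + of_bool (m = k) * (gram_gap d a b * f m))"
    by (intro sum.cong refl) (simp only: gram_mix_power2[OF assms], simp add: algebra_simps)
  then show ?thesis
    using sum_of_bool_eq(1)[OF assms, of "\<lambda>m. gram_gap d a b * f m"]
    by (simp only: sum.distrib sum_distrib_left finite_atLeastAtMost)
qed

text \<open>\<open>M\<close> is the derivative of the Gram matrix in the direction \<open>X\<close>,
  expressed by the entries and the row sums \<open>r\<close> of \<open>X\<close>.\<close>

lemma hessian_mix:
  fixes X :: matr and a b :: real
  assumes kl: "k \<in> {1..d}" "l \<in> {1..d}"
  defines "q \<equiv> gram_off d a b" and "r \<equiv> \<lambda>k. \<Sum>l=1..d. X k l"
  defines "M \<equiv> \<lambda>k l. a * (X k l + X l k) + b * (r k + r l)"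
  shows "hessian d (mix d a b) X k l = 6 * (2 * a * q * M k l + of_bool (k = l) * (2 * a ^ 3 * M k k)
    + 2 * b * (q * (\<Sum>m=1..d. M k m) + a\<^sup>2 * M k k) + q\<^sup>2 * (\<Sum>m=1..d. X m l)
    + (gram_gap d a b - 2 * b) * X k l - of_bool (k = l) * (2 * a * X k k))"
proof -
  have W: "(\<Sum>j=1..d. mix d a b m j * X k j) = a * X k m + b * r k" if "m \<in> {1..d}" for m k
  proof -
    have "(\<Sum>j=1..d. mix d a b m j * X k j) = (\<Sum>j=1..d. of_bool (m = j) * (a * X k j) + b * X k j)"
      using that by (intro sum.cong refl) (simp only: mix_entry, simp add: algebra_simps)
    then show ?thesis
      using sum_of_bool_eq(2)[OF that, of "\<lambda>j. a * X k j"]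
      by (simp only: sum.distrib sum_distrib_left[symmetric] finite_atLeastAtMost r_def)
  qed
  have "(\<Sum>m=1..d. gram d (mix d a b) k m * ((\<Sum>j=1..d. mix d a b m j * X k j) + (\<Sum>j=1..d. mix d a b k j * X m j)) * mix d a b m l)
    = (\<Sum>m=1..d. of_bool (m = l) * (q * a * M k m) + of_bool (m = k) * (of_bool (m = l) * (a ^ 3 * M k m))
       + of_bool (m = k) * (a\<^sup>2 * b * M k m) + q * b * M k m)"
  proof (intro sum.cong refl)
    fix m assume m: "m \<in> {1..d}"
    show "gram d (mix d a b) k m * ((\<Sum>j=1..d. mix d a b m j * X k j) + (\<Sum>j=1..d. mix d a b k j * X m j)) * mix d a b m l
      = of_bool (m = l) * (q * a * M k m) + of_bool (m = k) * (of_bool (m = l) * (a ^ 3 * M k m))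
       + of_bool (m = k) * (a\<^sup>2 * b * M k m) + q * b * M k m"
      unfolding W[OF m] W[OF kl(1)] gram_mix[OF kl(1) m] mix_entry[OF m kl(2)] M_def q_def[symmetric]
      by (simp add: algebra_simps power2_eq_square power3_eq_cube)
  qed
  also have "\<dots> = q * a * M k l + of_bool (k = l) * (a ^ 3 * M k k) + a\<^sup>2 * b * M k k + q * b * (\<Sum>m=1..d. M k m)"
    by (simp only: sum.distrib sum_of_bool_eq[OF kl(1)] sum_of_bool_eq[OF kl(2)] finite_atLeastAtMost sum_distrib_left)
  finally have 1: "(\<Sum>m=1..d. gram d (mix d a b) k m * ((\<Sum>j=1..d. mix d a b m j * X k j) + (\<Sum>j=1..d. mix d a b k j * X m j)) * mix d a b m l)
    = q * a * M k l + of_bool (k = l) * (a ^ 3 * M k k) + a\<^sup>2 * b * M k k + q * b * (\<Sum>m=1..d. M k m)" .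
  show ?thesis
    unfolding hessian_formula[OF kl] 1 sum_gram_power2[OF kl(1)] mix_entry[OF kl] q_def[symmetric]
    by (cases "k = l") (simp_all add: algebra_simps)
qed

text \<open>The gradient takes one value off the diagonal and one on it. The first hypothesis is the
  vanishing of the former, the second that of the difference, whose square part is
  \<open>(a + b)^2 - b^2\<close>.\<close>

lemma critical_mix:
  assumes "(gram_off d a b)\<^sup>2 * (a + real d * b) + gram_gap d a b * b = b\<^sup>2"
    and "gram_gap d a b * a = a\<^sup>2 + 2 * a * b"
  shows "critical d (mix d a b)"
  unfolding critical_iff
proof (intro conjI ballI mix_in_Mat)
  fix k l assume kl: "k \<in> {1..d}" "l \<in> {1..d}"
  have "grad d (mix d a b) k l = 6 * ((gram_off d a b)\<^sup>2 * (a + real d * b) + gram_gap d a b * (a * of_bool (k = l) + b)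
    - (a * of_bool (k = l) + b)\<^sup>2)"
    unfolding grad_def sum_gram_power2[OF kl(1)] sum_mix[OF kl(2)] mix_entry[OF kl] by (simp add: algebra_simps)
  also have "(gram_off d a b)\<^sup>2 * (a + real d * b) + gram_gap d a b * (a * of_bool (k = l) + b) = (a * of_bool (k = l) + b)\<^sup>2"
    using assms by (cases "k = l") (simp_all add: algebra_simps power2_eq_square)
  finally show "grad d (mix d a b) k l = 0" by simp
qed

lemma loss_mix:
  shows "loss d (mix d a b) = real d * (gram_off d a b + a\<^sup>2) ^ 3 + real d * (real d - 1) * (gram_off d a b) ^ 3
    - 2 * (real d * (a + b) ^ 3 + real d * (real d - 1) * b ^ 3) + real d"
proof -
  have S: "(\<Sum>i=1..d. \<Sum>j=1..d. y + (x - y) * of_bool (j = i)) = real d * x + real d * (real d - 1) * y" for x y :: real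
  proof -
    have "(\<Sum>j=1..d. y + (x - y) * of_bool (j = i)) = real d * y + (x - y)" if "i \<in> {1..d}" for i
      using sum_of_bool_eq(3)[OF that, of "\<lambda>_. x - y"] by (simp only: sum.distrib finite_atLeastAtMost) simp
    then have "(\<Sum>i=1..d. \<Sum>j=1..d. y + (x - y) * of_bool (j = i)) = (\<Sum>i=1..d. real d * y + (x - y))"
      by (intro sum.cong refl)
    then show ?thesis by (simp add: algebra_simps)
  qed
  have "(\<Sum>i=1..d. \<Sum>j=1..d. gram d (mix d a b) i j ^ 3)
    = (\<Sum>i=1..d. \<Sum>j=1..d. gram_off d a b ^ 3 + ((gram_off d a b + a\<^sup>2) ^ 3 - gram_off d a b ^ 3) * of_bool (j = i))"
  proof (intro sum.cong refl)
    fix i j assume "i \<in> {1..d}" "j \<in> {1..d}"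
    then show "gram d (mix d a b) i j ^ 3 = gram_off d a b ^ 3 + ((gram_off d a b + a\<^sup>2) ^ 3 - gram_off d a b ^ 3) * of_bool (j = i)"
      by (simp only: gram_mix) (cases "j = i"; simp)
  qed
  moreover have "(\<Sum>i=1..d. \<Sum>j=1..d. mix d a b i j ^ 3)
    = (\<Sum>i=1..d. \<Sum>j=1..d. b ^ 3 + ((a + b) ^ 3 - b ^ 3) * of_bool (j = i))"
  proof (intro sum.cong refl)
    fix i j assume "i \<in> {1..d}" "j \<in> {1..d}"
    then show "mix d a b i j ^ 3 = b ^ 3 + ((a + b) ^ 3 - b ^ 3) * of_bool (j = i)"
      by (simp only: mix_entry) (cases "j = i"; simp)
  qed
  ultimately show ?thesis unfolding loss_gram by (simp only: S)
qed

text \<open>A form of \<open>hessian_mix\<close> in which row sums, column sum and Gram derivative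
  are supplied as closed expressions, so that each type is a matter of comparing
  coefficients.\<close>

lemma hessian_mixI:
  fixes X M :: matr and a b :: real
  assumes kl: "k \<in> {1..d}" "l \<in> {1..d}"
    and r: "\<And>k. k \<in> {1..d} \<Longrightarrow> (\<Sum>l=1..d. X k l) = r k"
    and c: "(\<Sum>m=1..d. X m l) = c"
    and M: "\<And>i j. i \<in> {1..d} \<Longrightarrow> j \<in> {1..d} \<Longrightarrow> M i j = a * (X i j + X j i) + b * (r i + r j)"
    and s: "(\<Sum>m=1..d. M k m) = s"
  shows "hessian d (mix d a b) X k l = 6 * (2 * a * gram_off d a b * M k l + of_bool (k = l) * (2 * a ^ 3 * M k k)
    + 2 * b * (gram_off d a b * s + a\<^sup>2 * M k k) + (gram_off d a b)\<^sup>2 * c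
    + (gram_gap d a b - 2 * b) * X k l - of_bool (k = l) * (2 * a * X k k))"
proof -
  have M': "a * (X k j + X j k) + b * ((\<Sum>l=1..d. X k l) + (\<Sum>l=1..d. X j l)) = M k j" if "j \<in> {1..d}" for j
    unfolding r[OF kl(1)] r[OF that] M[OF kl(1) that] ..
  have "(\<Sum>j=1..d. a * (X k j + X j k) + b * ((\<Sum>l=1..d. X k l) + (\<Sum>l=1..d. X j l))) = s"
    unfolding s[symmetric] by (intro sum.cong refl M')
  then show ?thesis
    unfolding hessian_mix[OF kl] M'[OF kl(2)] M'[OF kl(1)] c by (simp only:)
qed

text \<open>The Gram derivative of a matrix of type s is again of the form \<open>std_mat\<close>:
  \<open>2 a u\<close> on the diagonal, and \<open>m\<close> both along rows and along
  columns.\<close>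

lemma hessian_std_mat:
  fixes a b :: real
  assumes uvw: "u \<in> std_rep d" "v \<in> std_rep d" "w \<in> std_rep d"
  defines "m \<equiv> \<lambda>k. a * (v k + w k) + b * (u k + real d * v k)"
  shows "hessian d (mix d a b) (std_mat d u v w) = std_mat d
    (\<lambda>k. 6 * (4 * a\<^sup>2 * gram_off d a b * u k + 4 * a ^ 3 * (a * u k + m k)
      + (gram_gap d a b - 2 * b) * u k - 2 * a * (u k + v k + w k)))
    (\<lambda>k. 6 * (2 * a * gram_off d a b * m k
      + 2 * b * (gram_off d a b * (2 * a * u k + real d * m k) + 2 * a\<^sup>2 * (a * u k + m k))
      + (gram_gap d a b - 2 * b) * v k))
    (\<lambda>k. 6 * (2 * a * gram_off d a b * m k + (gram_off d a b)\<^sup>2 * (u k + real d * w k)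
      + (gram_gap d a b - 2 * b) * w k))"
proof (intro ext)
  fix k l
  let ?U = "(\<lambda>k. 6 * (4 * a\<^sup>2 * gram_off d a b * u k + 4 * a ^ 3 * (a * u k + m k)
      + (gram_gap d a b - 2 * b) * u k - 2 * a * (u k + v k + w k)))"
  let ?V = "(\<lambda>k. 6 * (2 * a * gram_off d a b * m k
      + 2 * b * (gram_off d a b * (2 * a * u k + real d * m k) + 2 * a\<^sup>2 * (a * u k + m k))
      + (gram_gap d a b - 2 * b) * v k))"
  let ?W = "(\<lambda>k. 6 * (2 * a * gram_off d a b * m k + (gram_off d a b)\<^sup>2 * (u k + real d * w k)
      + (gram_gap d a b - 2 * b) * w k))"
  show "hessian d (mix d a b) (std_mat d u v w) k l = std_mat d ?U ?V ?W k l"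
  proof (cases "k \<in> {1..d} \<and> l \<in> {1..d}")
    case False
    then show ?thesis unfolding hessian_outside[OF False] by (simp add: std_mat_def)
  next
    case True
    then have kl: "k \<in> {1..d}" "l \<in> {1..d}" by blast+
    let ?M = "\<lambda>i j. 2 * a * (of_bool (i = j) * u i) + m i + m j"
    have "(\<Sum>i=1..d. m i) = 0"
      by (simp add: m_def sum.distrib sum_distrib_left[symmetric] std_rep_sum[OF uvw(1)] std_rep_sum[OF uvw(2)]
          std_rep_sum[OF uvw(3)] del: One_nat_def)
    then have s: "(\<Sum>j=1..d. ?M k j) = 2 * a * u k + real d * m k"
      using sum_of_bool_eq(2)[OF kl(1), of "\<lambda>_. u k"]
      by (simp only: sum.distrib sum_distrib_left[symmetric] finite_atLeastAtMost) simp
    have M: "?M i j = a * (std_mat d u v w i j + std_mat d u v w j i) + b * ((u i + real d * v i) + (u j + real d * v j))"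
      if "i \<in> {1..d}" "j \<in> {1..d}" for i j
      unfolding std_mat_entry[OF that] std_mat_entry[OF that(2,1)] m_def
      by (cases "i = j") (simp_all add: algebra_simps)
    have "hessian d (mix d a b) (std_mat d u v w) k l = 6 * (2 * a * gram_off d a b * ?M k l
      + of_bool (k = l) * (2 * a ^ 3 * ?M k k) + 2 * b * (gram_off d a b * (2 * a * u k + real d * m k) + a\<^sup>2 * ?M k k)
      + (gram_off d a b)\<^sup>2 * (u l + real d * w l) + (gram_gap d a b - 2 * b) * (of_bool (k = l) * u k + v k + w l)
      - of_bool (k = l) * (2 * a * (of_bool (k = k) * u k + v k + w k)))"
      unfolding std_mat_entry[OF kl, symmetric] std_mat_entry[OF kl(1) kl(1), symmetric]
      by (rule hessian_mixI[OF kl sum_std_mat(1)[OF _ uvw(2,3)] sum_std_mat(2)[OF kl(2) uvw(2,3)] M s])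
    then show ?thesis
      unfolding std_mat_entry[OF kl]
      by (cases "k = l") (simp_all add: algebra_simps power2_eq_square power3_eq_cube)
  qed
qed

lemma hessian_mix_mix:
  fixes a b x y :: real and d :: nat
  defines "m \<equiv> a * y + b * (x + real d * y)"
  shows "hessian d (mix d a b) (mix d x y) = mix d
    (6 * (4 * a\<^sup>2 * gram_off d a b * x + 4 * a ^ 3 * (a * x + m) + (gram_gap d a b - 2 * b) * x - 2 * a * (x + y)))
    (6 * (4 * a * gram_off d a b * m + 4 * b * (gram_off d a b * (a * x + real d * m) + a\<^sup>2 * (a * x + m))
      + (gram_off d a b)\<^sup>2 * (x + real d * y) + (gram_gap d a b - 2 * b) * y))"
proof (intro ext)
  fix k l
  let ?U = "6 * (4 * a\<^sup>2 * gram_off d a b * x + 4 * a ^ 3 * (a * x + m) + (gram_gap d a b - 2 * b) * x - 2 * a * (x + y))"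
  let ?V = "6 * (4 * a * gram_off d a b * m + 4 * b * (gram_off d a b * (a * x + real d * m) + a\<^sup>2 * (a * x + m))
      + (gram_off d a b)\<^sup>2 * (x + real d * y) + (gram_gap d a b - 2 * b) * y)"
  show "hessian d (mix d a b) (mix d x y) k l = mix d ?U ?V k l"
  proof (cases "k \<in> {1..d} \<and> l \<in> {1..d}")
    case False
    then show ?thesis unfolding hessian_outside[OF False] by (simp add: mix_def)
  next
    case True
    then have kl: "k \<in> {1..d}" "l \<in> {1..d}" by blast+
    let ?M = "\<lambda>(i :: nat) (j :: nat). 2 * a * (of_bool (i = j) * x) + 2 * m"
    have s: "(\<Sum>j=1..d. ?M k j) = 2 * (a * x + real d * m)"
      using sum_of_bool_eq(2)[OF kl(1), of "\<lambda>_. x"]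
      by (simp only: sum.distrib sum_distrib_left[symmetric] finite_atLeastAtMost) simp
    have M: "?M i j = a * (mix d x y i j + mix d x y j i) + b * ((x + real d * y) + (x + real d * y))"
      if "i \<in> {1..d}" "j \<in> {1..d}" for i j
      unfolding mix_entry[OF that] mix_entry[OF that(2,1)] m_def
      by (cases "i = j") (simp_all add: algebra_simps)
    have "hessian d (mix d a b) (mix d x y) k l = 6 * (2 * a * gram_off d a b * ?M k l
      + of_bool (k = l) * (2 * a ^ 3 * ?M k k) + 2 * b * (gram_off d a b * (2 * (a * x + real d * m)) + a\<^sup>2 * ?M k k)
      + (gram_off d a b)\<^sup>2 * (x + real d * y) + (gram_gap d a b - 2 * b) * (x * of_bool (k = l) + y)
      - of_bool (k = l) * (2 * a * (x * of_bool (k = k) + y)))"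
      unfolding mix_entry[OF kl, symmetric] mix_entry[OF kl(1) kl(1), symmetric]
      by (rule hessian_mixI[OF kl sum_mix(1) sum_mix(2)[OF kl(2)] M s])
    then show ?thesis
      unfolding mix_entry[OF kl]
      by (cases "k = l") (simp_all add: algebra_simps power2_eq_square power3_eq_cube)
  qed
qed

text \<open>The two conditions on \<open>X\<close> cover three situations: antisymmetric
  \<open>X\<close> with \<open>c = 0\<close>, symmetric \<open>X\<close> with zero diagonal and
  \<open>c = a\<close>, and arbitrary \<open>X\<close> with \<open>a = c = 0\<close>. The last one
  serves the type \<open>type_ss\<close>.\<close>

lemma hessian_zero_sums:
  assumes X: "X \<in> zero_sums d" and aX: "\<And>i. a * X i i = 0" and sym: "\<And>i j. a * (X i j + X j i) = 2 * c * X i j"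
  shows "hessian d (mix d a b) X = (6 * (4 * a * gram_off d a b * c + (gram_gap d a b - 2 * b))) *\<^sub>R X"
proof (intro ext)
  fix k l
  have XM: "X \<in> Mat d d" and z: "(\<Sum>l=1..d. X k l) = 0" "(\<Sum>l=1..d. X l k) = 0" for k
    using X unfolding zero_sums_def by blast+
  show "hessian d (mix d a b) X k l = ((6 * (4 * a * gram_off d a b * c + (gram_gap d a b - 2 * b))) *\<^sub>R X) k l"
  proof (cases "k \<in> {1..d} \<and> l \<in> {1..d}")
    case False
    then have "X k l = 0" using XM unfolding Mat_def by blast
    then show ?thesis unfolding hessian_outside[OF False] by (simp add: scaleR_fun_def)
  next
    case True
    then have kl: "k \<in> {1..d}" "l \<in> {1..d}" by blast+
    let ?M = "\<lambda>i j. 2 * c * X i j"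
    have s: "(\<Sum>j=1..d. ?M k j) = 0"
      unfolding sum_distrib_left[symmetric] z by simp
    have M: "?M i j = a * (X i j + X j i) + b * (0 + 0)" for i j
      unfolding sym by simp
    have cX: "c * X k k = 0" using sym[of k k] aX[of k] by simp
    have "hessian d (mix d a b) X k l = 6 * (2 * a * gram_off d a b * (2 * c * X k l) + of_bool (k = l) * (4 * a ^ 3 * (c * X k k))
       + 2 * b * (gram_off d a b * 0 + 2 * a\<^sup>2 * (c * X k k)) + (gram_off d a b)\<^sup>2 * 0 + (gram_gap d a b - 2 * b) * X k l
       - of_bool (k = l) * (2 * (a * X k k)))"
      unfolding hessian_mixI[where M = ?M, OF kl z(1) z(2) M s] by (simp add: algebra_simps)
    then show ?thesis unfolding cX aX by (simp add: scaleR_fun_def algebra_simps)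
  qed
qed

lemma hessian_alt_space:
  assumes "X \<in> alt_space d"
  shows "hessian d (mix d a b) X = (6 * (gram_gap d a b - 2 * b)) *\<^sub>R X"
proof -
  have Z: "X \<in> zero_sums d" and alt: "X i j = - X j i" for i j using assms unfolding alt_space_def by blast+
  have "X i i = 0" for i using alt[of i i] by simp
  moreover have "a * (X i j + X j i) = 2 * 0 * X i j" for i j by (subst alt) simp
  ultimately show ?thesis using hessian_zero_sums[OF Z, of a 0 b] by simp
qed

lemma hessian_sym_space:
  assumes "X \<in> sym_space d"
  shows "hessian d (mix d a b) X = (6 * (4 * a\<^sup>2 * gram_off d a b + (gram_gap d a b - 2 * b))) *\<^sub>R X"
proof -
  have Z: "X \<in> zero_sums d" and sym: "X j i = X i j" and dia: "X i i = 0" for i j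
    using assms unfolding sym_space_def by blast+
  have "a * (X i j + X j i) = 2 * a * X i j" for i j by (subst sym) (simp add: algebra_simps)
  from hessian_zero_sums[OF Z _ this, of b] dia show ?thesis by (simp add: power2_eq_square mult_ac)
qed

section \<open>Eigenvalue equations on the types and the spectra for one block\<close>

definition triv_eigen :: "nat \<Rightarrow> real \<Rightarrow> real \<Rightarrow> real \<Rightarrow> real \<Rightarrow> real \<Rightarrow> bool" where
  "triv_eigen d a b \<mu> x y \<longleftrightarrow>
    (let q = gram_off d a b; m = a * y + b * (x + real d * y); \<kappa> = gram_gap d a b - 2 * b in
      4 * a\<^sup>2 * q * x + 4 * a ^ 3 * (a * x + m) + \<kappa> * x - 2 * a * (x + y) = \<mu> * x \<and>
      4 * a * q * m + 4 * b * (q * (a * x + real d * m) + a\<^sup>2 * (a * x + m)) + q\<^sup>2 * (x + real d * y) + \<kappa> * y = \<mu> * y)"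

text \<open>On type s the Hessian acts on the three copies of the standard representation through a
  matrix of size three. The equations say that \<open>(x, y, z)\<close> is an eigenvector of that
  matrix, with the common factor 6 removed from the eigenvalue; \<open>triv_eigen\<close> does the
  same for type t.\<close>

definition std_eigen :: "nat \<Rightarrow> real \<Rightarrow> real \<Rightarrow> real \<Rightarrow> real \<Rightarrow> real \<Rightarrow> real \<Rightarrow> bool" where
  "std_eigen d a b \<mu> x y z \<longleftrightarrow>
    (let q = gram_off d a b; m = a * (y + z) + b * (x + real d * y); \<kappa> = gram_gap d a b - 2 * b in
      4 * a\<^sup>2 * q * x + 4 * a ^ 3 * (a * x + m) + \<kappa> * x - 2 * a * (x + y + z) = \<mu> * x \<and>
      2 * a * q * m + 2 * b * (q * (2 * a * x + real d * m) + 2 * a\<^sup>2 * (a * x + m)) + \<kappa> * y = \<mu> * y \<and>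
      2 * a * q * m + q\<^sup>2 * (x + real d * z) + \<kappa> * z = \<mu> * z)"

lemma hessian_triv_eigen:
  assumes "triv_eigen d a b \<mu> x y"
  shows "hessian d (mix d a b) (mix d x y) = (6 * \<mu>) *\<^sub>R mix d x y"
  using assms unfolding triv_eigen_def Let_def
  by (simp only: hessian_mix_mix mix_scale mult.assoc)

lemma hessian_std_eigen:
  assumes eig: "std_eigen d a b \<mu> x y z" and u: "u \<in> std_rep d"
  shows "hessian d (mix d a b) (std_mat d (x *\<^sub>R u) (y *\<^sub>R u) (z *\<^sub>R u)) = (6 * \<mu>) *\<^sub>R std_mat d (x *\<^sub>R u) (y *\<^sub>R u) (z *\<^sub>R u)"
proof -
  note sc = subspace_scale[OF subspace_std_rep u]
  define q m \<kappa> where "q = gram_off d a b" and "m = a * (y + z) + b * (x + real d * y)" and "\<kappa> = gram_gap d a b - 2 * b"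
  have e: "4 * a\<^sup>2 * q * x + 4 * a ^ 3 * (a * x + m) + \<kappa> * x - 2 * a * (x + y + z) = \<mu> * x"
    "2 * a * q * m + 2 * b * (q * (2 * a * x + real d * m) + 2 * a\<^sup>2 * (a * x + m)) + \<kappa> * y = \<mu> * y"
    "2 * a * q * m + q\<^sup>2 * (x + real d * z) + \<kappa> * z = \<mu> * z"
    using eig unfolding std_eigen_def Let_def q_def m_def \<kappa>_def by blast+
  have mk: "a * (y * u k + z * u k) + b * (x * u k + real d * (y * u k)) = m * u k" for k
    by (simp add: m_def algebra_simps)
  have "hessian d (mix d a b) (std_mat d (x *\<^sub>R u) (y *\<^sub>R u) (z *\<^sub>R u)) = std_mat d
    (\<lambda>k. 6 * ((4 * a\<^sup>2 * q * x + 4 * a ^ 3 * (a * x + m) + \<kappa> * x - 2 * a * (x + y + z)) * u k))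
    (\<lambda>k. 6 * ((2 * a * q * m + 2 * b * (q * (2 * a * x + real d * m) + 2 * a\<^sup>2 * (a * x + m)) + \<kappa> * y) * u k))
    (\<lambda>k. 6 * ((2 * a * q * m + q\<^sup>2 * (x + real d * z) + \<kappa> * z) * u k))"
    by (subst hessian_std_mat[OF sc sc sc], rule arg_cong3[where f = "std_mat d"]; rule ext;
        simp only: scaleR_fun_def real_scaleR_def mk q_def[symmetric] \<kappa>_def[symmetric]; simp add: algebra_simps)
  also have "\<dots> = (6 * \<mu>) *\<^sub>R std_mat d (x *\<^sub>R u) (y *\<^sub>R u) (z *\<^sub>R u)"
    unfolding e std_mat_scale by (simp only: scaleR_fun_def real_scaleR_def mult.assoc)
  finally show ?thesis .
qed

definition indep3 :: "real \<times> real \<times> real \<Rightarrow> real \<times> real \<times> real \<Rightarrow> real \<times> real \<times> real \<Rightarrow> bool" where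
  "indep3 p1 p2 p3 \<longleftrightarrow> (\<forall>c1 c2 c3 :: real. c1 *\<^sub>R p1 + c2 *\<^sub>R p2 + c3 *\<^sub>R p3 = 0 \<longrightarrow> c1 = 0 \<and> c2 = 0 \<and> c3 = 0)"

text \<open>Independence is injectivity of a linear endomap of a space of dimension three, hence
  surjectivity.\<close>

lemma indep3_span:
  assumes "indep3 p1 p2 p3"
  shows "\<exists>c1 c2 c3. c1 *\<^sub>R p1 + c2 *\<^sub>R p2 + c3 *\<^sub>R p3 = p"
proof -
  define f where "f c = fst c *\<^sub>R p1 + fst (snd c) *\<^sub>R p2 + snd (snd c) *\<^sub>R p3" for c :: "real \<times> real \<times> real"
  have f: "linear f" by (rule linearI) (simp_all add: f_def algebra_simps)
  have "inj f"
    unfolding linear_injective_0[OF f]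
  proof (intro allI impI)
    fix c assume "f c = 0"
    then have "fst c = 0 \<and> fst (snd c) = 0 \<and> snd (snd c) = 0"
      using assms unfolding f_def indep3_def by blast
    then show "c = 0" by (simp add: prod_eq_iff)
  qed
  then have "surj f" using linear_injective_imp_surjective[OF f] by simp
  then obtain c where "f c = p" by (metis surjD)
  then show ?thesis unfolding f_def by blast
qed

text \<open>\<open>std_space\<close> is the tensor product of the standard representation with a
  space of dimension three. A basis of the latter splits it into three copies, and on the copy of
  each basis vector \<open>H\<close> is the given scalar.\<close>

lemma diagonal_on_std_space:
  assumes ind: "indep3 (x1, y1, z1) (x2, y2, z2) (x3, y3, z3)"
    and H: "\<And>u. u \<in> std_rep d \<Longrightarrow> H (std_mat d (x1 *\<^sub>R u) (y1 *\<^sub>R u) (z1 *\<^sub>R u)) = \<mu>1 *\<^sub>R std_mat d (x1 *\<^sub>R u) (y1 *\<^sub>R u) (z1 *\<^sub>R u)"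
      "\<And>u. u \<in> std_rep d \<Longrightarrow> H (std_mat d (x2 *\<^sub>R u) (y2 *\<^sub>R u) (z2 *\<^sub>R u)) = \<mu>2 *\<^sub>R std_mat d (x2 *\<^sub>R u) (y2 *\<^sub>R u) (z2 *\<^sub>R u)"
      "\<And>u. u \<in> std_rep d \<Longrightarrow> H (std_mat d (x3 *\<^sub>R u) (y3 *\<^sub>R u) (z3 *\<^sub>R u)) = \<mu>3 *\<^sub>R std_mat d (x3 *\<^sub>R u) (y3 *\<^sub>R u) (z3 *\<^sub>R u)"
    and d: "d \<ge> 3"
  shows "diagonal_on H (std_space d) (repeat_mset (d - 1) {#\<mu>1, \<mu>2, \<mu>3#})"
proof -
  define F where "F x y z u = std_mat d (x *\<^sub>R u) (y *\<^sub>R u) (z *\<^sub>R u)" for x y z u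
  have lin: "linear (F x y z)" for x y z
    by (rule linearI) (simp_all add: F_def std_mat_add std_mat_scale algebra_simps)
  have sc: "c *\<^sub>R u \<in> std_rep d" if "u \<in> std_rep d" for c u
    by (rule subspace_scale[OF subspace_std_rep that])
  have F3: "F x1 y1 z1 u1 + F x2 y2 z2 u2 + F x3 y3 z3 u3 =
    std_mat d (x1 *\<^sub>R u1 + x2 *\<^sub>R u2 + x3 *\<^sub>R u3) (y1 *\<^sub>R u1 + y2 *\<^sub>R u2 + y3 *\<^sub>R u3) (z1 *\<^sub>R u1 + z2 *\<^sub>R u2 + z3 *\<^sub>R u3)"
    for u1 u2 u3 by (simp only: F_def std_mat_add)
  have zero: "u1 = 0 \<and> u2 = 0 \<and> u3 = 0"
    if u: "u1 \<in> std_rep d" "u2 \<in> std_rep d" "u3 \<in> std_rep d" and 0: "F x1 y1 z1 u1 + F x2 y2 z2 u2 + F x3 y3 z3 u3 = 0" for u1 u2 u3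
  proof -
    let ?x = "x1 *\<^sub>R u1 + x2 *\<^sub>R u2 + x3 *\<^sub>R u3" and ?y = "y1 *\<^sub>R u1 + y2 *\<^sub>R u2 + y3 *\<^sub>R u3" and ?z = "z1 *\<^sub>R u1 + z2 *\<^sub>R u2 + z3 *\<^sub>R u3"
    have mem: "?x \<in> std_rep d" "?y \<in> std_rep d" "?z \<in> std_rep d"
      using u by (auto intro!: subspace_add[OF subspace_std_rep] sc)
    have "u1 k = 0 \<and> u2 k = 0 \<and> u3 k = 0" for k
    proof (cases "k \<in> {1..d}")
      case False
      then show ?thesis using u std_rep_outside by blast
    next
      case True
      define X Y Z where "X = ?x" and "Y = ?y" and "Z = ?z"
      have "std_mat d X Y Z = 0" using 0 unfolding F3 X_def Y_def Z_def .
      then have XYZ: "std_mat d X Y Z i j = 0" for i j by simp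
      have m: "X \<in> std_rep d" "Y \<in> std_rep d" "Z \<in> std_rep d" using mem by (simp_all only: X_def Y_def Z_def)
      \<comment> \<open>Diagonal, row sum and column sum recover the three vectors, as
        \<open>d\<close> is at least 3.\<close>
      have e: "X k + Y k + Z k = 0" "X k + real d * Y k = 0" "X k + real d * Z k = 0"
        using XYZ[of k k] std_mat_entry[OF True True, of X Y Z]
          sum_std_mat[OF True m(2,3), of X] by (simp_all add: XYZ)
      have "real d * (Y k - Z k) = (X k + real d * Y k) - (X k + real d * Z k)" by (simp add: algebra_simps)
      then have "real d * (Y k - Z k) = 0" by (simp only: e diff_self)
      then have YZ: "Y k = Z k" using d by simp
      have "(real d - 2) * Y k = (X k + real d * Y k) - (X k + Y k + Y k)" by (simp add: algebra_simps)
      then have "(real d - 2) * Y k = 0" using e YZ by simp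
      then have Y0: "Y k = 0" using d by simp
      then have "X k = 0" "Z k = 0" using e YZ by simp_all
      with Y0 have "u1 k *\<^sub>R (x1, y1, z1) + u2 k *\<^sub>R (x2, y2, z2) + u3 k *\<^sub>R (x3, y3, z3) = 0"
        by (simp add: X_def Y_def Z_def scaleR_fun_def zero_prod_def mult.commute)
      then show ?thesis using ind unfolding indep3_def by blast
    qed
    then show ?thesis by (auto intro!: ext)
  qed
  have diag: "diagonal_on H (F x y z ` std_rep d) (replicate_mset (d - 1) \<mu>)"
    if inj: "\<And>u. u \<in> std_rep d \<Longrightarrow> F x y z u = 0 \<Longrightarrow> u = 0" and H: "\<And>u. u \<in> std_rep d \<Longrightarrow> H (F x y z u) = \<mu> *\<^sub>R F x y z u" for x y z \<mu>
  proof -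
    have "inj_on (F x y z) (std_rep d)"
    proof (rule inj_onI)
      fix u v assume uv: "u \<in> std_rep d" "v \<in> std_rep d" "F x y z u = F x y z v"
      then have "F x y z (u - v) = 0" by (simp add: linear_diff[OF lin])
      then have "u - v = 0" using uv by (intro inj subspace_diff[OF subspace_std_rep])
      then show "u = v" by simp
    qed
    from diagonal_on_image[OF lin this std_rep_diagonal, of H \<mu>] H show ?thesis by simp
  qed
  have F0: "F x y z 0 = 0" for x y z by (rule linear_0[OF lin])
  have z: "0 \<in> std_rep d" by (rule subspace_0[OF subspace_std_rep])
  have d1: "diagonal_on H (F x1 y1 z1 ` std_rep d) (replicate_mset (d - 1) \<mu>1)"
    by (rule diag) (use zero[OF _ z z] H(1) in \<open>auto simp: F0 F_def[symmetric]\<close>)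
  have d2: "diagonal_on H (F x2 y2 z2 ` std_rep d) (replicate_mset (d - 1) \<mu>2)"
    by (rule diag) (use zero[OF z _ z] H(2) in \<open>auto simp: F0 F_def[symmetric]\<close>)
  have d3: "diagonal_on H (F x3 y3 z3 ` std_rep d) (replicate_mset (d - 1) \<mu>3)"
    by (rule diag) (use zero[OF z z] H(3) in \<open>auto simp: F0 F_def[symmetric]\<close>)
  have "diagonal_on H (std_space d) (replicate_mset (d - 1) \<mu>1 + replicate_mset (d - 1) \<mu>2 + replicate_mset (d - 1) \<mu>3 + {#})"
  proof (rule diagonal_on_sum4[OF d1 d2 d3 diagonal_on_zero])
    fix w1 w2 w3 w4 assume w: "w1 \<in> F x1 y1 z1 ` std_rep d" "w2 \<in> F x2 y2 z2 ` std_rep d" "w3 \<in> F x3 y3 z3 ` std_rep d"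
      "w4 \<in> {0}" "w1 + w2 + w3 + w4 = 0"
    then obtain u1 u2 u3 where u: "u1 \<in> std_rep d" "u2 \<in> std_rep d" "u3 \<in> std_rep d"
      "w1 = F x1 y1 z1 u1" "w2 = F x2 y2 z2 u2" "w3 = F x3 y3 z3 u3" by blast
    with zero[of u1 u2 u3] w have "u1 = 0 \<and> u2 = 0 \<and> u3 = 0" by simp
    then show "w1 = 0 \<and> w2 = 0 \<and> w3 = 0 \<and> w4 = 0" using u w F0 by simp
  next
    show "std_space d = {w1 + w2 + w3 + w4 | w1 w2 w3 w4. w1 \<in> F x1 y1 z1 ` std_rep d \<and> w2 \<in> F x2 y2 z2 ` std_rep d
      \<and> w3 \<in> F x3 y3 z3 ` std_rep d \<and> w4 \<in> {0}}" (is "_ = ?W")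
    proof (intro equalityI subsetI)
      fix A assume "A \<in> ?W"
      then obtain u1 u2 u3 where u: "u1 \<in> std_rep d" "u2 \<in> std_rep d" "u3 \<in> std_rep d"
        and A: "A = F x1 y1 z1 u1 + F x2 y2 z2 u2 + F x3 y3 z3 u3" by auto
      show "A \<in> std_space d"
      proof -
        have "x1 *\<^sub>R u1 + x2 *\<^sub>R u2 + x3 *\<^sub>R u3 \<in> std_rep d" "y1 *\<^sub>R u1 + y2 *\<^sub>R u2 + y3 *\<^sub>R u3 \<in> std_rep d"
          "z1 *\<^sub>R u1 + z2 *\<^sub>R u2 + z3 *\<^sub>R u3 \<in> std_rep d"
          using u by (simp_all only: subspace_add[OF subspace_std_rep] sc)
        then show ?thesis unfolding A F3 std_space_def by blast
      qed
    next
      fix A assume "A \<in> std_space d"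
      then obtain u v w where A: "A = std_mat d u v w" and uvw: "u \<in> std_rep d" "v \<in> std_rep d" "w \<in> std_rep d"
        unfolding std_space_def by blast
      \<comment> \<open>Coordinates with respect to the three vectors are taken separately at every
        index \<open>k\<close>.\<close>
      have "\<forall>k. \<exists>c. fst c *\<^sub>R (x1, y1, z1) + fst (snd c) *\<^sub>R (x2, y2, z2) + snd (snd c) *\<^sub>R (x3, y3, z3) = (u k, v k, w k)"
        using indep3_span[OF ind] by (metis fst_conv snd_conv)
      then obtain c where c: "fst (c k) *\<^sub>R (x1, y1, z1) + fst (snd (c k)) *\<^sub>R (x2, y2, z2) + snd (snd (c k)) *\<^sub>R (x3, y3, z3) = (u k, v k, w k)" for k
        by metis
      define u1 u2 u3 where "u1 k = fst (c k)" and "u2 k = fst (snd (c k))" and "u3 k = snd (snd (c k))" for k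
      have ck: "u1 k *\<^sub>R (x1, y1, z1) + u2 k *\<^sub>R (x2, y2, z2) + u3 k *\<^sub>R (x3, y3, z3) = (u k, v k, w k)" for k
        using c by (simp only: u1_def u2_def u3_def)
      have out: "u1 k = 0 \<and> u2 k = 0 \<and> u3 k = 0" if "k \<notin> {1..d}" for k
      proof -
        have "(u k, v k, w k) = 0" using that uvw std_rep_outside by (simp add: zero_prod_def del: atLeastAtMost_iff)
        then show ?thesis using ck[of k] ind unfolding indep3_def by metis
      qed
      \<comment> \<open>The coordinate vectors lie in the standard representation: their sums are
        the coefficients of a vanishing combination of independent vectors.\<close>
      have "(\<Sum>k=1..d. u1 k) *\<^sub>R (x1, y1, z1) + (\<Sum>k=1..d. u2 k) *\<^sub>R (x2, y2, z2) + (\<Sum>k=1..d. u3 k) *\<^sub>R (x3, y3, z3)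
        = (\<Sum>k=1..d. u1 k *\<^sub>R (x1, y1, z1) + u2 k *\<^sub>R (x2, y2, z2) + u3 k *\<^sub>R (x3, y3, z3))"
        by (simp only: scaleR_left.sum sum.distrib)
      also have "\<dots> = (\<Sum>k=1..d. (u k, v k, w k))" by (simp only: ck)
      also have "\<dots> = 0"
        by (simp add: prod_eq_iff fst_sum snd_sum std_rep_sum[OF uvw(1)] std_rep_sum[OF uvw(2)] std_rep_sum[OF uvw(3)] del: One_nat_def)
      finally have "(\<Sum>k=1..d. u1 k) = 0 \<and> (\<Sum>k=1..d. u2 k) = 0 \<and> (\<Sum>k=1..d. u3 k) = 0"
        using ind unfolding indep3_def by blast
      then have mem: "u1 \<in> std_rep d" "u2 \<in> std_rep d" "u3 \<in> std_rep d"
        using out by (auto intro!: std_repI simp del: atLeastAtMost_iff)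
      have "A = F x1 y1 z1 u1 + F x2 y2 z2 u2 + F x3 y3 z3 u3 + 0"
        unfolding A F3 add_0_right
        by (rule arg_cong3[where f = "std_mat d"]; rule ext) (use ck in \<open>simp_all add: scaleR_fun_def mult.commute\<close>)
      then show "A \<in> ?W" using mem by blast
    qed
  qed
  moreover have "replicate_mset (d - 1) \<mu>1 + replicate_mset (d - 1) \<mu>2 + replicate_mset (d - 1) \<mu>3 + {#} = repeat_mset (d - 1) {#\<mu>1, \<mu>2, \<mu>3#}"
    by (rule multiset_eqI) simp
  ultimately show ?thesis by (simp only:)
qed

text \<open>For \<open>d\<close> at least 2 the parameters of \<open>mix\<close> are unique, so the
  space is a plane and two eigenvectors with nonzero determinant span it; the coefficients come from
  Cramer's rule.\<close>

lemma diagonal_on_triv_space: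
  assumes det: "x1 * y2 \<noteq> x2 * y1" and d: "d \<ge> 2"
    and H: "H (mix d x1 y1) = \<mu>1 *\<^sub>R mix d x1 y1" "H (mix d x2 y2) = \<mu>2 *\<^sub>R mix d x2 y2" and lin: "linear H"
  shows "diagonal_on H (triv_space d) {#\<mu>1, \<mu>2#}"
proof -
  have mix0: "x = 0 \<and> y = 0" if "mix d x y = 0" for x y
  proof -
    have "mix d x y 1 1 = 0" "mix d x y 1 2 = 0" using that by simp_all
    then show ?thesis using d by (simp add: mix_def)
  qed
  have diag: "diagonal_on H (range (\<lambda>c. c *\<^sub>R mix d x y)) {#\<mu>#}"
    if "mix d x y \<noteq> 0" "H (mix d x y) = \<mu> *\<^sub>R mix d x y" for x y \<mu>
    unfolding diagonal_on_def using that
    by (intro exI[of _ "{mix d x y}"] exI[of _ "\<lambda>_. \<mu>"]) (auto simp: span_singleton)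
  have ne: "mix d x1 y1 \<noteq> 0" "mix d x2 y2 \<noteq> 0" using mix0 det by fastforce+
  note D = diagonal_on_sum[OF diag[OF ne(1) H(1)] diag[OF ne(2) H(2)]]
  have "diagonal_on H (triv_space d) ({#\<mu>1#} + {#\<mu>2#})"
  proof (rule D)
    show "range (\<lambda>c. c *\<^sub>R mix d x1 y1) \<inter> range (\<lambda>c. c *\<^sub>R mix d x2 y2) \<subseteq> {0}"
    proof
      fix A assume "A \<in> range (\<lambda>c. c *\<^sub>R mix d x1 y1) \<inter> range (\<lambda>c. c *\<^sub>R mix d x2 y2)"
      then obtain c e where A: "A = c *\<^sub>R mix d x1 y1" "A = e *\<^sub>R mix d x2 y2" by blast
      then have "mix d (c * x1 + (- e) * x2) (c * y1 + (- e) * y2) = 0"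
        unfolding mix_add[symmetric] mix_scale[symmetric] by simp
      then have eq: "c * x1 = e * x2" "c * y1 = e * y2" using mix0 by fastforce+
      have "c * (x1 * y2 - x2 * y1) = (c * x1) * y2 - x2 * (c * y1)" by (simp add: algebra_simps)
      also have "\<dots> = 0" unfolding eq by simp
      finally have "c = 0" using det by simp
      then show "A \<in> {0}" using A by simp
    qed
    show "triv_space d = {u + v | u v. u \<in> range (\<lambda>c. c *\<^sub>R mix d x1 y1) \<and> v \<in> range (\<lambda>c. c *\<^sub>R mix d x2 y2)}" (is "_ = ?W")
    proof (intro equalityI subsetI)
      fix A assume "A \<in> ?W"
      then obtain c e where "A = c *\<^sub>R mix d x1 y1 + e *\<^sub>R mix d x2 y2" by blast
      then show "A \<in> triv_space d" unfolding triv_space_def mix_scale mix_add by blast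
    next
      fix A assume "A \<in> triv_space d"
      then obtain x y where A: "A = mix d x y" unfolding triv_space_def by blast
      define D where "D = x1 * y2 - x2 * y1"
      have D: "D \<noteq> 0" using det by (simp add: D_def)
      have "(x * y2 - x2 * y) * x1 + (x1 * y - x * y1) * x2 = x * D" "(x * y2 - x2 * y) * y1 + (x1 * y - x * y1) * y2 = y * D"
        by (simp_all add: D_def algebra_simps)
      then have e: "x = (x * y2 - x2 * y) / D * x1 + (x1 * y - x * y1) / D * x2"
        "y = (x * y2 - x2 * y) / D * y1 + (x1 * y - x * y1) / D * y2"
        using D by (simp_all add: eq_divide_eq add_divide_distrib[symmetric])
      have "A = ((x * y2 - x2 * y) / D) *\<^sub>R mix d x1 y1 + ((x1 * y - x * y1) / D) *\<^sub>R mix d x2 y2"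
        unfolding A mix_scale mix_add by (rule arg_cong2[where f = "mix d", OF e])
      then show "A \<in> ?W" by blast
    qed
  qed
  then show ?thesis by (simp add: add_mset_commute)
qed

text \<open>An antisymmetric matrix with zero sums is determined by its entries at
  \<open>i < j < d\<close>, and the matrices \<open>cyc i j d\<close> form the basis dual to these
  entries.\<close>

lemma dim_alt_space: "dim (alt_space d) = (d - 1) * (d - 2) div 2"
proof (cases "d = 0")
  case True
  have "A = 0" if "A \<in> alt_space 0" for A
  proof -
    have "A \<in> Mat 0 0" using that zero_sums_subset_Mat(2) by blast
    then have "A i j = 0" for i j by (simp add: Mat_def)
    then show ?thesis by (intro ext) simp
  qed
  then have "alt_space 0 = {0}" using subspace_0[OF subspace_alt_space, of 0] by blast
  moreover have "dim ({0} :: matr set) = 0"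
    using diagonal_on_dim[OF diagonal_on_zero] by simp
  ultimately show ?thesis using True by simp
next
  case False
  \<comment> \<open>Pairs are stored with the larger index first, so the row index is
    \<open>snd p\<close>.\<close>
  let ?I = "SIGMA j:{1..d - 1}. {1..<j}"
  have fin: "finite ?I" by auto
  have "diagonal_on (\<lambda>v. v) (alt_space d) (image_mset (\<lambda>_. 1) (mset_set ?I))"
  proof (rule diagonal_on_coords[where c = "\<lambda>p A. A (snd p) (fst p)" and e = "\<lambda>p. cyc (snd p) (fst p) d"])
    show "linear (\<lambda>A. A (snd p) (fst p) :: real)" for p :: "nat \<times> nat" by (rule linear_entry)
    have delta: "cyc (snd p') (fst p') d (snd p) (fst p) = of_bool (p = p')" if "p \<in> ?I" "p' \<in> ?I" for p p'
    proof -
      have lt: "1 \<le> snd p" "snd p < fst p" "fst p < d" "snd p' < fst p'"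
        using that by auto
      then have n: "fst p \<noteq> d" "snd p \<noteq> d" "\<not> (snd p = fst p' \<and> fst p = snd p')" by linarith+
      have "cyc (snd p') (fst p') d (snd p) (fst p) = of_bool (snd p = snd p' \<and> fst p = fst p')"
        unfolding cyc_apply by (simp only: n simp_thms of_bool_eq)
      also have "(snd p = snd p' \<and> fst p = fst p') \<longleftrightarrow> p = p'" unfolding prod_eq_iff by blast
      finally show ?thesis .
    qed
    show "cyc (snd p') (fst p') d (snd p) (fst p) = of_bool (p = p')" if "p \<in> ?I" "p' \<in> ?I" for p p'
      by (rule delta[OF that])
    have mem: "cyc (snd p) (fst p) d \<in> alt_space d" if "p \<in> ?I" for p
      unfolding ext_square_rep_eq[symmetric] using that False by (intro cyc_in_ext) auto
    show "cyc (snd p) (fst p) d \<in> alt_space d" if "p \<in> ?I" for p by (rule mem[OF that])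
    fix A assume A: "A \<in> alt_space d"
    \<comment> \<open>The remainder vanishes at \<open>i < j < d\<close>, hence by antisymmetry
      wherever both indices are below \<open>d\<close>; zero row sums then clear the last column and
      antisymmetry the last row.\<close>
    define B where "B = A - (\<Sum>p\<in>?I. A (snd p) (fst p) *\<^sub>R cyc (snd p) (fst p) d)"
    have B: "B \<in> alt_space d"
      unfolding B_def by (intro subspace_diff[OF subspace_alt_space A] subspace_sum[OF subspace_alt_space]
          subspace_scale[OF subspace_alt_space] mem)
    have BM: "B \<in> Mat d d" and rows: "(\<Sum>l=1..d. B k l) = 0" and alt: "B j i = - B i j" for i j k
      using B unfolding alt_space_def zero_sums_def by blast+
    have out: "B i j = 0" if "i \<notin> {1..d} \<or> j \<notin> {1..d}" for i j using BM that unfolding Mat_def by blast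
    have lt: "B i j = 0" if ij: "i \<in> {1..d}" "i < j" "j < d" for i j
    proof -
      have "(j, i) \<in> ?I" using ij by auto
      then have "(\<Sum>p\<in>?I. A (snd p) (fst p) * cyc (snd p) (fst p) d i j) = (\<Sum>p\<in>?I. if p = (j, i) then A i j else 0)"
        using delta[of "(j, i)"] by (intro sum.cong refl) (auto simp del: mem_Sigma_iff)
      also have "\<dots> = A i j" using \<open>(j, i) \<in> ?I\<close> fin by (simp del: mem_Sigma_iff)
      finally show ?thesis unfolding B_def fun_diff_def sum_fun_apply2 scaleR_fun_def real_scaleR_def by simp
    qed
    have ii: "B i i = 0" for i using alt[of i i] by simp
    have small: "B i j = 0" if "i \<in> {1..d}" "j \<in> {1..d}" "i \<noteq> d" "j \<noteq> d" for i j
      using that lt[of i j] lt[of j i] alt[of i j] ii[of i] by (cases i j rule: linorder_cases) auto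
    have last: "B i d = 0" if i: "i \<in> {1..d}" for i
    proof (cases "i = d")
      case False
      have "(\<Sum>l=1..d. B i l) = (\<Sum>l=1..d. if l = d then B i d else 0)"
        using small[OF i _ False] by (intro sum.cong refl) auto
      then show ?thesis using rows[of i] \<open>d \<noteq> 0\<close> by simp
    qed (simp add: ii)
    have last': "B i d = 0" for i using last[of i] out[of i d] by blast
    have "B d j = 0" for j using alt[where i = j and j = d] last'[of j] by simp
    then have "B i j = 0" for i j using last' small[of i j] out[of i j] by metis
    then have "B = 0" by (intro ext) simp
    then show "A = (\<Sum>p\<in>?I. A (snd p) (fst p) *\<^sub>R cyc (snd p) (fst p) d)" by (simp add: B_def)
  qed (use fin subspace_alt_space in simp_all)
  from diagonal_on_dim[OF this] have "dim (alt_space d) = card ?I" by simp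
  also have "\<dots> = (\<Sum>j=1..d - 1. j - 1)" by simp
  also have "\<dots> = (\<Sum>j<d - 1. j)" by (rule sum.reindex_bij_witness[of _ Suc "\<lambda>j. j - 1"]) auto
  also have "\<dots> = (d - 1) * (d - 2) div 2"
    by (simp add: Sum_Ico_nat lessThan_atLeast0 numeral_2_eq_2)
  finally show ?thesis .
qed

lemma indep3_unit: "indep3 (1, 0, 0) (0, 1, 0) (0, 0, 1)"
  by (auto simp: indep3_def zero_prod_def)

text \<open>Found by complement: the dimensions of the four types add up to \<open>d * d\<close>,
  and the other three are known.\<close>

lemma dim_types:
  assumes d: "d \<ge> 3"
  shows "dim (sym_space d) = d * (d - 3) div 2"
proof -
  let ?id = "\<lambda>v :: matr. v"
  have id: "linear ?id" by (rule linearI) simp_all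
  have dM: "diagonal_on ?id V (replicate_mset (dim V) 1)" if "subspace V" "V \<subseteq> Mat d d" for V
    using that by (intro diagonal_on_const_Supp[of "{1..d}" "{1..d}"]) (auto simp: Mat_eq_Supp)
  have "diagonal_on ?id (triv_space d) {#1, 1#}"
    by (rule diagonal_on_triv_space[of 1 1 0 0, OF _ _ _ _ id]) (use d in auto)
  moreover have "diagonal_on ?id (std_space d) (repeat_mset (d - 1) {#1, 1, 1#})"
    by (rule diagonal_on_std_space[OF indep3_unit _ _ _ d]) simp_all
  ultimately have "diagonal_on ?id (Mat d d) ({#1, 1#} + repeat_mset (d - 1) {#1, 1, 1#}
      + replicate_mset (dim (alt_space d)) 1 + replicate_mset (dim (sym_space d)) 1)"
    by (rule diagonal_on_sum4[OF _ _ dM[OF subspace_alt_space zero_sums_subset_Mat(2)]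
        dM[OF subspace_sym_space zero_sums_subset_Mat(3)] diag_types_independent[OF d] diag_types_cover[OF d]])
  from diagonal_on_dim[OF this] have "d * d = 2 + (d - 1) * 3 + (d - 1) * (d - 2) div 2 + dim (sym_space d)"
    by (simp add: Mat_eq_Supp dim_Supp dim_alt_space)
  \<comment> \<open>The substitution removes the truncated subtractions; evenness of the two
    products then removes the halving.\<close>
  moreover obtain k where k: "d = k + 3" using d by (metis le_add_diff_inverse2)
  have "even ((k + 2) * (k + 1))" "even ((k + 3) * k)" by auto
  then obtain s t where st: "(k + 2) * (k + 1) = 2 * s" "(k + 3) * k = 2 * t" by (metis evenE)
  have "(d - 1) * (d - 2) div 2 = s" "d * (d - 3) div 2 = t" "(d - 1) * 3 = 3 * k + 6" "d * d = k * k + 6 * k + 9"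
    using st by (simp_all add: k algebra_simps)
  ultimately show ?thesis using st by (simp add: algebra_simps)
qed

text \<open>Types x and y occur once, so their eigenvalues are explicit. Those of types t and s come
  from eigenvalue problems of size two and three and enter as the parameters \<open>T\<close> and
  \<open>U\<close>.\<close>

definition mix_spectrum :: "nat \<Rightarrow> real \<Rightarrow> real \<Rightarrow> real multiset \<Rightarrow> real multiset \<Rightarrow> (matr set \<times> real multiset) list" where
  "mix_spectrum d a b T U = [(type_t d, T), (type_s d, repeat_mset (d - 1) U),
    (type_x d, replicate_mset ((d - 1) * (d - 2) div 2) (6 * (gram_gap d a b - 2 * b))),
    (type_y d, replicate_mset (d * (d - 3) div 2) (6 * (4 * a\<^sup>2 * gram_off d a b + (gram_gap d a b - 2 * b))))]"

text \<open>The first conclusion is the spectrum by type, the second an eigenbasis that can be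
  reused when the matrix is a block of a larger one.\<close>

lemma mix_spectrum:
  assumes d: "d \<ge> 3"
    and triv: "triv_eigen d a b \<tau>1 u1 v1" "triv_eigen d a b \<tau>2 u2 v2" "u1 * v2 \<noteq> u2 * v1"
    and std: "std_eigen d a b \<mu>1 x1 y1 z1" "std_eigen d a b \<mu>2 x2 y2 z2" "std_eigen d a b \<mu>3 x3 y3 z3"
      "indep3 (x1, y1, z1) (x2, y2, z2) (x3, y3, z3)"
  shows "has_spectrum_by_type (hessian d (mix d a b)) (Mat d d) (mix_spectrum d a b {#6 * \<tau>1, 6 * \<tau>2#} {#6 * \<mu>1, 6 * \<mu>2, 6 * \<mu>3#})"
    and "diagonal_on (hessian d (mix d a b)) (Mat d d)
      (sum_list (map snd (mix_spectrum d a b {#6 * \<tau>1, 6 * \<tau>2#} {#6 * \<mu>1, 6 * \<mu>2, 6 * \<mu>3#})))"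
proof -
  let ?H = "hessian d (mix d a b)"
  have dt: "diagonal_on ?H (triv_space d) {#6 * \<tau>1, 6 * \<tau>2#}"
    by (rule diagonal_on_triv_space[OF triv(3) _ hessian_triv_eigen[OF triv(1)] hessian_triv_eigen[OF triv(2)] linear_hessian])
      (use d in simp)
  have ds: "diagonal_on ?H (std_space d) (repeat_mset (d - 1) {#6 * \<mu>1, 6 * \<mu>2, 6 * \<mu>3#})"
    by (rule diagonal_on_std_space[OF std(4) hessian_std_eigen[OF std(1)] hessian_std_eigen[OF std(2)] hessian_std_eigen[OF std(3)] d])
  have dx: "diagonal_on ?H (alt_space d) (replicate_mset ((d - 1) * (d - 2) div 2) (6 * (gram_gap d a b - 2 * b)))"
    unfolding dim_alt_space[symmetric]
    by (rule diagonal_on_const_Supp[of "{1..d}" "{1..d}"])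
      (use zero_sums_subset_Mat(2) in \<open>simp_all only: hessian_alt_space subspace_alt_space Mat_eq_Supp finite_atLeastAtMost\<close>)
  have dy: "diagonal_on ?H (sym_space d) (replicate_mset (d * (d - 3) div 2) (6 * (4 * a\<^sup>2 * gram_off d a b + (gram_gap d a b - 2 * b))))"
    unfolding dim_types[OF d, symmetric]
    by (rule diagonal_on_const_Supp[of "{1..d}" "{1..d}"])
      (use zero_sums_subset_Mat(3) in \<open>simp_all only: hessian_sym_space subspace_sym_space Mat_eq_Supp finite_atLeastAtMost\<close>)
  have d1: "d \<ge> 1" using d by simp
  note dM = diagonal_on_sum4[OF dt ds dx dy diag_types_independent[OF d] diag_types_cover[OF d]]
  then show dM': "diagonal_on ?H (Mat d d) (sum_list (map snd (mix_spectrum d a b {#6 * \<tau>1, 6 * \<tau>2#} {#6 * \<mu>1, 6 * \<mu>2, 6 * \<mu>3#})))"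
    unfolding mix_spectrum_def
    by (simp only: list.map snd_conv sum_list.Cons sum_list.Nil add_0_right add.assoc)
  note sp = diagonal_on_has_spectrum[OF linear_hessian]
  show "has_spectrum_by_type ?H (Mat d d) (mix_spectrum d a b {#6 * \<tau>1, 6 * \<tau>2#} {#6 * \<mu>1, 6 * \<mu>2, 6 * \<mu>3#})"
    unfolding has_spectrum_by_type_def
  proof
    show "\<forall>(U, S)\<in>set (mix_spectrum d a b {#6 * \<tau>1, 6 * \<tau>2#} {#6 * \<mu>1, 6 * \<mu>2, 6 * \<mu>3#}). has_spectrum ?H U S"
      unfolding mix_spectrum_def type_t_eq[OF d1] type_s_eq[OF d] type_x_eq[OF d1] type_y_eq[OF d]
      using sp[OF dt] sp[OF ds] sp[OF dx] sp[OF dy]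
      by (simp only: list.set ball_simps prod.case simp_thms)
  qed (rule sp[OF dM'])
qed

text \<open>With \<open>a = 0\<close> and \<open>b = 1 / d\<close> the Gram matrix is constant with
  entry \<open>1 / d\<close>, so the eigenvalues are exact. The case \<open>d = 2\<close> provides
  the eigenvalues 9, 0, -3, -6 of the small block of \<open>C_4\<close>.\<close>

lemma prod_type_spectrum:
  assumes d: "d \<ge> 1"
  defines "S \<equiv> [(type_tt d, {#18 / real d#}), (type_st d, replicate_mset (d - 1) 0),
     (type_ts d, replicate_mset (d - 1) (- 6 / real d)), (type_ss d, replicate_mset ((d - 1)\<^sup>2) (- 12 / real d))]"
  shows "has_spectrum_by_type (hessian d (mix d 0 (1 / real d))) (Mat d d) S"
    and "diagonal_on (hessian d (mix d 0 (1 / real d))) (Mat d d) (sum_list (map snd S))"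
proof -
  let ?H = "hessian d (mix d 0 (1 / real d))"
  have q: "gram_off d 0 (1 / real d) = 1 / real d" "gram_gap d 0 (1 / real d) = 0"
    using d by (simp_all add: gram_off_def gram_gap_def power2_eq_square)
  have z: "0 \<in> std_rep d" by (rule subspace_0[OF subspace_std_rep])
  have H_const: "?H (mix d 0 c) = (18 / real d) *\<^sub>R mix d 0 c" for c
    unfolding hessian_mix_mix mix_scale q using d
    by (intro arg_cong2[where f = "mix d"]) (simp_all add: field_simps power2_eq_square)
  have H_row: "?H (std_mat d 0 u 0) = 0 *\<^sub>R std_mat d 0 u 0" if "u \<in> std_rep d" for u
    unfolding hessian_std_mat[OF z that z] std_mat_scale q using d
    by (intro arg_cong3[where f = "std_mat d"]; intro ext; simp add: field_simps power2_eq_square)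
  have H_col: "?H (std_mat d 0 0 u) = (- 6 / real d) *\<^sub>R std_mat d 0 0 u" if "u \<in> std_rep d" for u
    unfolding hessian_std_mat[OF z z that] std_mat_scale q using d
    by (intro arg_cong3[where f = "std_mat d"]; intro ext; simp add: field_simps power2_eq_square scaleR_fun_def)
  have H_zero: "?H X = (- 12 / real d) *\<^sub>R X" if "X \<in> zero_sums d" for X
    using hessian_zero_sums[OF that, of 0 0 "1 / real d"] by (simp add: q)
  have "mix d 0 1 1 1 \<noteq> 0" using d by (simp add: mix_def)
  then have ne: "mix d 0 1 \<noteq> 0" by auto
  have "const_space d = span {mix d 0 1}"
    unfolding const_space_def span_singleton by (auto simp: mix_scale)
  then have dtt: "diagonal_on ?H (const_space d) {#18 / real d#}"
    unfolding diagonal_on_def using ne H_const[of 1]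
    by (intro exI[of _ "{mix d 0 1}"] exI[of _ "\<lambda>_. 18 / real d"]) simp
  have dst: "diagonal_on ?H (row_space d) (replicate_mset (d - 1) 0)"
    using diagonal_on_image[OF linear_std_mat(2) inj_std_mat(2) std_rep_diagonal, of d ?H 0] H_row
    unfolding row_space_def by simp
  have dts: "diagonal_on ?H (col_space d) (replicate_mset (d - 1) (- 6 / real d))"
    using diagonal_on_image[OF linear_std_mat(3) inj_std_mat(3) std_rep_diagonal, of d ?H "- 6 / real d"] H_col
    unfolding col_space_def by simp
  have dss: "diagonal_on ?H (zero_sums d) (replicate_mset (dim (zero_sums d)) (- 12 / real d))"
    by (rule diagonal_on_const_Supp[of "{1..d}" "{1..d}"])
      (use zero_sums_subset_Mat(1) in \<open>simp_all only: H_zero subspace_zero_sums Mat_eq_Supp finite_atLeastAtMost\<close>)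
  note dM = diagonal_on_sum4[OF dtt dst dts dss prod_types_independent[OF d] prod_types_cover[OF d]]
  \<comment> \<open>The multiplicity of the last type is again found by counting the
    complement.\<close>
  have "dim (Mat d d) = 1 + (d - 1) + (d - 1) + dim (zero_sums d)"
    using diagonal_on_dim[OF dM] by (simp only: size_union size_replicate_mset size_single)
  moreover have "dim (Mat d d) = d * d" unfolding Mat_eq_Supp by (simp add: dim_Supp)
  moreover obtain k where k: "d = Suc k" using d by (cases d) auto
  moreover have "d * d = k * k + 2 * k + 1" by (simp add: k)
  ultimately have "dim (zero_sums d) = k * k" by linarith
  then have dim: "dim (zero_sums d) = (d - 1)\<^sup>2" by (simp add: k power2_eq_square)
  note dss = dss[unfolded dim]
  from dM show dM': "diagonal_on ?H (Mat d d) (sum_list (map snd S))"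
    unfolding S_def dim by (simp only: list.map snd_conv sum_list.Cons sum_list.Nil add_0_right add.assoc)
  note sp = diagonal_on_has_spectrum[OF linear_hessian]
  show "has_spectrum_by_type ?H (Mat d d) S"
    unfolding has_spectrum_by_type_def
  proof
    show "\<forall>(U, M)\<in>set S. has_spectrum ?H U M"
      unfolding S_def type_tt_eq[OF d] type_st_eq[OF d] type_ts_eq[OF d] type_ss_eq[OF d]
      using sp[OF dtt] sp[OF dst] sp[OF dts] sp[OF dss]
      by (simp only: list.set ball_simps prod.case simp_thms)
  qed (rule sp[OF dM'])
qed

lemma hessian_id_unit:
  assumes "i \<in> {1..n}" "j \<in> {1..n}"
  shows "hessian n (mix n 1 0) (unit_mat i j) = (if i = j then 18 else 6) *\<^sub>R unit_mat i j"
proof (intro ext)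
  fix k l
  have q: "gram_off n 1 0 = 0" "gram_gap n 1 0 = 1" by (simp_all add: gram_off_def gram_gap_def)
  show "hessian n (mix n 1 0) (unit_mat i j) k l = ((if i = j then 18 else 6) *\<^sub>R unit_mat i j) k l"
  proof (cases "k \<in> {1..n} \<and> l \<in> {1..n}")
    case False
    then show ?thesis unfolding hessian_outside[OF False] using assms by (auto simp: unit_mat_def scaleR_fun_def)
  next
    case True
    show ?thesis
      unfolding hessian_mix[OF conjunct1[OF True] conjunct2[OF True]] q
      by (cases "i = j"; cases "k = l"; simp add: unit_mat_def scaleR_fun_def; blast?)
  qed
qed

lemma image_mset_if_eq:
  fixes x y :: real
  shows "image_mset (\<lambda>p. if fst p = snd p then x else y) (mset_set ({1..n} \<times> {1..n}))
    = replicate_mset n x + replicate_mset (n * n - n) y"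
proof -
  let ?D = "(\<lambda>i. (i, i)) ` {1..n}"
  have D: "?D \<subseteq> {1..n} \<times> {1..n}" "finite ?D" by auto
  have "card ?D = n" by (subst card_image) (auto simp: inj_on_def)
  then have cards: "card ?D = n" "card ({1..n} \<times> {1..n} - ?D) = n * n - n"
    using D by (simp_all add: card_Diff_subset card_cartesian_product)
  have "mset_set (?D \<union> ({1..n} \<times> {1..n} - ?D)) = mset_set ?D + mset_set ({1..n} \<times> {1..n} - ?D)"
    by (rule mset_set_Union) (use D(2) in \<open>simp_all add: Int_Diff\<close>)
  moreover have "?D \<union> ({1..n} \<times> {1..n} - ?D) = {1..n} \<times> {1..n}" using D(1) by blast
  ultimately have "mset_set ({1..n} \<times> {1..n}) = mset_set ?D + mset_set ({1..n} \<times> {1..n} - ?D)"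
    by (simp only:)
  moreover have "image_mset (\<lambda>p. if fst p = snd p then x else y) (mset_set ?D) = image_mset (\<lambda>_. x) (mset_set ?D)"
    by (intro image_mset_cong) auto
  moreover have "image_mset (\<lambda>p. if fst p = snd p then x else y) (mset_set ({1..n} \<times> {1..n} - ?D))
    = image_mset (\<lambda>_. y) (mset_set ({1..n} \<times> {1..n} - ?D))"
    by (intro image_mset_cong) auto
  ultimately show ?thesis by (simp only: image_mset_union image_mset_const_eq size_mset_set cards)
qed

lemma diagonal_on_id: "diagonal_on (hessian n (mix n 1 0)) (Mat n n) (replicate_mset n 18 + replicate_mset (n * n - n) 6)"
  using diagonal_on_Supp[of "{1..n}" "{1..n}" "hessian n (mix n 1 0)" "\<lambda>i j. if i = j then 18 else 6"] hessian_id_unit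
  by (simp only: Mat_eq_Supp image_mset_if_eq finite_atLeastAtMost)

lemma diagonal_on_zero_mat: "diagonal_on (hessian d (mix d 0 0)) (Mat d d) (replicate_mset (d * d) 0)"
proof -
  have "hessian d (mix d 0 0) X k l = 0" for X k l
    unfolding mix_zero
    by (cases "k \<in> {1..d} \<and> l \<in> {1..d}") (simp_all add: hessian_formula hessian_outside gram_def del: atLeastAtMost_iff)
  then have "hessian d (mix d 0 0) X = 0 *\<^sub>R X" for X
    by (intro ext) simp
  then have "diagonal_on (hessian d (mix d 0 0)) (Mat d d) (replicate_mset (dim (Mat d d)) 0)"
    unfolding Mat_eq_Supp
    by (intro diagonal_on_const_Supp[of "{1..d}" "{1..d}"] subspace_Supp) auto
  then show ?thesis by (simp add: Mat_eq_Supp dim_Supp)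
qed

section \<open>Block sums\<close>

lemma diagonal_on_cong: "diagonal_on H V S \<Longrightarrow> (\<And>v. v \<in> V \<Longrightarrow> H v = H' v) \<Longrightarrow> diagonal_on H' V S"
  unfolding diagonal_on_def by (metis span_superset subsetD)

lemma sum_split: "(\<Sum>i=1..n + m. f i) = (\<Sum>i=1..n. f i) + (\<Sum>i=1..m. f (n + i))"
  for f :: "nat \<Rightarrow> real"
  by (induction m) (simp_all add: add.assoc)

context
  fixes n m :: nat and A B :: matr
begin

lemma direct_sum_entry:
  "k \<in> {1..n} \<Longrightarrow> l \<in> {1..n} \<Longrightarrow> (direct_sum n A B) k l = A k l"
  "k \<in> {1..m} \<Longrightarrow> l \<in> {1..m} \<Longrightarrow> (direct_sum n A B) (n + k) (n + l) = B k l"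
  "k \<in> {1..n} \<Longrightarrow> l \<in> {1..m} \<Longrightarrow> (direct_sum n A B) k (n + l) = 0"
  "k \<in> {1..m} \<Longrightarrow> l \<in> {1..n} \<Longrightarrow> (direct_sum n A B) (n + k) l = 0"
  by (simp_all add: direct_sum_def)

lemma sum_direct_sum:
  "k \<in> {1..n} \<Longrightarrow> (\<Sum>j=1..n + m. (direct_sum n A B) k j * f j) = (\<Sum>j=1..n. A k j * f j)"
  "k \<in> {1..m} \<Longrightarrow> (\<Sum>j=1..n + m. (direct_sum n A B) (n + k) j * f j) = (\<Sum>j=1..m. B k j * f (n + j))"
  unfolding sum_split by (simp_all add: direct_sum_entry del: One_nat_def atLeastAtMost_iff)

lemma gram_direct_sum:
  "k \<in> {1..n} \<Longrightarrow> l \<in> {1..n} \<Longrightarrow> gram (n + m) (direct_sum n A B) k l = gram n A k l"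
  "k \<in> {1..m} \<Longrightarrow> l \<in> {1..m} \<Longrightarrow> gram (n + m) (direct_sum n A B) (n + k) (n + l) = gram m B k l"
  "k \<in> {1..n} \<Longrightarrow> l \<in> {1..m} \<Longrightarrow> gram (n + m) (direct_sum n A B) k (n + l) = 0"
  "k \<in> {1..m} \<Longrightarrow> l \<in> {1..n} \<Longrightarrow> gram (n + m) (direct_sum n A B) (n + k) l = 0"
  unfolding gram_def by (simp_all add: sum_direct_sum direct_sum_entry del: One_nat_def atLeastAtMost_iff)

text \<open>The matrix and its Gram matrix are block diagonal. Inside a diagonal block the Hessian
  is that of the block; at a mixed position the terms with the Gram derivative and the diagonal term
  vanish, and only the squared Gram entries act, on rows.\<close>

lemma hessian_direct_sum:
  "k \<in> {1..n} \<Longrightarrow> l \<in> {1..n} \<Longrightarrow> hessian (n + m) (direct_sum n A B) X k l = hessian n A X k l"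
  "k \<in> {1..m} \<Longrightarrow> l \<in> {1..m} \<Longrightarrow> hessian (n + m) (direct_sum n A B) X (n + k) (n + l) = hessian m B (\<lambda>i j. X (n + i) (n + j)) k l"
  "k \<in> {1..n} \<Longrightarrow> l \<in> {1..m} \<Longrightarrow> hessian (n + m) (direct_sum n A B) X k (n + l) = 6 * (\<Sum>j=1..n. (gram n A k j)\<^sup>2 * X j (n + l))"
  "k \<in> {1..m} \<Longrightarrow> l \<in> {1..n} \<Longrightarrow> hessian (n + m) (direct_sum n A B) X (n + k) l = 6 * (\<Sum>j=1..m. (gram m B k j)\<^sup>2 * X (n + j) l)"
proof -
  have R1: "k \<in> {1..n + m}" if "k \<in> {1..n}" for k using that by auto
  have R2: "n + k \<in> {1..n + m}" if "k \<in> {1..m}" for k using that by auto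
  show "hessian (n + m) (direct_sum n A B) X k l = hessian n A X k l" if kl: "k \<in> {1..n}" "l \<in> {1..n}"
    \<comment> \<open>The patterns restrict the splitting to the outer sums; the inner products over
      \<open>j\<close> stay whole for \<open>sum_direct_sum\<close>.\<close>
    unfolding hessian_formula[OF R1[OF kl(1)] R1[OF kl(2)]] hessian_formula[OF kl] sum_split[where f = "\<lambda>m. _ m * _ m * _ m"]
      sum_split[where f = "\<lambda>m. (_ m)\<^sup>2 * _ m"]
    using kl by (simp add: sum_direct_sum direct_sum_entry gram_direct_sum del: One_nat_def atLeastAtMost_iff)
  show "hessian (n + m) (direct_sum n A B) X (n + k) (n + l) = hessian m B (\<lambda>i j. X (n + i) (n + j)) k l" if kl: "k \<in> {1..m}" "l \<in> {1..m}"
    unfolding hessian_formula[OF R2[OF kl(1)] R2[OF kl(2)]] hessian_formula[OF kl] sum_split[where f = "\<lambda>m. _ m * _ m * _ m"]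
      sum_split[where f = "\<lambda>m. (_ m)\<^sup>2 * _ m"]
    using kl by (simp add: sum_direct_sum direct_sum_entry gram_direct_sum del: One_nat_def atLeastAtMost_iff)
  show "hessian (n + m) (direct_sum n A B) X k (n + l) = 6 * (\<Sum>j=1..n. (gram n A k j)\<^sup>2 * X j (n + l))" if kl: "k \<in> {1..n}" "l \<in> {1..m}"
    unfolding hessian_formula[OF R1[OF kl(1)] R2[OF kl(2)]] sum_split[where f = "\<lambda>m. _ m * _ m * _ m"]
      sum_split[where f = "\<lambda>m. (_ m)\<^sup>2 * _ m"]
    using kl by (simp add: sum_direct_sum direct_sum_entry gram_direct_sum del: One_nat_def atLeastAtMost_iff)
  show "hessian (n + m) (direct_sum n A B) X (n + k) l = 6 * (\<Sum>j=1..m. (gram m B k j)\<^sup>2 * X (n + j) l)" if kl: "k \<in> {1..m}" "l \<in> {1..n}"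
    unfolding hessian_formula[OF R2[OF kl(1)] R1[OF kl(2)]] sum_split[where f = "\<lambda>m. _ m * _ m * _ m"]
      sum_split[where f = "\<lambda>m. (_ m)\<^sup>2 * _ m"]
    using kl by (simp add: sum_direct_sum direct_sum_entry gram_direct_sum del: One_nat_def atLeastAtMost_iff)
qed

lemma index_cases:
  assumes "k \<in> {1..n + m}"
  obtains "k \<in> {1..n}" | i where "k = n + i" "i \<in> {1..m}"
proof (cases "k \<le> n")
  case False
  then have "k = n + (k - n)" "k - n \<in> {1..m}" using assms by auto
  then show thesis using that(2) by blast
qed (use assms that(1) in auto)

lemma direct_sum_in_Mat:
  assumes "A \<in> Mat n n" "B \<in> Mat m m"
  shows "(direct_sum n A B) \<in> Mat (n + m) (n + m)"
  unfolding Mat_def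
proof clarify
  fix i j assume out: "i \<notin> {1..n + m} \<or> j \<notin> {1..n + m}"
  have "A i j = 0" if "i \<le> n" "j \<le> n" using assms(1) out that unfolding Mat_def by auto
  moreover have "B (i - n) (j - n) = 0" if "n < i" "n < j"
  proof -
    have "i - n \<notin> {1..m} \<or> j - n \<notin> {1..m}" using out that by auto
    then show ?thesis using assms(2) unfolding Mat_def by blast
  qed
  ultimately show "(direct_sum n A B) i j = 0" by (simp add: direct_sum_def)
qed

lemma critical_direct_sum:
  assumes "critical n A" "critical m B"
  shows "critical (n + m) (direct_sum n A B)"
  unfolding critical_iff
proof (intro conjI ballI direct_sum_in_Mat)
  show "A \<in> Mat n n" "B \<in> Mat m m" using assms unfolding critical_def by blast+
  have gA: "grad n A k l = 0" if "k \<in> {1..n}" "l \<in> {1..n}" for k l using assms(1) that unfolding critical_iff by blast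
  have gB: "grad m B k l = 0" if "k \<in> {1..m}" "l \<in> {1..m}" for k l using assms(2) that unfolding critical_iff by blast
  fix k l assume "k \<in> {1..n + m}" "l \<in> {1..n + m}"
  then show "grad (n + m) (direct_sum n A B) k l = 0"
  proof (elim index_cases)
    assume kl: "k \<in> {1..n}" "l \<in> {1..n}"
    have "grad (n + m) (direct_sum n A B) k l = grad n A k l"
      unfolding grad_def sum_split using kl
      by (simp add: direct_sum_entry gram_direct_sum del: One_nat_def atLeastAtMost_iff)
    then show ?thesis using gA[OF kl] by simp
  next
    fix i assume kl: "k \<in> {1..n}" "l = n + i" "i \<in> {1..m}"
    then show ?thesis unfolding grad_def sum_split
      by (simp add: direct_sum_entry gram_direct_sum del: One_nat_def atLeastAtMost_iff)
  next
    fix i assume kl: "k = n + i" "i \<in> {1..m}" "l \<in> {1..n}"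
    then show ?thesis unfolding grad_def sum_split
      by (simp add: direct_sum_entry gram_direct_sum del: One_nat_def atLeastAtMost_iff)
  next
    fix i j assume kl: "k = n + i" "i \<in> {1..m}" "l = n + j" "j \<in> {1..m}"
    have "grad (n + m) (direct_sum n A B) k l = grad m B i j"
      unfolding grad_def sum_split using kl
      by (simp add: direct_sum_entry gram_direct_sum del: One_nat_def atLeastAtMost_iff)
    then show ?thesis using gB kl by simp
  qed
qed

lemma loss_direct_sum: "loss (n + m) (direct_sum n A B) = loss n A + loss m B"
  unfolding loss_gram sum_split
  by (simp add: direct_sum_entry gram_direct_sum sum.distrib del: One_nat_def atLeastAtMost_iff)

text \<open>Moves a matrix to the lower right corner. \<open>Mat n n\<close> already consists of
  matrices supported in the upper left corner.\<close>

definition shift_block :: "matr \<Rightarrow> matr" where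
  "shift_block Y = (\<lambda>i j. if n < i \<and> n < j then Y (i - n) (j - n) else 0)"

lemma linear_shift_block: "linear shift_block"
  by (rule linearI; intro ext; simp add: shift_block_def scaleR_fun_def)

lemma shift_block_image: "shift_block ` Mat m m = Supp {n + 1..n + m} {n + 1..n + m}"
proof (intro equalityI subsetI)
  fix X assume "X \<in> shift_block ` Mat m m"
  then obtain Y where X: "X = shift_block Y" and Y: "Y \<in> Mat m m" by blast
  have "X i j = 0" if "i \<notin> {n + 1..n + m} \<or> j \<notin> {n + 1..n + m}" for i j
  proof (cases "n < i \<and> n < j")
    case True
    then have "i - n \<notin> {1..m} \<or> j - n \<notin> {1..m}" using that by auto
    then have "Y (i - n) (j - n) = 0" using Y unfolding Mat_def by blast
    then show ?thesis by (simp add: X shift_block_def)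
  qed (auto simp: X shift_block_def)
  then show "X \<in> Supp {n + 1..n + m} {n + 1..n + m}" unfolding Supp_def by blast
next
  fix X assume X: "X \<in> Supp {n + 1..n + m} {n + 1..n + m}"
  define Y where "Y = (\<lambda>i j. if i \<in> {1..m} \<and> j \<in> {1..m} then X (n + i) (n + j) else 0)"
  have "X i j = shift_block Y i j" for i j
  proof (cases "i \<in> {n + 1..n + m} \<and> j \<in> {n + 1..n + m}")
    case True
    then have "i - n \<in> {1..m}" "j - n \<in> {1..m}" "n + (i - n) = i" "n + (j - n) = j" "n < i" "n < j" by auto
    then show ?thesis by (simp add: shift_block_def Y_def del: atLeastAtMost_iff)
  next
    case False
    then have "X i j = 0" using X unfolding Supp_def by blast
    moreover have "\<not> (n < i \<and> n < j) \<or> i - n \<notin> {1..m} \<or> j - n \<notin> {1..m}" using False by auto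
    then have "shift_block Y i j = 0" by (auto simp: shift_block_def Y_def simp del: atLeastAtMost_iff)
    ultimately show ?thesis by simp
  qed
  then have "X = shift_block Y" by (intro ext)
  moreover have "Y \<in> Mat m m" by (auto simp: Y_def Mat_def)
  ultimately show "X \<in> shift_block ` Mat m m" by blast
qed

lemma inj_shift_block: "inj_on shift_block (Mat m m)"
proof (rule inj_onI)
  fix X Y assume XY: "X \<in> Mat m m" "Y \<in> Mat m m" "shift_block X = shift_block Y"
  have "X i j = Y i j" for i j
  proof (cases "i \<in> {1..m} \<and> j \<in> {1..m}")
    case True
    then have "0 < i" "0 < j" by auto
    then show ?thesis using fun_cong[OF fun_cong[OF XY(3)], of "n + i" "n + j"] by (simp add: shift_block_def)
  next
    case False
    then have "X i j = 0" "Y i j = 0" using XY(1,2) unfolding Mat_def by blast+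
    then show ?thesis by simp
  qed
  then show "X = Y" by (intro ext)
qed

lemma hessian_cong:
  assumes "\<And>i j. i \<in> {1..d} \<Longrightarrow> j \<in> {1..d} \<Longrightarrow> X i j = Y i j"
  shows "hessian d V X = hessian d V Y"
  unfolding hessian_def by (intro ext) (simp add: assms del: One_nat_def atLeastAtMost_iff)

lemma hessian_0: "hessian d V 0 = 0"
  by (rule linear_0[OF linear_hessian])

text \<open>The four support blocks are invariant under the Hessian. The diagonal ones inherit the
  spectra of the summands, so only the mixed blocks remain to be supplied.\<close>

lemma diagonal_on_direct_sum:
  assumes dA: "diagonal_on (hessian n A) (Mat n n) M1" and dB: "diagonal_on (hessian m B) (Mat m m) M2"
    and d3: "diagonal_on (hessian (n + m) (direct_sum n A B)) (Supp {1..n} {n + 1..n + m}) M3"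
    and d4: "diagonal_on (hessian (n + m) (direct_sum n A B)) (Supp {n + 1..n + m} {1..n}) M4"
  shows "diagonal_on (hessian (n + m) (direct_sum n A B)) (Mat (n + m) (n + m)) (M1 + M2 + M3 + M4)"
proof -
  let ?R1 = "{1..n}" and ?R2 = "{n + 1..n + m}" and ?H = "hessian (n + m) (direct_sum n A B)"
  have d1: "diagonal_on ?H (Supp ?R1 ?R1) M1"
    unfolding Mat_eq_Supp[symmetric]
  proof (rule diagonal_on_cong[OF dA], intro ext)
    fix X k l assume X: "X \<in> Mat n n"
    have X0: "X i j = 0" if "i \<notin> {1..n} \<or> j \<notin> {1..n}" for i j using X that unfolding Mat_def by blast
    show "hessian n A X k l = ?H X k l"
    proof (cases "k \<in> {1..n + m} \<and> l \<in> {1..n + m}")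
      case False
      then have "\<not> (k \<in> {1..n} \<and> l \<in> {1..n})" by auto
      then show ?thesis using hessian_outside[OF False] hessian_outside[of k n l] by simp
    next
      case True
      then have "k \<in> {1..n + m}" "l \<in> {1..n + m}" by blast+
      then show ?thesis
      proof (elim index_cases)
        assume "k \<in> {1..n}" "l \<in> {1..n}"
        then show ?thesis by (simp only: hessian_direct_sum)
      next
        fix i assume kl: "k \<in> {1..n}" "l = n + i" "i \<in> {1..m}"
        then have "\<not> (k \<in> {1..n} \<and> l \<in> {1..n})" by auto
        note 0 = hessian_outside[OF this]
        have "X j (n + i) = 0" for j using kl by (intro X0) auto
        then have "hessian (n + m) (direct_sum n A B) X k l = 0" unfolding kl(2) hessian_direct_sum(3)[OF kl(1,3)] by simp
        with 0 show ?thesis by simp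
      next
        fix i assume kl: "k = n + i" "i \<in> {1..m}" "l \<in> {1..n}"
        then have "\<not> (k \<in> {1..n} \<and> l \<in> {1..n})" by auto
        note 0 = hessian_outside[OF this]
        have "(\<Sum>j=1..m. (gram m B i j)\<^sup>2 * X (n + j) l) = 0"
          by (intro sum.neutral ballI) (simp add: X0)
        then have "hessian (n + m) (direct_sum n A B) X k l = 0" unfolding kl(1) hessian_direct_sum(4)[OF kl(2,3)] by simp
        with 0 show ?thesis by simp
      next
        fix i j assume kl: "k = n + i" "i \<in> {1..m}" "l = n + j" "j \<in> {1..m}"
        then have "\<not> (k \<in> {1..n} \<and> l \<in> {1..n})" by auto
        note 0 = hessian_outside[OF this]
        have "hessian m B (\<lambda>i j. X (n + i) (n + j)) = hessian m B 0"
          by (rule hessian_cong) (simp add: X0)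
        then have "hessian (n + m) (direct_sum n A B) X k l = 0" unfolding kl(1,3) hessian_direct_sum(2)[OF kl(2,4)] by (simp add: hessian_0)
        with 0 show ?thesis by simp
      qed
    qed
  qed
  have "?H (shift_block Y) k l = shift_block (hessian m B Y) k l" if Y: "Y \<in> Mat m m" for Y k l
  proof (cases "k \<in> {1..n + m} \<and> l \<in> {1..n + m}")
    case False
    then have "\<not> (k - n \<in> {1..m} \<and> l - n \<in> {1..m}) \<or> \<not> (n < k \<and> n < l)" by auto
    then have "shift_block (hessian m B Y) k l = 0" unfolding shift_block_def using hessian_outside by auto
    then show ?thesis by (simp only: hessian_outside[OF False])
  next
    case True
    then have "k \<in> {1..n + m}" "l \<in> {1..n + m}" by blast+
    then show ?thesis
    proof (elim index_cases)
      assume kl: "k \<in> {1..n}" "l \<in> {1..n}"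
      have "hessian n A (shift_block Y) = hessian n A 0"
        by (rule hessian_cong) (simp add: shift_block_def)
      then show ?thesis unfolding hessian_direct_sum(1)[OF kl] using kl by (simp add: hessian_0 shift_block_def)
    next
      fix i assume kl: "k \<in> {1..n}" "l = n + i" "i \<in> {1..m}"
      then show ?thesis unfolding kl(2) hessian_direct_sum(3)[OF kl(1,3)] by (simp add: shift_block_def)
    next
      fix i assume kl: "k = n + i" "i \<in> {1..m}" "l \<in> {1..n}"
      then show ?thesis unfolding kl(1) hessian_direct_sum(4)[OF kl(2,3)] by (simp add: shift_block_def)
    next
      fix i j assume kl: "k = n + i" "i \<in> {1..m}" "l = n + j" "j \<in> {1..m}"
      have "hessian m B (\<lambda>i j. shift_block Y (n + i) (n + j)) = hessian m B Y"
        by (rule hessian_cong) (simp add: shift_block_def)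
      then show ?thesis unfolding kl(1,3) hessian_direct_sum(2)[OF kl(2,4)] using kl by (simp add: shift_block_def)
    qed
  qed
  then have HY: "?H (shift_block Y) = 1 *\<^sub>R shift_block (hessian m B Y)" if "Y \<in> Mat m m" for Y
    using that by (intro ext) (simp add: scaleR_fun_def)
  have "diagonal_on ?H (shift_block ` Mat m m) (image_mset ((*) 1) M2)"
    by (rule diagonal_on_image[OF linear_shift_block inj_shift_block dB]) (rule HY)
  moreover have "((*) (1 :: real)) = (\<lambda>x. x)" by (rule ext) simp
  ultimately have d2: "diagonal_on ?H (Supp ?R2 ?R2) M2" by (simp only: shift_block_image multiset.map_ident)
  show ?thesis
  proof (rule diagonal_on_sum4[OF d1 d2 d3 d4])
    fix X1 X2 X3 X4
    assume X: "X1 \<in> Supp ?R1 ?R1" "X2 \<in> Supp ?R2 ?R2" "X3 \<in> Supp ?R1 ?R2" "X4 \<in> Supp ?R2 ?R1"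
      and 0: "X1 + X2 + X3 + X4 = 0"
    have disj: "i \<in> ?R1 \<Longrightarrow> i \<notin> ?R2" for i by auto
    have ent: "X1 i j + X2 i j + X3 i j + X4 i j = 0" for i j using fun_cong[OF fun_cong[OF 0], of i j] by simp
    have out: "i \<notin> ?R1 \<or> j \<notin> ?R1 \<Longrightarrow> X1 i j = 0" "i \<notin> ?R2 \<or> j \<notin> ?R2 \<Longrightarrow> X2 i j = 0"
      "i \<notin> ?R1 \<or> j \<notin> ?R2 \<Longrightarrow> X3 i j = 0" "i \<notin> ?R2 \<or> j \<notin> ?R1 \<Longrightarrow> X4 i j = 0" for i j
      using X unfolding Supp_def by blast+
    have "X1 i j = 0 \<and> X2 i j = 0 \<and> X3 i j = 0 \<and> X4 i j = 0" for i j
    proof (cases "i \<in> ?R1"; cases "j \<in> ?R1")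
      assume "i \<in> ?R1" "j \<in> ?R1"
      then have "X2 i j = 0" "X3 i j = 0" "X4 i j = 0" using out disj by blast+
      then show ?thesis using ent[of i j] by simp
    next
      assume "i \<in> ?R1" "j \<notin> ?R1"
      then have "X1 i j = 0" "X2 i j = 0" "X4 i j = 0" using out disj by blast+
      then show ?thesis using ent[of i j] by simp
    next
      assume "i \<notin> ?R1" "j \<in> ?R1"
      then have "X1 i j = 0" "X2 i j = 0" "X3 i j = 0" using out disj by blast+
      then show ?thesis using ent[of i j] by simp
    next
      assume "i \<notin> ?R1" "j \<notin> ?R1"
      then have "X1 i j = 0" "X3 i j = 0" "X4 i j = 0" using out disj by blast+
      then show ?thesis using ent[of i j] by simp
    qed
    then show "X1 = 0 \<and> X2 = 0 \<and> X3 = 0 \<and> X4 = 0" by (auto intro!: ext)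
  next
    let ?S = "{X1 + X2 + X3 + X4 | X1 X2 X3 X4. X1 \<in> Supp ?R1 ?R1 \<and> X2 \<in> Supp ?R2 ?R2 \<and> X3 \<in> Supp ?R1 ?R2 \<and> X4 \<in> Supp ?R2 ?R1}"
    show "Mat (n + m) (n + m) = ?S"
    proof (intro equalityI subsetI)
      fix X assume "X \<in> ?S"
      then obtain X1 X2 X3 X4 where X: "X = X1 + X2 + X3 + X4"
        and mem: "X1 \<in> Supp ?R1 ?R1" "X2 \<in> Supp ?R2 ?R2" "X3 \<in> Supp ?R1 ?R2" "X4 \<in> Supp ?R2 ?R1" by blast
      have "?R1 \<subseteq> {1..n + m}" "?R2 \<subseteq> {1..n + m}" by auto
      then have "Supp R C \<subseteq> Mat (n + m) (n + m)" if "R \<in> {?R1, ?R2}" "C \<in> {?R1, ?R2}" for R C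
        using that unfolding Supp_def Mat_def by blast
      then show "X \<in> Mat (n + m) (n + m)"
        using mem unfolding X Mat_eq_Supp by (intro subspace_add[OF subspace_Supp]) blast+
    next
      fix X assume X: "X \<in> Mat (n + m) (n + m)"
      define P where "P R C = (\<lambda>i j. if i \<in> R \<and> j \<in> C then X i j else 0)" for R C
      have P: "P R C \<in> Supp R C" for R C by (simp add: P_def Supp_def)
      have un: "{1..n + m} = ?R1 \<union> ?R2" "?R1 \<inter> ?R2 = {}" by auto
      have "X = P ?R1 ?R1 + P ?R2 ?R2 + P ?R1 ?R2 + P ?R2 ?R1"
      proof (intro ext)
        fix i j
        have z: "X i j = 0" if "\<not> (i \<in> ?R1 \<or> i \<in> ?R2) \<or> \<not> (j \<in> ?R1 \<or> j \<in> ?R2)"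
          using X that unfolding Mat_def un by blast
        have ne: "\<not> (i \<in> ?R1 \<and> i \<in> ?R2)" "\<not> (j \<in> ?R1 \<and> j \<in> ?R2)" using un(2) by blast+
        show "X i j = (P ?R1 ?R1 + P ?R2 ?R2 + P ?R1 ?R2 + P ?R2 ?R1) i j"
          unfolding plus_fun_apply P_def
          by (cases "i \<in> ?R1"; cases "i \<in> ?R2"; cases "j \<in> ?R1"; cases "j \<in> ?R2";
              use ne z in \<open>simp del: atLeastAtMost_iff\<close>)
      qed
      then show "X \<in> ?S" using P by blast
    qed
  qed
qed

end

lemma diagonal_on_const_block:
  assumes "finite R" "finite C" "\<And>X. X \<in> Supp R C \<Longrightarrow> H X = \<mu> *\<^sub>R X"
  shows "diagonal_on H (Supp R C) (replicate_mset (card R * card C) \<mu>)"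
  using diagonal_on_const_Supp[OF assms(1,2) subspace_Supp order_refl assms(3)] dim_Supp[OF assms(1,2)] by simp

text \<open>Column by column the operator is \<alpha> plus \<nu> times the all-ones matrix on the
  rows \<open>R\<close>. Constant columns (\<open>P\<close>) have the shifted eigenvalue, columns
  with sum zero (\<open>Z\<close>) have \<alpha>, and the dimension of \<open>Z\<close> is the
  complement of that of \<open>P\<close>.\<close>

lemma diagonal_on_mean_block:
  assumes fin: "finite R" "finite C" "R \<noteq> {}"
    and H: "\<And>X k l. X \<in> Supp R C \<Longrightarrow> H X k l = \<alpha> * X k l + of_bool (k \<in> R \<and> l \<in> C) * (\<nu> * (\<Sum>i\<in>R. X i l))"
  shows "diagonal_on H (Supp R C) (replicate_mset (card C) (\<alpha> + real (card R) * \<nu>) + replicate_mset ((card R - 1) * card C) \<alpha>)"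
proof -
  define P where "P = {X \<in> Supp R C. \<forall>k\<in>R. \<forall>k'\<in>R. \<forall>l. X k l = X k' l}"
  define Z where "Z = {X \<in> Supp R C. \<forall>l. (\<Sum>i\<in>R. X i l) = 0}"
  have subP: "subspace P"
  proof (rule subspaceI)
    show "0 \<in> P" unfolding P_def using subspace_0[OF subspace_Supp] by simp
  next
    fix X Y assume "X \<in> P" "Y \<in> P"
    then have mem: "X \<in> Supp R C" "Y \<in> Supp R C"
      and X: "\<And>k k' l. k \<in> R \<Longrightarrow> k' \<in> R \<Longrightarrow> X k l = X k' l"
      and Y: "\<And>k k' l. k \<in> R \<Longrightarrow> k' \<in> R \<Longrightarrow> Y k l = Y k' l"
      unfolding P_def by blast+
    have "(X + Y) k l = (X + Y) k' l" if "k \<in> R" "k' \<in> R" for k k' l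
      unfolding plus_fun_apply by (rule arg_cong2[where f = "(+)", OF X[OF that] Y[OF that]])
    then show "X + Y \<in> P" unfolding P_def using subspace_add[OF subspace_Supp mem] by blast
  next
    fix c X assume X: "X \<in> P"
    have "(c *\<^sub>R X) k l = (c *\<^sub>R X) k' l" if "k \<in> R" "k' \<in> R" for k k' l
    proof -
      have "X k l = X k' l" using X that unfolding P_def by blast
      then show ?thesis unfolding scaleR_fun_def by (rule arg_cong)
    qed
    moreover have "c *\<^sub>R X \<in> Supp R C" using X subspace_scale[OF subspace_Supp] unfolding P_def by blast
    ultimately show "c *\<^sub>R X \<in> P" unfolding P_def by blast
  qed
  have subZ: "subspace Z"
    unfolding Z_def using subspace_Supp[of R C]
    by (auto simp: subspace_def scaleR_fun_def sum.distrib sum_distrib_left[symmetric])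
  obtain r where r: "r \<in> R" using fin by blast
  have cR: "real (card R) \<noteq> 0" using fin by simp
  have Psum: "(\<Sum>i\<in>R. X i l) = real (card R) * X k l" if "X \<in> P" "k \<in> R" for X k l
  proof -
    have "(\<Sum>i\<in>R. X i l) = (\<Sum>i\<in>R. X k l)" using that unfolding P_def by (intro sum.cong refl) blast
    then show ?thesis by simp
  qed
  have PS: "P \<subseteq> Supp R C" and ZS: "Z \<subseteq> Supp R C" by (auto simp: P_def Z_def)
  have HP: "H X = (\<alpha> + real (card R) * \<nu>) *\<^sub>R X" if "X \<in> P" for X
  proof (intro ext)
    fix k l
    have X: "X \<in> Supp R C" using PS that by blast
    show "H X k l = ((\<alpha> + real (card R) * \<nu>) *\<^sub>R X) k l"
    proof (cases "k \<in> R \<and> l \<in> C")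
      case True
      then show ?thesis using Psum[OF that, of k l] by (simp add: H[OF X] scaleR_fun_def algebra_simps)
    next
      case False
      then have "X k l = 0" using X unfolding Supp_def by blast
      then show ?thesis using False by (simp add: H[OF X] scaleR_fun_def)
    qed
  qed
  have HZ: "H X = \<alpha> *\<^sub>R X" if "X \<in> Z" for X
    using that ZS by (intro ext) (auto simp: H scaleR_fun_def Z_def)
  have disj: "P \<inter> Z \<subseteq> {0}"
  proof
    fix X assume X: "X \<in> P \<inter> Z"
    have "X k l = 0" for k l
    proof (cases "k \<in> R")
      case True
      then have "real (card R) * X k l = 0" using Psum[of X k l] X by (auto simp: Z_def)
      then show ?thesis using cR by simp
    next
      case False
      then show ?thesis using X PS unfolding Supp_def by blast
    qed
    then show "X \<in> {0}" by (auto intro!: ext)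
  qed
  have cover: "Supp R C = {X + Y | X Y. X \<in> P \<and> Y \<in> Z}"
  proof (intro equalityI subsetI)
    fix A assume "A \<in> {X + Y | X Y. X \<in> P \<and> Y \<in> Z}"
    then show "A \<in> Supp R C" using PS ZS subspace_add[OF subspace_Supp, of _ R C] by blast
  next
    fix A assume A: "A \<in> Supp R C"
    define X where "X = (\<lambda>k l. of_bool (k \<in> R) * ((\<Sum>i\<in>R. A i l) / real (card R)))"
    have "(\<Sum>i\<in>R. A i l) = 0" if "l \<notin> C" for l
      using A that unfolding Supp_def by (intro sum.neutral) blast
    then have XS: "X \<in> Supp R C" by (auto simp: X_def Supp_def)
    then have "X \<in> P" by (simp add: P_def X_def)
    moreover have "A - X \<in> Z"
      unfolding Z_def using subspace_diff[OF subspace_Supp A XS] cR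
      by (simp add: sum_subtractf X_def)
    moreover have "A = X + (A - X)" by simp
    ultimately show "A \<in> {X + Y | X Y. X \<in> P \<and> Y \<in> Z}" by blast
  qed
  have dimP: "dim P = card C"
  proof -
    define e where "e l = (\<lambda>i j. of_bool (i \<in> R \<and> j = l) :: real)" for l :: nat
    have "diagonal_on (\<lambda>v. v) P (image_mset (\<lambda>_. 1) (mset_set C))"
    proof (rule diagonal_on_coords[where c = "\<lambda>l X. X r l" and e = e])
      show "linear (\<lambda>X. X r l :: real)" for l by (rule linear_entry)
      show "e l' r l = of_bool (l = l')" for l l' using r by (simp add: e_def)
      show "e l \<in> P" if "l \<in> C" for l using that by (auto simp: e_def P_def Supp_def)
      show "X = (\<Sum>l\<in>C. X r l *\<^sub>R e l)" if X: "X \<in> P" for X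
      proof (intro ext)
        fix i j
        have "(\<Sum>l\<in>C. X r l *\<^sub>R e l) i j = (\<Sum>l\<in>C. if l = j then of_bool (i \<in> R) * X r j else 0)"
          unfolding sum_fun_apply2 by (intro sum.cong refl) (auto simp: scaleR_fun_def e_def)
        also have "\<dots> = of_bool (j \<in> C) * (of_bool (i \<in> R) * X r j)" using fin by simp
        also have "\<dots> = X i j"
        proof (cases "i \<in> R \<and> j \<in> C")
          case True
          then have "X r j = X i j" using X r unfolding P_def by blast
          then show ?thesis using True by simp
        next
          case False
          then have "X i j = 0" using X unfolding P_def Supp_def by blast
          then show ?thesis using False by auto
        qed
        finally show "X i j = (\<Sum>l\<in>C. X r l *\<^sub>R e l) i j" ..
      qed
    qed (use fin subP in simp_all)
    from diagonal_on_dim[OF this] show ?thesis by simp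
  qed
  have "card R * card C = card C + dim Z"
    using dim_direct_sum_Supp[OF fin(1,2) subP subZ PS ZS disj] dim_Supp[OF fin(1,2)] dimP
    by (simp add: cover[symmetric])
  then have dimZ: "dim Z = (card R - 1) * card C" by (simp add: diff_mult_distrib)
  from diagonal_on_sum[OF diagonal_on_const_Supp[OF fin(1,2) subP PS HP] diagonal_on_const_Supp[OF fin(1,2) subZ ZS HZ] disj cover]
  show ?thesis by (simp add: dimP dimZ)
qed

text \<open>A mixed block sees only the entrywise square of the Gram matrix of
  \<open>a I + b J\<close>, which has the shape required by
  \<open>diagonal_on_mean_block\<close>.\<close>

lemma hessian_upper_block:
  assumes X: "X \<in> Supp {1..n} {n + 1..n + m}"
  shows "hessian (n + m) (direct_sum n (mix n a b) B) X k l = 6 * gram_gap n a b * X k l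
    + of_bool (k \<in> {1..n} \<and> l \<in> {n + 1..n + m}) * (6 * (gram_off n a b)\<^sup>2 * (\<Sum>i\<in>{1..n}. X i l))"
proof -
  let ?H = "hessian (n + m) (direct_sum n (mix n a b) B) X"
  have out: "X i j = 0" if "i \<notin> {1..n} \<or> j \<notin> {n + 1..n + m}" for i j using X that unfolding Supp_def by blast
  have zero: "?thesis" if "?H k l = 0" "\<not> (k \<in> {1..n} \<and> l \<in> {n + 1..n + m})"
    using that out[of k l] by (auto simp del: atLeastAtMost_iff)
  show ?thesis
  proof (cases "k \<in> {1..n + m} \<and> l \<in> {1..n + m}")
    case False
    then show ?thesis by (intro zero hessian_outside) auto
  next
    case True
    then have "k \<in> {1..n + m}" "l \<in> {1..n + m}" by blast+
    then show ?thesis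
    proof (elim index_cases)
      assume kl: "k \<in> {1..n}" "l \<in> {1..n}"
      have "hessian n (mix n a b) X = hessian n (mix n a b) 0" by (rule hessian_cong) (simp add: out)
      then show ?thesis using kl by (intro zero) (simp_all add: hessian_direct_sum(1)[OF kl] hessian_0)
    next
      fix i assume kl: "k \<in> {1..n}" "l = n + i" "i \<in> {1..m}"
      then have "l \<in> {n + 1..n + m}" by auto
      then show ?thesis unfolding kl(2) hessian_direct_sum(3)[OF kl(1,3)] sum_gram_power2[OF kl(1)]
        using kl by (simp add: algebra_simps del: atLeastAtMost_iff One_nat_def)
    next
      fix i assume kl: "k = n + i" "i \<in> {1..m}" "l \<in> {1..n}"
      have "(\<Sum>j=1..m. (gram m B i j)\<^sup>2 * X (n + j) l) = 0"
        using kl by (intro sum.neutral ballI) (simp add: out)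
      then show ?thesis using kl by (intro zero) (simp_all only: hessian_direct_sum(4)[OF kl(2,3)], auto)
    next
      fix i j assume kl: "k = n + i" "i \<in> {1..m}" "l = n + j" "j \<in> {1..m}"
      have "hessian m B (\<lambda>i j. X (n + i) (n + j)) = hessian m B 0" by (rule hessian_cong) (simp add: out)
      then show ?thesis using kl by (intro zero) (simp_all only: hessian_direct_sum(2)[OF kl(2,4)], auto simp: hessian_0)
    qed
  qed
qed

lemma sum_shift_index: "(\<Sum>i\<in>{n + 1..n + m}. f i) = (\<Sum>i=1..m. f (n + i))" for f :: "nat \<Rightarrow> real"
  by (rule sum.reindex_bij_witness[of _ "\<lambda>i. n + i" "\<lambda>i. i - n"]) auto

lemma hessian_lower_block:
  assumes X: "X \<in> Supp {n + 1..n + m} {1..n}"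
  shows "hessian (n + m) (direct_sum n A (mix m a b)) X k l = 6 * gram_gap m a b * X k l
    + of_bool (k \<in> {n + 1..n + m} \<and> l \<in> {1..n}) * (6 * (gram_off m a b)\<^sup>2 * (\<Sum>i\<in>{n + 1..n + m}. X i l))"
proof -
  let ?H = "hessian (n + m) (direct_sum n A (mix m a b)) X"
  have out: "X i j = 0" if "i \<notin> {n + 1..n + m} \<or> j \<notin> {1..n}" for i j using X that unfolding Supp_def by blast
  have zero: "?thesis" if "?H k l = 0" "\<not> (k \<in> {n + 1..n + m} \<and> l \<in> {1..n})"
    using that out[of k l] by (auto simp del: atLeastAtMost_iff)
  show ?thesis
  proof (cases "k \<in> {1..n + m} \<and> l \<in> {1..n + m}")
    case False
    then show ?thesis by (intro zero hessian_outside) auto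
  next
    case True
    then have "k \<in> {1..n + m}" "l \<in> {1..n + m}" by blast+
    then show ?thesis
    proof (elim index_cases)
      assume kl: "k \<in> {1..n}" "l \<in> {1..n}"
      have "hessian n A X = hessian n A 0" by (rule hessian_cong) (simp add: out)
      then show ?thesis using kl by (intro zero) (simp_all add: hessian_direct_sum(1)[OF kl] hessian_0)
    next
      fix i assume kl: "k \<in> {1..n}" "l = n + i" "i \<in> {1..m}"
      have "(\<Sum>j=1..n. (gram n A k j)\<^sup>2 * X j (n + i)) = 0"
        using kl by (intro sum.neutral ballI) (simp add: out)
      then show ?thesis using kl by (intro zero) (simp_all only: hessian_direct_sum(3)[OF kl(1,3)], auto)
    next
      fix i assume kl: "k = n + i" "i \<in> {1..m}" "l \<in> {1..n}"
      then have "k \<in> {n + 1..n + m}" by auto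
      then show ?thesis unfolding kl(1) hessian_direct_sum(4)[OF kl(2,3)] sum_gram_power2[OF kl(2)] sum_shift_index
        using kl by (simp add: algebra_simps del: atLeastAtMost_iff One_nat_def)
    next
      fix i j assume kl: "k = n + i" "i \<in> {1..m}" "l = n + j" "j \<in> {1..m}"
      have "hessian m (mix m a b) (\<lambda>i j. X (n + i) (n + j)) = hessian m (mix m a b) 0" by (rule hessian_cong) (simp add: out)
      then show ?thesis using kl by (intro zero) (simp_all only: hessian_direct_sum(2)[OF kl(2,4)], auto simp: hessian_0)
    qed
  qed
qed

lemma diagonal_on_upper_block:
  assumes "n \<ge> 1"
  shows "diagonal_on (hessian (n + m) (direct_sum n (mix n a b) B)) (Supp {1..n} {n + 1..n + m})
    (replicate_mset m (6 * gram_gap n a b + real n * (6 * (gram_off n a b)\<^sup>2)) + replicate_mset ((n - 1) * m) (6 * gram_gap n a b))"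
proof -
  have "diagonal_on (hessian (n + m) (direct_sum n (mix n a b) B)) (Supp {1..n} {n + 1..n + m})
    (replicate_mset (card {n + 1..n + m}) (6 * gram_gap n a b + real (card {1..n}) * (6 * (gram_off n a b)\<^sup>2))
      + replicate_mset ((card {1..n} - 1) * card {n + 1..n + m}) (6 * gram_gap n a b))"
    by (rule diagonal_on_mean_block) (use assms in \<open>simp_all add: hessian_upper_block del: atLeastAtMost_iff One_nat_def\<close>)
  then show ?thesis by simp
qed

lemma diagonal_on_lower_block:
  assumes "m \<ge> 1"
  shows "diagonal_on (hessian (n + m) (direct_sum n A (mix m a b))) (Supp {n + 1..n + m} {1..n})
    (replicate_mset n (6 * gram_gap m a b + real m * (6 * (gram_off m a b)\<^sup>2)) + replicate_mset ((m - 1) * n) (6 * gram_gap m a b))"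
proof -
  have "diagonal_on (hessian (n + m) (direct_sum n A (mix m a b))) (Supp {n + 1..n + m} {1..n})
    (replicate_mset (card {1..n}) (6 * gram_gap m a b + real (card {n + 1..n + m}) * (6 * (gram_off m a b)\<^sup>2))
      + replicate_mset ((card {n + 1..n + m} - 1) * card {1..n}) (6 * gram_gap m a b))"
    by (rule diagonal_on_mean_block) (use assms in \<open>simp_all add: hessian_lower_block del: atLeastAtMost_iff One_nat_def\<close>)
  then show ?thesis by simp
qed

text \<open>At an identity block the Gram matrix is the identity, so the mixed block is scalar. This
  form includes the empty block \<open>n = 0\<close>, which occurs in \<open>C_4\<close> for
  \<open>d = 2\<close>.\<close>

lemma diagonal_on_upper_block_id:
  "diagonal_on (hessian (n + m) (direct_sum n (mix n 1 0) B)) (Supp {1..n} {n + 1..n + m}) (replicate_mset (n * m) 6)"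
proof -
  have "hessian (n + m) (direct_sum n (mix n 1 0) B) X = 6 *\<^sub>R X" if "X \<in> Supp {1..n} {n + 1..n + m}" for X
    by (intro ext) (simp add: hessian_upper_block[OF that] scaleR_fun_def gram_off_def gram_gap_def)
  from diagonal_on_const_block[of "{1..n}" "{n + 1..n + m}", OF _ _ this] show ?thesis by simp
qed

section \<open>Roots and eigenvalues near their limits\<close>

lemma selection_tendsto:
  fixes L :: real
  assumes "\<And>\<delta>. \<delta> > 0 \<Longrightarrow> \<forall>\<^sub>F n in sequentially. \<exists>x. \<bar>x - L\<bar> < \<delta> \<and> R n x"
  shows "\<exists>x. x \<longlonglongrightarrow> L \<and> (\<forall>\<^sub>F n in sequentially. R n (x n))"
proof -
  define D where "D n = {\<bar>x - L\<bar> | x. R n x}" for n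
  \<comment> \<open>Solutions for different \<delta> need not agree. Taking at each \<open>n\<close>
    a solution whose distance from \<open>L\<close> is minimal up to \<open>1 / (n + 1)\<close>
    gives one sequence that is close for every \<delta>; the infimum itself need not be
    attained.\<close>
  define x where "x n = (SOME x. R n x \<and> \<bar>x - L\<bar> < Inf (D n) + 1 / (real n + 1))" for n
  have bdd: "bdd_below (D n)" for n by (rule bdd_belowI[of _ 0]) (auto simp: D_def)
  have x: "R n (x n) \<and> \<bar>x n - L\<bar> < Inf (D n) + 1 / (real n + 1)" if "\<exists>x. R n x" for n
  proof -
    have "D n \<noteq> {}" using that by (auto simp: D_def)
    moreover have "Inf (D n) < Inf (D n) + 1 / (real n + 1)" by simp
    ultimately obtain y where y: "y \<in> D n" "y < Inf (D n) + 1 / (real n + 1)" by (rule cInf_lessD[THEN bexE])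
    then obtain z where "R n z" "y = \<bar>z - L\<bar>" unfolding D_def by blast
    with y have "\<exists>z. R n z \<and> \<bar>z - L\<bar> < Inf (D n) + 1 / (real n + 1)" by blast
    then show ?thesis unfolding x_def by (rule someI_ex)
  qed
  have ev: "\<forall>\<^sub>F n in sequentially. R n (x n)"
    using assms[of 1, OF zero_less_one] by eventually_elim (use x in blast)
  have "x \<longlonglongrightarrow> L"
  proof (rule tendstoI)
    fix e :: real assume e: "e > 0"
    have "\<forall>\<^sub>F n in sequentially. 1 / (real n + 1) < e / 2" using e by real_asymp
    moreover have "\<forall>\<^sub>F n in sequentially. \<exists>x. \<bar>x - L\<bar> < e / 2 \<and> R n x" using assms[of "e / 2"] e by simp
    ultimately show "\<forall>\<^sub>F n in sequentially. dist (x n) L < e"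
    proof eventually_elim
      case (elim n)
      then obtain y where y: "\<bar>y - L\<bar> < e / 2" "R n y" by blast
      then have "\<bar>y - L\<bar> \<in> D n" unfolding D_def by blast
      then have "Inf (D n) \<le> \<bar>y - L\<bar>" by (rule cInf_lower[OF _ bdd])
      moreover have "\<bar>x n - L\<bar> < Inf (D n) + 1 / (real n + 1)" using x y(2) by blast
      ultimately show ?case using y(1) elim(1) unfolding dist_real_def by linarith
    qed
  qed
  then show ?thesis using ev by blast
qed

text \<open>The limit function changes sign across \<open>L\<close> at every small distance, so
  convergence at the two points \<open>L - e\<close> and \<open>L + e\<close> already forces a root
  between them. No uniformity in the argument is involved.\<close>

lemma root_near_sign_change:
  fixes p :: "nat \<Rightarrow> real \<Rightarrow> real"
  assumes lim: "\<And>x. (\<lambda>n. p n x) \<longlonglongrightarrow> q x" and cont: "\<And>n. continuous_on UNIV (p n)"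
    and sgn: "\<And>\<delta>. \<delta> > 0 \<Longrightarrow> \<delta> < r \<Longrightarrow> q (L - \<delta>) * q (L + \<delta>) < 0" and r: "r > 0"
  shows "\<exists>x. x \<longlonglongrightarrow> L \<and> (\<forall>\<^sub>F n in sequentially. p n (x n) = 0)"
proof (rule selection_tendsto)
  fix \<delta> :: real assume \<delta>: "\<delta> > 0"
  \<comment> \<open>Halving keeps the interval strictly inside both the requested neighbourhood and
    the range where the sign change is known.\<close>
  define e where "e = min \<delta> r / 2"
  have e: "e > 0" "e < r" "e < \<delta>" using \<delta> r by (auto simp: e_def)
  have "(\<lambda>n. p n (L - e) * p n (L + e)) \<longlonglongrightarrow> q (L - e) * q (L + e)" by (intro tendsto_mult lim)
  then have "\<forall>\<^sub>F n in sequentially. p n (L - e) * p n (L + e) < 0"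
    using sgn[OF e(1,2)] by (rule order_tendstoD)
  then show "\<forall>\<^sub>F n in sequentially. \<exists>x. \<bar>x - L\<bar> < \<delta> \<and> p n x = 0"
  proof eventually_elim
    case (elim n)
    have c: "continuous_on {L - e..L + e} (p n)" using cont continuous_on_subset by blast
    have "\<exists>x\<ge>L - e. x \<le> L + e \<and> p n x = 0"
    proof (cases "p n (L - e) < 0")
      case True
      then have "0 < p n (L + e)" using elim by (simp add: mult_less_0_iff)
      then show ?thesis using IVT'[of "p n" "L - e" 0 "L + e"] True c e by auto
    next
      case False
      then have "0 < p n (L - e)" "p n (L + e) < 0" using elim by (auto simp: mult_less_0_iff)
      then show ?thesis using IVT2'[of "p n" "L + e" 0 "L - e"] c e by auto
    qed
    then obtain x where "L - e \<le> x" "x \<le> L + e" "p n x = 0" by blast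
    then show ?case using e by (intro exI[of _ x]) auto
  qed
qed

lemma null_vector2:
  fixes p q r s :: real
  assumes "p * s - q * r = 0"
  shows "\<exists>x y. (x \<noteq> 0 \<or> y \<noteq> 0) \<and> p * x + q * y = 0 \<and> r * x + s * y = 0"
proof -
  consider "p \<noteq> 0 \<or> q \<noteq> 0" | "r \<noteq> 0 \<or> s \<noteq> 0" | "p = 0" "q = 0" "r = 0" "s = 0" by blast
  then show ?thesis
  proof cases
    case 1
    then show ?thesis using assms by (intro exI[of _ q] exI[of _ "- p"]) (auto simp: algebra_simps)
  next
    case 2
    then show ?thesis using assms by (intro exI[of _ s] exI[of _ "- r"]) (auto simp: algebra_simps)
  next
    case 3
    then show ?thesis by (intro exI[of _ 1]) simp
  qed
qed

definition det3 :: "(nat \<Rightarrow> nat \<Rightarrow> real) \<Rightarrow> real" where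
  "det3 M = M 1 1 * M 2 2 * M 3 3 + M 1 2 * M 2 3 * M 3 1 + M 1 3 * M 2 1 * M 3 2
     - M 1 1 * M 2 3 * M 3 2 - M 1 2 * M 2 1 * M 3 3 - M 1 3 * M 2 2 * M 3 1"

text \<open>\<open>det3\<close> is the determinant written out by the rule of Sarrus; passing to a
  matrix of type \<open>real^3^3\<close> turns its vanishing into a nontrivial kernel.\<close>

lemma null_vector3:
  fixes M :: "nat \<Rightarrow> nat \<Rightarrow> real"
  assumes "det3 M = 0"
  shows "\<exists>x y z. (x, y, z) \<noteq> (0, 0, 0) \<and> (\<forall>i\<in>{1, 2, 3}. M i 1 * x + M i 2 * y + M i 3 * z = 0)"
proof -
  define A :: "real^3^3" where "A = vector [vector [M 1 1, M 1 2, M 1 3], vector [M 2 1, M 2 2, M 2 3], vector [M 3 1, M 3 2, M 3 3]]"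
  have "det A = 0" using assms by (simp add: det_3 A_def det3_def)
  then have "\<not> invertible A" by (simp add: invertible_det_nz)
  then obtain v where v: "A *v v = 0" "v \<noteq> 0"
    unfolding invertible_left_inverse matrix_left_invertible_ker by blast
  have "\<forall>i. (A *v v) $ i = 0" using v(1) by simp
  then have "M 1 1 * v $ 1 + M 1 2 * v $ 2 + M 1 3 * v $ 3 = 0" "M 2 1 * v $ 1 + M 2 2 * v $ 2 + M 2 3 * v $ 3 = 0"
    "M 3 1 * v $ 1 + M 3 2 * v $ 2 + M 3 3 * v $ 3 = 0"
    by (simp_all add: forall_3 matrix_vector_mult_def sum_3 A_def)
  moreover have "v $ 1 \<noteq> 0 \<or> v $ 2 \<noteq> 0 \<or> v $ 3 \<noteq> 0" using v(2) by (auto simp: vec_eq_iff forall_3)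
  ultimately show ?thesis by (intro exI[of _ "v $ 1"] exI[of _ "v $ 2"] exI[of _ "v $ 3"]) auto
qed

text \<open>The limit matrix is upper triangular, so the characteristic polynomials converge to a
  product of linear factors. Distinct diagonal entries make \<open>L\<close> a simple root, where
  the sign changes.\<close>

lemma eigenvalue_limit2:
  fixes p q r s :: "nat \<Rightarrow> real"
  assumes lim: "p \<longlonglongrightarrow> u1" "q \<longlonglongrightarrow> c" "r \<longlonglongrightarrow> 0" "s \<longlonglongrightarrow> u2" and ne: "u1 \<noteq> u2" and L: "L \<in> {u1, u2}"
  shows "\<exists>x. x \<longlonglongrightarrow> L \<and> (\<forall>\<^sub>F n in sequentially. \<exists>v w. (v \<noteq> 0 \<or> w \<noteq> 0) \<and> p n * v + q n * w = x n * v \<and> r n * v + s n * w = x n * w)"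
proof -
  define P where "P n x = (p n - x) * (s n - x) - q n * r n" for n x
  have "\<exists>x. x \<longlonglongrightarrow> L \<and> (\<forall>\<^sub>F n in sequentially. P n (x n) = 0)"
  proof (rule root_near_sign_change)
    show "(\<lambda>n. P n x) \<longlonglongrightarrow> (u1 - x) * (u2 - x) - c * 0" for x unfolding P_def by (intro tendsto_intros lim)
    show "continuous_on UNIV (P n)" for n unfolding P_def by (intro continuous_intros)
    show "\<bar>u1 - u2\<bar> > 0" using ne by simp
    fix \<delta> :: real assume \<delta>: "\<delta> > 0" "\<delta> < \<bar>u1 - u2\<bar>"
    \<comment> \<open>The signed distance from \<open>L\<close> to the other root; for \<delta>
      below it the product of the two values is
      \<open>- \<delta>^2 (w^2 - \<delta>^2)\<close>.\<close>
    define w where "w = (if L = u1 then u2 else u1) - L"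
    have w: "\<bar>w\<bar> = \<bar>u1 - u2\<bar>" using L by (auto simp: w_def)
    then have w2: "\<delta>\<^sup>2 < w\<^sup>2" using \<delta> by (metis abs_of_pos power2_abs power_strict_mono abs_ge_zero less_imp_le pos2)
    have "((u1 - (L - \<delta>)) * (u2 - (L - \<delta>)) - c * 0) * ((u1 - (L + \<delta>)) * (u2 - (L + \<delta>)) - c * 0) = (- \<delta>\<^sup>2) * (w\<^sup>2 - \<delta>\<^sup>2)"
      using L by (auto simp: w_def power2_eq_square algebra_simps)
    then show "((u1 - (L - \<delta>)) * (u2 - (L - \<delta>)) - c * 0) * ((u1 - (L + \<delta>)) * (u2 - (L + \<delta>)) - c * 0) < 0"
      using w2 \<delta> by (simp add: mult_less_0_iff)
  qed
  then obtain x where x: "x \<longlonglongrightarrow> L" "\<forall>\<^sub>F n in sequentially. P n (x n) = 0" by blast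
  have "\<forall>\<^sub>F n in sequentially. \<exists>v w. (v \<noteq> 0 \<or> w \<noteq> 0) \<and> p n * v + q n * w = x n * v \<and> r n * v + s n * w = x n * w"
    using x(2)
  proof eventually_elim
    case (elim n)
    then obtain v w where "v \<noteq> 0 \<or> w \<noteq> 0" "(p n - x n) * v + q n * w = 0" "r n * v + (s n - x n) * w = 0"
      using null_vector2[of "p n - x n" "s n - x n" "q n" "r n"] unfolding P_def by blast
    then show ?case by (intro exI[of _ v] exI[of _ w]) (auto simp: algebra_simps)
  qed
  then show ?thesis using x(1) by blast
qed

text \<open>\<open>K1\<close> and \<open>K2\<close> are the two diagonal entries of the limit other
  than \<open>L\<close>. Both differ from \<open>L\<close>, so \<open>L\<close> is a simple root of
  the limiting characteristic polynomial.\<close>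

lemma eigenvalue_limit3:
  fixes M :: "nat \<Rightarrow> nat \<Rightarrow> nat \<Rightarrow> real" and U :: "nat \<Rightarrow> nat \<Rightarrow> real"
  assumes lim: "\<And>i j. i \<in> {1, 2, 3} \<Longrightarrow> j \<in> {1, 2, 3} \<Longrightarrow> (\<lambda>n. M n i j) \<longlonglongrightarrow> U i j"
    and tri: "U 2 1 = 0" "U 3 1 = 0" "U 3 2 = 0"
    and L: "L = U 1 1 \<and> K1 = U 2 2 \<and> K2 = U 3 3 \<or> L = U 2 2 \<and> K1 = U 1 1 \<and> K2 = U 3 3 \<or> L = U 3 3 \<and> K1 = U 1 1 \<and> K2 = U 2 2"
    and ne: "K1 \<noteq> L" "K2 \<noteq> L"
  shows "\<exists>x. x \<longlonglongrightarrow> L \<and> (\<forall>\<^sub>F n in sequentially. \<exists>v1 v2 v3. (v1, v2, v3) \<noteq> (0, 0, 0) \<and>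
      M n 1 1 * v1 + M n 1 2 * v2 + M n 1 3 * v3 = x n * v1 \<and>
      M n 2 1 * v1 + M n 2 2 * v2 + M n 2 3 * v3 = x n * v2 \<and>
      M n 3 1 * v1 + M n 3 2 * v2 + M n 3 3 * v3 = x n * v3)"
proof -
  define N where "N n x i j = M n i j - (if i = j then x else 0)" for n x and i j :: nat
  define P where "P n x = det3 (N n x)" for n x
  have "\<exists>x. x \<longlonglongrightarrow> L \<and> (\<forall>\<^sub>F n in sequentially. P n (x n) = 0)"
  proof (rule root_near_sign_change)
    show "(\<lambda>n. P n x) \<longlonglongrightarrow> (L - x) * (K1 - x) * (K2 - x)" for x
    proof -
      have l: "(\<lambda>n. N n x i j) \<longlonglongrightarrow> U i j - (if i = j then x else 0)" if "i \<in> {1, 2, 3}" "j \<in> {1, 2, 3}" for i j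
        unfolding N_def by (intro tendsto_intros lim that)
      have "(\<lambda>n. P n x) \<longlonglongrightarrow> det3 (\<lambda>i j. U i j - (if i = j then x else 0))"
        unfolding P_def det3_def by (intro tendsto_intros l) simp_all
      also have "det3 (\<lambda>i j. U i j - (if i = j then x else 0)) = (L - x) * (K1 - x) * (K2 - x)"
        using L tri by (auto simp: det3_def)
      finally show ?thesis .
    qed
    show "continuous_on UNIV (P n)" for n
      unfolding P_def N_def det3_def by (auto intro!: continuous_intros)
    show "min \<bar>K1 - L\<bar> \<bar>K2 - L\<bar> > 0" using ne by simp
    fix \<delta> :: real assume \<delta>: "\<delta> > 0" "\<delta> < min \<bar>K1 - L\<bar> \<bar>K2 - L\<bar>"
    then have "\<delta>\<^sup>2 < \<bar>K1 - L\<bar>\<^sup>2" "\<delta>\<^sup>2 < \<bar>K2 - L\<bar>\<^sup>2" by (intro power_strict_mono; simp)+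
    then have "0 < ((K1 - L)\<^sup>2 - \<delta>\<^sup>2) * ((K2 - L)\<^sup>2 - \<delta>\<^sup>2)" by simp
    moreover have "((L - (L - \<delta>)) * (K1 - (L - \<delta>)) * (K2 - (L - \<delta>))) * ((L - (L + \<delta>)) * (K1 - (L + \<delta>)) * (K2 - (L + \<delta>)))
      = - (\<delta>\<^sup>2 * (((K1 - L)\<^sup>2 - \<delta>\<^sup>2) * ((K2 - L)\<^sup>2 - \<delta>\<^sup>2)))"
      by (simp add: power2_eq_square algebra_simps)
    ultimately show "((L - (L - \<delta>)) * (K1 - (L - \<delta>)) * (K2 - (L - \<delta>))) * ((L - (L + \<delta>)) * (K1 - (L + \<delta>)) * (K2 - (L + \<delta>))) < 0"
      using \<delta> by simp
  qed
  then obtain x where x: "x \<longlonglongrightarrow> L" "\<forall>\<^sub>F n in sequentially. P n (x n) = 0" by blast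
  have "\<forall>\<^sub>F n in sequentially. \<exists>v1 v2 v3. (v1, v2, v3) \<noteq> (0, 0, 0) \<and>
      M n 1 1 * v1 + M n 1 2 * v2 + M n 1 3 * v3 = x n * v1 \<and>
      M n 2 1 * v1 + M n 2 2 * v2 + M n 2 3 * v3 = x n * v2 \<and>
      M n 3 1 * v1 + M n 3 2 * v2 + M n 3 3 * v3 = x n * v3"
    using x(2)
  proof eventually_elim
    case (elim n)
    then obtain v1 v2 v3 where v: "(v1, v2, v3) \<noteq> (0, 0, 0)"
      "\<forall>i\<in>{1, 2, 3}. N n (x n) i 1 * v1 + N n (x n) i 2 * v2 + N n (x n) i 3 * v3 = 0"
      using null_vector3[of "N n (x n)"] unfolding P_def by blast
    then have "N n (x n) 1 1 * v1 + N n (x n) 1 2 * v2 + N n (x n) 1 3 * v3 = 0"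
      "N n (x n) 2 1 * v1 + N n (x n) 2 2 * v2 + N n (x n) 2 3 * v3 = 0"
      "N n (x n) 3 1 * v1 + N n (x n) 3 2 * v2 + N n (x n) 3 3 * v3 = 0" by blast+
    then show ?case using v(1)
      by (intro exI[of _ v1] exI[of _ v2] exI[of _ v3]) (simp add: N_def algebra_simps)
  qed
  then show ?thesis using x(1) by blast
qed

section \<open>Critical points with ratio near -2 and their scaled equations\<close>

text \<open>
  For \<open>a = t b\<close> one of the two critical equations gives \<open>b\<^sup>3 = cube_fun n t\<close>. Inserting this
  in the other one leaves \<open>ratio_poly n t = 0\<close>.
\<close>

definition ratio_poly :: "real \<Rightarrow> real \<Rightarrow> real" where
  "ratio_poly n t = (t + 2) * (2 * t + n)\<^sup>2 * (t + n) + (1 + t) * t\<^sup>2 * (t\<^sup>2 + 4 * t + 2 * n)"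

definition cube_fun :: "real \<Rightarrow> real \<Rightarrow> real" where
  "cube_fun n t = - (1 + t) / ((2 * t + n)\<^sup>2 * (t + n))"

text \<open>
  The expansion of the root to this order suffices: an error \<open>O(n\<^sup>-\<^sup>4)\<close> in \<open>t\<close> changes \<open>b\<close> by \<open>O(n\<^sup>-\<^sup>5)\<close>.
\<close>

abbreviation ratio_lo :: "real \<Rightarrow> real" where "ratio_lo n \<equiv> - 2 + 8 / n ^ 2 + 64 / n ^ 3"
abbreviation ratio_hi :: "real \<Rightarrow> real" where "ratio_hi n \<equiv> - 2 + 8 / n ^ 2 + 64 / n ^ 3 + 1000 / n ^ 4"

text \<open>With \<open>t = -2 + s\<close> the leading balance of \<open>ratio_poly\<close> is
  \<open>n^3 s = 8 n\<close>, which is the origin of \<open>8 / n^2\<close>; the next order gives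
  \<open>64 / n^3\<close>.\<close>

lemma ratio_exists:
  "\<exists>t. \<forall>\<^sub>F n in sequentially. ratio_lo (real n) \<le> t n \<and> t n \<le> ratio_hi (real n) \<and> ratio_poly (real n) (t n) = 0"
proof -
  \<comment> \<open>The next coefficient of the root lies between 0 and 1000, so the polynomial is
    negative at the lower and positive at the upper end for large \<open>n\<close>.\<close>
  have lo: "\<forall>\<^sub>F n in sequentially. ratio_poly (real n) (ratio_lo (real n)) < 0"
    unfolding ratio_poly_def by real_asymp
  have hi: "\<forall>\<^sub>F n in sequentially. ratio_poly (real n) (ratio_hi (real n)) > 0"
    unfolding ratio_poly_def by real_asymp
  have "\<forall>\<^sub>F n in sequentially. \<exists>t. ratio_lo (real n) \<le> t \<and> t \<le> ratio_hi (real n) \<and> ratio_poly (real n) t = 0"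
    using lo hi eventually_gt_at_top[of 0]
  proof eventually_elim
    case (elim n)
    have "continuous_on {ratio_lo (real n)..ratio_hi (real n)} (ratio_poly (real n))"
      unfolding ratio_poly_def by (intro continuous_intros)
    moreover have "ratio_lo (real n) \<le> ratio_hi (real n)" by simp
    ultimately show ?case
      using IVT'[of "ratio_poly (real n)" "ratio_lo (real n)" 0 "ratio_hi (real n)"] elim by auto
  qed
  then show ?thesis
    by (intro exI[of _ "\<lambda>n. SOME t. ratio_lo (real n) \<le> t \<and> t \<le> ratio_hi (real n) \<and> ratio_poly (real n) t = 0"])
      (rule eventually_mono, assumption, rule someI_ex)
qed

text \<open>The value of \<open>b^3\<close> settles the off-diagonal critical equation. Combined
  with \<open>ratio_poly = 0\<close> it also yields
  \<open>b^3 t^2 (t^2 + 4 t + 2 n) = t + 2\<close>, that is \<open>gram_gap = a + 2 b\<close>, which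
  implies the other one.\<close>

lemma critical_from_ratio:
  fixes b t :: real and d :: nat
  assumes P: "ratio_poly (real d) t = 0" and b: "b ^ 3 = cube_fun (real d) t" and nz: "2 * t + real d \<noteq> 0" "t + real d \<noteq> 0"
  shows "gram_gap d (t * b) b = t * b + 2 * b" "critical d (mix d (t * b) b)"
proof -
  define n where "n = real d"
  have q: "gram_off d (t * b) b = b\<^sup>2 * (2 * t + n)"
    by (simp add: gram_off_def n_def power2_eq_square algebra_simps)
  have b3: "b ^ 3 * ((2 * t + n)\<^sup>2 * (t + n)) = - (1 + t)"
    using b nz by (simp add: cube_fun_def n_def)
  have "((2 * t + n)\<^sup>2 * (t + n)) * (b ^ 3 * t\<^sup>2 * (t\<^sup>2 + 4 * t + 2 * n)) = (b ^ 3 * ((2 * t + n)\<^sup>2 * (t + n))) * t\<^sup>2 * (t\<^sup>2 + 4 * t + 2 * n)"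
    by (simp only: mult_ac)
  also have "\<dots> = ((2 * t + n)\<^sup>2 * (t + n)) * (t + 2)"
    unfolding b3 using P unfolding ratio_poly_def n_def[symmetric] by (simp add: algebra_simps)
  finally have b3': "b ^ 3 * t\<^sup>2 * (t\<^sup>2 + 4 * t + 2 * n) = t + 2"
    using nz by (simp add: n_def)
  have "gram_gap d (t * b) b = b * (b ^ 3 * t\<^sup>2 * (t\<^sup>2 + 4 * t + 2 * n))"
    unfolding gram_gap_def q by (simp add: power2_eq_square power3_eq_cube algebra_simps)
  then show gap: "gram_gap d (t * b) b = t * b + 2 * b" unfolding b3' by (simp add: algebra_simps)
  have "(gram_off d (t * b) b)\<^sup>2 * (t * b + real d * b) = b\<^sup>2 * (b ^ 3 * ((2 * t + n)\<^sup>2 * (t + n)))"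
    unfolding q n_def by (simp add: power2_eq_square power3_eq_cube algebra_simps)
  then have off: "(gram_off d (t * b) b)\<^sup>2 * (t * b + real d * b) = b\<^sup>2 * - (1 + t)" unfolding b3 .
  then show "critical d (mix d (t * b) b)"
    by (intro critical_mix) (simp_all only: off gap, simp_all add: power2_eq_square algebra_simps)
qed

text \<open>With \<open>a\<close>, \<open>b\<close> and \<open>gram_off\<close> all written as
  multiples of \<open>e = 1 / d\<close>, the relation \<open>d e = 1\<close> removes
  \<open>d\<close> from the equations. Divided by \<open>e\<close> they have coefficients polynomial
  in \<open>e\<close>, so that a limit exists. By the critical equation
  \<open>gram_gap - 2 b\<close> is just \<open>a\<close>.\<close>

lemma std_eigenI:
  fixes \<alpha> \<beta> Q e :: real
  assumes e: "real d * e = 1" and q: "gram_off d (\<alpha> * e) (\<beta> * e) = Q * e"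
    and gap: "gram_gap d (\<alpha> * e) (\<beta> * e) = \<alpha> * e + 2 * (\<beta> * e)"
    and 1: "(4 * \<alpha>\<^sup>2 * Q * e\<^sup>2 + 4 * \<alpha> ^ 3 * (\<alpha> + \<beta>) * e ^ 3 - \<alpha>) * x + (4 * \<alpha> ^ 3 * e\<^sup>2 * (\<alpha> * e + \<beta>) - 2 * \<alpha>) * y
      + (4 * \<alpha> ^ 4 * e ^ 3 - 2 * \<alpha>) * z = \<nu> * x"
    and 2: "(2 * \<alpha> * \<beta> * Q * e\<^sup>2 + 2 * \<beta> * (Q * e * (2 * \<alpha> * e + \<beta>) + 2 * \<alpha>\<^sup>2 * (\<alpha> + \<beta>) * e ^ 3)) * x
      + (2 * \<alpha> * Q * e * (\<alpha> * e + \<beta>) + 2 * \<beta> * (Q * (\<alpha> * e + \<beta>) + 2 * \<alpha>\<^sup>2 * e\<^sup>2 * (\<alpha> * e + \<beta>)) + \<alpha>) * y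
      + (2 * \<alpha>\<^sup>2 * Q * e\<^sup>2 + 2 * \<beta> * (Q * \<alpha> * e + 2 * \<alpha> ^ 3 * e ^ 3)) * z = \<nu> * y"
    and 3: "(2 * \<alpha> * \<beta> * Q * e\<^sup>2 + Q\<^sup>2 * e) * x + (2 * \<alpha> * Q * e * (\<alpha> * e + \<beta>)) * y + (2 * \<alpha>\<^sup>2 * Q * e\<^sup>2 + Q\<^sup>2 + \<alpha>) * z = \<nu> * z"
  shows "std_eigen d (\<alpha> * e) (\<beta> * e) (\<nu> * e) x y z"
proof -
  define m where "m = \<alpha> * e * (y + z) + \<beta> * e * x + \<beta> * y"
  have m: "\<alpha> * e * (y + z) + \<beta> * e * (x + real d * y) = m"
  proof -
    have "\<beta> * e * (x + real d * y) = \<beta> * e * x + \<beta> * (real d * e) * y" by (simp add: algebra_simps)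
    then show ?thesis unfolding e m_def by simp
  qed
  have qm: "Q * e * (2 * (\<alpha> * e) * x + real d * m) = 2 * Q * \<alpha> * e\<^sup>2 * x + Q * m"
  proof -
    have "Q * e * (2 * (\<alpha> * e) * x + real d * m) = 2 * Q * \<alpha> * e\<^sup>2 * x + Q * (real d * e) * m"
      by (simp add: algebra_simps power2_eq_square)
    then show ?thesis unfolding e by simp
  qed
  have qz: "(Q * e)\<^sup>2 * (x + real d * z) = Q\<^sup>2 * e * (e * x + z)"
  proof -
    have "(Q * e)\<^sup>2 * (x + real d * z) = Q\<^sup>2 * e * (e * x + (real d * e) * z)"
      by (simp add: algebra_simps power2_eq_square)
    then show ?thesis unfolding e by simp
  qed
  have \<kappa>: "\<alpha> * e + 2 * (\<beta> * e) - 2 * (\<beta> * e) = \<alpha> * e" by simp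
  \<comment> \<open>The hypotheses are the equations divided by \<open>e\<close>; multiplying back
    by \<open>e\<close> restores them.\<close>
  note h1 = arg_cong[OF 1, of "\<lambda>u. e * u"] and h2 = arg_cong[OF 2, of "\<lambda>u. e * u"] and h3 = arg_cong[OF 3, of "\<lambda>u. e * u"]
  show ?thesis
    unfolding std_eigen_def Let_def q gap m \<kappa> mult.assoc[of 2 "\<alpha> * e"] qm[unfolded mult.assoc[of 2 "\<alpha> * e"]] qz
  proof (intro conjI)
    show "4 * (\<alpha> * e)\<^sup>2 * (Q * e) * x + 4 * (\<alpha> * e) ^ 3 * (\<alpha> * e * x + m) + \<alpha> * e * x - 2 * (\<alpha> * e * (x + y + z)) = \<nu> * e * x"
      using h1 unfolding m_def by (simp add: algebra_simps power2_eq_square power3_eq_cube power4_eq_xxxx)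
    show "2 * (\<alpha> * e * (Q * e)) * m + 2 * (\<beta> * e) * (2 * Q * \<alpha> * e\<^sup>2 * x + Q * m + 2 * (\<alpha> * e)\<^sup>2 * (\<alpha> * e * x + m)) + \<alpha> * e * y = \<nu> * e * y"
      using h2 unfolding m_def by (simp add: algebra_simps power2_eq_square power3_eq_cube)
    show "2 * (\<alpha> * e * (Q * e)) * m + Q\<^sup>2 * e * (e * x + z) + \<alpha> * e * z = \<nu> * e * z"
      using h3 unfolding m_def by (simp add: algebra_simps power2_eq_square)
  qed
qed

lemma triv_eigenI:
  fixes \<alpha> \<beta> Q e :: real
  assumes e: "real d * e = 1" and q: "gram_off d (\<alpha> * e) (\<beta> * e) = Q * e"
    and gap: "gram_gap d (\<alpha> * e) (\<beta> * e) = \<alpha> * e + 2 * (\<beta> * e)"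
    and 1: "(4 * \<alpha>\<^sup>2 * Q * e\<^sup>2 + 4 * \<alpha> ^ 3 * (\<alpha> + \<beta>) * e ^ 3 - \<alpha>) * x + (4 * \<alpha> ^ 3 * e\<^sup>2 * (\<alpha> * e + \<beta>) - 2 * \<alpha>) * y = \<nu> * x"
    and 2: "(4 * \<alpha> * Q * \<beta> * e\<^sup>2 + 4 * \<beta> * (Q * \<alpha> * e\<^sup>2 + Q * \<beta> * e + \<alpha>\<^sup>2 * e\<^sup>2 * (\<alpha> * e + \<beta> * e)) + Q\<^sup>2 * e) * x
      + ((4 * \<alpha> * Q * e + 4 * \<beta> * Q + 4 * \<beta> * \<alpha>\<^sup>2 * e\<^sup>2) * (\<alpha> * e + \<beta>) + Q\<^sup>2 + \<alpha>) * y = \<nu> * y"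
  shows "triv_eigen d (\<alpha> * e) (\<beta> * e) (\<nu> * e) x y"
proof -
  define m where "m = \<alpha> * e * y + \<beta> * e * x + \<beta> * y"
  have m: "\<alpha> * e * y + \<beta> * e * (x + real d * y) = m"
  proof -
    have "\<beta> * e * (x + real d * y) = \<beta> * e * x + \<beta> * (real d * e) * y" by (simp add: algebra_simps)
    then show ?thesis unfolding e m_def by simp
  qed
  have qm: "Q * e * (\<alpha> * e * x + real d * m) = Q * \<alpha> * e\<^sup>2 * x + Q * m"
  proof -
    have "Q * e * (\<alpha> * e * x + real d * m) = Q * \<alpha> * e\<^sup>2 * x + Q * (real d * e) * m"
      by (simp add: algebra_simps power2_eq_square)
    then show ?thesis unfolding e by simp
  qed
  have qz: "(Q * e)\<^sup>2 * (x + real d * y) = Q\<^sup>2 * e * (e * x + y)"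
  proof -
    have "(Q * e)\<^sup>2 * (x + real d * y) = Q\<^sup>2 * e * (e * x + (real d * e) * y)"
      by (simp add: algebra_simps power2_eq_square)
    then show ?thesis unfolding e by simp
  qed
  have \<kappa>: "\<alpha> * e + 2 * (\<beta> * e) - 2 * (\<beta> * e) = \<alpha> * e" by simp
  note h1 = arg_cong[OF 1, of "\<lambda>u. e * u"] and h2 = arg_cong[OF 2, of "\<lambda>u. e * u"]
  show ?thesis
    unfolding triv_eigen_def Let_def q gap m \<kappa> qm qz
  proof (intro conjI)
    show "4 * (\<alpha> * e)\<^sup>2 * (Q * e) * x + 4 * (\<alpha> * e) ^ 3 * (\<alpha> * e * x + m) + \<alpha> * e * x - 2 * (\<alpha> * e) * (x + y) = \<nu> * e * x"
      using h1 unfolding m_def by (simp add: algebra_simps power2_eq_square power3_eq_cube)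
    show "4 * (\<alpha> * e) * (Q * e) * m + 4 * (\<beta> * e) * (Q * \<alpha> * e\<^sup>2 * x + Q * m + (\<alpha> * e)\<^sup>2 * (\<alpha> * e * x + m))
        + Q\<^sup>2 * e * (e * x + y) + \<alpha> * e * y = \<nu> * e * y"
      using h2 unfolding m_def by (simp add: algebra_simps power2_eq_square power3_eq_cube)
  qed
qed

text \<open>If the determinant vanished, the eigenvalue equations would force every product of a
  coordinate of one vector with a coordinate of the other to be 0, so one of them would be
  zero.\<close>

lemma distinct_eigenvalues_indep2:
  fixes p q r s :: real
  assumes "p * v1 + q * w1 = x1 * v1" "r * v1 + s * w1 = x1 * w1" "p * v2 + q * w2 = x2 * v2" "r * v2 + s * w2 = x2 * w2"
    and nz: "v1 \<noteq> 0 \<or> w1 \<noteq> 0" "v2 \<noteq> 0 \<or> w2 \<noteq> 0" and ne: "x1 \<noteq> x2"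
  shows "v1 * w2 \<noteq> v2 * w1"
proof
  assume eq: "v1 * w2 = v2 * w1"
  have "(x1 - x2) * (v1 * v2) = (x1 * v1) * v2 - (x2 * v2) * v1" by (simp add: algebra_simps)
  also have "\<dots> = q * (v2 * w1 - v1 * w2)" unfolding assms(1,3)[symmetric] by (simp add: algebra_simps)
  finally have a: "v1 * v2 = 0" using eq ne by simp
  have "(x1 - x2) * (w1 * w2) = (x1 * w1) * w2 - (x2 * w2) * w1" by (simp add: algebra_simps)
  also have "\<dots> = r * (v1 * w2 - v2 * w1)" unfolding assms(2,4)[symmetric] by (simp add: algebra_simps)
  finally have b: "w1 * w2 = 0" using eq ne by simp
  have "(x1 - x2) * (v1 * w2) = (x1 * v1) * w2 - (x2 * v2) * w1 - x2 * (v1 * w2 - v2 * w1)" by (simp add: algebra_simps)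
  also have "\<dots> = (p - x2) * (v1 * w2 - v2 * w1)" unfolding assms(1,3)[symmetric] by (simp add: algebra_simps)
  finally have c: "v1 * w2 = 0" using eq ne by simp
  then have "v2 * w1 = 0" using eq by simp
  then show False using a b c nz by auto
qed

text \<open>Applying \<open>(F - u) (F - v)\<close> with two of the eigenvalues annihilates two of
  the three terms of a vanishing combination.\<close>

lemma distinct_eigenvalues_indep3:
  fixes F :: "real \<times> real \<times> real \<Rightarrow> real \<times> real \<times> real"
  assumes F: "linear F" and eig: "F p1 = x1 *\<^sub>R p1" "F p2 = x2 *\<^sub>R p2" "F p3 = x3 *\<^sub>R p3"
    and nz: "p1 \<noteq> 0" "p2 \<noteq> 0" "p3 \<noteq> 0" and ne: "x1 \<noteq> x2" "x1 \<noteq> x3" "x2 \<noteq> x3"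
  shows "indep3 p1 p2 p3"
  unfolding indep3_def
proof (intro allI impI)
  fix c1 c2 c3 :: real assume 0: "c1 *\<^sub>R p1 + c2 *\<^sub>R p2 + c3 *\<^sub>R p3 = 0"
  have 1: "(c1 * x1) *\<^sub>R p1 + (c2 * x2) *\<^sub>R p2 + (c3 * x3) *\<^sub>R p3 = 0"
    using arg_cong[OF 0, of F] by (simp add: linear_add[OF F] linear_scale[OF F] linear_0[OF F] eig)
  have 2: "(c1 * x1 * x1) *\<^sub>R p1 + (c2 * x2 * x2) *\<^sub>R p2 + (c3 * x3 * x3) *\<^sub>R p3 = 0"
    using arg_cong[OF 1, of F] by (simp add: linear_add[OF F] linear_scale[OF F] linear_0[OF F] eig)
  have comb: "(c1 * x1 * x1) *\<^sub>R p1 + (c2 * x2 * x2) *\<^sub>R p2 + (c3 * x3 * x3) *\<^sub>R p3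
      - (u + v) *\<^sub>R ((c1 * x1) *\<^sub>R p1 + (c2 * x2) *\<^sub>R p2 + (c3 * x3) *\<^sub>R p3) + (u * v) *\<^sub>R (c1 *\<^sub>R p1 + c2 *\<^sub>R p2 + c3 *\<^sub>R p3) = 0" for u v
    unfolding 0 1 2 by simp
  have "(c1 * ((x1 - x2) * (x1 - x3))) *\<^sub>R p1 = 0" using comb[of x2 x3] by (simp add: algebra_simps)
  moreover have "(c2 * ((x2 - x1) * (x2 - x3))) *\<^sub>R p2 = 0" using comb[of x1 x3] by (simp add: algebra_simps)
  moreover have "(c3 * ((x3 - x1) * (x3 - x2))) *\<^sub>R p3 = 0" using comb[of x1 x2] by (simp add: algebra_simps)
  ultimately show "c1 = 0 \<and> c2 = 0 \<and> c3 = 0" using nz ne by simp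
qed

section \<open>Isotropy, orbits and spectra of the exact families and of the block shape\<close>

lemma id_mat_eq_mix: "id_mat d = mix d 1 0"
  by (intro ext) (auto simp: id_mat_def mix_def)

lemma ones_mat_eq_mix: "ones_mat d = mix d 0 1"
  by (intro ext) (auto simp: ones_mat_def mix_def)

text \<open>For \<open>a\<close> nonzero the value \<open>a + b\<close> marks exactly the diagonal
  positions, so the row and the column permutation must agree.\<close>

lemma isotropy_mix:
  assumes "a \<noteq> 0"
  shows "isotropy d (mix d a b) = Delta (carrier (sym_group d))"
proof (intro equalityI subrelI)
  fix g h assume "(g, h) \<in> isotropy d (mix d a b)"
  then have gh: "g permutes {1..d}" "h permutes {1..d}" "mix d a b (g i) (h j) = mix d a b i j" for i j
    unfolding isotropy_iff by blast+
  have "g i = h i" for i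
  proof (cases "i \<in> {1..d}")
    case True
    then have R: "g i \<in> {1..d}" "h i \<in> {1..d}" unfolding permutes_range[OF gh(1)] permutes_range[OF gh(2)] by blast+
    show ?thesis
      using gh(3)[of i i] assms unfolding mix_entry[OF True True] mix_entry[OF R] by (simp split: if_splits)
  next
    case False
    then show ?thesis using permutes_not_in[OF gh(1)] permutes_not_in[OF gh(2)] by simp
  qed
  then have "g = h" by (intro ext)
  then show "(g, h) \<in> Delta (carrier (sym_group d))" unfolding Delta_iff carrier_sym_group using gh(1) by blast
next
  fix g h assume "(g, h) \<in> Delta (carrier (sym_group d))"
  then have hg: "h = g" and g: "g permutes {1..d}" unfolding Delta_iff carrier_sym_group by blast+
  show "(g, h) \<in> isotropy d (mix d a b)"
    unfolding isotropy_iff mix_def hg permutes_range[OF g] permutes_eq[OF g] using g by blast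
qed

lemma isotropy_mix_0: "isotropy d (mix d 0 b) = carrier (sym_group d) \<times> carrier (sym_group d)"
proof (intro equalityI subrelI)
  fix g h assume "(g, h) \<in> isotropy d (mix d 0 b)"
  then show "(g, h) \<in> carrier (sym_group d) \<times> carrier (sym_group d)"
    unfolding isotropy_iff mem_Sigma_iff carrier_sym_group by blast
next
  fix g h assume "(g, h) \<in> carrier (sym_group d) \<times> carrier (sym_group d)"
  then have gh: "g permutes {1..d}" "h permutes {1..d}" unfolding mem_Sigma_iff carrier_sym_group by blast+
  then show "(g, h) \<in> isotropy d (mix d 0 b)"
    unfolding isotropy_iff mix_def permutes_range[OF gh(1)] permutes_range[OF gh(2)] by simp
qed

lemma orbit_length_mix: "a \<noteq> 0 \<Longrightarrow> orbit_length d (mix d a b) = fact d"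
  using orbit_length_isotropy[of d "mix d a b"] by (simp add: isotropy_mix card_Delta card_sym_group)

lemma orbit_length_mix_0: "orbit_length d (mix d 0 b) = 1"
  using orbit_length_isotropy[of d "mix d 0 b"] by (simp add: isotropy_mix_0 card_cartesian_product card_sym_group)

lemma critical_id: "critical d (mix d 1 0)"
  by (rule critical_mix) (simp_all add: gram_off_def gram_gap_def)

lemma loss_id: "loss d (mix d 1 0) = 0"
  unfolding loss_mix by (simp add: gram_off_def)

lemma critical_const: "d \<ge> 1 \<Longrightarrow> critical d (mix d 0 (1 / real d))"
  by (rule critical_mix) (simp_all add: gram_off_def gram_gap_def power2_eq_square)

lemma loss_const: "d \<ge> 1 \<Longrightarrow> loss d (mix d 0 (1 / real d)) = real d - 1 / real d"
  unfolding loss_mix by (simp add: gram_off_def field_simps power2_eq_square power3_eq_cube)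

lemma critical_zero: "critical d (mix d 0 0)"
  by (rule critical_mix) (simp_all add: gram_off_def gram_gap_def)

lemma spectrum_id:
  assumes "d \<ge> 3"
  shows "has_spectrum_by_type (hessian d (mix d 1 0)) (Mat d d)
    [(type_t d, {#18, 6#}), (type_s d, repeat_mset (d - 1) {#18, 6, 6#}),
     (type_x d, replicate_mset ((d - 1) * (d - 2) div 2) 6), (type_y d, replicate_mset (d * (d - 3) div 2) 6)]"
proof -
  have q: "gram_off d 1 0 = 0" "gram_gap d 1 0 = 1" by (simp_all add: gram_off_def gram_gap_def)
  have "has_spectrum_by_type (hessian d (mix d 1 0)) (Mat d d) (mix_spectrum d 1 0 {#6 * 3, 6 * 1#} {#6 * 3, 6 * 1, 6 * 1#})"
    \<comment> \<open>Eigenvectors at the identity: \<open>(1, 0)\<close> and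
      \<open>(1, 0, 0)\<close> have eigenvalue 3; \<open>(1, -1)\<close>, \<open>(1, -1, 0)\<close>
      and \<open>(1, 0, -1)\<close>, all describing matrices with zero diagonal, have eigenvalue
      1.\<close>
    by (rule mix_spectrum(1)[OF assms, of 1 0 3 1 0 1 "-1" 1 3 1 0 0 1 "-1" 1 0 1 "-1" 0 1])
      (auto simp: triv_eigen_def std_eigen_def q indep3_def zero_prod_def)
  then show ?thesis by (simp add: mix_spectrum_def q)
qed

lemma C_4_eq: "C_4 d = direct_sum (d - 2) (mix (d - 2) 1 0) (mix 2 0 (1 / real 2))"
  unfolding C_4_def id_mat_eq_mix ones_mat_eq_mix mix_scale by simp

text \<open>The identity block contributes 18 and 6, the constant block 9, 0, -3, -6, the upper
  mixed block only 6, and the lower one 3 and 0, each \<open>d - 2\<close> times.\<close>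

lemma spectrum_C_4:
  assumes d: "d \<ge> 2"
  shows "has_spectrum (hessian d (C_4 d)) (Mat d d)
    (replicate_mset (d - 2) 18 + replicate_mset 1 9 + replicate_mset (d\<^sup>2 + 2 - 3 * d) 6 + replicate_mset (d - 2) 3 +
     replicate_mset (d - 1) 0 + replicate_mset 1 (- 3) + replicate_mset 1 (- 6))" (is "has_spectrum _ _ ?S")
proof -
  define n where "n = d - 2"
  have dn: "d = n + 2" using d by (simp add: n_def)
  let ?A = "mix n 1 0" and ?B = "mix 2 0 (1 / real 2)"
  have B: "diagonal_on (hessian 2 ?B) (Mat 2 2) ({#9#} + (replicate_mset 1 0 + (replicate_mset 1 (- 3) + replicate_mset 1 (- 6))))"
    using prod_type_spectrum(2)[of 2] by simp
  have q: "gram_off 2 0 (1 / real 2) = 1 / 2" "gram_gap 2 0 (1 / real 2) = 0"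
    by (simp_all add: gram_off_def gram_gap_def power2_eq_square)
  have low: "diagonal_on (hessian (n + 2) (direct_sum n ?A ?B)) (Supp {n + 1..n + 2} {1..n}) (replicate_mset n 3 + replicate_mset n 0)"
    using diagonal_on_lower_block[of 2 n ?A 0 "1 / real 2"] unfolding q by (simp add: power2_eq_square)
  note D = diagonal_on_direct_sum[OF diagonal_on_id B diagonal_on_upper_block_id low]
  \<comment> \<open>The addition precedes the subtraction of \<open>3 * d\<close>, so the natural
    number is the intended \<open>(d - 1) * (d - 2)\<close>.\<close>
  have count: "d\<^sup>2 + 2 - 3 * d = (n * n - n) + n * 2"
  proof -
    have "d\<^sup>2 + 2 = n * n + n + 3 * d" by (simp add: dn power2_eq_square)
    moreover have "n \<le> n * n" by simp
    ultimately show ?thesis by simp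
  qed
  have E: "replicate_mset n 18 + replicate_mset (n * n - n) 6 +
      ({#9#} + (replicate_mset 1 0 + (replicate_mset 1 (- 3) + replicate_mset 1 (- 6)))) +
      replicate_mset (n * 2) 6 + (replicate_mset n 3 + replicate_mset n 0) = ?S"
    unfolding count by (rule multiset_eqI) (simp add: dn)
  have C: "C_4 d = direct_sum n ?A ?B" unfolding C_4_eq n_def ..
  show ?thesis using diagonal_on_has_spectrum[OF linear_hessian D] unfolding E C dn[symmetric] .
qed

text \<open>The single unit entry is absorbed into the identity block: the matrix is the identity of
  size \<open>d - 1\<close> bordered by a zero row and a zero column.\<close>

lemma C_5_eq:
  assumes "d \<ge> 2"
  shows "C_5 d = direct_sum (d - 1) (mix (d - 1) 1 0) (mix 1 0 0)"
proof (intro ext)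
  fix i j
  have "C_5 d i j = of_bool (i = j \<and> 1 \<le> i \<and> i \<le> d - 1)"
    using assms by (auto simp: C_5_def direct_sum_def id_mat_def unit_mat_def)
  moreover have "direct_sum (d - 1) (mix (d - 1) 1 0) (mix 1 0 0) i j = of_bool (i = j \<and> 1 \<le> i \<and> i \<le> d - 1)"
    by (auto simp: direct_sum_def mix_def)
  ultimately show "C_5 d i j = direct_sum (d - 1) (mix (d - 1) 1 0) (mix 1 0 0) i j" by simp
qed

lemma C_5_entry: "d \<ge> 2 \<Longrightarrow> C_5 d i j = of_bool (i = j \<and> i \<in> {1..d - 1})"
  unfolding C_5_eq by (auto simp: direct_sum_def mix_def)

lemma spectrum_C_5:
  assumes d: "d \<ge> 2"
  shows "has_spectrum (hessian d (C_5 d)) (Mat d d)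
    (replicate_mset (d - 1) 18 + replicate_mset ((d - 1)\<^sup>2) 6 + replicate_mset d 0)" (is "has_spectrum _ _ ?S")
proof -
  define n where "n = d - 1"
  have dn: "d = n + 1" using d by (simp add: n_def)
  let ?A = "mix n 1 0" and ?B = "mix 1 0 0"
  have q: "gram_off 1 0 0 = 0" "gram_gap 1 0 0 = 0" by (simp_all add: gram_off_def gram_gap_def)
  have low: "diagonal_on (hessian (n + 1) (direct_sum n ?A ?B)) (Supp {n + 1..n + 1} {1..n}) (replicate_mset n 0)"
    using diagonal_on_lower_block[of 1 n ?A 0 0] unfolding q by simp
  note D = diagonal_on_direct_sum[OF diagonal_on_id diagonal_on_zero_mat diagonal_on_upper_block_id low]
  have count: "(d - 1)\<^sup>2 = (n * n - n) + n * 1" by (simp add: dn power2_eq_square)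
  have E: "replicate_mset n 18 + replicate_mset (n * n - n) 6 + replicate_mset (1 * 1) 0 + replicate_mset (n * 1) 6 + replicate_mset n 0 = ?S"
    unfolding count by (rule multiset_eqI) (simp add: dn)
  have C: "C_5 d = direct_sum n ?A ?B" unfolding C_5_eq[OF d] n_def ..
  show ?thesis using diagonal_on_has_spectrum[OF linear_hessian D] unfolding E C dn[symmetric] .
qed

text \<open>Row \<open>d\<close> and column \<open>d\<close> are the only zero ones, so both
  permutations fix \<open>d\<close>; the ones on the diagonal make them agree elsewhere. The index
  \<open>d - 1\<close> is not distinguished from the smaller ones.\<close>

lemma isotropy_C_5:
  assumes d: "d \<ge> 2"
  shows "isotropy d (C_5 d) = Delta (fix_last d)"
proof (intro equalityI subrelI)
  fix g h assume "(g, h) \<in> isotropy d (C_5 d)"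
  then have gh: "g permutes {1..d}" "h permutes {1..d}"
    and inv: "(of_bool (g i = h j \<and> g i \<in> {1..d - 1}) :: real) = of_bool (i = j \<and> i \<in> {1..d - 1})" for i j
    unfolding isotropy_iff C_5_entry[OF d] by blast+
  have inv': "g i = h j \<and> g i \<in> {1..d - 1} \<longleftrightarrow> i = j \<and> i \<in> {1..d - 1}" for i j
    using inv[of i j] by (simp only: of_bool_eq_iff)
  have R: "x \<in> {1..d} \<longleftrightarrow> x \<in> {1..d - 1} \<or> x = d" for x using d by auto
  have "d \<in> {1..d}" using d by simp
  then have "g d \<in> {1..d}" "h d \<in> {1..d}" unfolding permutes_range[OF gh(1)] permutes_range[OF gh(2)] by blast+
  have dn: "d \<notin> {1..d - 1}" using d by simp
  \<comment> \<open>Otherwise row \<open>d\<close> would be moved to a row that contains a 1,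
    whereas row \<open>d\<close> is zero.\<close>
  have gd: "g d = d"
  proof (rule ccontr)
    assume "g d \<noteq> d"
    then have gd: "g d \<in> {1..d - 1}" using \<open>g d \<in> {1..d}\<close> R by blast
    obtain j where "h j = g d" using permutes_surj[OF gh(2)] by (metis surjD)
    then show False using inv'[of d j] gd dn by auto
  qed
  have hd: "h d = d"
  proof (rule ccontr)
    assume "h d \<noteq> d"
    then have hd: "h d \<in> {1..d - 1}" using \<open>h d \<in> {1..d}\<close> R by blast
    obtain i where "g i = h d" using permutes_surj[OF gh(1)] by (metis surjD)
    then show False using inv'[of i d] hd dn by auto
  qed
  have "g i = h i" for i
  proof (cases "i \<in> {1..d - 1}")
    case True then show ?thesis using inv'[of i i] by blast
  next
    case False
    then have "i = d \<or> i \<notin> {1..d}" using R by blast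
    then show ?thesis using gd hd permutes_not_in[OF gh(1)] permutes_not_in[OF gh(2)] by metis
  qed
  then have "g = h" by (intro ext)
  then show "(g, h) \<in> Delta (fix_last d)"
    unfolding Delta_iff fix_last_def mem_Collect_eq carrier_sym_group using gh gd by blast
next
  fix g h assume "(g, h) \<in> Delta (fix_last d)"
  then have "h = g" and g: "g permutes {1..d - 1}"
    using d unfolding Delta_iff by (auto simp: fix_last_eq)
  have "g permutes {1..d}" using g by (rule permutes_subset) auto
  then show "(g, h) \<in> isotropy d (C_5 d)"
    unfolding isotropy_iff C_5_entry[OF d] \<open>h = g\<close> permutes_range[OF g] permutes_eq[OF g] by blast
qed

text \<open>The quotient of \<open>d!^2\<close> by \<open>(d - 1)!\<close>.\<close>

lemma orbit_length_fix_last: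
  assumes d: "d \<ge> 1" and iso: "isotropy d W = Delta (fix_last d)"
  shows "orbit_length d W = d * fact d"
proof -
  have f: "(fact d :: nat) = d * fact (d - 1)" using d by (simp add: fact_reduce)
  have c: "card (isotropy d W) = fact (d - 1)" unfolding iso card_Delta by (rule card_fix_last[OF d])
  have "orbit_length d W * fact (d - 1) = fact d * fact d"
    using orbit_length_isotropy[of d W] unfolding c .
  also have "\<dots> = (d * fact d) * fact (d - 1)" by (subst f) (simp only: mult_ac)
  finally show ?thesis by simp
qed

text \<open>Row \<open>d\<close> has one nonzero entry and every other row has \<open>d - 1\<close>,
  at least two; columns likewise. So \<open>d\<close> is fixed on both sides, and the two different
  values in the large block force the permutations to agree.\<close>

lemma isotropy_Xi:
  assumes d: "d \<ge> 3" and x: "x1 \<noteq> x2" "x1 \<noteq> 0" "x2 \<noteq> 0"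
  shows "isotropy d (Xi d x1 x2 0 0 1) = Delta (fix_last d)"
proof (intro equalityI subrelI)
  let ?X = "Xi d x1 x2 0 0 1"
  have R: "x \<in> {1..d} \<longleftrightarrow> x \<in> {1..d - 1} \<or> x = d" for x using d by auto
  have dn: "d \<notin> {1..d - 1}" "d \<in> {1..d}" using d by simp_all
  have up: "?X i j = (if i = j then x1 else x2)" if "i \<in> {1..d - 1}" "j \<in> {1..d - 1}" for i j
    using that d by (auto simp: Xi_def)
  have side: "?X i d = 0" "?X d i = 0" if "i \<in> {1..d - 1}" for i using that d by (auto simp: Xi_def)
  fix g h assume "(g, h) \<in> isotropy d ?X"
  then have gh: "g permutes {1..d}" "h permutes {1..d}" and inv: "?X (g i) (h j) = ?X i j" for i j
    unfolding isotropy_iff by blast+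
  have two: "1 \<in> {1..d - 1}" "2 \<in> {1..d - 1}" using d by auto
  have gR: "g x \<in> {1..d} \<longleftrightarrow> x \<in> {1..d}" "h x \<in> {1..d} \<longleftrightarrow> x \<in> {1..d}" for x
    using permutes_range[OF gh(1)] permutes_range[OF gh(2)] by blast+
  have gd: "g i \<noteq> d" if i: "i \<in> {1..d - 1}" for i
  proof
    assume gi: "g i = d"
    \<comment> \<open>The entry at \<open>i j\<close> is nonzero and row \<open>d\<close> is nonzero
      only in column \<open>d\<close>; so all columns below \<open>d\<close> would be sent to
      \<open>d\<close>, contradicting injectivity.\<close>
    have "h j = d" if "j \<in> {1..d - 1}" for j
    proof (rule ccontr)
      assume "h j \<noteq> d"
      moreover have "h j \<in> {1..d}" using that R gR(2) by blast
      ultimately have "h j \<in> {1..d - 1}" using R by blast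
      then have "?X (g i) (h j) = 0" unfolding gi by (rule side)
      then show False using inv[of i j] up[OF i that] x by (simp split: if_splits)
    qed
    then have "h 1 = h 2" using two by metis
    then show False using permutes_eq[OF gh(2), of 1 2] by simp
  qed
  have hd: "h i \<noteq> d" if i: "i \<in> {1..d - 1}" for i
  proof
    assume hi: "h i = d"
    have "g j = d" if "j \<in> {1..d - 1}" for j using gd[OF that] side(1)[of "g j"] inv[of j i] up[OF that i] x hi R[of "g j"] gR(1)[of j] R[of j] that
      by (auto simp del: atLeastAtMost_iff split: if_splits)
    then show False using gd[OF two(1)] two by blast
  qed
  have gU: "g i \<in> {1..d - 1}" "h i \<in> {1..d - 1}" if "i \<in> {1..d - 1}" for i
    using gd[OF that] hd[OF that] that R gR by blast+
  have lt: "g i = h i" if "i \<in> {1..d - 1}" for i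
    using inv[of i i] up[OF gU(1)[OF that] gU(2)[OF that]] up[OF that that] x(1) by (simp split: if_splits)
  have last: "g d = d" "h d = d"
  proof -
    obtain i where i: "g i = d" using permutes_surj[OF gh(1)] by (metis surjD)
    then show "g d = d" using gd dn gR(1)[of i] R[of i] by metis
    obtain i where i: "h i = d" using permutes_surj[OF gh(2)] by (metis surjD)
    then show "h d = d" using hd dn gR(2)[of i] R[of i] by metis
  qed
  have "g i = h i" for i
  proof (cases "i \<in> {1..d - 1}")
    case False
    then have "i = d \<or> i \<notin> {1..d}" using R by blast
    then show ?thesis using last permutes_not_in[OF gh(1)] permutes_not_in[OF gh(2)] by metis
  qed (rule lt)
  then have "g = h" by (intro ext)
  then show "(g, h) \<in> Delta (fix_last d)"
    unfolding Delta_iff fix_last_def mem_Collect_eq carrier_sym_group using gh last by blast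
next
  let ?X = "Xi d x1 x2 0 0 1"
  fix g h assume "(g, h) \<in> Delta (fix_last d)"
  then have hg: "h = g" and g: "g permutes {1..d}" "g d = d"
    unfolding Delta_iff fix_last_def mem_Collect_eq carrier_sym_group by blast+
  have lt: "g i < d \<longleftrightarrow> i < d" if "i \<in> {1..d}" for i
  proof -
    have "g i \<in> {1..d}" using that unfolding permutes_range[OF g(1)] .
    moreover have "g i = d \<longleftrightarrow> i = d" using permutes_eq[OF g(1), of i d] g(2) by simp
    ultimately show ?thesis using that by auto
  qed
  have "?X (g i) (g j) = ?X i j" for i j
    unfolding Xi_def permutes_range[OF g(1)] permutes_eq[OF g(1)]
    by (cases "i \<in> {1..d} \<and> j \<in> {1..d}") (simp_all add: lt del: atLeastAtMost_iff)
  then show "(g, h) \<in> isotropy d ?X" unfolding isotropy_iff hg using g(1) by blast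
qed

lemma C_4_entry:
  assumes "d \<ge> 2"
  shows "C_4 d i j = (if i \<in> {1..d - 2} \<and> j = i then 1 else if i \<in> {d - 1, d} \<and> j \<in> {d - 1, d} then 1 / 2 else 0)"
  using assms unfolding C_4_eq by (auto simp: direct_sum_def mix_def)

text \<open>The last two rows of \<open>C_4\<close> are equal, and so are its last two columns.
  Hence they can be exchanged independently, and the isotropy group is larger than a diagonal
  group.\<close>

definition pair_group :: "nat \<Rightarrow> ((nat \<Rightarrow> nat) \<times> (nat \<Rightarrow> nat)) set" where
  "pair_group d = {(g, h). g \<in> preserve_last_two d \<and> h \<in> preserve_last_two d \<and> (\<forall>i\<in>{1..d - 2}. g i = h i)}"

lemma preserve_last_two_upper:
  assumes d: "d \<ge> 2" and g: "g \<in> preserve_last_two d"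
  shows "g permutes {1..d}" "g i \<in> {d - 1, d} \<longleftrightarrow> i \<in> {d - 1, d}" "g i \<in> {1..d - 2} \<longleftrightarrow> i \<in> {1..d - 2}"
proof -
  show p: "g permutes {1..d}" and im: "g i \<in> {d - 1, d} \<longleftrightarrow> i \<in> {d - 1, d}"
  proof -
    show p: "g permutes {1..d}" using g unfolding preserve_last_two_def mem_Collect_eq carrier_sym_group by blast
    have "g ` {d - 1, d} = {d - 1, d}" using g unfolding preserve_last_two_def by blast
    then have "g i \<in> {d - 1, d} \<longleftrightarrow> g i \<in> g ` {d - 1, d}" by simp
    also have "\<dots> \<longleftrightarrow> i \<in> {d - 1, d}" by (rule inj_image_mem_iff[OF permutes_inj[OF p]])
    finally show "g i \<in> {d - 1, d} \<longleftrightarrow> i \<in> {d - 1, d}" .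
  qed
  have R: "x \<in> {1..d - 2} \<longleftrightarrow> x \<in> {1..d} \<and> x \<notin> {d - 1, d}" for x using d by auto
  show "g i \<in> {1..d - 2} \<longleftrightarrow> i \<in> {1..d - 2}" unfolding R im permutes_range[OF p] ..
qed

lemma isotropy_C_4:
  assumes d: "d \<ge> 2"
  shows "isotropy d (C_4 d) = pair_group d"
proof (intro equalityI subrelI)
  fix g h assume "(g, h) \<in> isotropy d (C_4 d)"
  then have gh: "g permutes {1..d}" "h permutes {1..d}" and inv: "C_4 d (g i) (h j) = C_4 d i j" for i j
    unfolding isotropy_iff by blast+
  have one: "C_4 d i j = 1 \<longleftrightarrow> i \<in> {1..d - 2} \<and> j = i" for i j unfolding C_4_entry[OF d] by simp
  have eq: "g i \<in> {1..d - 2} \<and> h j = g i \<longleftrightarrow> i \<in> {1..d - 2} \<and> j = i" for i j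
    using inv[of i j] one by metis
  have R: "x \<in> {d - 1, d} \<longleftrightarrow> x \<in> {1..d} \<and> x \<notin> {1..d - 2}" for x using d by auto
  have gU: "g i \<in> {1..d - 2} \<longleftrightarrow> i \<in> {1..d - 2}" for i
  proof
    assume "g i \<in> {1..d - 2}"
    moreover obtain j where "h j = g i" using permutes_surj[OF gh(2)] by (metis surjD)
    ultimately show "i \<in> {1..d - 2}" using eq by blast
  qed (use eq[of i i] in blast)
  have hU: "h i \<in> {1..d - 2} \<longleftrightarrow> i \<in> {1..d - 2}" for i
  proof
    assume "h i \<in> {1..d - 2}"
    moreover obtain j where "g j = h i" using permutes_surj[OF gh(1)] by (metis surjD)
    ultimately have "j \<in> {1..d - 2} \<and> i = j" using eq[of j i] by simp
    then show "i \<in> {1..d - 2}" by blast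
  next
    assume "i \<in> {1..d - 2}"
    then show "h i \<in> {1..d - 2}" using eq[of i i] by metis
  qed
  have pres: "f \<in> preserve_last_two d" if f: "f permutes {1..d}" and U: "\<And>i. f i \<in> {1..d - 2} \<longleftrightarrow> i \<in> {1..d - 2}" for f
  proof -
    have iff: "f x \<in> {d - 1, d} \<longleftrightarrow> x \<in> {d - 1, d}" for x unfolding R U permutes_range[OF f] ..
    have "f ` {d - 1, d} = {d - 1, d}"
    proof (intro equalityI subsetI)
      fix y assume "y \<in> f ` {d - 1, d}"
      then show "y \<in> {d - 1, d}" using iff by blast
    next
      fix y assume y: "y \<in> {d - 1, d}"
      obtain x where "f x = y" using permutes_surj[OF f] by (metis surjD)
      then show "y \<in> f ` {d - 1, d}" using iff[of x] y by blast
    qed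
    then show ?thesis unfolding preserve_last_two_def mem_Collect_eq carrier_sym_group using f by blast
  qed
  have "\<forall>i\<in>{1..d - 2}. g i = h i" using eq by metis
  then show "(g, h) \<in> pair_group d" unfolding pair_group_def using pres[OF gh(1) gU] pres[OF gh(2) hU] by blast
next
  fix g h assume "(g, h) \<in> pair_group d"
  then have g: "g \<in> preserve_last_two d" and h: "h \<in> preserve_last_two d" and eq: "\<forall>i\<in>{1..d - 2}. g i = h i"
    unfolding pair_group_def by blast+
  note G = preserve_last_two_upper[OF d g] and Hh = preserve_last_two_upper[OF d h]
  have "h j = g i \<longleftrightarrow> j = i" if "i \<in> {1..d - 2}" for i j
    using eq that permutes_eq[OF Hh(1), of j i] by metis
  then have "C_4 d (g i) (h j) = C_4 d i j" for i j
    unfolding C_4_entry[OF d] G(2,3) Hh(2) by (cases "i \<in> {1..d - 2}") (simp_all del: atLeastAtMost_iff)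
  then show "(g, h) \<in> isotropy d (C_4 d)" unfolding isotropy_iff using G(1) Hh(1) by blast
qed

text \<open>The group is parametrised by a common permutation \<open>s\<close> of the first
  \<open>d - 2\<close> indices and two independent choices \<open>t\<close>, \<open>u\<close> of
  whether to swap the last two.\<close>

lemma card_pair_group:
  assumes d: "d \<ge> 2"
  shows "card (pair_group d) = 4 * fact (d - 2)"
proof -
  let ?\<tau> = "Transposition.transpose (d - 1) d"
  let ?T = "{id, ?\<tau>}"
  let ?S = "{s. s permutes {1..d - 2}}"
  let ?F = "\<lambda>p :: (nat \<Rightarrow> nat) \<times> (nat \<Rightarrow> nat) \<times> (nat \<Rightarrow> nat). (fst p \<circ> fst (snd p), fst p \<circ> snd (snd p))"
  have ne: "d - 1 \<noteq> d" "d - 1 \<in> {1..d}" "d \<in> {1..d}" using d by auto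
  have low: "x \<in> {1..d - 2} \<Longrightarrow> x \<noteq> d - 1 \<and> x \<noteq> d" for x by auto
  have nl: "d - 1 \<notin> {1..d - 2}" "d \<notin> {1..d - 2}" using low by blast+
  have \<tau>: "?\<tau> (d - 1) = d" "?\<tau> d = d - 1" "x \<in> {1..d - 2} \<Longrightarrow> ?\<tau> x = x" for x
    using low by (auto simp: Transposition.transpose_def)
  have idne: "id \<noteq> ?\<tau>" using \<tau>(1) ne(1) by (metis id_apply)
  have sl: "s (d - 1) = d - 1" "s d = d" if "s \<in> ?S" for s
    using that nl permutes_not_in by (metis mem_Collect_eq)+
  have inj: "inj_on ?F (?S \<times> ?T \<times> ?T)"
  proof (rule inj_onI)
    fix p p' assume p: "p \<in> ?S \<times> ?T \<times> ?T" and p': "p' \<in> ?S \<times> ?T \<times> ?T" and eq: "?F p = ?F p'"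
    obtain s t u where P: "p = (s, t, u)" by (cases p)
    obtain s' t' u' where P': "p' = (s', t', u')" by (cases p')
    have mem: "s \<in> ?S" "t \<in> ?T" "u \<in> ?T" "s' \<in> ?S" "t' \<in> ?T" "u' \<in> ?T" using p p' unfolding P P' by blast+
    have e1: "s (t x) = s' (t' x)" and e2: "s (u x) = s' (u' x)" for x
      using eq unfolding P P' fst_conv snd_conv prod.inject by (metis comp_apply)+
    \<comment> \<open>\<open>s\<close> and \<open>s'\<close> fix the last two indices, so the value
      at \<open>d\<close> reveals whether the swap was applied.\<close>
    have pick: "t = t'" if "t \<in> ?T" "t' \<in> ?T" "s (t d) = s' (t' d)" for t t'
    proof -
      have "t d = d \<or> t d = d - 1" "t' d = d \<or> t' d = d - 1" using that(1,2) \<tau> by auto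
      then have "t d = t' d" using that(3) sl[OF mem(1)] sl[OF mem(4)] by metis
      then show ?thesis using that(1,2) \<tau>(2) ne(1) by (metis id_apply insertE singletonD)
    qed
    have tt: "t = t'" "u = u'" using pick mem e1 e2 by blast+
    have "s x = s' x" for x
    proof -
      obtain y where "t y = x"
        using mem(2) permutes_surj[OF swap_permutes[OF ne(2,3)]] by (metis id_apply insertE singletonD surjD)
      then show ?thesis using e1[of y] tt by simp
    qed
    then have "s = s'" by (intro ext)
    then show "p = p'" unfolding P P' using tt by simp
  qed
  have "?F ` (?S \<times> ?T \<times> ?T) = pair_group d"
  proof (intro equalityI subsetI)
    fix q assume "q \<in> ?F ` (?S \<times> ?T \<times> ?T)"
    then obtain p where p: "q = ?F p" "p \<in> ?S \<times> ?T \<times> ?T" by (rule imageE)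
    obtain s t u where P: "p = (s, t, u)" by (cases p)
    have q: "q = (s \<circ> t, s \<circ> u)" using p(1) unfolding P by simp
    have mem: "s \<in> ?S" "t \<in> ?T" "u \<in> ?T" using p(2) unfolding P by blast+
    have pres: "s \<circ> t \<in> preserve_last_two d" if "t \<in> ?T" for t
    proof -
      have "{1..d - 2} \<subseteq> {1..d}" by auto
      then have "s permutes {1..d}" using mem(1) permutes_subset by blast
      moreover have "t permutes {1..d}" using that swap_permutes[OF ne(2,3)] permutes_id by blast
      ultimately have "s \<circ> t permutes {1..d}" by (intro permutes_compose)
      moreover have "(s \<circ> t) ` {d - 1, d} = {d - 1, d}"
        using that \<tau>(1,2) sl[OF mem(1)] by (auto simp: insert_commute)
      ultimately show ?thesis unfolding preserve_last_two_def mem_Collect_eq carrier_sym_group by blast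
    qed
    have "(s \<circ> t) i = (s \<circ> u) i" if "i \<in> {1..d - 2}" for i
      using mem(2,3) \<tau>(3)[OF that] by auto
    then show "q \<in> pair_group d" unfolding q pair_group_def using pres mem by blast
  next
    fix q assume "q \<in> pair_group d"
    then obtain g h where q: "q = (g, h)" and g: "g \<in> preserve_last_two d" and h: "h \<in> preserve_last_two d"
      and eq: "\<forall>i\<in>{1..d - 2}. g i = h i" unfolding pair_group_def by blast
    \<comment> \<open>The common part of \<open>g\<close> and \<open>h\<close>: \<open>g\<close> on
      the first \<open>d - 2\<close> indices and the identity elsewhere.\<close>
    define s where "s x = (if x \<in> {1..d - 2} then g x else x)" for x
    have dec: "\<exists>t\<in>?T. f = s \<circ> t" if f: "f \<in> preserve_last_two d" and fg: "\<forall>i\<in>{1..d - 2}. f i = g i" for f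
    proof -
      note Fp = preserve_last_two_upper[OF d f]
      have out: "f x = x" if "x \<notin> {1..d}" for x using permutes_not_in[OF Fp(1) that] .
      have R: "x \<in> {1..d} \<longleftrightarrow> x \<in> {1..d - 2} \<or> x = d - 1 \<or> x = d" for x using d by auto
      have fd: "f d \<in> {d - 1, d}" "f (d - 1) \<in> {d - 1, d}" unfolding Fp(2) by blast+
      have inj: "f d \<noteq> f (d - 1)" using permutes_eq[OF Fp(1), of d "d - 1"] ne(1) by metis
      show ?thesis
      proof (cases "f d = d")
        case True
        then have "f (d - 1) = d - 1" using fd inj by auto
        then have "f x = (s \<circ> id) x" for x
          unfolding comp_apply id_apply s_def using True fg out[of x] R[of x] by (auto simp del: atLeastAtMost_iff)
        then show ?thesis by blast
      next
        case False
        then have f': "f d = d - 1" "f (d - 1) = d" using fd inj by auto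
        have "f x = (s \<circ> ?\<tau>) x" for x
        proof -
          consider "x \<in> {1..d - 2}" | "x = d" | "x = d - 1" | "x \<notin> {1..d}" using R by blast
          then show ?thesis
          proof cases
            case 1 then show ?thesis using fg \<tau>(3) by (simp add: s_def del: atLeastAtMost_iff)
          next
            case 2 then show ?thesis using f' \<tau>(2) nl by (simp add: s_def del: atLeastAtMost_iff)
          next
            case 3 then show ?thesis using f' \<tau>(1) nl by (simp add: s_def del: atLeastAtMost_iff)
          next
            case 4
            then have "?\<tau> x = x" using ne by (auto simp: Transposition.transpose_def)
            moreover have "x \<notin> {1..d - 2}" using 4 R by blast
            ultimately show ?thesis using out[OF 4] by (simp add: s_def del: atLeastAtMost_iff)
          qed
        qed
        then show ?thesis by blast
      qed
    qed
    obtain t where t: "t \<in> ?T" "g = s \<circ> t" using dec[OF g] by blast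
    obtain u where u: "u \<in> ?T" "h = s \<circ> u" using dec[OF h] eq by metis
    have "s permutes {1..d - 2}"
      unfolding permutes_def
    proof (intro conjI allI impI)
      show "s x = x" if "x \<notin> {1..d - 2}" for x using that by (simp only: s_def if_False)
      have "bij g" using preserve_last_two_upper(1)[OF d g] by (rule permutes_bij)
      moreover have "bij t" using t(1) permutes_bij[OF swap_permutes[OF ne(2,3)]] bij_id by blast
      moreover have "s = g \<circ> inv_into UNIV t"
        using t(2) \<open>bij t\<close> by (simp add: comp_assoc bij_is_surj surj_iff[THEN iffD1])
      ultimately have "bij s" by (metis bij_comp bij_imp_bij_inv)
      then show "\<exists>!x. s x = y" for y by (metis bij_pointE)
    qed
    then have "(s, t, u) \<in> ?S \<times> ?T \<times> ?T" using t u by blast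
    moreover have "q = ?F (s, t, u)" unfolding q using t u by simp
    ultimately show "q \<in> ?F ` (?S \<times> ?T \<times> ?T)" by blast
  qed
  then have "card (pair_group d) = card (?S \<times> ?T \<times> ?T)" using card_image[OF inj] by simp
  moreover have "card ?T = 2" using idne by simp
  moreover have "card ?S = fact (d - 2)" using card_permutations[of "{1..d - 2}" "d - 2"] by simp
  ultimately show ?thesis by (simp only: card_cartesian_product)
qed

text \<open>The quotient of \<open>d!^2\<close> by \<open>4 (d - 2)!\<close>. It is stated over the
  reals because of the division by 4.\<close>

lemma orbit_length_C_4:
  assumes d: "d \<ge> 2"
  shows "real (orbit_length d (C_4 d)) = real d * (real d - 1) * fact d / 4"
proof -
  obtain n where n: "d = n + 2" using d by (metis le_add_diff_inverse2)
  have f: "(fact d :: real) = real d * (real d - 1) * fact (d - 2)" by (simp add: n algebra_simps)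
  have "real (orbit_length d (C_4 d) * (4 * fact (d - 2))) = real (fact d * fact d)"
    using orbit_length_isotropy[of d "C_4 d"] unfolding isotropy_C_4[OF d] card_pair_group[OF d] by simp
  then have "real (orbit_length d (C_4 d)) * 4 * fact (d - 2) = (real d * (real d - 1) * fact d) * fact (d - 2)"
    by (simp add: f mult_ac)
  then have "real (orbit_length d (C_4 d)) * 4 = real d * (real d - 1) * fact d" by simp
  then show ?thesis by simp
qed

section \<open>Error terms, multiplicities and scaled quantities\<close>

lemma smallo_inverse_powerI:
  fixes f :: "nat \<Rightarrow> real"
  assumes "(\<lambda>n. real n ^ k * f n) \<longlonglongrightarrow> 0"
  shows "f \<in> o(\<lambda>n. 1 / real n ^ k)"
proof (rule smalloI_tendsto)
  show "(\<lambda>n. f n / (1 / real n ^ k)) \<longlonglongrightarrow> 0" using assms by (simp add: mult.commute)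
  show "\<forall>\<^sub>F n in sequentially. 1 / real n ^ k \<noteq> 0"
    using eventually_gt_at_top[of 0] by eventually_elim simp
qed

lemmas smallo_inverseI = smallo_inverse_powerI[where k = 1, unfolded power_one_right]

lemma smallo_scaled:
  fixes f \<nu> :: "nat \<Rightarrow> real"
  assumes f: "\<forall>\<^sub>F n in sequentially. f n = \<nu> n * (1 / real n)" and \<nu>: "\<nu> \<longlonglongrightarrow> c"
  shows "(\<lambda>n. f n - c / real n) \<in> o(\<lambda>n. 1 / real n)"
proof (rule smallo_inverseI, rule Lim_transform_eventually)
  show "(\<lambda>n. \<nu> n - c) \<longlonglongrightarrow> 0" using tendsto_diff[OF \<nu> tendsto_const[of c]] by simp
  show "\<forall>\<^sub>F n in sequentially. \<nu> n - c = real n * (f n - c / real n)"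
    using f eventually_gt_at_top[of 0] by eventually_elim (simp add: field_simps)
qed

lemma filterlim_pred: "filterlim (\<lambda>d. d - 1 :: nat) sequentially sequentially"
  by (rule filterlim_minus_const_nat_at_top)

text \<open>A block of size \<open>d - 1\<close> is compared with multiples of \<open>1 / d\<close>;
  replacing \<open>1 / (d - 1)\<close> by \<open>1 / d\<close> costs only
  \<open>o(1 / d)\<close>.\<close>

lemma smallo_scaled_shift:
  fixes f \<nu> :: "nat \<Rightarrow> real"
  assumes f: "\<forall>\<^sub>F n in sequentially. f n = \<nu> n * (1 / real n)" and \<nu>: "\<nu> \<longlonglongrightarrow> c"
  shows "(\<lambda>d. f (d - 1) - c / real d) \<in> o(\<lambda>d. 1 / real d)"
proof (rule smallo_inverseI, rule Lim_transform_eventually)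
  have "(\<lambda>d. real d / (real d - 1)) \<longlonglongrightarrow> 1" by real_asymp
  moreover have "(\<lambda>d. \<nu> (d - 1)) \<longlonglongrightarrow> c" by (rule filterlim_compose[OF \<nu> filterlim_pred])
  ultimately have "(\<lambda>d. real d / (real d - 1) * \<nu> (d - 1) - c) \<longlonglongrightarrow> 1 * c - c" by (intro tendsto_intros)
  then show "(\<lambda>d. real d / (real d - 1) * \<nu> (d - 1) - c) \<longlonglongrightarrow> 0" by simp
  show "\<forall>\<^sub>F d in sequentially. real d / (real d - 1) * \<nu> (d - 1) - c = real d * (f (d - 1) - c / real d)"
    using eventually_compose_filterlim[OF f filterlim_pred] eventually_gt_at_top[of 1]
  proof eventually_elim
    case (elim d)
    then have "real (d - 1) = real d - 1" by simp
    then show ?case using elim(2) unfolding elim(1) by (simp add: field_simps)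
  qed
qed

lemma rel_mset_union:
  assumes "rel_mset R A B" "rel_mset R C D"
  shows "rel_mset R (A + C) (B + D)"
proof -
  have "rel_mset' R A B" using assms(1) unfolding rel_mset_rel_mset' .
  from this assms(2) show ?thesis by induction (simp_all add: rel_mset_Plus)
qed

lemma rel_mset_replicate: "R x y \<Longrightarrow> rel_mset R (replicate_mset k x) (replicate_mset k y)"
  by (induction k) (simp_all add: rel_mset_Zero rel_mset_Plus)

text \<open>For \<open>t\<close> at most -1 the numerator is nonnegative and decreases, while the
  denominator increases. Bounds for the ratio thereby turn into reversed bounds for
  \<open>b\<close>.\<close>

lemma cube_fun_antimono:
  assumes "s \<le> t" "t \<le> - 1" "2 * s + n > 0" "s + n > 0"
  shows "cube_fun n t \<le> cube_fun n s"
  unfolding cube_fun_def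
proof (rule frac_le)
  show "(2 * s + n)\<^sup>2 * (s + n) \<le> (2 * t + n)\<^sup>2 * (t + n)"
    using assms by (intro mult_mono power_mono) auto
qed (use assms in auto)

text \<open>The loss minus \<open>N\<close>, multiplied by \<open>N\<close>, becomes an expression
  without \<open>N\<close>. At the limit \<open>(-2, 1, 1, 0)\<close> of
  \<open>(\<alpha>, \<beta>, Q, e)\<close> its value is \<open>1 - 2 = -1\<close>, the coefficient
  in the loss \<open>N - 1 / N\<close>.\<close>

lemma scaled_loss:
  fixes N e :: real
  assumes e: "N * e = 1"
  shows "N * (N * (Q * e + (\<alpha> * e)\<^sup>2) ^ 3 + N * (N - 1) * (Q * e) ^ 3 - 2 * (N * (\<alpha> * e + \<beta> * e) ^ 3 + N * (N - 1) * (\<beta> * e) ^ 3) + N - N)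
    = e * (Q + \<alpha>\<^sup>2 * e) ^ 3 + (1 - e) * Q ^ 3 - 2 * (e * (\<alpha> + \<beta>) ^ 3 + (1 - e) * \<beta> ^ 3)" (is "?L = _")
proof -
  have 1: "N * (N * (Q * e + (\<alpha> * e)\<^sup>2) ^ 3) = (N * e)\<^sup>2 * (e * (Q + \<alpha>\<^sup>2 * e) ^ 3)"
    by (simp add: power2_eq_square power3_eq_cube algebra_simps)
  have 2: "N * (N * (N - 1) * (x * e) ^ 3) = (N * e)\<^sup>2 * ((N * e - e) * x ^ 3)" for x
    by (simp add: power2_eq_square power3_eq_cube algebra_simps)
  have 3: "N * (N * (\<alpha> * e + \<beta> * e) ^ 3) = (N * e)\<^sup>2 * (e * (\<alpha> + \<beta>) ^ 3)"
    by (simp add: power2_eq_square power3_eq_cube algebra_simps)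
  have "?L = N * (N * (Q * e + (\<alpha> * e)\<^sup>2) ^ 3) + N * (N * (N - 1) * (Q * e) ^ 3)
    - 2 * (N * (N * (\<alpha> * e + \<beta> * e) ^ 3) + N * (N * (N - 1) * (\<beta> * e) ^ 3))"
    by (simp add: algebra_simps)
  then show ?thesis unfolding 1 2 3 e by simp
qed

text \<open>
  The equations of \<^const>\<open>std_eigen\<close> with \<open>a = \<alpha> e\<close>, \<open>b = \<beta> e\<close>, \<open>gram_off = Q e\<close>, \<open>e = 1 / n\<close>, divided by \<open>e\<close>.
  At the limit \<open>(\<alpha>, \<beta>, Q, e) = (-2, 1, 1, 0)\<close> this matrix is upper triangular with diagonal \<open>2, 0, -1\<close>.
\<close>

definition std_matrix :: "real \<Rightarrow> real \<Rightarrow> real \<Rightarrow> real \<Rightarrow> nat \<Rightarrow> nat \<Rightarrow> real" where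
  "std_matrix \<alpha> \<beta> Q e i j =
    (if i = 1 then
       if j = 1 then 4 * \<alpha>\<^sup>2 * Q * e\<^sup>2 + 4 * \<alpha> ^ 3 * (\<alpha> + \<beta>) * e ^ 3 - \<alpha>
       else if j = 2 then 4 * \<alpha> ^ 3 * e\<^sup>2 * (\<alpha> * e + \<beta>) - 2 * \<alpha>
       else 4 * \<alpha> ^ 4 * e ^ 3 - 2 * \<alpha>
     else if i = 2 then
       if j = 1 then 2 * \<alpha> * \<beta> * Q * e\<^sup>2 + 2 * \<beta> * (Q * e * (2 * \<alpha> * e + \<beta>) + 2 * \<alpha>\<^sup>2 * (\<alpha> + \<beta>) * e ^ 3)
       else if j = 2 then 2 * \<alpha> * Q * e * (\<alpha> * e + \<beta>) + 2 * \<beta> * (Q * (\<alpha> * e + \<beta>) + 2 * \<alpha>\<^sup>2 * e\<^sup>2 * (\<alpha> * e + \<beta>)) + \<alpha>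
       else 2 * \<alpha>\<^sup>2 * Q * e\<^sup>2 + 2 * \<beta> * (Q * \<alpha> * e + 2 * \<alpha> ^ 3 * e ^ 3)
     else
       if j = 1 then 2 * \<alpha> * \<beta> * Q * e\<^sup>2 + Q\<^sup>2 * e
       else if j = 2 then 2 * \<alpha> * Q * e * (\<alpha> * e + \<beta>)
       else 2 * \<alpha>\<^sup>2 * Q * e\<^sup>2 + Q\<^sup>2 + \<alpha>)"

lemma std_matrix_entry:
  "std_matrix \<alpha> \<beta> Q e 1 1 = 4 * \<alpha>\<^sup>2 * Q * e\<^sup>2 + 4 * \<alpha> ^ 3 * (\<alpha> + \<beta>) * e ^ 3 - \<alpha>"
  "std_matrix \<alpha> \<beta> Q e 1 2 = 4 * \<alpha> ^ 3 * e\<^sup>2 * (\<alpha> * e + \<beta>) - 2 * \<alpha>"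
  "std_matrix \<alpha> \<beta> Q e 1 3 = 4 * \<alpha> ^ 4 * e ^ 3 - 2 * \<alpha>"
  "std_matrix \<alpha> \<beta> Q e 2 1 = 2 * \<alpha> * \<beta> * Q * e\<^sup>2 + 2 * \<beta> * (Q * e * (2 * \<alpha> * e + \<beta>) + 2 * \<alpha>\<^sup>2 * (\<alpha> + \<beta>) * e ^ 3)"
  "std_matrix \<alpha> \<beta> Q e 2 2 = 2 * \<alpha> * Q * e * (\<alpha> * e + \<beta>) + 2 * \<beta> * (Q * (\<alpha> * e + \<beta>) + 2 * \<alpha>\<^sup>2 * e\<^sup>2 * (\<alpha> * e + \<beta>)) + \<alpha>"
  "std_matrix \<alpha> \<beta> Q e 2 3 = 2 * \<alpha>\<^sup>2 * Q * e\<^sup>2 + 2 * \<beta> * (Q * \<alpha> * e + 2 * \<alpha> ^ 3 * e ^ 3)"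
  "std_matrix \<alpha> \<beta> Q e 3 1 = 2 * \<alpha> * \<beta> * Q * e\<^sup>2 + Q\<^sup>2 * e"
  "std_matrix \<alpha> \<beta> Q e 3 2 = 2 * \<alpha> * Q * e * (\<alpha> * e + \<beta>)"
  "std_matrix \<alpha> \<beta> Q e 3 3 = 2 * \<alpha>\<^sup>2 * Q * e\<^sup>2 + Q\<^sup>2 + \<alpha>"
  by (simp_all add: std_matrix_def)

lemma eq_mod_inverse_scaled:
  assumes "\<forall>\<^sub>F n in sequentially. f n = \<nu> n * (1 / real n)" "\<nu> \<longlonglongrightarrow> c" "\<And>n. g n = c / real n"
  shows "eq_mod_inverse f g"
  using smallo_scaled[OF assms(1,2)] unfolding eq_mod_inverse_def assms(3) .

lemma replicate_mset_add: "replicate_mset (m + n) x = replicate_mset m x + replicate_mset n x"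
  by (induction m) simp_all

text \<open>With \<open>d = n + 1\<close>, the types x and y of the block of size \<open>n\<close>
  both have eigenvalues near \<open>-12 / d\<close>; together they give the multiplicity
  \<open>d^2 - 5 d + 5\<close>.\<close>

lemma eigenvalue_count:
  fixes n :: nat
  assumes "n \<ge> 3"
  shows "(n + 1)\<^sup>2 + 5 - 5 * (n + 1) = (n - 1) * (n - 2) div 2 + n * (n - 3) div 2"
proof -
  obtain k where k: "n = k + 3" using assms by (metis le_add_diff_inverse2)
  have "even ((k + 2) * (k + 1))" "even ((k + 3) * k)" by auto
  then obtain s t where st: "(k + 2) * (k + 1) = 2 * s" "(k + 3) * k = 2 * t" by (metis evenE)
  have "(n - 1) * (n - 2) div 2 = s" "n * (n - 3) div 2 = t" using st by (simp_all add: k algebra_simps)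
  moreover have "(n + 1)\<^sup>2 + 5 = s + t + 5 * (n + 1)" using st by (simp add: k power2_eq_square algebra_simps)
  ultimately show ?thesis by simp
qed

text \<open>Eigenvalues of different origin share a limit: \<open>B\<close> occurs once in type t
  and \<open>n - 1\<close> times in type s, \<open>Z\<close> in type s and in the upper mixed block,
  and \<open>X\<close> in types x and y.\<close>

lemma regroup_spectrum:
  fixes A :: 'a
  assumes n: "n \<ge> 1"
  shows "replicate_mset 1 A + replicate_mset 1 B + (replicate_mset (n - 1) B + replicate_mset (n - 1) Z + replicate_mset (n - 1) G)
     + replicate_mset p X + replicate_mset q X + replicate_mset 1 E + (replicate_mset 1 H + replicate_mset (n - 1) Z) + replicate_mset n I
   = replicate_mset 1 E + replicate_mset n I + replicate_mset 1 A + replicate_mset n B + replicate_mset 1 H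
     + replicate_mset (2 * n - 2) Z + replicate_mset (n - 1) G + replicate_mset (p + q) X"
proof -
  have B: "replicate_mset n B = replicate_mset 1 B + replicate_mset (n - 1) B" using n by (cases n) simp_all
  have "2 * n - 2 = (n - 1) + (n - 1)" by simp
  then have Z: "replicate_mset (2 * n - 2) Z = replicate_mset (n - 1) Z + replicate_mset (n - 1) Z" by (simp only: replicate_mset_add)
  show ?thesis unfolding B Z replicate_mset_add by (simp only: ac_simps)
qed

text \<open>With zero border and corner 1 the matrix is a block sum with the identity of size 1, so
  critical points of size \<open>n\<close> extend to size \<open>n + 1\<close>.\<close>

lemma Xi_eq_direct_sum:
  assumes "n \<ge> 1"
  shows "Xi (n + 1) (a + b) b 0 0 1 = direct_sum n (mix n a b) (mix 1 1 0)"
proof (intro ext)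
  fix i j
  consider "i = 0 \<or> j = 0" | "i \<in> {1..n}" "j \<in> {1..n}" | "i \<in> {1..n}" "j > n" | "i > n" "j \<in> {1..n}" | "i > n" "j > n" by force
  then show "Xi (n + 1) (a + b) b 0 0 1 i j = direct_sum n (mix n a b) (mix 1 1 0) i j"
    by cases (auto simp: Xi_def direct_sum_def mix_def)
qed

section \<open>The critical family with ratio near -2\<close>

context
  fixes t b \<alpha> \<beta> Q e :: "nat \<Rightarrow> real"
  assumes t: "\<forall>\<^sub>F n in sequentially. ratio_lo (real n) \<le> t n \<and> t n \<le> ratio_hi (real n) \<and> ratio_poly (real n) (t n) = 0"
    and b: "\<And>n. b n = cube_fun (real n) (t n) powr (1 / 3)"
    and \<beta>: "\<And>n. \<beta> n = real n * b n" and \<alpha>: "\<And>n. \<alpha> n = t n * \<beta> n"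
    and Q: "\<And>n. Q n = (\<beta> n)\<^sup>2 * (2 * (t n / real n) + 1)" and e: "\<And>n. e n = 1 / real n"
begin

lemma ratio_tendsto: "t \<longlonglongrightarrow> - 2"
proof (rule tendsto_sandwich)
  show "\<forall>\<^sub>F n in sequentially. ratio_lo (real n) \<le> t n" using t by eventually_elim blast
  show "\<forall>\<^sub>F n in sequentially. t n \<le> ratio_hi (real n)" using t by eventually_elim blast
  show "(\<lambda>n. ratio_lo (real n)) \<longlonglongrightarrow> - 2" by real_asymp
  show "(\<lambda>n. ratio_hi (real n)) \<longlonglongrightarrow> - 2" by real_asymp
qed

lemma ratio_over: "(\<lambda>n. t n / real n) \<longlonglongrightarrow> 0"
  by (rule real_tendsto_divide_at_top[OF ratio_tendsto filterlim_real_sequentially])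

lemma scaled_cube_tendsto: "(\<lambda>n. real n ^ 3 * cube_fun (real n) (t n)) \<longlonglongrightarrow> 1"
proof (rule Lim_transform_eventually)
  have "(\<lambda>n. - (1 + t n) / ((2 * (t n / real n) + 1)\<^sup>2 * (t n / real n + 1))) \<longlonglongrightarrow> - (1 + - 2) / ((2 * 0 + 1)\<^sup>2 * (0 + 1))"
    by (intro tendsto_intros ratio_tendsto ratio_over) simp_all
  then show "(\<lambda>n. - (1 + t n) / ((2 * (t n / real n) + 1)\<^sup>2 * (t n / real n + 1))) \<longlonglongrightarrow> 1" by simp
  show "\<forall>\<^sub>F n in sequentially. - (1 + t n) / ((2 * (t n / real n) + 1)\<^sup>2 * (t n / real n + 1)) = real n ^ 3 * cube_fun (real n) (t n)"
    using eventually_gt_at_top[of 0]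
  proof eventually_elim
    case (elim n)
    have 1: "2 * t n + real n = real n * (2 * (t n / real n) + 1)" using elim by (simp add: field_simps)
    have 2: "t n + real n = real n * (t n / real n + 1)" using elim by (simp add: field_simps)
    have 3: "(real n * x)\<^sup>2 * (real n * y) = real n ^ 3 * (x\<^sup>2 * y)" for x y
      by (simp add: power2_eq_square power3_eq_cube)
    show ?case unfolding cube_fun_def 1 2 3 using elim by simp
  qed
qed

text \<open>Positivity makes the real power \<open>1 / 3\<close> in the definition of
  \<open>b\<close> a genuine cube root.\<close>

lemma cube_pos: "\<forall>\<^sub>F n in sequentially. cube_fun (real n) (t n) > 0"
  using order_tendstoD(1)[OF scaled_cube_tendsto zero_less_one] eventually_gt_at_top[of 0]
  by eventually_elim (simp add: zero_less_mult_iff)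

lemma beta_tendsto: "\<beta> \<longlonglongrightarrow> 1"
proof (rule Lim_transform_eventually)
  have "(\<lambda>n. (real n ^ 3 * cube_fun (real n) (t n)) powr (1 / 3)) \<longlonglongrightarrow> 1 powr (1 / 3)"
    by (intro tendsto_powr scaled_cube_tendsto tendsto_const) simp
  then show "(\<lambda>n. (real n ^ 3 * cube_fun (real n) (t n)) powr (1 / 3)) \<longlonglongrightarrow> 1" by simp
  show "\<forall>\<^sub>F n in sequentially. (real n ^ 3 * cube_fun (real n) (t n)) powr (1 / 3) = \<beta> n"
    using cube_pos eventually_gt_at_top[of 0]
  proof eventually_elim
    case (elim n)
    have "(real n ^ 3) powr (1 / 3) = (real n powr 3) powr (1 / 3)" using elim by (simp add: powr_numeral)
    also have "\<dots> = real n" using elim by (simp only: powr_powr) simp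
    finally show ?case using elim unfolding \<beta> b by (simp add: powr_mult)
  qed
qed

text \<open>\<alpha>, \<beta> and \<open>Q\<close> are \<open>a\<close>, \<open>b\<close> and
  \<open>gram_off\<close> multiplied by \<open>n\<close>. They are the quantities of order 1, and
  every limit below is an evaluation at these four values.\<close>

lemma limits: "\<alpha> \<longlonglongrightarrow> - 2" "\<beta> \<longlonglongrightarrow> 1" "Q \<longlonglongrightarrow> 1" "e \<longlonglongrightarrow> 0"
proof -
  have "(\<lambda>n. t n * \<beta> n) \<longlonglongrightarrow> - 2 * 1" by (intro tendsto_intros ratio_tendsto beta_tendsto)
  then show "\<alpha> \<longlonglongrightarrow> - 2" unfolding \<alpha>[abs_def] by simp
  show "\<beta> \<longlonglongrightarrow> 1" by (rule beta_tendsto)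
  have "(\<lambda>n. (\<beta> n)\<^sup>2 * (2 * (t n / real n) + 1)) \<longlonglongrightarrow> 1\<^sup>2 * (2 * 0 + 1)" by (intro tendsto_intros beta_tendsto ratio_over)
  then show "Q \<longlonglongrightarrow> 1" unfolding Q[abs_def] by simp
  show "e \<longlonglongrightarrow> 0" unfolding e[abs_def] by real_asymp
qed

text \<open>Collects what holds eventually, in the scaled form expected by \<open>std_eigenI\<close>
  and \<open>triv_eigenI\<close>.\<close>

lemma family_basic:
  "\<forall>\<^sub>F n in sequentially. n \<ge> 3 \<and> real n * e n = 1 \<and> b n > 0 \<and> t n < - 1 \<and> \<alpha> n * e n = t n * b n \<and> \<beta> n * e n = b n \<and>
     gram_off n (\<alpha> n * e n) (\<beta> n * e n) = Q n * e n \<and> gram_gap n (\<alpha> n * e n) (\<beta> n * e n) = \<alpha> n * e n + 2 * (\<beta> n * e n) \<and>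
     critical n (mix n (t n * b n) (b n))"
  \<comment> \<open>For \<open>t > -3\<close> and \<open>n\<close> at least 7 the quantities
    \<open>2 t + n\<close> and \<open>t + n\<close> are positive, so
    \<open>critical_from_ratio\<close> applies.\<close>
  using t cube_pos order_tendstoD(2)[OF ratio_tendsto, of "- 1", simplified] order_tendstoD(1)[OF ratio_tendsto, of "- 3", simplified] eventually_ge_at_top[of 7]
proof eventually_elim
  case (elim n)
  have P: "ratio_poly (real n) (t n) = 0" using elim(1) by blast
  have n: "real n \<ge> 7" using elim(5) by simp
  have b3: "b n ^ 3 = cube_fun (real n) (t n)" using elim(2) unfolding b by (simp add: powr_power)
  have pos: "b n > 0" using elim(2) unfolding b by simp
  have nz: "2 * t n + real n \<noteq> 0" "t n + real n \<noteq> 0" using n elim(4) by auto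
  have e1: "real n * e n = 1" using n by (simp add: e)
  have ae: "\<alpha> n * e n = t n * b n" "\<beta> n * e n = b n" using n by (simp_all add: \<alpha> \<beta> e)
  have q: "gram_off n (t n * b n) (b n) = Q n * e n"
    using n by (simp add: gram_off_def Q \<beta> e power2_eq_square field_simps)
  note c = critical_from_ratio[OF P b3 nz]
  show ?case using n pos elim(3) e1 q c unfolding ae by simp
qed

lemma family_std:
  assumes L: "L = 2 \<or> L = 0 \<or> L = - 1"
  shows "\<exists>\<nu>. \<nu> \<longlonglongrightarrow> L \<and> (\<forall>\<^sub>F n in sequentially. \<exists>x y z. (x, y, z) \<noteq> (0, 0, 0) \<and>
    std_matrix (\<alpha> n) (\<beta> n) (Q n) (e n) 1 1 * x + std_matrix (\<alpha> n) (\<beta> n) (Q n) (e n) 1 2 * y + std_matrix (\<alpha> n) (\<beta> n) (Q n) (e n) 1 3 * z = \<nu> n * x \<and>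
    std_matrix (\<alpha> n) (\<beta> n) (Q n) (e n) 2 1 * x + std_matrix (\<alpha> n) (\<beta> n) (Q n) (e n) 2 2 * y + std_matrix (\<alpha> n) (\<beta> n) (Q n) (e n) 2 3 * z = \<nu> n * y \<and>
    std_matrix (\<alpha> n) (\<beta> n) (Q n) (e n) 3 1 * x + std_matrix (\<alpha> n) (\<beta> n) (Q n) (e n) 3 2 * y + std_matrix (\<alpha> n) (\<beta> n) (Q n) (e n) 3 3 * z = \<nu> n * z)"
proof -
  let ?U = "std_matrix (- 2) 1 1 0"
  have U: "?U 1 1 = 2" "?U 2 2 = 0" "?U 3 3 = - 1" "?U 2 1 = 0" "?U 3 1 = 0" "?U 3 2 = 0"
    unfolding std_matrix_entry by simp_all
  have lim: "(\<lambda>n. std_matrix (\<alpha> n) (\<beta> n) (Q n) (e n) i j) \<longlonglongrightarrow> ?U i j" for i j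
    unfolding std_matrix_def
    by (cases "i = 1"; cases "i = 2"; cases "j = 1"; cases "j = 2")
      (simp_all only: if_True if_False simp_thms, (intro tendsto_intros limits)+)
  \<comment> \<open>The two members of \<open>{2, 0, -1}\<close> different from \<open>L\<close>, in
    the order of the diagonal.\<close>
  define K1 K2 :: real where "K1 = (if L = 2 then 0 else 2)" and "K2 = (if L = - 1 then 0 else - 1)"
  have K: "L = ?U 1 1 \<and> K1 = ?U 2 2 \<and> K2 = ?U 3 3 \<or> L = ?U 2 2 \<and> K1 = ?U 1 1 \<and> K2 = ?U 3 3 \<or> L = ?U 3 3 \<and> K1 = ?U 1 1 \<and> K2 = ?U 2 2" "K1 \<noteq> L" "K2 \<noteq> L"
    unfolding U using L by (auto simp: K1_def K2_def)
  show ?thesis by (rule eigenvalue_limit3[where U = ?U, OF lim U(4-6) K])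
qed

lemma family_std_eigen:
  "\<exists>\<nu>1 \<nu>2 \<nu>3. \<nu>1 \<longlonglongrightarrow> 2 \<and> \<nu>2 \<longlonglongrightarrow> 0 \<and> \<nu>3 \<longlonglongrightarrow> - 1 \<and> (\<forall>\<^sub>F n in sequentially. \<exists>x1 y1 z1 x2 y2 z2 x3 y3 z3.
    std_eigen n (t n * b n) (b n) (\<nu>1 n * e n) x1 y1 z1 \<and> std_eigen n (t n * b n) (b n) (\<nu>2 n * e n) x2 y2 z2 \<and>
    std_eigen n (t n * b n) (b n) (\<nu>3 n * e n) x3 y3 z3 \<and> indep3 (x1, y1, z1) (x2, y2, z2) (x3, y3, z3))"
proof -
  obtain \<nu>1 where 1: "\<nu>1 \<longlonglongrightarrow> 2" and ev1: "\<forall>\<^sub>F n in sequentially. \<exists>x y z. (x, y, z) \<noteq> (0, 0, 0) \<and>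
    std_matrix (\<alpha> n) (\<beta> n) (Q n) (e n) 1 1 * x + std_matrix (\<alpha> n) (\<beta> n) (Q n) (e n) 1 2 * y + std_matrix (\<alpha> n) (\<beta> n) (Q n) (e n) 1 3 * z = \<nu>1 n * x \<and>
    std_matrix (\<alpha> n) (\<beta> n) (Q n) (e n) 2 1 * x + std_matrix (\<alpha> n) (\<beta> n) (Q n) (e n) 2 2 * y + std_matrix (\<alpha> n) (\<beta> n) (Q n) (e n) 2 3 * z = \<nu>1 n * y \<and>
    std_matrix (\<alpha> n) (\<beta> n) (Q n) (e n) 3 1 * x + std_matrix (\<alpha> n) (\<beta> n) (Q n) (e n) 3 2 * y + std_matrix (\<alpha> n) (\<beta> n) (Q n) (e n) 3 3 * z = \<nu>1 n * z"
    using family_std[of 2] by auto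
  obtain \<nu>2 where 2: "\<nu>2 \<longlonglongrightarrow> 0" and ev2: "\<forall>\<^sub>F n in sequentially. \<exists>x y z. (x, y, z) \<noteq> (0, 0, 0) \<and>
    std_matrix (\<alpha> n) (\<beta> n) (Q n) (e n) 1 1 * x + std_matrix (\<alpha> n) (\<beta> n) (Q n) (e n) 1 2 * y + std_matrix (\<alpha> n) (\<beta> n) (Q n) (e n) 1 3 * z = \<nu>2 n * x \<and>
    std_matrix (\<alpha> n) (\<beta> n) (Q n) (e n) 2 1 * x + std_matrix (\<alpha> n) (\<beta> n) (Q n) (e n) 2 2 * y + std_matrix (\<alpha> n) (\<beta> n) (Q n) (e n) 2 3 * z = \<nu>2 n * y \<and>
    std_matrix (\<alpha> n) (\<beta> n) (Q n) (e n) 3 1 * x + std_matrix (\<alpha> n) (\<beta> n) (Q n) (e n) 3 2 * y + std_matrix (\<alpha> n) (\<beta> n) (Q n) (e n) 3 3 * z = \<nu>2 n * z"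
    using family_std[of 0] by auto
  obtain \<nu>3 where 3: "\<nu>3 \<longlonglongrightarrow> - 1" and ev3: "\<forall>\<^sub>F n in sequentially. \<exists>x y z. (x, y, z) \<noteq> (0, 0, 0) \<and>
    std_matrix (\<alpha> n) (\<beta> n) (Q n) (e n) 1 1 * x + std_matrix (\<alpha> n) (\<beta> n) (Q n) (e n) 1 2 * y + std_matrix (\<alpha> n) (\<beta> n) (Q n) (e n) 1 3 * z = \<nu>3 n * x \<and>
    std_matrix (\<alpha> n) (\<beta> n) (Q n) (e n) 2 1 * x + std_matrix (\<alpha> n) (\<beta> n) (Q n) (e n) 2 2 * y + std_matrix (\<alpha> n) (\<beta> n) (Q n) (e n) 2 3 * z = \<nu>3 n * y \<and>
    std_matrix (\<alpha> n) (\<beta> n) (Q n) (e n) 3 1 * x + std_matrix (\<alpha> n) (\<beta> n) (Q n) (e n) 3 2 * y + std_matrix (\<alpha> n) (\<beta> n) (Q n) (e n) 3 3 * z = \<nu>3 n * z"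
    using family_std[of "- 1"] by auto
  \<comment> \<open>The thresholds 1 and \<open>- (1/2)\<close> separate the limits 2, 0 and -1. The
    eigenvalues are therefore eventually distinct and the eigenvectors independent.\<close>
  have sep: "\<forall>\<^sub>F n in sequentially. \<nu>1 n > 1" "\<forall>\<^sub>F n in sequentially. \<nu>2 n < 1" "\<forall>\<^sub>F n in sequentially. \<nu>2 n > - (1/2)" "\<forall>\<^sub>F n in sequentially. \<nu>3 n < - (1/2)"
    using order_tendstoD(1)[OF 1, of 1] order_tendstoD(2)[OF 2, of 1] order_tendstoD(1)[OF 2, of "- (1/2)"] order_tendstoD(2)[OF 3, of "- (1/2)"] by simp_all
  show ?thesis
  proof (rule exI[of _ \<nu>1], rule exI[of _ \<nu>2], rule exI[of _ \<nu>3], intro conjI 1 2 3)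
    show "\<forall>\<^sub>F n in sequentially. \<exists>x1 y1 z1 x2 y2 z2 x3 y3 z3.
      std_eigen n (t n * b n) (b n) (\<nu>1 n * e n) x1 y1 z1 \<and> std_eigen n (t n * b n) (b n) (\<nu>2 n * e n) x2 y2 z2 \<and>
      std_eigen n (t n * b n) (b n) (\<nu>3 n * e n) x3 y3 z3 \<and> indep3 (x1, y1, z1) (x2, y2, z2) (x3, y3, z3)"
      using family_basic ev1 ev2 ev3 sep
    proof eventually_elim
      case (elim n)
      define M where "M = std_matrix (\<alpha> n) (\<beta> n) (Q n) (e n)"
      note base = elim(1)
      have ae: "\<alpha> n * e n = t n * b n" "\<beta> n * e n = b n" using base by blast+
      have en: "real n * e n = 1" "gram_off n (\<alpha> n * e n) (\<beta> n * e n) = Q n * e n"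
        "gram_gap n (\<alpha> n * e n) (\<beta> n * e n) = \<alpha> n * e n + 2 * (\<beta> n * e n)" using base by blast+
      have I0: "std_eigen n (\<alpha> n * e n) (\<beta> n * e n) (\<nu> * e n) x y z"
        if "M 1 1 * x + M 1 2 * y + M 1 3 * z = \<nu> * x" "M 2 1 * x + M 2 2 * y + M 2 3 * z = \<nu> * y" "M 3 1 * x + M 3 2 * y + M 3 3 * z = \<nu> * z"
        for x y z \<nu>
        by (rule std_eigenI[OF en that[unfolded M_def std_matrix_entry]])
      note I = I0[unfolded ae]
      define F where "F p = (M 1 1 * fst p + M 1 2 * fst (snd p) + M 1 3 * snd (snd p),
        M 2 1 * fst p + M 2 2 * fst (snd p) + M 2 3 * snd (snd p),
        M 3 1 * fst p + M 3 2 * fst (snd p) + M 3 3 * snd (snd p))" for p :: "real \<times> real \<times> real"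
      have F: "linear F" unfolding F_def by (rule linearI) (simp_all add: algebra_simps)
      obtain x1 y1 z1 where v1: "(x1, y1, z1) \<noteq> (0, 0, 0)" "M 1 1 * x1 + M 1 2 * y1 + M 1 3 * z1 = \<nu>1 n * x1"
        "M 2 1 * x1 + M 2 2 * y1 + M 2 3 * z1 = \<nu>1 n * y1" "M 3 1 * x1 + M 3 2 * y1 + M 3 3 * z1 = \<nu>1 n * z1"
        using elim(2) unfolding M_def by blast
      obtain x2 y2 z2 where v2: "(x2, y2, z2) \<noteq> (0, 0, 0)" "M 1 1 * x2 + M 1 2 * y2 + M 1 3 * z2 = \<nu>2 n * x2"
        "M 2 1 * x2 + M 2 2 * y2 + M 2 3 * z2 = \<nu>2 n * y2" "M 3 1 * x2 + M 3 2 * y2 + M 3 3 * z2 = \<nu>2 n * z2"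
        using elim(3) unfolding M_def by blast
      obtain x3 y3 z3 where v3: "(x3, y3, z3) \<noteq> (0, 0, 0)" "M 1 1 * x3 + M 1 2 * y3 + M 1 3 * z3 = \<nu>3 n * x3"
        "M 2 1 * x3 + M 2 2 * y3 + M 2 3 * z3 = \<nu>3 n * y3" "M 3 1 * x3 + M 3 2 * y3 + M 3 3 * z3 = \<nu>3 n * z3"
        using elim(4) unfolding M_def by blast
      have Fp: "F (x1, y1, z1) = \<nu>1 n *\<^sub>R (x1, y1, z1)" "F (x2, y2, z2) = \<nu>2 n *\<^sub>R (x2, y2, z2)" "F (x3, y3, z3) = \<nu>3 n *\<^sub>R (x3, y3, z3)"
        unfolding F_def fst_conv snd_conv v1(2-) v2(2-) v3(2-) by simp_all
      have "indep3 (x1, y1, z1) (x2, y2, z2) (x3, y3, z3)"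
        by (rule distinct_eigenvalues_indep3[OF F Fp]) (use v1(1) v2(1) v3(1) elim(5-8) in \<open>simp_all add: zero_prod_def\<close>)
      then show ?case using I[OF v1(2-)] I[OF v2(2-)] I[OF v3(2-)] by blast
    qed
  qed
qed

lemma family_triv_eigen:
  "\<exists>\<nu>1 \<nu>2. \<nu>1 \<longlonglongrightarrow> 3 \<and> \<nu>2 \<longlonglongrightarrow> 2 \<and> (\<forall>\<^sub>F n in sequentially. \<exists>x1 y1 x2 y2.
    triv_eigen n (t n * b n) (b n) (\<nu>1 n * e n) x1 y1 \<and> triv_eigen n (t n * b n) (b n) (\<nu>2 n * e n) x2 y2 \<and> x1 * y2 \<noteq> x2 * y1)"
proof -
  \<comment> \<open>The scaled matrix of type t, row by row; its limit is upper triangular with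
    diagonal entries 2 and 3 and upper entry 4.\<close>
  define p where "p n = 4 * (\<alpha> n)\<^sup>2 * Q n * (e n)\<^sup>2 + 4 * \<alpha> n ^ 3 * (\<alpha> n + \<beta> n) * e n ^ 3 - \<alpha> n" for n
  define q where "q n = 4 * \<alpha> n ^ 3 * (e n)\<^sup>2 * (\<alpha> n * e n + \<beta> n) - 2 * \<alpha> n" for n
  define r where "r n = 4 * \<alpha> n * Q n * \<beta> n * (e n)\<^sup>2 + 4 * \<beta> n * (Q n * \<alpha> n * (e n)\<^sup>2 + Q n * \<beta> n * e n + (\<alpha> n)\<^sup>2 * (e n)\<^sup>2 * (\<alpha> n * e n + \<beta> n * e n)) + (Q n)\<^sup>2 * e n" for n
  define s where "s n = (4 * \<alpha> n * Q n * e n + 4 * \<beta> n * Q n + 4 * \<beta> n * (\<alpha> n)\<^sup>2 * (e n)\<^sup>2) * (\<alpha> n * e n + \<beta> n) + (Q n)\<^sup>2 + \<alpha> n" for n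
  have "p \<longlonglongrightarrow> 4 * (- 2)\<^sup>2 * 1 * 0\<^sup>2 + 4 * (- 2) ^ 3 * (- 2 + 1) * 0 ^ 3 - - 2"
    unfolding p_def[abs_def] by (intro tendsto_intros limits)
  then have p: "p \<longlonglongrightarrow> 2" by simp
  have "q \<longlonglongrightarrow> 4 * (- 2) ^ 3 * 0\<^sup>2 * (- 2 * 0 + 1) - 2 * - 2"
    unfolding q_def[abs_def] by (intro tendsto_intros limits)
  then have q: "q \<longlonglongrightarrow> 4" by simp
  have "r \<longlonglongrightarrow> 4 * - 2 * 1 * 1 * 0\<^sup>2 + 4 * 1 * (1 * - 2 * 0\<^sup>2 + 1 * 1 * 0 + (- 2)\<^sup>2 * 0\<^sup>2 * (- 2 * 0 + 1 * 0)) + 1\<^sup>2 * 0"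
    unfolding r_def[abs_def] by (intro tendsto_intros limits)
  then have r: "r \<longlonglongrightarrow> 0" by simp
  have "s \<longlonglongrightarrow> (4 * - 2 * 1 * 0 + 4 * 1 * 1 + 4 * 1 * (- 2)\<^sup>2 * 0\<^sup>2) * (- 2 * 0 + 1) + 1\<^sup>2 + - 2"
    unfolding s_def[abs_def] by (intro tendsto_intros limits)
  then have s: "s \<longlonglongrightarrow> 3" by simp
  have "(2 :: real) \<noteq> 3" "(3 :: real) \<in> {2, 3}" "(2 :: real) \<in> {2, 3}" by simp_all
  note E = eigenvalue_limit2[OF p q r s this(1) this(2)] eigenvalue_limit2[OF p q r s this(1) this(3)]
  obtain \<nu>1 where 1: "\<nu>1 \<longlonglongrightarrow> 3" and ev1: "\<forall>\<^sub>F n in sequentially. \<exists>v w. (v \<noteq> 0 \<or> w \<noteq> 0) \<and> p n * v + q n * w = \<nu>1 n * v \<and> r n * v + s n * w = \<nu>1 n * w"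
    using E(1) by blast
  obtain \<nu>2 where 2: "\<nu>2 \<longlonglongrightarrow> 2" and ev2: "\<forall>\<^sub>F n in sequentially. \<exists>v w. (v \<noteq> 0 \<or> w \<noteq> 0) \<and> p n * v + q n * w = \<nu>2 n * v \<and> r n * v + s n * w = \<nu>2 n * w"
    using E(2) by blast
  have sep: "\<forall>\<^sub>F n in sequentially. \<nu>1 n > 5 / 2" "\<forall>\<^sub>F n in sequentially. \<nu>2 n < 5 / 2"
    using order_tendstoD(1)[OF 1, of "5 / 2"] order_tendstoD(2)[OF 2, of "5 / 2"] by simp_all
  show ?thesis
  proof (rule exI[of _ \<nu>1], rule exI[of _ \<nu>2], intro conjI 1 2)
    show "\<forall>\<^sub>F n in sequentially. \<exists>x1 y1 x2 y2.
      triv_eigen n (t n * b n) (b n) (\<nu>1 n * e n) x1 y1 \<and> triv_eigen n (t n * b n) (b n) (\<nu>2 n * e n) x2 y2 \<and> x1 * y2 \<noteq> x2 * y1"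
      using family_basic ev1 ev2 sep
    proof eventually_elim
      case (elim n)
      note base = elim(1)
      have ae: "\<alpha> n * e n = t n * b n" "\<beta> n * e n = b n" using base by blast+
      have en: "real n * e n = 1" "gram_off n (\<alpha> n * e n) (\<beta> n * e n) = Q n * e n"
        "gram_gap n (\<alpha> n * e n) (\<beta> n * e n) = \<alpha> n * e n + 2 * (\<beta> n * e n)" using base by blast+
      have I0: "triv_eigen n (\<alpha> n * e n) (\<beta> n * e n) (\<nu> * e n) x y"
        if "p n * x + q n * y = \<nu> * x" "r n * x + s n * y = \<nu> * y" for x y \<nu>
        by (rule triv_eigenI[OF en that[unfolded p_def q_def r_def s_def]])
      note I = I0[unfolded ae]
      obtain x1 y1 where v1: "x1 \<noteq> 0 \<or> y1 \<noteq> 0" "p n * x1 + q n * y1 = \<nu>1 n * x1" "r n * x1 + s n * y1 = \<nu>1 n * y1"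
        using elim(2) by blast
      obtain x2 y2 where v2: "x2 \<noteq> 0 \<or> y2 \<noteq> 0" "p n * x2 + q n * y2 = \<nu>2 n * x2" "r n * x2 + s n * y2 = \<nu>2 n * y2"
        using elim(3) by blast
      have "x1 * y2 \<noteq> x2 * y1"
        by (rule distinct_eigenvalues_indep2[OF v1(2,3) v2(2,3) v1(1) v2(1)]) (use elim(4,5) in simp)
      then show ?case using I[OF v1(2,3)] I[OF v2(2,3)] by blast
    qed
  qed
qed

lemma family_spectrum:
  "\<exists>\<tau>1 \<tau>2 \<mu>1 \<mu>2 \<mu>3. \<tau>1 \<longlonglongrightarrow> 3 \<and> \<tau>2 \<longlonglongrightarrow> 2 \<and> \<mu>1 \<longlonglongrightarrow> 2 \<and> \<mu>2 \<longlonglongrightarrow> 0 \<and> \<mu>3 \<longlonglongrightarrow> - 1 \<and> (\<forall>\<^sub>F n in sequentially.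
    has_spectrum_by_type (hessian n (mix n (t n * b n) (b n))) (Mat n n)
      (mix_spectrum n (t n * b n) (b n) {#6 * (\<tau>1 n * e n), 6 * (\<tau>2 n * e n)#} {#6 * (\<mu>1 n * e n), 6 * (\<mu>2 n * e n), 6 * (\<mu>3 n * e n)#}) \<and>
    diagonal_on (hessian n (mix n (t n * b n) (b n))) (Mat n n)
      (sum_list (map snd (mix_spectrum n (t n * b n) (b n) {#6 * (\<tau>1 n * e n), 6 * (\<tau>2 n * e n)#} {#6 * (\<mu>1 n * e n), 6 * (\<mu>2 n * e n), 6 * (\<mu>3 n * e n)#}))))"
proof -
  obtain \<tau>1 \<tau>2 where T: "\<tau>1 \<longlonglongrightarrow> 3" "\<tau>2 \<longlonglongrightarrow> 2" and evT: "\<forall>\<^sub>F n in sequentially. \<exists>x1 y1 x2 y2.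
    triv_eigen n (t n * b n) (b n) (\<tau>1 n * e n) x1 y1 \<and> triv_eigen n (t n * b n) (b n) (\<tau>2 n * e n) x2 y2 \<and> x1 * y2 \<noteq> x2 * y1"
    using family_triv_eigen by blast
  obtain \<mu>1 \<mu>2 \<mu>3 where M: "\<mu>1 \<longlonglongrightarrow> 2" "\<mu>2 \<longlonglongrightarrow> 0" "\<mu>3 \<longlonglongrightarrow> - 1" and evM: "\<forall>\<^sub>F n in sequentially. \<exists>x1 y1 z1 x2 y2 z2 x3 y3 z3.
    std_eigen n (t n * b n) (b n) (\<mu>1 n * e n) x1 y1 z1 \<and> std_eigen n (t n * b n) (b n) (\<mu>2 n * e n) x2 y2 z2 \<and>
    std_eigen n (t n * b n) (b n) (\<mu>3 n * e n) x3 y3 z3 \<and> indep3 (x1, y1, z1) (x2, y2, z2) (x3, y3, z3)"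
    using family_std_eigen by blast
  have "\<forall>\<^sub>F n in sequentially.
    has_spectrum_by_type (hessian n (mix n (t n * b n) (b n))) (Mat n n)
      (mix_spectrum n (t n * b n) (b n) {#6 * (\<tau>1 n * e n), 6 * (\<tau>2 n * e n)#} {#6 * (\<mu>1 n * e n), 6 * (\<mu>2 n * e n), 6 * (\<mu>3 n * e n)#}) \<and>
    diagonal_on (hessian n (mix n (t n * b n) (b n))) (Mat n n)
      (sum_list (map snd (mix_spectrum n (t n * b n) (b n) {#6 * (\<tau>1 n * e n), 6 * (\<tau>2 n * e n)#} {#6 * (\<mu>1 n * e n), 6 * (\<mu>2 n * e n), 6 * (\<mu>3 n * e n)#})))"
    using eventually_ge_at_top[of 3] evT evM
  proof eventually_elim
    case (elim n)
    obtain x1 y1 x2 y2 where T: "triv_eigen n (t n * b n) (b n) (\<tau>1 n * e n) x1 y1" "triv_eigen n (t n * b n) (b n) (\<tau>2 n * e n) x2 y2" "x1 * y2 \<noteq> x2 * y1"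
      using elim(2) by blast
    obtain u1 v1 w1 u2 v2 w2 u3 v3 w3 where M: "std_eigen n (t n * b n) (b n) (\<mu>1 n * e n) u1 v1 w1" "std_eigen n (t n * b n) (b n) (\<mu>2 n * e n) u2 v2 w2"
      "std_eigen n (t n * b n) (b n) (\<mu>3 n * e n) u3 v3 w3" "indep3 (u1, v1, w1) (u2, v2, w2) (u3, v3, w3)"
      using elim(3) by blast
    show ?case using mix_spectrum[OF elim(1) T M] by blast
  qed
  then show ?thesis using T M by blast
qed

lemma family_values:
  "\<forall>\<^sub>F n in sequentially. n \<ge> 3 \<and> t n * b n = \<alpha> n * (1 / real n) \<and> b n = \<beta> n * (1 / real n) \<and>
    gram_off n (t n * b n) (b n) = Q n * (1 / real n) \<and> gram_gap n (t n * b n) (b n) = (\<alpha> n + 2 * \<beta> n) * (1 / real n)"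
  using family_basic
proof eventually_elim
  case (elim n)
  then have ae: "\<alpha> n * e n = t n * b n" "\<beta> n * e n = b n" by blast+
  from elim have "n \<ge> 3" "gram_off n (t n * b n) (b n) = Q n * e n" "gram_gap n (t n * b n) (b n) = \<alpha> n * e n + 2 * (\<beta> n * e n)"
    unfolding ae by blast+
  then show ?case using ae unfolding e by (simp add: algebra_simps)
qed

text \<open>By the critical equation \<open>gram_gap - 2 b\<close> equals \<open>a\<close>, so the
  eigenvalue is simply \<open>6 a\<close>.\<close>

lemma family_type_x: "\<forall>\<^sub>F n in sequentially. 6 * (gram_gap n (t n * b n) (b n) - 2 * b n) = (6 * \<alpha> n) * (1 / real n)"
  using family_values
proof eventually_elim
  case (elim n)
  then have v: "b n = \<beta> n * (1 / real n)" "gram_gap n (t n * b n) (b n) = (\<alpha> n + 2 * \<beta> n) * (1 / real n)" by blast+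
  show ?case unfolding v(2) by (subst v(1)) (simp add: algebra_simps)
qed

lemma family_type_y:
  "\<forall>\<^sub>F n in sequentially. 6 * (4 * (t n * b n)\<^sup>2 * gram_off n (t n * b n) (b n) + (gram_gap n (t n * b n) (b n) - 2 * b n))
    = (6 * (4 * (\<alpha> n)\<^sup>2 * Q n * (e n)\<^sup>2 + \<alpha> n)) * (1 / real n)"
  using family_values family_type_x
proof eventually_elim
  case (elim n)
  then have v: "t n * b n = \<alpha> n * (1 / real n)" "gram_off n (t n * b n) (b n) = Q n * (1 / real n)" by blast+
  have "4 * (t n * b n)\<^sup>2 * gram_off n (t n * b n) (b n) = 4 * (\<alpha> n * (1 / real n))\<^sup>2 * (Q n * (1 / real n))"
    unfolding v(2) unfolding v(1) ..
  then show ?case using elim(2) unfolding e by (simp add: algebra_simps power2_eq_square)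
qed

text \<open>The eigenvalue on constant columns of the upper mixed block. Since
  \<open>\<alpha> + 2 \<beta>\<close> tends to 0, only the term with \<open>Q\<close> survives in
  the limit.\<close>

lemma family_upper_block:
  "\<forall>\<^sub>F n in sequentially. 6 * gram_gap n (t n * b n) (b n) + real n * (6 * (gram_off n (t n * b n) (b n))\<^sup>2)
    = (6 * (\<alpha> n + 2 * \<beta> n) + 6 * (Q n)\<^sup>2) * (1 / real n)"
  using family_values
proof eventually_elim
  case (elim n)
  then have v: "n \<ge> 3" "gram_gap n (t n * b n) (b n) = (\<alpha> n + 2 * \<beta> n) * (1 / real n)" "gram_off n (t n * b n) (b n) = Q n * (1 / real n)" by blast+
  show ?case unfolding v(2,3) using v(1) by (simp add: field_simps power2_eq_square)
qed

lemma family_limits: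
  "(\<lambda>n. 6 * \<alpha> n) \<longlonglongrightarrow> - 12" "(\<lambda>n. 6 * (4 * (\<alpha> n)\<^sup>2 * Q n * (e n)\<^sup>2 + \<alpha> n)) \<longlonglongrightarrow> - 12"
  "(\<lambda>n. 6 * (\<alpha> n + 2 * \<beta> n) + 6 * (Q n)\<^sup>2) \<longlonglongrightarrow> 6" "(\<lambda>n. 6 * (\<alpha> n + 2 * \<beta> n)) \<longlonglongrightarrow> 0"
proof -
  have "(\<lambda>n. 6 * \<alpha> n) \<longlonglongrightarrow> 6 * - 2" by (intro tendsto_intros limits)
  then show "(\<lambda>n. 6 * \<alpha> n) \<longlonglongrightarrow> - 12" by simp
  have "(\<lambda>n. 6 * (4 * (\<alpha> n)\<^sup>2 * Q n * (e n)\<^sup>2 + \<alpha> n)) \<longlonglongrightarrow> 6 * (4 * (- 2)\<^sup>2 * 1 * 0\<^sup>2 + - 2)" by (intro tendsto_intros limits)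
  then show "(\<lambda>n. 6 * (4 * (\<alpha> n)\<^sup>2 * Q n * (e n)\<^sup>2 + \<alpha> n)) \<longlonglongrightarrow> - 12" by simp
  have "(\<lambda>n. 6 * (\<alpha> n + 2 * \<beta> n) + 6 * (Q n)\<^sup>2) \<longlonglongrightarrow> 6 * (- 2 + 2 * 1) + 6 * 1\<^sup>2" by (intro tendsto_intros limits)
  then show "(\<lambda>n. 6 * (\<alpha> n + 2 * \<beta> n) + 6 * (Q n)\<^sup>2) \<longlonglongrightarrow> 6" by simp
  have "(\<lambda>n. 6 * (\<alpha> n + 2 * \<beta> n)) \<longlonglongrightarrow> 6 * (- 2 + 2 * 1)" by (intro tendsto_intros limits)
  then show "(\<lambda>n. 6 * (\<alpha> n + 2 * \<beta> n)) \<longlonglongrightarrow> 0" by simp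
qed

lemma family_loss:
  "\<exists>\<nu>. \<nu> \<longlonglongrightarrow> - 1 \<and> (\<forall>\<^sub>F n in sequentially. loss n (mix n (t n * b n) (b n)) - real n = \<nu> n * (1 / real n))"
proof -
  define F where "F n = e n * (Q n + (\<alpha> n)\<^sup>2 * e n) ^ 3 + (1 - e n) * Q n ^ 3 - 2 * (e n * (\<alpha> n + \<beta> n) ^ 3 + (1 - e n) * \<beta> n ^ 3)" for n
  have "F \<longlonglongrightarrow> 0 * (1 + (- 2)\<^sup>2 * 0) ^ 3 + (1 - 0) * 1 ^ 3 - 2 * (0 * (- 2 + 1) ^ 3 + (1 - 0) * 1 ^ 3)"
    unfolding F_def[abs_def] by (intro tendsto_intros limits)
  then have lim: "F \<longlonglongrightarrow> - 1" by simp
  have "\<forall>\<^sub>F n in sequentially. loss n (mix n (t n * b n) (b n)) - real n = F n * (1 / real n)"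
    using family_basic
  proof eventually_elim
    case (elim n)
    then have v: "n \<ge> 3" "real n * e n = 1" "\<alpha> n * e n = t n * b n" "\<beta> n * e n = b n"
      "gram_off n (\<alpha> n * e n) (\<beta> n * e n) = Q n * e n" by blast+
    have "real n * (loss n (mix n (\<alpha> n * e n) (\<beta> n * e n)) - real n) = F n"
      unfolding loss_mix v(5) F_def by (rule scaled_loss[OF v(2)])
    then show ?case unfolding v(3,4) using v(1) by (simp add: field_simps)
  qed
  then show ?thesis using lim by blast
qed

lemma family_mix:
  "(\<exists>C :: nat \<Rightarrow> matr.
        (\<forall>\<^sub>F d in sequentially. critical d (C d) \<and>
           (\<exists>\<xi>1 \<xi>2 :: real. C d = \<xi>1 *\<^sub>R id_mat d + \<xi>2 *\<^sub>R (ones_mat d - id_mat d)) \<and>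
           isotropy d (C d) = Delta (carrier (sym_group d)) \<and>
           orbit_length d (C d) = fact d) \<and>
        (\<exists>err \<in> o(\<lambda>d. 1 / real d). \<forall>\<^sub>F d in sequentially. \<forall>i \<in> {1..d}. \<forall>j \<in> {1..d}.
           \<bar>C d i j - ((1 / real d) *\<^sub>R (ones_mat d - 2 *\<^sub>R id_mat d)) i j\<bar> \<le> err d) \<and>
        eq_mod_inverse (\<lambda>d. loss d (C d)) (\<lambda>d. real d - 1 / real d) \<and>
        (\<exists>t1 t2 s1 s2 s3 x y :: nat \<Rightarrow> real.
           eq_mod_inverse t1 (\<lambda>d. 18 / real d) \<and>
           eq_mod_inverse t2 (\<lambda>d. 12 / real d) \<and>
           eq_mod_inverse s1 (\<lambda>d. 12 / real d) \<and>
           eq_mod_inverse s2 (\<lambda>d. 0) \<and>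
           eq_mod_inverse s3 (\<lambda>d. - 6 / real d) \<and>
           eq_mod_inverse x (\<lambda>d. - 12 / real d) \<and>
           eq_mod_inverse y (\<lambda>d. - 12 / real d) \<and>
           (\<forall>\<^sub>F d in sequentially. has_spectrum_by_type (hessian d (C d)) (Mat d d)
             [(type_t d, {#t1 d, t2 d#}),
              (type_s d, repeat_mset (d - 1) {#s1 d, s2 d, s3 d#}),
              (type_x d, replicate_mset ((d - 1) * (d - 2) div 2) (x d)),
              (type_y d, replicate_mset (d * (d - 3) div 2) (y d))])))"
proof (intro exI[of _ "\<lambda>n. mix n (t n * b n) (b n)"] conjI)
  show "\<forall>\<^sub>F d in sequentially. critical d (mix d (t d * b d) (b d)) \<and>
     (\<exists>\<xi>1 \<xi>2. mix d (t d * b d) (b d) = \<xi>1 *\<^sub>R id_mat d + \<xi>2 *\<^sub>R (ones_mat d - id_mat d)) \<and>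
     isotropy d (mix d (t d * b d) (b d)) = Delta (carrier (sym_group d)) \<and> orbit_length d (mix d (t d * b d) (b d)) = fact d"
    using family_basic
  proof eventually_elim
    case (elim n)
    then have c: "critical n (mix n (t n * b n) (b n))" and ne: "t n * b n \<noteq> 0" by auto
    have "mix n (t n * b n) (b n) = (t n * b n + b n) *\<^sub>R id_mat n + b n *\<^sub>R (ones_mat n - id_mat n)"
      by (intro ext) (auto simp: mix_def id_mat_def ones_mat_def scaleR_fun_def fun_diff_def)
    then show ?case using c isotropy_mix[OF ne] orbit_length_mix[OF ne] by blast
  qed
  \<comment> \<open>The error on the diagonal plus the error off the diagonal, so that one function
    bounds every entry.\<close>
  define err where "err n = \<bar>t n * b n + b n + 1 / real n\<bar> + \<bar>b n - 1 / real n\<bar>" for n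
  show "\<exists>err\<in>o(\<lambda>d. 1 / real d). \<forall>\<^sub>F d in sequentially. \<forall>i\<in>{1..d}. \<forall>j\<in>{1..d}.
     \<bar>mix d (t d * b d) (b d) i j - ((1 / real d) *\<^sub>R (ones_mat d - 2 *\<^sub>R id_mat d)) i j\<bar> \<le> err d"
  proof (intro bexI[of _ err] always_eventually allI ballI)
    fix d i j :: nat assume "i \<in> {1..d}" "j \<in> {1..d}"
    then show "\<bar>mix d (t d * b d) (b d) i j - ((1 / real d) *\<^sub>R (ones_mat d - 2 *\<^sub>R id_mat d)) i j\<bar> \<le> err d"
      by (cases "i = j") (simp_all add: mix_def id_mat_def ones_mat_def scaleR_fun_def fun_diff_def err_def)
  next
    show "err \<in> o(\<lambda>d. 1 / real d)"
    proof (rule smallo_inverseI, rule Lim_transform_eventually)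
      have "(\<lambda>n. \<bar>\<alpha> n + \<beta> n + 1\<bar> + \<bar>\<beta> n - 1\<bar>) \<longlonglongrightarrow> \<bar>- 2 + 1 + 1\<bar> + \<bar>1 - 1\<bar>" by (intro tendsto_intros limits)
      then show "(\<lambda>n. \<bar>\<alpha> n + \<beta> n + 1\<bar> + \<bar>\<beta> n - 1\<bar>) \<longlonglongrightarrow> 0" by simp
      show "\<forall>\<^sub>F n in sequentially. \<bar>\<alpha> n + \<beta> n + 1\<bar> + \<bar>\<beta> n - 1\<bar> = real n * err n"
        using eventually_gt_at_top[of 0]
      proof eventually_elim
        case (elim n)
        have m: "real n * \<bar>x\<bar> = \<bar>real n * x\<bar>" for x by (simp add: abs_mult)
        have "real n * err n = \<bar>real n * (t n * b n + b n + 1 / real n)\<bar> + \<bar>real n * (b n - 1 / real n)\<bar>"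
          unfolding err_def distrib_left[of _ "\<bar>_\<bar>"] m ..
        also have "real n * (t n * b n + b n + 1 / real n) = \<alpha> n + \<beta> n + 1" using elim by (simp add: \<alpha> \<beta> field_simps)
        also have "real n * (b n - 1 / real n) = \<beta> n - 1" using elim by (simp add: \<beta> field_simps)
        finally show ?case ..
      qed
    qed
  qed
  obtain \<nu> where \<nu>: "\<nu> \<longlonglongrightarrow> - 1" "\<forall>\<^sub>F n in sequentially. loss n (mix n (t n * b n) (b n)) - real n = \<nu> n * (1 / real n)"
    using family_loss by blast
  show "eq_mod_inverse (\<lambda>d. loss d (mix d (t d * b d) (b d))) (\<lambda>d. real d - 1 / real d)"
    using smallo_scaled[OF \<nu>(2,1)] unfolding eq_mod_inverse_def by (simp add: algebra_simps)
  obtain \<tau>1 \<tau>2 \<mu>1 \<mu>2 \<mu>3 where l: "\<tau>1 \<longlonglongrightarrow> 3" "\<tau>2 \<longlonglongrightarrow> 2" "\<mu>1 \<longlonglongrightarrow> 2" "\<mu>2 \<longlonglongrightarrow> 0" "\<mu>3 \<longlonglongrightarrow> - 1" and sp: "\<forall>\<^sub>F n in sequentially.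
    has_spectrum_by_type (hessian n (mix n (t n * b n) (b n))) (Mat n n)
      (mix_spectrum n (t n * b n) (b n) {#6 * (\<tau>1 n * e n), 6 * (\<tau>2 n * e n)#} {#6 * (\<mu>1 n * e n), 6 * (\<mu>2 n * e n), 6 * (\<mu>3 n * e n)#})"
    using family_spectrum by (elim exE conjE) (auto simp: eventually_conj_iff)
  have S: "eq_mod_inverse (\<lambda>n. 6 * (\<nu> n * e n)) g" if "\<nu> \<longlonglongrightarrow> c" "\<And>n. g n = (6 * c) / real n" for \<nu> c g
    by (rule eq_mod_inverse_scaled[OF _ tendsto_mult_left[OF that(1)] that(2)]) (simp add: e)
  show "\<exists>t1 t2 s1 s2 s3 x y. eq_mod_inverse t1 (\<lambda>d. 18 / real d) \<and> eq_mod_inverse t2 (\<lambda>d. 12 / real d) \<and>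
     eq_mod_inverse s1 (\<lambda>d. 12 / real d) \<and> eq_mod_inverse s2 (\<lambda>d. 0) \<and> eq_mod_inverse s3 (\<lambda>d. - 6 / real d) \<and>
     eq_mod_inverse x (\<lambda>d. - 12 / real d) \<and> eq_mod_inverse y (\<lambda>d. - 12 / real d) \<and>
     (\<forall>\<^sub>F d in sequentially. has_spectrum_by_type (hessian d (mix d (t d * b d) (b d))) (Mat d d)
       [(type_t d, {#t1 d, t2 d#}), (type_s d, repeat_mset (d - 1) {#s1 d, s2 d, s3 d#}),
        (type_x d, replicate_mset ((d - 1) * (d - 2) div 2) (x d)), (type_y d, replicate_mset (d * (d - 3) div 2) (y d))])"
    by (rule exI, rule exI, rule exI, rule exI, rule exI, rule exI, rule exI, intro conjI,
        rule S[OF l(1)], simp, rule S[OF l(2)], simp, rule S[OF l(3)], simp, rule S[OF l(4)], simp, rule S[OF l(5)], simp,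
        rule eq_mod_inverse_scaled[OF family_type_x family_limits(1)], simp,
        rule eq_mod_inverse_scaled[OF family_type_y family_limits(2)], simp,
        rule sp[unfolded mix_spectrum_def])
qed

text \<open>Since \<open>cube_fun\<close> decreases, the upper bound for the ratio yields the lower
  bound for \<open>b\<close> and conversely.\<close>

lemma family_bounds:
  "\<forall>\<^sub>F n in sequentially. ratio_lo (real n) \<le> t n \<and> t n \<le> ratio_hi (real n) \<and> ratio_lo (real n) \<ge> - 2 \<and>
    0 \<le> cube_fun (real n) (ratio_hi (real n)) powr (1 / 3) \<and>
    cube_fun (real n) (ratio_hi (real n)) powr (1 / 3) \<le> b n \<and> b n \<le> cube_fun (real n) (ratio_lo (real n)) powr (1 / 3)"
proof -
  have "\<forall>\<^sub>F n in sequentially. ratio_hi (real n) \<le> - 1" by real_asymp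
  moreover have "\<forall>\<^sub>F n in sequentially. ratio_lo (real n) \<ge> - 2" by real_asymp
  moreover have "\<forall>\<^sub>F n in sequentially. cube_fun (real n) (ratio_hi (real n)) \<ge> 0" unfolding cube_fun_def by real_asymp
  ultimately show ?thesis using t cube_pos eventually_ge_at_top[of 7]
  proof eventually_elim
    case (elim n)
    have n: "real n \<ge> 7" using elim by simp
    have pos: "0 < 2 * s + real n" "0 < s + real n" if "- 2 \<le> s" for s using that n by linarith+
    from elim have lo: "ratio_lo (real n) \<le> t n" and hi: "t n \<le> ratio_hi (real n)" by blast+
    have "cube_fun (real n) (t n) \<le> cube_fun (real n) (ratio_lo (real n))"
      by (rule cube_fun_antimono[OF lo]) (use elim(1) hi in linarith, (rule pos[OF elim(2)])+)
    moreover have "cube_fun (real n) (ratio_hi (real n)) \<le> cube_fun (real n) (t n)"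
      by (rule cube_fun_antimono[OF hi]) (use elim(1,2) lo n in linarith)+
    ultimately show ?case using elim lo hi unfolding b by (auto intro!: powr_mono2)
  qed
qed

text \<open>Upper and lower bounds have the same expansion up to \<open>d^-4\<close>, so it suffices
  to expand explicit functions of \<open>d\<close>. In the coefficient 13/3, the part 10/3 comes
  from the factors \<open>(n - 4)^2 (n - 2)\<close> in the denominator of \<open>b^3\<close> at
  \<open>t = -2\<close> and the part 1 from \<open>n = d - 1\<close>.\<close>

lemma family_expansion:
  "(\<lambda>d. t (d - 1) * b (d - 1) + b (d - 1) - (- 1 / real d - 13 / (3 * real d ^ 2) - 77 / (9 * real d ^ 3) + 6421 / (81 * real d ^ 4))) \<in> o(\<lambda>d. 1 / real d ^ 4)"
  "(\<lambda>d. b (d - 1) - (1 / real d + 13 / (3 * real d ^ 2) + 149 / (9 * real d ^ 3) + 2867 / (81 * real d ^ 4))) \<in> o(\<lambda>d. 1 / real d ^ 4)"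
proof -
  let ?lo = "\<lambda>d. cube_fun (real d - 1) (ratio_hi (real d - 1)) powr (1 / 3)"
  let ?hi = "\<lambda>d. cube_fun (real d - 1) (ratio_lo (real d - 1)) powr (1 / 3)"
  let ?E1 = "\<lambda>d. - 1 / real d - 13 / (3 * real d ^ 2) - 77 / (9 * real d ^ 3) + 6421 / (81 * real d ^ 4)"
  let ?E2 = "\<lambda>d. 1 / real d + 13 / (3 * real d ^ 2) + 149 / (9 * real d ^ 3) + 2867 / (81 * real d ^ 4)"
  have B: "\<forall>\<^sub>F d in sequentially. ratio_lo (real d - 1) \<le> t (d - 1) \<and> t (d - 1) \<le> ratio_hi (real d - 1) \<and> ratio_lo (real d - 1) \<ge> - 2 \<and>
    0 \<le> ?lo d \<and> ?lo d \<le> b (d - 1) \<and> b (d - 1) \<le> ?hi d"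
    using eventually_compose_filterlim[OF family_bounds filterlim_pred] eventually_ge_at_top[of 1]
    by eventually_elim (simp only: of_nat_diff of_nat_1)
  show "(\<lambda>d. b (d - 1) - ?E2 d) \<in> o(\<lambda>d. 1 / real d ^ 4)"
  proof (rule smallo_inverse_powerI, rule tendsto_sandwich)
    show "\<forall>\<^sub>F d in sequentially. real d ^ 4 * (?lo d - ?E2 d) \<le> real d ^ 4 * (b (d - 1) - ?E2 d)"
      using B by eventually_elim (intro mult_left_mono diff_right_mono, auto)
    show "\<forall>\<^sub>F d in sequentially. real d ^ 4 * (b (d - 1) - ?E2 d) \<le> real d ^ 4 * (?hi d - ?E2 d)"
      using B by eventually_elim (intro mult_left_mono diff_right_mono, auto)
    show "(\<lambda>d. real d ^ 4 * (?lo d - ?E2 d)) \<longlonglongrightarrow> 0" unfolding cube_fun_def by real_asymp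
    show "(\<lambda>d. real d ^ 4 * (?hi d - ?E2 d)) \<longlonglongrightarrow> 0" unfolding cube_fun_def by real_asymp
  qed
  let ?l = "\<lambda>d. (ratio_lo (real d - 1) + 2) * ?lo d - ?hi d" and ?h = "\<lambda>d. (ratio_hi (real d - 1) + 2) * ?hi d - ?lo d"
  have C: "\<forall>\<^sub>F d in sequentially. ?l d \<le> t (d - 1) * b (d - 1) + b (d - 1) \<and> t (d - 1) * b (d - 1) + b (d - 1) \<le> ?h d"
    using B
  proof eventually_elim
    case (elim d)
    \<comment> \<open>Written in this way both factors of the product are nonnegative, so their
      bounds multiply; \<open>t + 2\<close> is small enough for the resulting error not to
      matter.\<close>
    have eq: "t (d - 1) * b (d - 1) + b (d - 1) = (t (d - 1) + 2) * b (d - 1) - b (d - 1)" by (simp add: algebra_simps)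
    have "(ratio_lo (real d - 1) + 2) * ?lo d \<le> (t (d - 1) + 2) * b (d - 1)"
      by (rule mult_mono) (use elim in linarith)+
    moreover have "(t (d - 1) + 2) * b (d - 1) \<le> (ratio_hi (real d - 1) + 2) * ?hi d"
      by (rule mult_mono) (use elim in linarith)+
    ultimately show ?case unfolding eq using elim by linarith
  qed
  show "(\<lambda>d. t (d - 1) * b (d - 1) + b (d - 1) - ?E1 d) \<in> o(\<lambda>d. 1 / real d ^ 4)"
  proof (rule smallo_inverse_powerI, rule tendsto_sandwich)
    show "\<forall>\<^sub>F d in sequentially. real d ^ 4 * (?l d - ?E1 d) \<le> real d ^ 4 * (t (d - 1) * b (d - 1) + b (d - 1) - ?E1 d)"
      using C by eventually_elim (intro mult_left_mono diff_right_mono, auto)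
    show "\<forall>\<^sub>F d in sequentially. real d ^ 4 * (t (d - 1) * b (d - 1) + b (d - 1) - ?E1 d) \<le> real d ^ 4 * (?h d - ?E1 d)"
      using C by eventually_elim (intro mult_left_mono diff_right_mono, auto)
    show "(\<lambda>d. real d ^ 4 * (?l d - ?E1 d)) \<longlonglongrightarrow> 0" unfolding cube_fun_def by real_asymp
    show "(\<lambda>d. real d ^ 4 * (?h d - ?E1 d)) \<longlonglongrightarrow> 0" unfolding cube_fun_def by real_asymp
  qed
qed

text \<open>The spectrum is that of the block of size \<open>d - 1\<close>, the eigenvalue 18 of the
  corner, the eigenvalue 6 of the lower mixed block, and two asymptotic eigenvalues \<open>u\<close>
  and \<open>z\<close> of the upper mixed block.\<close>

lemma family_Xi_spectrum:
  fixes X :: "nat \<Rightarrow> matr"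
  assumes X: "\<forall>\<^sub>F d in sequentially. X d = direct_sum (d - 1) (mix (d - 1) (t (d - 1) * b (d - 1)) (b (d - 1))) (mix 1 1 0)"
  shows "\<exists>(S :: nat \<Rightarrow> real multiset) (err :: nat \<Rightarrow> real). err \<in> o(\<lambda>d. 1 / real d) \<and>
     (\<forall>\<^sub>F d in sequentially. has_spectrum (hessian d (X d)) (Mat d d) (S d) \<and>
        rel_mset (\<lambda>x y. \<bar>x - y\<bar> \<le> err d) (S d)
          (replicate_mset 1 18 + replicate_mset (d - 1) 6 + replicate_mset 1 (18 / real d) + replicate_mset (d - 1) (12 / real d) +
           replicate_mset 1 (6 / real d) + replicate_mset (2 * d - 4) 0 + replicate_mset (d - 2) (- 6 / real d) +
           replicate_mset (d\<^sup>2 + 5 - 5 * d) (- 12 / real d)))"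
proof -
  obtain \<tau>1 \<tau>2 \<mu>1 \<mu>2 \<mu>3 where l: "\<tau>1 \<longlonglongrightarrow> 3" "\<tau>2 \<longlonglongrightarrow> 2" "\<mu>1 \<longlonglongrightarrow> 2" "\<mu>2 \<longlonglongrightarrow> 0" "\<mu>3 \<longlonglongrightarrow> - 1" and sp: "\<forall>\<^sub>F n in sequentially.
    diagonal_on (hessian n (mix n (t n * b n) (b n))) (Mat n n)
      (sum_list (map snd (mix_spectrum n (t n * b n) (b n) {#6 * (\<tau>1 n * e n), 6 * (\<tau>2 n * e n)#} {#6 * (\<mu>1 n * e n), 6 * (\<mu>2 n * e n), 6 * (\<mu>3 n * e n)#})))"
    using family_spectrum by (elim exE conjE) (auto simp: eventually_conj_iff)
  define f where "f \<nu> n = 6 * (\<nu> n * e n)" for \<nu> and n :: nat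
  define x where "x n = 6 * (gram_gap n (t n * b n) (b n) - 2 * b n)" for n
  define y where "y n = 6 * (4 * (t n * b n)\<^sup>2 * gram_off n (t n * b n) (b n) + (gram_gap n (t n * b n) (b n) - 2 * b n))" for n
  define z where "z n = 6 * gram_gap n (t n * b n) (b n)" for n
  define u where "u n = z n + real n * (6 * (gram_off n (t n * b n) (b n))\<^sup>2)" for n
  have zv: "\<forall>\<^sub>F n in sequentially. z n = (6 * (\<alpha> n + 2 * \<beta> n)) * (1 / real n)"
    using family_values
  proof eventually_elim
    case (elim n)
    then have v: "gram_gap n (t n * b n) (b n) = (\<alpha> n + 2 * \<beta> n) * (1 / real n)" by blast
    show ?case unfolding z_def v by simp
  qed
  have F: "(\<lambda>d. f \<nu> (d - 1) - (6 * c) / real d) \<in> o(\<lambda>d. 1 / real d)" if "\<nu> \<longlonglongrightarrow> c" for \<nu> c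
    by (rule smallo_scaled_shift[OF _ tendsto_mult_left[OF that]]) (simp add: e f_def)
  define a1 a2 a3 a4 a5 where "a1 d = \<bar>f \<tau>1 (d - 1) - (6 * 3) / real d\<bar>" and "a2 d = \<bar>f \<tau>2 (d - 1) - (6 * 2) / real d\<bar>"
    and "a3 d = \<bar>f \<mu>1 (d - 1) - (6 * 2) / real d\<bar>" and "a4 d = \<bar>f \<mu>2 (d - 1) - (6 * 0) / real d\<bar>"
    and "a5 d = \<bar>f \<mu>3 (d - 1) - (6 * - 1) / real d\<bar>" for d
  define a6 a7 a8 a9 where "a6 d = \<bar>x (d - 1) - (- 12) / real d\<bar>" and "a7 d = \<bar>y (d - 1) - (- 12) / real d\<bar>"
    and "a8 d = \<bar>u (d - 1) - 6 / real d\<bar>" and "a9 d = \<bar>z (d - 1) - 0 / real d\<bar>" for d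
  have nn: "0 \<le> a1 d" "0 \<le> a2 d" "0 \<le> a3 d" "0 \<le> a4 d" "0 \<le> a5 d" "0 \<le> a6 d" "0 \<le> a7 d" "0 \<le> a8 d" "0 \<le> a9 d" for d
    by (simp_all add: a1_def a2_def a3_def a4_def a5_def a6_def a7_def a8_def a9_def)
  \<comment> \<open>The comparison of multisets uses a single error bound; the sum of all nine
    deviations dominates each of them.\<close>
  define err where "err d = a1 d + a2 d + a3 d + a4 d + a5 d + a6 d + a7 d + a8 d + a9 d" for d
  have err: "0 \<le> err d" "a1 d \<le> err d" "a2 d \<le> err d" "a3 d \<le> err d" "a4 d \<le> err d" "a5 d \<le> err d" "a6 d \<le> err d" "a7 d \<le> err d" "a8 d \<le> err d" "a9 d \<le> err d" for d
    using nn[of d] unfolding err_def by linarith+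
  have small: "a1 \<in> o(\<lambda>d. 1 / real d)" "a2 \<in> o(\<lambda>d. 1 / real d)" "a3 \<in> o(\<lambda>d. 1 / real d)" "a4 \<in> o(\<lambda>d. 1 / real d)" "a5 \<in> o(\<lambda>d. 1 / real d)"
    unfolding a1_def[abs_def] a2_def[abs_def] a3_def[abs_def] a4_def[abs_def] a5_def[abs_def] landau_o.small.abs_in_iff
    by (rule F, rule l)+
  have small': "a6 \<in> o(\<lambda>d. 1 / real d)" "a7 \<in> o(\<lambda>d. 1 / real d)" "a8 \<in> o(\<lambda>d. 1 / real d)" "a9 \<in> o(\<lambda>d. 1 / real d)"
    unfolding a6_def[abs_def] a7_def[abs_def] a8_def[abs_def] a9_def[abs_def] landau_o.small.abs_in_iff
    using smallo_scaled_shift[OF family_type_x[folded x_def] family_limits(1)] smallo_scaled_shift[OF family_type_y[folded y_def] family_limits(2)]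
      smallo_scaled_shift[OF family_upper_block[folded z_def, folded u_def] family_limits(3)] smallo_scaled_shift[OF zv family_limits(4)]
    by blast+
  have err_small: "err \<in> o(\<lambda>d. 1 / real d)"
    unfolding err_def[abs_def] by (intro sum_in_smallo small small')
  define S where "S n = replicate_mset 1 (f \<tau>1 n) + replicate_mset 1 (f \<tau>2 n)
     + (replicate_mset (n - 1) (f \<mu>1 n) + replicate_mset (n - 1) (f \<mu>2 n) + replicate_mset (n - 1) (f \<mu>3 n))
     + replicate_mset ((n - 1) * (n - 2) div 2) (x n) + replicate_mset (n * (n - 3) div 2) (y n)
     + replicate_mset 1 18 + (replicate_mset 1 (u n) + replicate_mset (n - 1) (z n)) + replicate_mset n 6" for n
  have main: "\<forall>\<^sub>F d in sequentially. has_spectrum (hessian d (X d)) (Mat d d) (S (d - 1))"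
    using X eventually_compose_filterlim[OF sp filterlim_pred] eventually_ge_at_top[of 2]
  proof eventually_elim
    case (elim d)
    define n where "n = d - 1"
    have dn: "d = n + 1" and n: "n \<ge> 1" using elim(3) by (simp_all add: n_def)
    let ?A = "mix n (t n * b n) (b n)" and ?B = "mix 1 1 0"
    have q: "gram_off 1 1 0 = 0" "gram_gap 1 1 0 = 1" by (simp_all add: gram_off_def gram_gap_def)
    have low: "diagonal_on (hessian (n + 1) (direct_sum n ?A ?B)) (Supp {n + 1..n + 1} {1..n}) (replicate_mset n 6)"
      using diagonal_on_lower_block[of 1 n ?A 1 0] unfolding q by simp
    have B: "diagonal_on (hessian 1 ?B) (Mat 1 1) (replicate_mset 1 18)"
      using diagonal_on_id[of 1] by simp
    have up: "diagonal_on (hessian (n + 1) (direct_sum n ?A ?B)) (Supp {1..n} {n + 1..n + 1}) (replicate_mset 1 (u n) + replicate_mset (n - 1) (z n))"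
      using diagonal_on_upper_block[OF n, of 1 "t n * b n" "b n" ?B] unfolding u_def z_def mult_1_right .
    have rep: "repeat_mset (n - 1) {#p, q, r#} = replicate_mset (n - 1) p + replicate_mset (n - 1) q + replicate_mset (n - 1) r" for p q r :: real
      by (rule multiset_eqI) simp
    have pair: "{#p, q#} = replicate_mset 1 p + replicate_mset 1 q" for p q :: real by simp
    have A: "diagonal_on (hessian n ?A) (Mat n n) (replicate_mset 1 (f \<tau>1 n) + replicate_mset 1 (f \<tau>2 n)
     + (replicate_mset (n - 1) (f \<mu>1 n) + replicate_mset (n - 1) (f \<mu>2 n) + replicate_mset (n - 1) (f \<mu>3 n))
     + replicate_mset ((n - 1) * (n - 2) div 2) (x n) + replicate_mset (n * (n - 3) div 2) (y n))"
      using elim(2) unfolding n_def[symmetric] mix_spectrum_def f_def x_def y_def list.map snd_conv sum_list.Cons sum_list.Nil add_0_right rep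
      unfolding pair by (simp only: add.assoc)
    show ?case
      using diagonal_on_has_spectrum[OF linear_hessian diagonal_on_direct_sum[OF A B up low]]
      unfolding elim(1) n_def[symmetric] dn[symmetric] S_def .
  qed
  have rel: "\<forall>\<^sub>F d in sequentially. rel_mset (\<lambda>x y. \<bar>x - y\<bar> \<le> err d) (S (d - 1))
    (replicate_mset 1 18 + replicate_mset (d - 1) 6 + replicate_mset 1 (18 / real d) + replicate_mset (d - 1) (12 / real d) +
     replicate_mset 1 (6 / real d) + replicate_mset (2 * d - 4) 0 + replicate_mset (d - 2) (- 6 / real d) +
     replicate_mset (d\<^sup>2 + 5 - 5 * d) (- 12 / real d))"
    using eventually_ge_at_top[of 5]
  proof eventually_elim
    case (elim d)
    define n where "n = d - 1"
    have dn: "d = n + 1" and n: "n \<ge> 4" using elim by (simp_all add: n_def)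
    have b1: "\<bar>f \<tau>1 n - 18 / real d\<bar> \<le> err d" using err(2)[of d] unfolding a1_def n_def by simp
    have b2: "\<bar>f \<tau>2 n - 12 / real d\<bar> \<le> err d" using err(3)[of d] unfolding a2_def n_def by simp
    have b3: "\<bar>f \<mu>1 n - 12 / real d\<bar> \<le> err d" using err(4)[of d] unfolding a3_def n_def by simp
    have b4: "\<bar>f \<mu>2 n - 0\<bar> \<le> err d" using err(5)[of d] unfolding a4_def n_def by simp
    have b5: "\<bar>f \<mu>3 n - - 6 / real d\<bar> \<le> err d" using err(6)[of d] unfolding a5_def n_def by simp
    have b6: "\<bar>x n - - 12 / real d\<bar> \<le> err d" using err(7)[of d] unfolding a6_def n_def by simp
    have b7: "\<bar>y n - - 12 / real d\<bar> \<le> err d" using err(8)[of d] unfolding a7_def n_def by simp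
    have b8: "\<bar>u n - 6 / real d\<bar> \<le> err d" using err(9)[of d] unfolding a8_def n_def by simp
    have b9: "\<bar>z n - 0\<bar> \<le> err d" using err(10)[of d] unfolding a9_def n_def by simp
    have b10: "\<bar>18 - 18 :: real\<bar> \<le> err d" "\<bar>6 - 6 :: real\<bar> \<le> err d" using err(1)[of d] by simp_all
    have "rel_mset (\<lambda>x y. \<bar>x - y\<bar> \<le> err d) (S n) (replicate_mset 1 (18 / real d) + replicate_mset 1 (12 / real d)
     + (replicate_mset (n - 1) (12 / real d) + replicate_mset (n - 1) 0 + replicate_mset (n - 1) (- 6 / real d))
     + replicate_mset ((n - 1) * (n - 2) div 2) (- 12 / real d) + replicate_mset (n * (n - 3) div 2) (- 12 / real d)
     + replicate_mset 1 18 + (replicate_mset 1 (6 / real d) + replicate_mset (n - 1) 0) + replicate_mset n 6)"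
      unfolding S_def by (intro rel_mset_union rel_mset_replicate b1 b2 b3 b4 b5 b6 b7 b8 b9 b10)
    also have "\<dots> = replicate_mset 1 18 + replicate_mset n 6 + replicate_mset 1 (18 / real d) + replicate_mset n (12 / real d) + replicate_mset 1 (6 / real d)
     + replicate_mset (2 * n - 2) 0 + replicate_mset (n - 1) (- 6 / real d) + replicate_mset ((n - 1) * (n - 2) div 2 + n * (n - 3) div 2) (- 12 / real d)"
      by (rule regroup_spectrum) (use n in simp)
    finally have R: "rel_mset (\<lambda>x y. \<bar>x - y\<bar> \<le> err d) (S n) (replicate_mset 1 18 + replicate_mset n 6 + replicate_mset 1 (18 / real d) + replicate_mset n (12 / real d) + replicate_mset 1 (6 / real d)
     + replicate_mset (2 * n - 2) 0 + replicate_mset (n - 1) (- 6 / real d) + replicate_mset ((n - 1) * (n - 2) div 2 + n * (n - 3) div 2) (- 12 / real d))" .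
    have "2 * d - 4 = 2 * n - 2" "d - 2 = n - 1" "d - 1 = n" using n by (simp_all add: dn)
    moreover have "d\<^sup>2 + 5 - 5 * d = (n - 1) * (n - 2) div 2 + n * (n - 3) div 2" unfolding dn by (rule eigenvalue_count) (use n in simp)
    ultimately show ?case using R by (simp only:)
  qed
  show ?thesis
    by (rule exI[of _ "\<lambda>d. S (d - 1)"], rule exI[of _ err]) (intro conjI err_small eventually_conj main rel)
qed

text \<open>\<xi>3, \<xi>4 and \<xi>5 are constant sequences, and \<xi>1, \<xi>2 are the diagonal
  and off-diagonal entries of the family at \<open>d - 1\<close>.\<close>

lemma family_Xi:
  "(\<exists>\<xi>1 \<xi>2 \<xi>3 \<xi>4 \<xi>5 :: nat \<Rightarrow> real.
        (\<lambda>d. \<xi>1 d - (- 1 / real d - 13 / (3 * real d ^ 2) - 77 / (9 * real d ^ 3)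
                    + 6421 / (81 * real d ^ 4))) \<in> o(\<lambda>d. 1 / real d ^ 4) \<and>
        (\<lambda>d. \<xi>2 d - (1 / real d + 13 / (3 * real d ^ 2) + 149 / (9 * real d ^ 3)
                    + 2867 / (81 * real d ^ 4))) \<in> o(\<lambda>d. 1 / real d ^ 4) \<and>
        \<xi>3 \<in> o(\<lambda>d. 1 / real d ^ 4) \<and>
        \<xi>4 \<in> o(\<lambda>d. 1 / real d ^ 4) \<and>
        (\<lambda>d. \<xi>5 d - 1) \<in> o(\<lambda>d. 1 / real d ^ 4) \<and>
        (let C = (\<lambda>d. Xi d (\<xi>1 d) (\<xi>2 d) (\<xi>3 d) (\<xi>4 d) (\<xi>5 d)) in
          (\<forall>\<^sub>F d in sequentially. critical d (C d) \<and>
             isotropy d (C d) = Delta (fix_last d) \<and>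
             orbit_length d (C d) = d * fact d) \<and>
          eq_mod_inverse (\<lambda>d. loss d (C d)) (\<lambda>d. real d - 1 - 1 / real d) \<and>
          (\<exists>(S :: nat \<Rightarrow> real multiset) (err :: nat \<Rightarrow> real). err \<in> o(\<lambda>d. 1 / real d) \<and>
             (\<forall>\<^sub>F d in sequentially. has_spectrum (hessian d (C d)) (Mat d d) (S d) \<and>
                rel_mset (\<lambda>x y. \<bar>x - y\<bar> \<le> err d) (S d)
                  (replicate_mset 1 18 +
                   replicate_mset (d - 1) 6 +
                   replicate_mset 1 (18 / real d) +
                   replicate_mset (d - 1) (12 / real d) +
                   replicate_mset 1 (6 / real d) +
                   replicate_mset (2 * d - 4) 0 +
                   replicate_mset (d - 2) (- 6 / real d) +
                   replicate_mset (d\<^sup>2 + 5 - 5 * d) (- 12 / real d))))))"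
proof -
  let ?A = "\<lambda>n. mix n (t n * b n) (b n)"
  let ?X = "\<lambda>d. Xi d (t (d - 1) * b (d - 1) + b (d - 1)) (b (d - 1)) 0 0 1"
  have X: "\<forall>\<^sub>F d in sequentially. ?X d = direct_sum (d - 1) (?A (d - 1)) (mix 1 1 0)"
    using eventually_ge_at_top[of 2]
  proof eventually_elim
    case (elim d)
    then have "d - 1 \<ge> 1" "d - 1 + 1 = d" by simp_all
    then show ?case using Xi_eq_direct_sum[of "d - 1"] by metis
  qed
  have 1: "\<forall>\<^sub>F d in sequentially. critical d (?X d) \<and> isotropy d (?X d) = Delta (fix_last d) \<and> orbit_length d (?X d) = d * fact d"
    using X eventually_compose_filterlim[OF family_basic filterlim_pred]
  proof eventually_elim
    case (elim d)
    from elim(2) have b: "d - 1 \<ge> 3" "b (d - 1) > 0" "t (d - 1) < - 1" "critical (d - 1) (?A (d - 1))" by blast+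
    then have d: "d \<ge> 3" "d \<ge> 1" "d - 1 + 1 = d" by simp_all
    have neg: "t (d - 1) * b (d - 1) + b (d - 1) < 0"
    proof -
      have "(t (d - 1) + 1) * b (d - 1) < 0" using b by (intro mult_neg_pos) auto
      then show ?thesis by (simp add: algebra_simps)
    qed
    have iso: "isotropy d (?X d) = Delta (fix_last d)"
      by (rule isotropy_Xi[OF d(1)]) (use neg b in auto)
    have "critical d (?X d)"
      using critical_direct_sum[OF b(4) critical_id[of 1]] unfolding elim(1) d(3) .
    then show ?case using iso orbit_length_fix_last[OF d(2) iso] by blast
  qed
  obtain \<nu> where \<nu>: "\<nu> \<longlonglongrightarrow> - 1" "\<forall>\<^sub>F n in sequentially. loss n (?A n) - real n = \<nu> n * (1 / real n)"
    using family_loss by blast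
  \<comment> \<open>The corner has loss 0, so the loss is that of the block of size
    \<open>d - 1\<close>; its term of order \<open>1 / d\<close> persists.\<close>
  have "\<forall>\<^sub>F d in sequentially. loss d (?X d) - (real d - 1 - 1 / real d) = (loss (d - 1) (?A (d - 1)) - real (d - 1)) - - 1 / real d"
    using X eventually_ge_at_top[of 2]
  proof eventually_elim
    case (elim d)
    then have d: "d - 1 + 1 = d" "real (d - 1) = real d - 1" by simp_all
    have "loss d (?X d) = loss (d - 1) (?A (d - 1))"
      using loss_direct_sum[of "d - 1" 1 "?A (d - 1)" "mix 1 1 0"] unfolding elim(1) d(1) loss_id add_0_right .
    then show ?case unfolding d(2) by simp
  qed
  from landau_o.small.in_cong[OF this] have 2: "eq_mod_inverse (\<lambda>d. loss d (?X d)) (\<lambda>d. real d - 1 - 1 / real d)"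
    using smallo_scaled_shift[OF \<nu>(2,1)] unfolding eq_mod_inverse_def by blast
  have zero: "(\<lambda>_. 0) \<in> o(\<lambda>d. 1 / real d ^ 4)" "(\<lambda>_. 1 - 1 :: real) \<in> o(\<lambda>d. 1 / real d ^ 4)" by simp_all
  show ?thesis
    unfolding Let_def
    by (rule exI[of _ "\<lambda>d. t (d - 1) * b (d - 1) + b (d - 1)"], rule exI[of _ "\<lambda>d. b (d - 1)"], rule exI[of _ "\<lambda>_. 0"], rule exI[of _ "\<lambda>_. 0"],
        rule exI[of _ "\<lambda>_. 1"]) (intro conjI family_expansion zero 1 2 family_Xi_spectrum[OF X])
qed

end

section \<open>The seven families\<close>

lemma loss_zero: "loss d (mix d 0 0) = real d"
  unfolding loss_mix by (simp add: gram_off_def)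

lemma properties_C_I:
  "(\<forall>d \<ge> 1. critical d (C_I d) \<and>
        isotropy d (C_I d) = Delta (carrier (sym_group d)) \<and>
        loss d (C_I d) = 0 \<and>
        orbit_length d (C_I d) = fact d \<and>
        (d \<ge> 3 \<longrightarrow> has_spectrum_by_type (hessian d (C_I d)) (Mat d d)
          [(type_t d, {#18, 6#}),
           (type_s d, repeat_mset (d - 1) {#18, 6, 6#}),
           (type_x d, replicate_mset ((d - 1) * (d - 2) div 2) 6),
           (type_y d, replicate_mset (d * (d - 3) div 2) 6)]))"
  unfolding C_I_def id_mat_eq_mix
  by (intro allI impI conjI critical_id loss_id spectrum_id isotropy_mix orbit_length_mix) simp_all

lemma properties_C_0:
  "(\<forall>d \<ge> 1. critical d (C_0 d) \<and>
        isotropy d (C_0 d) = carrier (sym_group d) \<times> carrier (sym_group d) \<and>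
        loss d (C_0 d) = real d \<and>
        orbit_length d (C_0 d) = 1 \<and>
        has_spectrum (hessian d (C_0 d)) (Mat d d) (replicate_mset (d\<^sup>2) 0))"
proof -
  have C: "C_0 d = mix d 0 0" for d by (simp add: C_0_def mix_zero)
  show ?thesis
    unfolding C power2_eq_square
    by (intro allI impI conjI critical_zero isotropy_mix_0 loss_zero orbit_length_mix_0 diagonal_on_has_spectrum[OF linear_hessian diagonal_on_zero_mat])
qed

lemma C_1_eq: "C_1 d = mix d 0 (1 / real d)"
  unfolding C_1_def ones_mat_eq_mix mix_scale by simp

lemma properties_C_1:
  "(\<forall>d \<ge> 1. critical d (C_1 d) \<and>
        isotropy d (C_1 d) = carrier (sym_group d) \<times> carrier (sym_group d) \<and>
        loss d (C_1 d) = real d - 1 / real d \<and>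
        orbit_length d (C_1 d) = 1)"
  unfolding C_1_eq
  by (intro allI impI conjI critical_const isotropy_mix_0 loss_const orbit_length_mix_0) simp_all

text \<open>The asymptotic values are attained exactly here and serve as their own
  witnesses.\<close>

lemma spectrum_C_1:
  "(\<exists>p q r u :: nat \<Rightarrow> real.
        eq_mod_inverse p (\<lambda>d. 18 / real d) \<and>
        eq_mod_inverse q (\<lambda>d. 0) \<and>
        eq_mod_inverse r (\<lambda>d. - 6 / real d) \<and>
        eq_mod_inverse u (\<lambda>d. - 12 / real d) \<and>
        (\<forall>d \<ge> 1. has_spectrum_by_type (hessian d (C_1 d)) (Mat d d)
          [(type_tt d, {#p d#}),
           (type_st d, replicate_mset (d - 1) (q d)),
           (type_ts d, replicate_mset (d - 1) (r d)),
           (type_ss d, replicate_mset ((d - 1)\<^sup>2) (u d))]))"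
  unfolding C_1_eq
  by (rule exI[of _ "\<lambda>d. 18 / real d"], rule exI[of _ "\<lambda>_. 0"], rule exI[of _ "\<lambda>d. - 6 / real d"], rule exI[of _ "\<lambda>d. - 12 / real d"],
      intro conjI allI impI prod_type_spectrum(1)) (simp_all add: eq_mod_inverse_def)

lemma properties_C_4:
  "(\<forall>d \<ge> 2. critical d (C_4 d) \<and>
        isotropy d (C_4 d) = {(g, h). g \<in> preserve_last_two d \<and> h \<in> preserve_last_two d \<and>
          (\<forall>i \<in> {1..d - 2}. g i = h i)} \<and>
        loss d (C_4 d) = 3 / 2 \<and>
        real (orbit_length d (C_4 d)) = real d * (real d - 1) * fact d / 4 \<and>
        has_spectrum (hessian d (C_4 d)) (Mat d d)
          (replicate_mset (d - 2) 18 +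
           replicate_mset 1 9 +
           replicate_mset (d\<^sup>2 + 2 - 3 * d) 6 +
           replicate_mset (d - 2) 3 +
           replicate_mset (d - 1) 0 +
           replicate_mset 1 (- 3) +
           replicate_mset 1 (- 6)))"
proof (intro allI impI conjI)
  fix d :: nat assume d: "d \<ge> 2"
  then have d2: "d - 2 + 2 = d" by simp
  show "critical d (C_4 d)"
    using critical_direct_sum[OF critical_id[of "d - 2"] critical_const[of 2]] unfolding C_4_eq d2 by simp
  show "loss d (C_4 d) = 3 / 2"
    using loss_direct_sum[of "d - 2" 2 "mix (d - 2) 1 0" "mix 2 0 (1 / real 2)"] unfolding C_4_eq d2 loss_id
    by (simp only: loss_const one_le_numeral)
  show "isotropy d (C_4 d) = {(g, h). g \<in> preserve_last_two d \<and> h \<in> preserve_last_two d \<and> (\<forall>i\<in>{1..d - 2}. g i = h i)}"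
    using isotropy_C_4[OF d] unfolding pair_group_def .
  show "real (orbit_length d (C_4 d)) = real d * (real d - 1) * fact d / 4" by (rule orbit_length_C_4[OF d])
qed (rule spectrum_C_4)

lemma properties_C_5:
  "(\<forall>d \<ge> 2. critical d (C_5 d) \<and>
        isotropy d (C_5 d) = Delta (fix_last d) \<and>
        loss d (C_5 d) = 1 \<and>
        orbit_length d (C_5 d) = d * fact d \<and>
        has_spectrum (hessian d (C_5 d)) (Mat d d)
          (replicate_mset (d - 1) 18 +
           replicate_mset ((d - 1)\<^sup>2) 6 +
           replicate_mset d 0))"
proof (intro allI impI conjI)
  fix d :: nat assume d: "d \<ge> 2"
  then have d1: "d - 1 + 1 = d" "d \<ge> 1" by simp_all
  show "critical d (C_5 d)"
    using critical_direct_sum[OF critical_id[of "d - 1"] critical_zero[of 1]] unfolding C_5_eq[OF d] d1(1) .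
  show "loss d (C_5 d) = 1"
    using loss_direct_sum[of "d - 1" 1 "mix (d - 1) 1 0" "mix 1 0 0"] unfolding C_5_eq[OF d] d1(1) loss_id loss_zero by simp
  show "orbit_length d (C_5 d) = d * fact d" by (rule orbit_length_fix_last[OF d1(2) isotropy_C_5[OF d]])
  show "isotropy d (C_5 d) = Delta (fix_last d)" by (rule isotropy_C_5[OF d])
qed (rule spectrum_C_5)

text \<open>The structure of the matrices dictates three entries. The loss of the fifth family keeps
  the term \<open>- 1 / d\<close>, which is not \<open>o(1 / d)\<close>. The equal rows and columns
  of \<open>C_4\<close> can be swapped independently, which enlarges its isotropy group and divides
  the orbit length by 4. \<open>C_5\<close> is an identity of size \<open>d - 1\<close> bordered by
  zeros, so only the index \<open>d\<close> is singled out.\<close>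

theorem theorem1:
  shows
    "(\<forall>d \<ge> 1. critical d (C_I d) \<and>
        isotropy d (C_I d) = Delta (carrier (sym_group d)) \<and>
        loss d (C_I d) = 0 \<and>
        orbit_length d (C_I d) = fact d \<and>
        (d \<ge> 3 \<longrightarrow> has_spectrum_by_type (hessian d (C_I d)) (Mat d d)
          [(type_t d, {#18, 6#}),
           (type_s d, repeat_mset (d - 1) {#18, 6, 6#}),
           (type_x d, replicate_mset ((d - 1) * (d - 2) div 2) 6),
           (type_y d, replicate_mset (d * (d - 3) div 2) 6)])) \<and>

     (\<forall>d \<ge> 1. critical d (C_0 d) \<and>
        isotropy d (C_0 d) = carrier (sym_group d) \<times> carrier (sym_group d) \<and>
        loss d (C_0 d) = real d \<and>
        orbit_length d (C_0 d) = 1 \<and>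
        has_spectrum (hessian d (C_0 d)) (Mat d d) (replicate_mset (d\<^sup>2) 0)) \<and>

     (\<forall>d \<ge> 1. critical d (C_1 d) \<and>
        isotropy d (C_1 d) = carrier (sym_group d) \<times> carrier (sym_group d) \<and>
        loss d (C_1 d) = real d - 1 / real d \<and>
        orbit_length d (C_1 d) = 1) \<and>
     (\<exists>p q r u :: nat \<Rightarrow> real.
        eq_mod_inverse p (\<lambda>d. 18 / real d) \<and>
        eq_mod_inverse q (\<lambda>d. 0) \<and>
        eq_mod_inverse r (\<lambda>d. - 6 / real d) \<and>
        eq_mod_inverse u (\<lambda>d. - 12 / real d) \<and>
        (\<forall>d \<ge> 1. has_spectrum_by_type (hessian d (C_1 d)) (Mat d d)
          [(type_tt d, {#p d#}),
           (type_st d, replicate_mset (d - 1) (q d)),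
           (type_ts d, replicate_mset (d - 1) (r d)),
           (type_ss d, replicate_mset ((d - 1)\<^sup>2) (u d))])) \<and>

     (\<exists>C :: nat \<Rightarrow> matr.
        (\<forall>\<^sub>F d in sequentially. critical d (C d) \<and>
           (\<exists>\<xi>1 \<xi>2 :: real. C d = \<xi>1 *\<^sub>R id_mat d + \<xi>2 *\<^sub>R (ones_mat d - id_mat d)) \<and>
           isotropy d (C d) = Delta (carrier (sym_group d)) \<and>
           orbit_length d (C d) = fact d) \<and>
        (\<exists>err \<in> o(\<lambda>d. 1 / real d). \<forall>\<^sub>F d in sequentially. \<forall>i \<in> {1..d}. \<forall>j \<in> {1..d}.
           \<bar>C d i j - ((1 / real d) *\<^sub>R (ones_mat d - 2 *\<^sub>R id_mat d)) i j\<bar> \<le> err d) \<and>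
        eq_mod_inverse (\<lambda>d. loss d (C d)) (\<lambda>d. real d - 1 / real d) \<and>
        (\<exists>t1 t2 s1 s2 s3 x y :: nat \<Rightarrow> real.
           eq_mod_inverse t1 (\<lambda>d. 18 / real d) \<and>
           eq_mod_inverse t2 (\<lambda>d. 12 / real d) \<and>
           eq_mod_inverse s1 (\<lambda>d. 12 / real d) \<and>
           eq_mod_inverse s2 (\<lambda>d. 0) \<and>
           eq_mod_inverse s3 (\<lambda>d. - 6 / real d) \<and>
           eq_mod_inverse x (\<lambda>d. - 12 / real d) \<and>
           eq_mod_inverse y (\<lambda>d. - 12 / real d) \<and>
           (\<forall>\<^sub>F d in sequentially. has_spectrum_by_type (hessian d (C d)) (Mat d d)
             [(type_t d, {#t1 d, t2 d#}),
              (type_s d, repeat_mset (d - 1) {#s1 d, s2 d, s3 d#}),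
              (type_x d, replicate_mset ((d - 1) * (d - 2) div 2) (x d)),
              (type_y d, replicate_mset (d * (d - 3) div 2) (y d))]))) \<and>

     (\<exists>\<xi>1 \<xi>2 \<xi>3 \<xi>4 \<xi>5 :: nat \<Rightarrow> real.
        (\<lambda>d. \<xi>1 d - (- 1 / real d - 13 / (3 * real d ^ 2) - 77 / (9 * real d ^ 3)
                    + 6421 / (81 * real d ^ 4))) \<in> o(\<lambda>d. 1 / real d ^ 4) \<and>
        (\<lambda>d. \<xi>2 d - (1 / real d + 13 / (3 * real d ^ 2) + 149 / (9 * real d ^ 3)
                    + 2867 / (81 * real d ^ 4))) \<in> o(\<lambda>d. 1 / real d ^ 4) \<and>
        \<xi>3 \<in> o(\<lambda>d. 1 / real d ^ 4) \<and>
        \<xi>4 \<in> o(\<lambda>d. 1 / real d ^ 4) \<and>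
        (\<lambda>d. \<xi>5 d - 1) \<in> o(\<lambda>d. 1 / real d ^ 4) \<and>
        (let C = (\<lambda>d. Xi d (\<xi>1 d) (\<xi>2 d) (\<xi>3 d) (\<xi>4 d) (\<xi>5 d)) in
          (\<forall>\<^sub>F d in sequentially. critical d (C d) \<and>
             isotropy d (C d) = Delta (fix_last d) \<and>
             orbit_length d (C d) = d * fact d) \<and>
          eq_mod_inverse (\<lambda>d. loss d (C d)) (\<lambda>d. real d - 1 - 1 / real d) \<and>
          (\<exists>(S :: nat \<Rightarrow> real multiset) (err :: nat \<Rightarrow> real). err \<in> o(\<lambda>d. 1 / real d) \<and>
             (\<forall>\<^sub>F d in sequentially. has_spectrum (hessian d (C d)) (Mat d d) (S d) \<and>
                rel_mset (\<lambda>x y. \<bar>x - y\<bar> \<le> err d) (S d)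
                  (replicate_mset 1 18 +
                   replicate_mset (d - 1) 6 +
                   replicate_mset 1 (18 / real d) +
                   replicate_mset (d - 1) (12 / real d) +
                   replicate_mset 1 (6 / real d) +
                   replicate_mset (2 * d - 4) 0 +
                   replicate_mset (d - 2) (- 6 / real d) +
                   replicate_mset (d\<^sup>2 + 5 - 5 * d) (- 12 / real d)))))) \<and>

     (\<forall>d \<ge> 2. critical d (C_4 d) \<and>
        isotropy d (C_4 d) = {(g, h). g \<in> preserve_last_two d \<and> h \<in> preserve_last_two d \<and>
          (\<forall>i \<in> {1..d - 2}. g i = h i)} \<and>
        loss d (C_4 d) = 3 / 2 \<and>
        real (orbit_length d (C_4 d)) = real d * (real d - 1) * fact d / 4 \<and>
        has_spectrum (hessian d (C_4 d)) (Mat d d)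
          (replicate_mset (d - 2) 18 +
           replicate_mset 1 9 +
           replicate_mset (d\<^sup>2 + 2 - 3 * d) 6 +
           replicate_mset (d - 2) 3 +
           replicate_mset (d - 1) 0 +
           replicate_mset 1 (- 3) +
           replicate_mset 1 (- 6))) \<and>

     (\<forall>d \<ge> 2. critical d (C_5 d) \<and>
        isotropy d (C_5 d) = Delta (fix_last d) \<and>
        loss d (C_5 d) = 1 \<and>
        orbit_length d (C_5 d) = d * fact d \<and>
        has_spectrum (hessian d (C_5 d)) (Mat d d)
          (replicate_mset (d - 1) 18 +
           replicate_mset ((d - 1)\<^sup>2) 6 +
           replicate_mset d 0))"
proof -
  \<comment> \<open>One ratio sequence serves both asymptotic families, at size \<open>d\<close> for
    the fourth and at size \<open>d - 1\<close> for the fifth. The scaled sequences are instantiated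
    by their defining equations.\<close>
  obtain t where t: "\<forall>\<^sub>F n in sequentially. ratio_lo (real n) \<le> t n \<and> t n \<le> ratio_hi (real n) \<and> ratio_poly (real n) (t n) = 0"
    using ratio_exists by blast
  show ?thesis
    by (intro conjI properties_C_I properties_C_0 properties_C_1 spectrum_C_1 properties_C_4 properties_C_5
        family_mix[OF t refl refl refl refl refl] family_Xi[OF t refl refl refl refl refl])
qed

end
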